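(* Let $(M,\varphi,\hat\varphi,\psi)$ be a simple cuspidal QP-module over the Lie-Rinehart pair $(\dot A,\dot{\mathfrak k})$, with weight space decomposition $M=\bigoplus_{\lambda\in\mathfrak t^*}M^\lambda$. Set $\mathfrak t':=\mathrm{span}_{\mathbb C}\{1,d_i\mid 1\le i\le m\}$ and, for $\mu\in(\mathfrak t')^*$, set $$M_{(\mu)}:=\bigoplus_{\lambda\in\mathfrak t^*,\ \lambda|_{\mathfrak t'}=\mu}M^\lambda .$$ Fix $\mu_0\in(\mathfrak t')^*$ with $M_{(\mu_0)}\neq\{0\}$ and set $$N:=M_{(\mu_0)},\qquad \Omega:=\Omega(N)=\{u\in N\mid \psi_{\partial_k}u=0\ \ (1\le k\le n)\}.$$ Then the following hold. (i) $\Omega$ is invariant under $\varphi_{t_j^{-1}}\psi_{t_j\partial}-\psi_\partial$, under $\varphi_{\zeta_p}\psi_\partial-\psi_{\zeta_p\partial}$ and under $\hat\varphi_\partial$, for all $1\le j\le m$, $1\le p\le n$ and $\partial\in\{1,\partial_k,d_i\mid 1\le k\le n,\ 1\le i\le m\}$. (ii) $\Omega$ (viewed in $L(M)$ via $u\mapsto 1\otimes u$) is a $\mathcal T$-submodule of the $(A\#\mathfrak k)$-module $L(M)$, and it has a weight space decomposition with respect to $\{\zeta_k\partial_k\mid 1\le k\le n\}$ with finite dimensional weight spaces and bounded weight multiplicities. (iii) If $U$ is a nonzero $\mathcal T$-submodule of $\Omega$, then $$\mathrm{span}_{\mathbb C}\{\varphi_{\zeta_I}u\mid I\subseteq\{1,\ldots,n\},\,u\in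 U\}=N\quad\text{and}\quad \mathrm{span}_{\mathbb C}\{\varphi_a u\mid a\in\dot A,\,u\in U\}=M.$$ (iv) $\Omega$ is a simple $\mathcal T$-module. In particular, $\Omega$ is a simple admissible $\mathfrak{gl}(m+1,n)$-module via the representation $\Phi$ defined, for $1\le i,j\le m$ and $1\le k,l\le n$ (all operators restricted to $\Omega$), by $$\begin{array}{lll} \Phi(E_{0,0}):=-\hat\varphi_1, & \Phi(E_{0,i}):=-\hat\varphi_{d_i}, & \Phi(E_{0,\bar k}):=-\hat\varphi_{\partial_k},\\ \Phi(E_{i,0}):=\varphi_{t_i^{-1}}\psi_{t_i}-\psi_1, & \Phi(E_{i,j}):=\varphi_{t_i^{-1}}\psi_{t_id_j}-\psi_{d_j}, & \Phi(E_{i,\bar k}):=\varphi_{t_i^{-1}}\psi_{t_i\partial_k}-\psi_{\partial_k},\\ \Phi(E_{\bar k,0}):=\psi_{\zeta_k}-\varphi_{\zeta_k}\psi_1, & \Phi(E_{\bar k,i}):=\psi_{\zeta_kd_i}-\varphi_{\zeta_k}\psi_{d_i}, & \Phi(E_{\bar k,\bar l}):=\psi_{\zeta_k\partial_l}-\varphi_{\zeta_k}\psi_{\partial_l}. \end{array}$$ (v) The simple cuspidal QP-module $(M,\varphi,\hat\varphi,\psi)$ is a Shen-Larsson QP-module, i.e. it is isomorphic to some $M_{\dot A}(\Omega',\bar{\boldsymbol\mu})$ with $\Omega'$ a $\mathfrak{gl}(m+1,n)$-module and $\bar{\boldsymbol\mu}=(\mu(0),\ldots,\mu(m+n))\in\mathbb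 C^{m+n+1}$, $\mu(m+k)=0$ for $1\le k\le n$.
   Context: All vector spaces are over $\mathbb C$. Fix positive integers $m,n$. $\Lambda_n$ is the Grassmann algebra on odd generators $\zeta_1,\dots,\zeta_n$; for $I=\{j_1<\dots<j_p\}\subseteq\{1,\dots,n\}$, $\zeta_I:=\zeta_{j_1}\cdots\zeta_{j_p}$, $\zeta_\emptyset:=1$. Put $\dot A:=\mathbb C[t_1^{\pm1},\dots,t_m^{\pm1}]\otimes\Lambda_n$, $\dot{\mathfrak k}:=\mathrm{Der}(\dot A)$, $A:=\mathbb C[t_0^{\pm1},\dots,t_m^{\pm1}]\otimes\Lambda_n$, $\mathfrak k:=\mathrm{Der}(A)$, $d_i:=t_i\frac{d}{dt_i}$, $\partial_k:=\frac{\partial}{\partial\zeta_k}$. So $\dot{\mathfrak k}=\bigoplus_{i=1}^m\dot A d_i\oplus\bigoplus_{k=1}^n\dot A\partial_k$ and $\mathfrak k=\bigoplus_{i=0}^mAd_i\oplus\bigoplus_{k=1}^nA\partial_k$. For $1\le k\le n$, $\bar k:=m+k$. For $\bar r=(r_0,\dots,r_m)\in\mathbb Z^{m+1}$, $t^{\bar r}:=t_0^{r_0}\cdots t_m^{r_m}$. $E_{\alpha,\beta}$ ($0\le\alpha,\beta\le m+n$) are the elementary matrices of the general linear Lie superalgebra $\mathfrak{gl}(m+1,n)$, indices $0,\dots,m$ being even and $m+1,\dots,m+n$ odd. An admissible $\mathfrak{gl}(m+1,n)$-module is a simple module with a weight space decomposition with respect to the diagonal matrices, with finite dimensional weight spaces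 and bounded weight multiplicities. Lie-Rinehart pairs and QP-superalgebras. A Lie-Rinehart pair $(B,\mathfrak l)$ consists of a unital supercommutative associative superalgebra $B$ and a Lie superalgebra $\mathfrak l$ such that $\mathfrak l$ is a $B$-module, $\mathfrak l$ acts on $B$ by derivations, and $[a\delta,b\gamma]=a\delta(b)\gamma-(-1)^{|a\delta||b\gamma|}b\gamma(a)\delta+(-1)^{|b||\delta|}ab[\delta,\gamma]$ for $a,b\in B$, $\delta,\gamma\in\mathfrak l$. Its associated QP-superalgebra is $\mathfrak g:=B\oplus\mathfrak l$ with the product $(a\oplus\delta)\cdot(b\oplus\sigma)=ab\oplus(a\sigma+(-1)^{|b||\delta|}b\delta)$, the Lie bracket $\{a\oplus\delta,b\oplus\sigma\}=(\delta(b)-(-1)^{|a||\sigma|}\sigma(a))\oplus[\delta,\sigma]$, and the projection $\pi:\mathfrak g\to B$, $a\oplus\delta\mapsto a$. Here $(\dot A,\dot{\mathfrak k})$ is such a pair, $\mathfrak g=\dot A\oplus\dot{\mathfrak k}$, and $1\in\dot A\subset\mathfrak g$ denotes the unit of $\dot A$; products such as $t_j\partial$, $\zeta_p\partial$ are taken in $(\mathfrak g,\cdot)$. QP-modules. A QP-module over $(B,\mathfrak l)$ is a superspace $M$ with parity-preserving linear maps $\varphi:B\to\mathrm{End}(M)$, $\psi,\hat\varphi:\mathfrak g\to\mathrm{End}(M)$ such that for $a\in B$, $x,y\in\mathfrak g$ (with $x(a):=\{x,a\}$ and supercommutators on the left): (1) $\varphi$ is a (unital) associative superalgebra homomorphism;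 (2) $\psi$ is a Lie superalgebra homomorphism from $(\mathfrak g,\{\cdot,\cdot\})$; (3) $[\hat\varphi_x,\hat\varphi_y]=\hat\varphi_{x\cdot\pi(y)}-\hat\varphi_{\pi(x)\cdot y}$; (4) $\hat\varphi_{a\cdot x}=\varphi_a\hat\varphi_x$; (5) $[\hat\varphi_x,\varphi_a]=0$; (6) $[\hat\varphi_x,\psi_y]=\hat\varphi_{\{x,y\}}-(-1)^{|x||y|}\varphi_{\pi(y)}\psi_x+\psi_{x\cdot\pi(y)}$; (7) $[\psi_x,\varphi_a]=\varphi_{x(a)}$. Homomorphisms are linear maps intertwining $\varphi,\psi,\hat\varphi$; submodules, simplicity and isomorphism are defined as usual. A QP-module over $(\dot A,\dot{\mathfrak k})$ is cuspidal if, via $\psi$, it has a weight space decomposition with respect to $\mathfrak t:=\mathrm{span}_{\mathbb C}\{1,d_i,\zeta_k\partial_k\mid1\le i\le m,1\le k\le n\}\subset\mathfrak g$, i.e. $M=\bigoplus_{\lambda\in\mathfrak t^*}M^\lambda$ with $M^\lambda=\{v\mid\psi_hv=\lambda(h)v\ \forall h\in\mathfrak t\}$, with finite dimensional weight spaces and bounded weight multiplicities. The module $L(M)$. For a QP-module $M$ over $(\dot A,\dot{\mathfrak k})$, $L(M):=\mathbb C[t_0^{\pm1}]\otimes M$ is an $A$-module and a $\mathfrak k$-module compatible by the Leibniz rule $\delta(av)=\delta(a)v+(-1)^{|\delta||a|}a(\delta v)$. Identify $A=\mathbb C[t_0^{\pm1}]\otimes\dot A$ and $\mathfrak k$ with $\mathbb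 C[t_0^{\pm1}]\otimes\mathfrak g$, where $t_0^ra\,d_0\leftrightarrow t_0^r\otimes a$ and $t_0^r\delta\leftrightarrow t_0^r\otimes\delta$ ($a\in\dot A$, $\delta\in\dot{\mathfrak k}$). The actions are $(t_0^r\otimes x)*(t_0^s\otimes\omega)=t_0^{r+s}\otimes(\psi_x(\omega)-r\hat\varphi_x(\omega)+s\varphi_{\pi(x)}(\omega))$ and $(t_0^r\otimes a)\cdot(t_0^s\otimes\omega)=t_0^{r+s}\otimes\varphi_a(\omega)$. Thus $L(M)$ is a module over the smash product $A\#U(\mathfrak k)$, the space $A\otimes U(\mathfrak k)$ with product $(a\otimes u)\#(b\otimes v)=\sum_i(-1)^{|b||u_i^2|}a\,u_i^1(b)\otimes u_i^2v$, where $\sum_iu_i^1\otimes u_i^2$ is the coproduct of $u$; $a\#u$ acts by $v\mapsto a(uv)$. The subspace $A\#\mathfrak k$ is a Lie subsuperalgebra of $A\#U(\mathfrak k)$ under the supercommutator, and $L(M)$ is an $(A\#\mathfrak k)$-module by restriction. The Lie superalgebra $\mathcal T$. For $I=\{i_1<\dots<i_p\}$, $J=\{j_1<\dots<j_q\}$ let $\tau(I,J):=\sum_{s=1}^q|\{r\mid j_s<i_r\}|$. For $\bar r\in\mathbb Z^{m+1}$ and $\partial\in\{d_i,\partial_k\mid0\le i\le m,1\le k\le n\}$ put $X_{\bar r,J,\partial}:=\sum_{I\subseteq J}(-1)^{|I|+\tau(I,J\setminus I)}t^{-\bar r}\zeta_I\#t^{\bar r}\zeta_{J\setminus I}\partial$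 if $J\ne\emptyset$ and $X_{\bar r,\emptyset,\partial}:=(t^{-\bar r}\#t^{\bar r}\partial)-\partial$ (where $\partial$ means $1\#\partial$). $\mathcal T\subset A\#\mathfrak k$ is the span of all $X_{\bar r,J,\partial}$ with $J\neq\emptyset$ and all $X_{\bar s,\emptyset,\partial}$ with $\bar s\ne0$; it is a Lie subsuperalgebra of $A\#\mathfrak k$. Shen-Larsson QP-modules. Let $\Omega'$ be a $\mathfrak{gl}(m+1,n)$-module and $\bar{\boldsymbol\mu}=(\mu(0),\dots,\mu(m+n))\in\mathbb C^{m+n+1}$ with $\mu(m+k)=0$ for $1\le k\le n$. For $0\le\alpha\le m+n$ let $\partial_\alpha$ (as an indexed element of $\mathfrak g$) be $1$ if $\alpha=0$, $d_i$ if $\alpha=i\in\{1,\dots,m\}$, and $\frac{\partial}{\partial\zeta_k}$ if $\alpha=\bar k=m+k$; $\partial_\alpha(b)$ means $\{\partial_\alpha,b\}$, so $\partial_0(b)=0$. Then $M_{\dot A}(\Omega',\bar{\boldsymbol\mu}):=\dot A\otimes\Omega'$ with $\varphi_a(b\otimes v)=ab\otimes v$, $\hat\varphi_{a\partial_\alpha}(b\otimes v)=-(-1)^{|b||\partial_\alpha|}ab\otimes E_{0,\alpha}v$, $\psi_{a\partial_\alpha}(b\otimes v)=a(\partial_\alpha(b)+\mu(\alpha)b)\otimes v+\sum_{\beta=1}^{m+n}(-1)^{|ab||\partial_\beta|+|\partial_\beta|+|b||\partial_\alpha|}\partial_\beta(a)b\otimes E_{\beta,\alpha}v$ is a QP-module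 over $(\dot A,\dot{\mathfrak k})$, called a Shen-Larsson QP-module. *)

theory Defs
  imports Complex_Main "HOL-Library.Poly_Mapping" "HOL-Library.Function_Algebras" "HOL-Library.Product_Plus"
begin

section \<open>Superspaces\<close>

text \<open>Parities are booleans (\<open>True\<close> is odd), so the sum of parities is \<open>\<noteq>\<close>. All spaces are complex
  and live inside an ambient type; a superspace consists of its homogeneous parts.\<close>

definition ksign :: "bool \<Rightarrow> bool \<Rightarrow> complex" where
  "ksign p q = (if p \<and> q then -1 else 1)"

record 'v superspace =
  scal :: "complex \<Rightarrow> 'v \<Rightarrow> 'v"
  part :: "bool \<Rightarrow> 'v set"

definition carr :: "('v::ab_group_add, 'z) superspace_scheme \<Rightarrow> 'v set" where
  "carr V = {x + y | x y. x \<in> part V False \<and> y \<in> part V True}"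

definition is_superspace :: "('v::ab_group_add, 'z) superspace_scheme \<Rightarrow> bool" where
  "is_superspace V \<longleftrightarrow> vector_space (scal V) \<and> (\<forall>p. module.subspace (scal V) (part V p)) \<and>
     part V False \<inter> part V True = {0}"

text \<open>Subobjects of superspaces are graded, as usual.\<close>

definition sub_superspace :: "('v::ab_group_add, 'z) superspace_scheme \<Rightarrow> 'v set \<Rightarrow> bool" where
  "sub_superspace V U \<longleftrightarrow> module.subspace (scal V) U \<and>
     U = {x + y | x y. x \<in> U \<inter> part V False \<and> y \<in> U \<inter> part V True}"

definition lin_on :: "(complex \<Rightarrow> 'a::ab_group_add \<Rightarrow> 'a) \<Rightarrow> (complex \<Rightarrow> 'b::ab_group_add \<Rightarrow> 'b)
    \<Rightarrow> 'a set \<Rightarrow> ('a \<Rightarrow> 'b) \<Rightarrow> bool" where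
  "lin_on s1 s2 S f \<longleftrightarrow> (\<forall>x\<in>S. \<forall>y\<in>S. f (x + y) = f x + f y) \<and> (\<forall>c. \<forall>x\<in>S. f (s1 c x) = s2 c (f x))"

text \<open>Parity-preserving linear maps \<open>L \<rightarrow> End(V)\<close>; operators only matter on \<open>carr V\<close>.\<close>

definition super_map :: "('l::ab_group_add, 'y) superspace_scheme \<Rightarrow>
    ('v::ab_group_add, 'z) superspace_scheme \<Rightarrow> ('l \<Rightarrow> 'v \<Rightarrow> 'v) \<Rightarrow> bool" where
  "super_map L V \<rho> \<longleftrightarrow>
     (\<forall>v\<in>carr V. lin_on (scal L) (scal V) (carr L) (\<lambda>x. \<rho> x v)) \<and>
     (\<forall>x\<in>carr L. lin_on (scal V) (scal V) (carr V) (\<rho> x)) \<and>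
     (\<forall>p q. \<forall>x\<in>part L p. \<forall>v\<in>part V q. \<rho> x v \<in> part V (p \<noteq> q))"

definition supercomm :: "('v::ab_group_add, 'z) superspace_scheme \<Rightarrow> bool \<Rightarrow> bool \<Rightarrow>
    ('v \<Rightarrow> 'v) \<Rightarrow> ('v \<Rightarrow> 'v) \<Rightarrow> 'v \<Rightarrow> 'v" where
  "supercomm V p q f g v = f (g v) - scal V (ksign p q) (g (f v))"

definition super_rep :: "('l::ab_group_add, 'y) superspace_scheme \<Rightarrow> ('l \<Rightarrow> 'l \<Rightarrow> 'l) \<Rightarrow>
    ('v::ab_group_add, 'z) superspace_scheme \<Rightarrow> ('l \<Rightarrow> 'v \<Rightarrow> 'v) \<Rightarrow> bool" where
  "super_rep L br V \<rho> \<longleftrightarrow> super_map L V \<rho> \<and>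
     (\<forall>p q. \<forall>x\<in>part L p. \<forall>y\<in>part L q. \<forall>v\<in>carr V.
        \<rho> (br x y) v = supercomm V p q (\<rho> x) (\<rho> y) v)"

section \<open>Weight space decompositions\<close>

text \<open>The dual of a subspace \<open>T\<close>; functionals are normalised to be \<open>0\<close> outside \<open>T\<close>.\<close>

definition dual :: "(complex \<Rightarrow> 'a::ab_group_add \<Rightarrow> 'a) \<Rightarrow> 'a set \<Rightarrow> ('a \<Rightarrow> complex) set" where
  "dual s T = {l. lin_on s (*) T l \<and> (\<forall>h. h \<notin> T \<longrightarrow> l h = 0)}"

definition weight_space :: "(complex \<Rightarrow> 'v \<Rightarrow> 'v) \<Rightarrow> 'v set \<Rightarrow> 'a set \<Rightarrow> ('a \<Rightarrow> 'v \<Rightarrow> 'v)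
    \<Rightarrow> ('a \<Rightarrow> complex) \<Rightarrow> 'v set" where
  "weight_space s W T \<rho> l = {v \<in> W. \<forall>h\<in>T. \<rho> h v = s (l h) v}"

definition direct_sum :: "(complex \<Rightarrow> 'v::ab_group_add \<Rightarrow> 'v) \<Rightarrow> 'v set \<Rightarrow> 'i set \<Rightarrow> ('i \<Rightarrow> 'v set) \<Rightarrow> bool" where
  "direct_sum s W K F \<longleftrightarrow> (\<forall>i\<in>K. module.subspace s (F i)) \<and> W = module.span s (\<Union>i\<in>K. F i) \<and>
     (\<forall>J f. finite J \<and> J \<subseteq> K \<and> (\<forall>j\<in>J. f j \<in> F j) \<and> (\<Sum>j\<in>J. f j) = 0 \<longrightarrow> (\<forall>j\<in>J. f j = 0))"

text \<open>\<open>W\<close> has a weight space decomposition with respect to \<open>T\<close> (acting by \<open>\<rho>\<close>) with finite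
  dimensional weight spaces and bounded weight multiplicities.\<close>

definition bounded_weight :: "(complex \<Rightarrow> 'a::ab_group_add \<Rightarrow> 'a) \<Rightarrow> 'a set \<Rightarrow>
    (complex \<Rightarrow> 'v::ab_group_add \<Rightarrow> 'v) \<Rightarrow> 'v set \<Rightarrow> ('a \<Rightarrow> 'v \<Rightarrow> 'v) \<Rightarrow> bool" where
  "bounded_weight sT T s W \<rho> \<longleftrightarrow>
     direct_sum s W (dual sT T) (weight_space s W T \<rho>) \<and>
     (\<forall>l\<in>dual sT T. \<exists>B. finite B \<and> weight_space s W T \<rho> l \<subseteq> module.span s B) \<and>
     (\<exists>K. \<forall>l\<in>dual sT T. vector_space.dim s (weight_space s W T \<rho> l) \<le> K)"

section \<open>Laurent polynomials with Grassmann coefficients\<close>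

text \<open>The monomial \<open>(r, I)\<close> stands for \<open>t\<^sup>r \<zeta>\<^sub>I\<close>. For a basis-indexed space the tensor product with
  \<open>V\<close> is modelled by finitely supported functions from the basis to \<open>V\<close>.\<close>

type_synonym mon = "(nat \<Rightarrow>\<^sub>0 int) \<times> nat set"
type_synonym lgr = "mon \<Rightarrow>\<^sub>0 complex"

definition pm_scale :: "(complex \<Rightarrow> 'v::zero \<Rightarrow> 'v) \<Rightarrow> complex \<Rightarrow> ('k \<Rightarrow>\<^sub>0 'v) \<Rightarrow> ('k \<Rightarrow>\<^sub>0 'v)" where
  "pm_scale s c f = Poly_Mapping.map (s c) f"

abbreviation lg_scale :: "complex \<Rightarrow> lgr \<Rightarrow> lgr" where
  "lg_scale \<equiv> pm_scale (*)"

definition tens :: "(complex \<Rightarrow> 'v::ab_group_add \<Rightarrow> 'v) \<Rightarrow> lgr \<Rightarrow> 'v \<Rightarrow> (mon \<Rightarrow>\<^sub>0 'v)" where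
  "tens s b v = (\<Sum>k\<in>Poly_Mapping.keys b. Poly_Mapping.single k (s (Poly_Mapping.lookup b k) v))"

definition tau :: "nat set \<Rightarrow> nat set \<Rightarrow> nat" where
  "tau I J = (\<Sum>j\<in>J. card {i\<in>I. j < i})"

definition lg_mult :: "lgr \<Rightarrow> lgr \<Rightarrow> lgr" (infixl \<open>\<star>\<close> 70) where
  "a \<star> b = (\<Sum>(r, I)\<in>Poly_Mapping.keys a. \<Sum>(s, J)\<in>Poly_Mapping.keys b.
     if I \<inter> J = {} then Poly_Mapping.single (r + s, I \<union> J)
       ((-1) ^ tau I J * Poly_Mapping.lookup a (r, I) * Poly_Mapping.lookup b (s, J)) else 0)"

definition lmono :: "(nat \<Rightarrow>\<^sub>0 int) \<Rightarrow> nat set \<Rightarrow> lgr" where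
  "lmono r I = Poly_Mapping.single (r, I) 1"

definition tpow :: "nat \<Rightarrow> int \<Rightarrow> lgr" where
  "tpow i k = lmono (Poly_Mapping.single i k) {}"

definition zeta :: "nat \<Rightarrow> lgr" where
  "zeta k = lmono 0 {k}"

definition mon_parity :: "mon \<Rightarrow> bool" where
  "mon_parity k = odd (card (snd k))"

definition lg_filter :: "(mon \<Rightarrow> bool) \<Rightarrow> lgr \<Rightarrow> lgr" where
  "lg_filter P a = (\<Sum>k\<in>{k\<in>Poly_Mapping.keys a. P k}. Poly_Mapping.single k (Poly_Mapping.lookup a k))"

definition lg_part :: "bool \<Rightarrow> lgr \<Rightarrow> lgr" where
  "lg_part p = lg_filter (\<lambda>k. mon_parity k = p)"

text \<open>The algebra on \<open>t\<^sub>i\<close> (\<open>i \<in> S\<close>) and \<open>\<zeta>\<^sub>1, \<dots>, \<zeta>\<^sub>n\<close>: \<open>S = {1..m}\<close> gives the dotted algebra,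
  \<open>S = {0..m}\<close> the algebra \<open>A\<close>.\<close>

definition mons :: "nat set \<Rightarrow> nat \<Rightarrow> mon set" where
  "mons S n = {(r, I). Poly_Mapping.keys r \<subseteq> S \<and> I \<subseteq> {1..n}}"

definition lg_alg :: "nat set \<Rightarrow> nat \<Rightarrow> lgr superspace" where
  "lg_alg S n = \<lparr>scal = lg_scale,
     part = (\<lambda>p. {a. Poly_Mapping.keys a \<subseteq> {k \<in> mons S n. mon_parity k = p}})\<rparr>"

section \<open>Superderivations\<close>

text \<open>A derivation of \<open>lg_alg S n\<close> is represented by its unique linear extension to the ambient
  type that kills all monomials outside \<open>mons S n\<close>.\<close>

definition superder :: "nat set \<Rightarrow> nat \<Rightarrow> bool \<Rightarrow> (lgr \<Rightarrow> lgr) set" where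
  "superder S n p = {\<delta>. Vector_Spaces.linear lg_scale lg_scale \<delta> \<and>
     (\<forall>k c. k \<notin> mons S n \<longrightarrow> \<delta> (Poly_Mapping.single k c) = 0) \<and>
     (\<forall>q. \<forall>a\<in>part (lg_alg S n) q. \<delta> a \<in> part (lg_alg S n) (p \<noteq> q)) \<and>
     (\<forall>q. \<forall>a\<in>part (lg_alg S n) q. \<forall>b\<in>carr (lg_alg S n).
        \<delta> (a \<star> b) = \<delta> a \<star> b + lg_scale (ksign p q) (a \<star> \<delta> b))}"

definition der_scale :: "complex \<Rightarrow> (lgr \<Rightarrow> lgr) \<Rightarrow> (lgr \<Rightarrow> lgr)" where
  "der_scale c \<delta> = (\<lambda>f. lg_scale c (\<delta> f))"

definition Der :: "nat set \<Rightarrow> nat \<Rightarrow> (lgr \<Rightarrow> lgr) superspace" where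
  "Der S n = \<lparr>scal = der_scale, part = superder S n\<rparr>"

definition der_part :: "bool \<Rightarrow> (lgr \<Rightarrow> lgr) \<Rightarrow> (lgr \<Rightarrow> lgr)" where
  "der_part p \<delta> = (\<lambda>f. \<Sum>q\<in>UNIV. lg_part (p \<noteq> q) (\<delta> (lg_part q f)))"

definition der_bracket :: "(lgr \<Rightarrow> lgr) \<Rightarrow> (lgr \<Rightarrow> lgr) \<Rightarrow> (lgr \<Rightarrow> lgr)" where
  "der_bracket \<delta> \<sigma> = (\<lambda>f. \<delta> (\<sigma> f) -
     (\<Sum>p\<in>UNIV. \<Sum>q\<in>UNIV. lg_scale (ksign p q) (der_part q \<sigma> (der_part p \<delta> f))))"

text \<open>\<open>d\<^sub>i = t\<^sub>i d/dt\<^sub>i\<close> and the (left) derivative by \<open>\<zeta>\<^sub>k\<close>, as derivations of \<open>lg_alg S n\<close>.\<close>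

definition dt :: "nat set \<Rightarrow> nat \<Rightarrow> nat \<Rightarrow> lgr \<Rightarrow> lgr" where
  "dt S n i f = (\<Sum>(r, I)\<in>Poly_Mapping.keys f \<inter> mons S n.
     Poly_Mapping.single (r, I) (of_int (Poly_Mapping.lookup r i) * Poly_Mapping.lookup f (r, I)))"

definition dzeta :: "nat set \<Rightarrow> nat \<Rightarrow> nat \<Rightarrow> lgr \<Rightarrow> lgr" where
  "dzeta S n k f = (\<Sum>(r, I)\<in>Poly_Mapping.keys f \<inter> mons S n.
     if k \<in> I then Poly_Mapping.single (r, I - {k})
       ((-1) ^ card {i\<in>I. i < k} * Poly_Mapping.lookup f (r, I)) else 0)"

section \<open>The QP-superalgebra of the dotted pair\<close>

type_synonym qp_el = "lgr \<times> (lgr \<Rightarrow> lgr)"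

abbreviation Adot :: "nat \<Rightarrow> nat \<Rightarrow> lgr superspace" where
  "Adot m n \<equiv> lg_alg {1..m} n"

abbreviation kdot :: "nat \<Rightarrow> nat \<Rightarrow> (lgr \<Rightarrow> lgr) superspace" where
  "kdot m n \<equiv> Der {1..m} n"

definition g_scale :: "complex \<Rightarrow> qp_el \<Rightarrow> qp_el" where
  "g_scale c x = (lg_scale c (fst x), der_scale c (snd x))"

definition gdot :: "nat \<Rightarrow> nat \<Rightarrow> qp_el superspace" where
  "gdot m n = \<lparr>scal = g_scale, part = (\<lambda>p. part (Adot m n) p \<times> part (kdot m n) p)\<rparr>"

text \<open>Product and bracket are the bilinear extensions of the formulas for homogeneous elements.\<close>

definition g_mult :: "qp_el \<Rightarrow> qp_el \<Rightarrow> qp_el" where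
  "g_mult x y = (fst x \<star> fst y, \<lambda>f. fst x \<star> snd y f +
     (\<Sum>p\<in>UNIV. \<Sum>q\<in>UNIV. lg_scale (ksign p q) (lg_part p (fst y) \<star> der_part q (snd x) f)))"

definition g_bracket :: "qp_el \<Rightarrow> qp_el \<Rightarrow> qp_el" where
  "g_bracket x y = (snd x (fst y) -
     (\<Sum>p\<in>UNIV. \<Sum>q\<in>UNIV. lg_scale (ksign p q) (der_part q (snd y) (lg_part p (fst x)))),
     der_bracket (snd x) (snd y))"

definition emb :: "lgr \<Rightarrow> qp_el" where
  "emb a = (a, 0)"

definition g_act :: "qp_el \<Rightarrow> lgr \<Rightarrow> lgr" where
  "g_act x a = fst (g_bracket x (emb a))"

text \<open>The indexed elements \<open>\<partial>\<^sub>\<alpha>\<close> (\<open>0 \<le> \<alpha> \<le> m + n\<close>); \<open>\<partial>\<^sub>0\<close> is the unit of the algebra.\<close>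

definition gen :: "nat \<Rightarrow> nat \<Rightarrow> nat \<Rightarrow> qp_el" where
  "gen m n \<alpha> = (if \<alpha> = 0 then emb (lmono 0 {})
     else if \<alpha> \<le> m then (0, dt {1..m} n \<alpha>) else (0, dzeta {1..m} n (\<alpha> - m)))"

section \<open>QP-modules\<close>

record 'v qp_data = "'v superspace" +
  phi :: "lgr \<Rightarrow> 'v \<Rightarrow> 'v"
  hphi :: "qp_el \<Rightarrow> 'v \<Rightarrow> 'v"
  psi :: "qp_el \<Rightarrow> 'v \<Rightarrow> 'v"

definition qp_module :: "nat \<Rightarrow> nat \<Rightarrow> ('v::ab_group_add) qp_data \<Rightarrow> bool" where
  "qp_module m n M \<longleftrightarrow>
     is_superspace M \<and>
     super_map (Adot m n) M (phi M) \<and> super_map (gdot m n) M (hphi M) \<and>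
     (\<forall>v\<in>carr M. phi M (lmono 0 {}) v = v) \<and>
     (\<forall>a\<in>carr (Adot m n). \<forall>b\<in>carr (Adot m n). \<forall>v\<in>carr M. phi M (a \<star> b) v = phi M a (phi M b v)) \<and>
     super_rep (gdot m n) g_bracket M (psi M) \<and>
     (\<forall>p q. \<forall>x\<in>part (gdot m n) p. \<forall>y\<in>part (gdot m n) q. \<forall>v\<in>carr M.
        supercomm M p q (hphi M x) (hphi M y) v =
          hphi M (g_mult x (emb (fst y))) v - hphi M (g_mult (emb (fst x)) y) v) \<and>
     (\<forall>a\<in>carr (Adot m n). \<forall>x\<in>carr (gdot m n). \<forall>v\<in>carr M.
        hphi M (g_mult (emb a) x) v = phi M a (hphi M x v)) \<and>
     (\<forall>p q. \<forall>x\<in>part (gdot m n) p. \<forall>a\<in>part (Adot m n) q. \<forall>v\<in>carr M.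
        supercomm M p q (hphi M x) (phi M a) v = 0) \<and>
     (\<forall>p q. \<forall>x\<in>part (gdot m n) p. \<forall>y\<in>part (gdot m n) q. \<forall>v\<in>carr M.
        supercomm M p q (hphi M x) (psi M y) v =
          hphi M (g_bracket x y) v - scal M (ksign p q) (phi M (fst y) (psi M x v))
          + psi M (g_mult x (emb (fst y))) v) \<and>
     (\<forall>p q. \<forall>x\<in>part (gdot m n) p. \<forall>a\<in>part (Adot m n) q. \<forall>v\<in>carr M.
        supercomm M p q (psi M x) (phi M a) v = phi M (g_act x a) v)"

definition qp_submodule :: "nat \<Rightarrow> nat \<Rightarrow> ('v::ab_group_add) qp_data \<Rightarrow> 'v set \<Rightarrow> bool" where
  "qp_submodule m n M U \<longleftrightarrow> sub_superspace M U \<and>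
     (\<forall>a\<in>carr (Adot m n). \<forall>u\<in>U. phi M a u \<in> U) \<and>
     (\<forall>x\<in>carr (gdot m n). \<forall>u\<in>U. hphi M x u \<in> U \<and> psi M x u \<in> U)"

definition qp_simple :: "nat \<Rightarrow> nat \<Rightarrow> ('v::ab_group_add) qp_data \<Rightarrow> bool" where
  "qp_simple m n M \<longleftrightarrow> qp_module m n M \<and> carr M \<noteq> {0} \<and>
     (\<forall>U. qp_submodule m n M U \<longrightarrow> U = {0} \<or> U = carr M)"

text \<open>Homomorphisms are not required to preserve parity.\<close>

definition qp_isomorphic :: "nat \<Rightarrow> nat \<Rightarrow> ('v::ab_group_add) qp_data \<Rightarrow> ('w::ab_group_add) qp_data \<Rightarrow> bool" where
  "qp_isomorphic m n M M' \<longleftrightarrow> (\<exists>f. bij_betw f (carr M) (carr M') \<and>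
     lin_on (scal M) (scal M') (carr M) f \<and>
     (\<forall>a\<in>carr (Adot m n). \<forall>v\<in>carr M. f (phi M a v) = phi M' a (f v)) \<and>
     (\<forall>x\<in>carr (gdot m n). \<forall>v\<in>carr M. f (hphi M x v) = hphi M' x (f v) \<and> f (psi M x v) = psi M' x (f v)))"

definition zeta_dzeta :: "nat \<Rightarrow> nat \<Rightarrow> qp_el set" where
  "zeta_dzeta m n = {g_mult (emb (zeta k)) (gen m n (m + k)) | k. k \<in> {1..n}}"

definition cartan' :: "nat \<Rightarrow> nat \<Rightarrow> qp_el set" where
  "cartan' m n = module.span g_scale (gen m n ` {0..m})"

definition cartan :: "nat \<Rightarrow> nat \<Rightarrow> qp_el set" where
  "cartan m n = module.span g_scale (gen m n ` {0..m} \<union> zeta_dzeta m n)"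

definition cuspidal :: "nat \<Rightarrow> nat \<Rightarrow> ('v::ab_group_add) qp_data \<Rightarrow> bool" where
  "cuspidal m n M \<longleftrightarrow> bounded_weight g_scale (cartan m n) (scal M) (carr M) (psi M)"

definition qp_weight_sum :: "nat \<Rightarrow> nat \<Rightarrow> ('v::ab_group_add) qp_data \<Rightarrow> (qp_el \<Rightarrow> complex) \<Rightarrow> 'v set" where
  "qp_weight_sum m n M \<mu> = module.span (scal M)
     (\<Union>l\<in>{l \<in> dual g_scale (cartan m n). \<forall>h\<in>cartan' m n. l h = \<mu> h}.
        weight_space (scal M) (carr M) (cartan m n) (psi M) l)"

definition Omega :: "nat \<Rightarrow> nat \<Rightarrow> ('v::ab_group_add) qp_data \<Rightarrow> 'v set \<Rightarrow> 'v set" where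
  "Omega m n M N = {u \<in> N. \<forall>k\<in>{1..n}. psi M (gen m n (m + k)) u = 0}"

section \<open>The module L(M) and the Lie superalgebra T\<close>

definition loop_space :: "('v::ab_group_add) qp_data \<Rightarrow> (int \<Rightarrow>\<^sub>0 'v) superspace" where
  "loop_space M = \<lparr>scal = pm_scale (scal M),
     part = (\<lambda>p. {f. \<forall>r. Poly_Mapping.lookup f r \<in> part M p})\<rparr>"

text \<open>\<open>tcoeff r f\<close> is the coefficient of \<open>t\<^sub>0\<^sup>r\<close> in \<open>f\<close>.\<close>

definition tcoeff :: "int \<Rightarrow> lgr \<Rightarrow> lgr" where
  "tcoeff r f = (\<Sum>(s, I)\<in>{(s, I)\<in>Poly_Mapping.keys f. Poly_Mapping.lookup s 0 = r}.
     Poly_Mapping.single (s - Poly_Mapping.single 0 r, I) (Poly_Mapping.lookup f (s, I)))"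

text \<open>Components of \<open>D \<in> Der(A)\<close> under the identification with \<open>\<complex>[t\<^sub>0\<^sup>\<plusminus>\<^sup>1] \<otimes> \<gg>\<close>:
  if \<open>D\<close> is the sum of all \<open>t\<^sub>0\<^sup>r a\<^sub>r d\<^sub>0 + t\<^sub>0\<^sup>r \<delta>\<^sub>r\<close>, then
  \<open>t\<^sub>0\<^sup>-\<^sup>1 D(t\<^sub>0)\<close> is the sum of the \<open>t\<^sub>0\<^sup>r a\<^sub>r\<close>, and \<open>D(b)\<close> that of the \<open>t\<^sub>0\<^sup>r \<delta>\<^sub>r(b)\<close> for \<open>b\<close> free of \<open>t\<^sub>0\<close>.\<close>

definition kcoeff :: "nat \<Rightarrow> nat \<Rightarrow> int \<Rightarrow> (lgr \<Rightarrow> lgr) \<Rightarrow> qp_el" where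
  "kcoeff m n r D = (tcoeff r (tpow 0 (-1) \<star> D (tpow 0 1)),
     \<lambda>b. tcoeff r (D (lg_filter (\<lambda>k. k \<in> mons {1..m} n) b)))"

definition loop_A :: "('v::ab_group_add) qp_data \<Rightarrow> lgr \<Rightarrow> (int \<Rightarrow>\<^sub>0 'v) \<Rightarrow> (int \<Rightarrow>\<^sub>0 'v)" where
  "loop_A M a w = (\<Sum>r\<in>{r. tcoeff r a \<noteq> 0}. \<Sum>s\<in>Poly_Mapping.keys w.
     Poly_Mapping.single (r + s) (phi M (tcoeff r a) (Poly_Mapping.lookup w s)))"

definition loop_k :: "nat \<Rightarrow> nat \<Rightarrow> ('v::ab_group_add) qp_data \<Rightarrow> (lgr \<Rightarrow> lgr) \<Rightarrow> (int \<Rightarrow>\<^sub>0 'v) \<Rightarrow> (int \<Rightarrow>\<^sub>0 'v)" where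
  "loop_k m n M D w = (\<Sum>r\<in>{r. kcoeff m n r D \<noteq> 0}. \<Sum>s\<in>Poly_Mapping.keys w.
     let x = kcoeff m n r D; \<omega> = Poly_Mapping.lookup w s in
     Poly_Mapping.single (r + s)
       (psi M x \<omega> - scal M (of_int r) (hphi M x \<omega>) + scal M (of_int s) (phi M (fst x) \<omega>)))"

text \<open>The space \<open>A # Der(A)\<close>, as a vector space the tensor product of \<open>A\<close> and \<open>Der(A)\<close>, and its
  action on \<open>L(M)\<close>, in which \<open>a # D\<close> sends \<open>w\<close> to \<open>a (D w)\<close>.\<close>

type_synonym smash = "mon \<Rightarrow>\<^sub>0 (lgr \<Rightarrow> lgr)"

abbreviation smash_scale :: "complex \<Rightarrow> smash \<Rightarrow> smash" where
  "smash_scale \<equiv> pm_scale der_scale"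

abbreviation hash :: "lgr \<Rightarrow> (lgr \<Rightarrow> lgr) \<Rightarrow> smash" where
  "hash \<equiv> tens der_scale"

definition smash_act :: "nat \<Rightarrow> nat \<Rightarrow> ('v::ab_group_add) qp_data \<Rightarrow> smash \<Rightarrow> (int \<Rightarrow>\<^sub>0 'v) \<Rightarrow> (int \<Rightarrow>\<^sub>0 'v)" where
  "smash_act m n M X w = (\<Sum>k\<in>Poly_Mapping.keys X.
     loop_A M (Poly_Mapping.single k 1) (loop_k m n M (Poly_Mapping.lookup X k) w))"

text \<open>The indexed derivations \<open>d\<^sub>0, \<dots>, d\<^sub>m, \<partial>\<^sub>1, \<dots>, \<partial>\<^sub>n\<close> of \<open>A\<close>.\<close>

definition kgen :: "nat \<Rightarrow> nat \<Rightarrow> nat \<Rightarrow> lgr \<Rightarrow> lgr" where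
  "kgen m n \<alpha> = (if \<alpha> \<le> m then dt {0..m} n \<alpha> else dzeta {0..m} n (\<alpha> - m))"

definition X_el :: "nat \<Rightarrow> nat \<Rightarrow> (nat \<Rightarrow>\<^sub>0 int) \<Rightarrow> nat set \<Rightarrow> nat \<Rightarrow> smash" where
  "X_el m n r J \<alpha> =
     (if J \<noteq> {} then \<Sum>I\<in>Pow J. smash_scale ((-1) ^ (card I + tau I (J - I)))
        (hash (lmono (- r) I) (\<lambda>f. lmono r (J - I) \<star> kgen m n \<alpha> f))
      else hash (lmono (- r) {}) (\<lambda>f. lmono r {} \<star> kgen m n \<alpha> f) - hash (lmono 0 {}) (kgen m n \<alpha>))"

definition T_alg :: "nat \<Rightarrow> nat \<Rightarrow> smash set" where
  "T_alg m n = module.span smash_scale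
     {X_el m n r J \<alpha> | r J \<alpha>. Poly_Mapping.keys r \<subseteq> {0..m} \<and> J \<subseteq> {1..n} \<and> \<alpha> \<le> m + n \<and> (J \<noteq> {} \<or> r \<noteq> 0)}"

definition T_submodule :: "nat \<Rightarrow> nat \<Rightarrow> ('v::ab_group_add) qp_data \<Rightarrow> (int \<Rightarrow>\<^sub>0 'v) set \<Rightarrow> bool" where
  "T_submodule m n M W \<longleftrightarrow> sub_superspace (loop_space M) W \<and>
     (\<forall>X\<in>T_alg m n. \<forall>w\<in>W. smash_act m n M X w \<in> W)"

definition one_tens :: "'v::ab_group_add \<Rightarrow> (int \<Rightarrow>\<^sub>0 'v)" where
  "one_tens u = Poly_Mapping.single 0 u"

definition T_simple :: "nat \<Rightarrow> nat \<Rightarrow> ('v::ab_group_add) qp_data \<Rightarrow> (int \<Rightarrow>\<^sub>0 'v) set \<Rightarrow> bool" where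
  "T_simple m n M W \<longleftrightarrow> T_submodule m n M W \<and> W \<noteq> {0} \<and>
     (\<forall>U. U \<subseteq> W \<and> T_submodule m n M U \<longrightarrow> U = {0} \<or> U = W)"

section \<open>Modules over gl(m+1, n)\<close>

text \<open>Matrices are indexed by \<open>0, \<dots>, m + n\<close> and vanish outside; the indices \<open>> m\<close> are odd.\<close>

type_synonym mat = "nat \<Rightarrow> nat \<Rightarrow> complex"

definition gl :: "nat \<Rightarrow> nat \<Rightarrow> mat superspace" where
  "gl m n = \<lparr>scal = (\<lambda>c X \<alpha> \<beta>. c * X \<alpha> \<beta>),
     part = (\<lambda>p. {X. \<forall>\<alpha> \<beta>. X \<alpha> \<beta> \<noteq> 0 \<longrightarrow> \<alpha> \<le> m + n \<and> \<beta> \<le> m + n \<and> ((m < \<alpha>) \<noteq> (m < \<beta>)) = p})\<rparr>"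

definition gl_bracket :: "nat \<Rightarrow> nat \<Rightarrow> mat \<Rightarrow> mat \<Rightarrow> mat" where
  "gl_bracket m n X Y = (\<lambda>\<alpha> \<beta>. \<Sum>\<gamma>\<le>m + n. X \<alpha> \<gamma> * Y \<gamma> \<beta> -
     ksign ((m < \<gamma>) \<noteq> (m < \<beta>)) ((m < \<alpha>) \<noteq> (m < \<gamma>)) * Y \<alpha> \<gamma> * X \<gamma> \<beta>)"

definition Emat :: "nat \<Rightarrow> nat \<Rightarrow> mat" where
  "Emat \<alpha> \<beta> = (\<lambda>i j. if i = \<alpha> \<and> j = \<beta> then 1 else 0)"

definition gl_diag :: "nat \<Rightarrow> nat \<Rightarrow> mat set" where
  "gl_diag m n = {X \<in> carr (gl m n). \<forall>\<alpha> \<beta>. \<alpha> \<noteq> \<beta> \<longrightarrow> X \<alpha> \<beta> = 0}"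

record 'v gl_data = "'v superspace" +
  glact :: "mat \<Rightarrow> 'v \<Rightarrow> 'v"

definition gl_module :: "nat \<Rightarrow> nat \<Rightarrow> ('v::ab_group_add) gl_data \<Rightarrow> bool" where
  "gl_module m n W \<longleftrightarrow> is_superspace W \<and> super_rep (gl m n) (gl_bracket m n) W (glact W)"

definition gl_simple :: "nat \<Rightarrow> nat \<Rightarrow> ('v::ab_group_add) gl_data \<Rightarrow> bool" where
  "gl_simple m n W \<longleftrightarrow> gl_module m n W \<and> carr W \<noteq> {0} \<and>
     (\<forall>U. sub_superspace W U \<and> (\<forall>X\<in>carr (gl m n). \<forall>u\<in>U. glact W X u \<in> U) \<longrightarrow> U = {0} \<or> U = carr W)"

definition gl_admissible :: "nat \<Rightarrow> nat \<Rightarrow> ('v::ab_group_add) gl_data \<Rightarrow> bool" where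
  "gl_admissible m n W \<longleftrightarrow> gl_simple m n W \<and>
     bounded_weight (scal (gl m n)) (gl_diag m n) (scal W) (carr W) (glact W)"

text \<open>The operators \<open>\<Phi>(E\<^sub>\<alpha>\<^sub>,\<^sub>\<beta>)\<close>; the three columns of the defining table are unified by \<open>gen\<close>.\<close>

definition Phi_E :: "nat \<Rightarrow> nat \<Rightarrow> ('v::ab_group_add) qp_data \<Rightarrow> nat \<Rightarrow> nat \<Rightarrow> 'v \<Rightarrow> 'v" where
  "Phi_E m n M \<alpha> \<beta> u =
     (if \<alpha> = 0 then - hphi M (gen m n \<beta>) u
      else if \<alpha> \<le> m then
        phi M (tpow \<alpha> (-1)) (psi M (g_mult (emb (tpow \<alpha> 1)) (gen m n \<beta>)) u) - psi M (gen m n \<beta>) u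
      else psi M (g_mult (emb (zeta (\<alpha> - m))) (gen m n \<beta>)) u - phi M (zeta (\<alpha> - m)) (psi M (gen m n \<beta>) u))"

definition Phi :: "nat \<Rightarrow> nat \<Rightarrow> ('v::ab_group_add) qp_data \<Rightarrow> mat \<Rightarrow> 'v \<Rightarrow> 'v" where
  "Phi m n M X u = (\<Sum>\<alpha>\<le>m + n. \<Sum>\<beta>\<le>m + n. scal M (X \<alpha> \<beta>) (Phi_E m n M \<alpha> \<beta> u))"

definition Omega_gl :: "nat \<Rightarrow> nat \<Rightarrow> ('v::ab_group_add) qp_data \<Rightarrow> 'v set \<Rightarrow> 'v gl_data" where
  "Omega_gl m n M W = \<lparr>scal = scal M, part = (\<lambda>p. W \<inter> part M p), glact = Phi m n M\<rparr>"

section \<open>Shen-Larsson QP-modules\<close>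

text \<open>Coefficient of \<open>\<partial>\<^sub>\<alpha>\<close> when \<open>x \<in> \<gg>\<close> is written as the sum of \<open>a\<^sub>\<alpha> \<partial>\<^sub>\<alpha>\<close>.\<close>

definition g_coord :: "nat \<Rightarrow> qp_el \<Rightarrow> nat \<Rightarrow> lgr" where
  "g_coord m x \<alpha> = (if \<alpha> = 0 then fst x
     else if \<alpha> \<le> m then tpow \<alpha> (-1) \<star> snd x (tpow \<alpha> 1) else snd x (zeta (\<alpha> - m)))"

text \<open>The formulas for \<open>b \<otimes> v\<close>, with \<open>b\<close> a monomial, are extended linearly, and in the case of
  \<open>\<psi>\<close> the coefficient \<open>a\<close> is decomposed into its homogeneous parts.\<close>

definition SL_phi :: "('v::ab_group_add) gl_data \<Rightarrow> lgr \<Rightarrow> (mon \<Rightarrow>\<^sub>0 'v) \<Rightarrow> (mon \<Rightarrow>\<^sub>0 'v)" where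
  "SL_phi W a f = (\<Sum>k\<in>Poly_Mapping.keys f.
     tens (scal W) (a \<star> Poly_Mapping.single k 1) (Poly_Mapping.lookup f k))"

definition SL_hphi :: "nat \<Rightarrow> nat \<Rightarrow> ('v::ab_group_add) gl_data \<Rightarrow> qp_el \<Rightarrow> (mon \<Rightarrow>\<^sub>0 'v) \<Rightarrow> (mon \<Rightarrow>\<^sub>0 'v)" where
  "SL_hphi m n W x f = (\<Sum>\<alpha>\<le>m + n. \<Sum>k\<in>Poly_Mapping.keys f.
     - pm_scale (scal W) (ksign (mon_parity k) (m < \<alpha>))
       (tens (scal W) (g_coord m x \<alpha> \<star> Poly_Mapping.single k 1)
          (glact W (Emat 0 \<alpha>) (Poly_Mapping.lookup f k))))"

definition SL_psi_hom :: "nat \<Rightarrow> nat \<Rightarrow> ('v::ab_group_add) gl_data \<Rightarrow> (nat \<Rightarrow> complex) \<Rightarrow>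
    nat \<Rightarrow> bool \<Rightarrow> lgr \<Rightarrow> mon \<Rightarrow> 'v \<Rightarrow> (mon \<Rightarrow>\<^sub>0 'v)" where
  "SL_psi_hom m n W \<mu> \<alpha> p a k v = (let b = Poly_Mapping.single k 1; q = mon_parity k in
     tens (scal W) (a \<star> (g_act (gen m n \<alpha>) b + lg_scale (\<mu> \<alpha>) b)) v +
     (\<Sum>\<beta>\<in>{1..m + n}. pm_scale (scal W)
        (ksign (p \<noteq> q) (m < \<beta>) * ksign True (m < \<beta>) * ksign q (m < \<alpha>))
        (tens (scal W) (g_act (gen m n \<beta>) a \<star> b) (glact W (Emat \<beta> \<alpha>) v))))"

definition SL_psi :: "nat \<Rightarrow> nat \<Rightarrow> ('v::ab_group_add) gl_data \<Rightarrow> (nat \<Rightarrow> complex) \<Rightarrow>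
    qp_el \<Rightarrow> (mon \<Rightarrow>\<^sub>0 'v) \<Rightarrow> (mon \<Rightarrow>\<^sub>0 'v)" where
  "SL_psi m n W \<mu> x f = (\<Sum>\<alpha>\<le>m + n. \<Sum>p\<in>UNIV. \<Sum>k\<in>Poly_Mapping.keys f.
     SL_psi_hom m n W \<mu> \<alpha> p (lg_part p (g_coord m x \<alpha>)) k (Poly_Mapping.lookup f k))"

definition shen_larsson :: "nat \<Rightarrow> nat \<Rightarrow> ('v::ab_group_add) gl_data \<Rightarrow> (nat \<Rightarrow> complex) \<Rightarrow> (mon \<Rightarrow>\<^sub>0 'v) qp_data" where
  "shen_larsson m n W \<mu> = \<lparr>scal = pm_scale (scal W),
     part = (\<lambda>p. {f. Poly_Mapping.keys f \<subseteq> mons {1..m} n \<and>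
       (\<forall>k\<in>Poly_Mapping.keys f. Poly_Mapping.lookup f k \<in> part W (p \<noteq> mon_parity k))}),
     phi = SL_phi W, hphi = SL_hphi m n W, psi = SL_psi m n W \<mu>\<rparr>"

end

theory Submission
  imports Defs "HOL-Computational_Algebra.Fundamental_Theorem_Algebra"
begin

text \<open>
  The idea is that the failure of \<open>\<psi>\<close> to be linear over the coefficient algebra is a derivation, and
  that a derivation is known from its values on generators.

  As a module over the coefficient algebra \<open>\<gg>\<close> is free on \<open>\<partial>\<^sub>0 = 1, \<partial>\<^sub>1, \<dots>, \<partial>\<^sub>m\<^sub>+\<^sub>n\<close> (\<open>g_expand\<close>), so everything is
  determined by the operators \<open>\<psi>(a \<partial>\<^sub>\<alpha>)\<close>. Put \<open>T(a, \<alpha>) = \<psi>(a \<partial>\<^sub>\<alpha>) - \<phi>(a) \<psi>(\<partial>\<^sub>\<alpha>)\<close>. The compatibility of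
  \<open>\<phi>\<close>-hat with \<open>\<psi>\<close>, read for \<open>a \<partial>\<^sub>\<alpha>\<close> and an element \<open>b\<close> of the algebra, says exactly that
  \<open>T(ab, \<alpha>) = \<phi>(a) T(b, \<alpha>) \<plusminus> \<phi>(b) T(a, \<alpha>)\<close> (\<open>T_mult\<close>). Hence \<open>T(a, \<alpha>)\<close> is the sum of the
  \<open>\<plusminus>\<phi>(\<partial>\<^sub>\<beta> a) E\<^sub>\<beta>\<^sub>\<alpha>\<close>, where \<open>E\<^sub>\<beta>\<^sub>\<alpha>\<close> is, up to a unit, the value of \<open>T\<close> at the generator \<open>t\<^sub>\<beta>\<close> or \<open>\<zeta>\<^sub>k\<close>
  (\<open>\<psi>_formula\<close>). Together with \<open>E\<^sub>0\<^sub>\<alpha>\<close>, which is minus \<open>\<phi>\<close>-hat of \<open>\<partial>\<^sub>\<alpha>\<close>, these operators satisfy the relations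
  of \<open>\<gg>\<ll>(m+1,n)\<close> (\<open>E_E\<close>) and supercommute with all \<open>\<phi>(a)\<close> and \<open>\<psi>(\<partial>\<^sub>\<alpha>)\<close>. In particular they preserve \<open>\<Omega>\<close>.

  Next \<open>M\<close> is recovered from \<open>\<Omega>\<close>. The operators \<open>\<psi>(d\<^sub>i)\<close> and \<open>\<phi>(\<zeta>\<^sub>k) \<psi>(\<partial>\<^sub>k)\<close> are diagonal on the vectors
  \<open>\<phi>(t\<^sup>r \<zeta>\<^sub>I) u\<close> with \<open>u \<in> \<Omega>\<close>, and their eigenvalues determine \<open>(r, I)\<close>. So \<open>a \<otimes> u \<mapsto> \<phi>(a) u\<close> is
  injective on the tensor product of the algebra with \<open>\<Omega>\<close> (\<open>mono_sum_inj\<close>). If \<open>U\<close> is a graded subspace of \<open>\<Omega>\<close> stable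
  under all \<open>E\<^sub>\<alpha>\<^sub>\<beta>\<close>, then by the structure formula the vectors \<open>\<phi>(a) u\<close> with \<open>u \<in> U\<close> span a submodule
  (\<open>gspan_submodule\<close>). If \<open>U\<close> is nonzero, this is all of \<open>M\<close>, and comparing eigenvalues shows that the
  \<open>\<phi>(\<zeta>\<^sub>I) u\<close> span \<open>N\<close> (\<open>wt_expand\<close>) and that \<open>U = \<Omega>\<close> (\<open>Om_simple\<close>). That \<open>\<Omega>\<close> is nonzero follows by applying
  odd derivatives to a vector of \<open>N\<close> until all of them kill it (\<open>Om_nonzero\<close>).

  The algebra \<open>\<T>\<close> acts on \<open>\<Omega>\<close> through \<open>\<gg>\<ll>(m+1,n)\<close>: \<open>X\<^sub>r\<^sub>,\<^sub>J\<^sub>,\<^sub>\<alpha>\<close> with \<open>J = {}\<close> acts as the sum of the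
  \<open>r\<^sub>i E\<^sub>i\<^sub>\<alpha>\<close>, the element for \<open>J = {k}\<close> as \<open>E\<^sub>m\<^sub>+\<^sub>k\<^sub>,\<^sub>\<alpha>\<close>, and those with larger \<open>J\<close> as \<open>0\<close>, again because \<open>T\<close> is a derivation
  (\<open>X_action\<close>). So \<open>\<T>\<close>-submodules are the graded \<open>\<gg>\<ll>(m+1,n)\<close>-stable subspaces (\<open>T_submodule_iff\<close>).

  On \<open>\<Omega>\<close> the element \<open>\<zeta>\<^sub>k \<partial>\<^sub>k\<close> acts as the diagonal operator \<open>E\<^sub>m\<^sub>+\<^sub>k\<^sub>,\<^sub>m\<^sub>+\<^sub>k\<close> and the rest of the Cartan subalgebra of \<open>\<gg>\<close> by
  scalars, so cuspidality bounds the joint eigenspaces of the \<open>\<zeta>\<^sub>k \<partial>\<^sub>k\<close> (\<open>Om_zeta_weights\<close>). One of them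
  is nonzero and finite dimensional and contains a common eigenvector of all \<open>E\<^sub>\<gamma>\<^sub>\<gamma>\<close>; common
  eigenvectors span a stable subspace, which is everything by simplicity (\<open>diag_eig_span\<close>). This makes \<open>\<Omega>\<close>
  admissible. Finally \<open>a \<otimes> u \<mapsto> \<phi>(a) u\<close> is an isomorphism from the Shen-Larsson module of
  \<open>\<Omega>\<close>, whose \<open>\<psi>\<close> is given by the structure formula (\<open>SL_isomorphic\<close>).
\<close>

section \<open>Laurent polynomials with Grassmann coefficients\<close>

abbreviation lookup :: "('k \<Rightarrow>\<^sub>0 'v::zero) \<Rightarrow> 'k \<Rightarrow> 'v" where "lookup \<equiv> Poly_Mapping.lookup"
abbreviation keys :: "('k \<Rightarrow>\<^sub>0 'v::zero) \<Rightarrow> 'k set" where "keys \<equiv> Poly_Mapping.keys"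
abbreviation single :: "'k \<Rightarrow> 'v \<Rightarrow> ('k \<Rightarrow>\<^sub>0 'v::zero)" where "single \<equiv> Poly_Mapping.single"
abbreviation mmon :: "mon \<Rightarrow> lgr" where "mmon k \<equiv> single k 1"

lemma lookup_pm_scale:
  assumes "s c 0 = 0"
  shows "lookup (pm_scale s c f) k = s c (lookup f k)"
  using assms by (simp add: pm_scale_def Poly_Mapping.map.rep_eq when_def)

lemma vector_space_pm_scale:
  assumes "vector_space s"
  shows "vector_space (pm_scale s)"
proof -
  interpret vector_space s by fact
  show ?thesis
    by (unfold_locales)
      (rule poly_mapping_eqI, simp add: lookup_pm_scale lookup_add scale_right_distrib scale_left_distrib)+
qed

lemma pm_scale_single:
  assumes "vector_space s"
  shows "pm_scale s c (single k v) = single k (s c v)"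
proof -
  interpret vector_space s by fact
  show ?thesis by (rule poly_mapping_eqI) (simp add: lookup_pm_scale lookup_single when_def)
qed

lemma keys_pm_scale: "s c 0 = 0 \<Longrightarrow> keys (pm_scale s c f) \<subseteq> keys f"
  by (auto simp: in_keys_iff lookup_pm_scale)

lemma sum_single_lookup:
  fixes f :: "'k \<Rightarrow> 'v::comm_monoid_add"
  assumes "finite A"
  shows "lookup (\<Sum>r\<in>A. single r (f r)) t = (if t \<in> A then f t else 0)"
proof -
  have "lookup (\<Sum>r\<in>A. single r (f r)) t = (\<Sum>r\<in>A. if r = t then f t else 0)"
    unfolding lookup_sum by (rule sum.cong) (auto simp: lookup_single when_def)
  then show ?thesis using assms by simp
qed

interpretation cx: vector_space "(*) :: complex \<Rightarrow> complex \<Rightarrow> complex"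
  by unfold_locales (auto simp: algebra_simps)

interpretation lg: vector_space lg_scale
  by (rule vector_space_pm_scale) (rule cx.vector_space_axioms)

lemma lookup_lg_scale [simp]: "lookup (lg_scale c f) k = c * lookup f k"
  by (simp add: lookup_pm_scale)

lemma lg_scale_single [simp]: "lg_scale c (single k d) = single k (c * d)"
  by (simp add: pm_scale_single[OF cx.vector_space_axioms])

abbreviation lin :: "(lgr \<Rightarrow> lgr) \<Rightarrow> bool" where
  "lin \<equiv> Vector_Spaces.linear lg_scale lg_scale"

lemma lin_iff: "lin f \<longleftrightarrow> (\<forall>x y. f (x + y) = f x + f y) \<and> (\<forall>c x. f (lg_scale c x) = lg_scale c (f x))"
  by (simp flip: module_hom_iff_linear add: module_hom_iff lg.module_axioms)

lemma lin_0: "lin f \<Longrightarrow> f 0 = 0"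
  using lin_iff[of f] by (metis add_cancel_right_right)

lemma lin_sum: "lin f \<Longrightarrow> f (\<Sum>i\<in>I. g i) = (\<Sum>i\<in>I. f (g i))"
  by (induction I rule: infinite_finite_induct) (auto simp: lin_0 lin_iff)

lemma lin_add: "lin f \<Longrightarrow> f (x + y) = f x + f y"
  and lin_scale: "lin f \<Longrightarrow> f (lg_scale c x) = lg_scale c (f x)"
  by (auto simp: lin_iff)

lemma lin_minus: "lin f \<Longrightarrow> f (- x) = - f x"
  using lin_scale[of f "-1" x] by simp

lemma lin_diff: "lin f \<Longrightarrow> f (x - y) = f x - f y"
  using lin_add[of f x "- y"] by (simp add: lin_minus)

named_theorems lin_intros

lemma lin_id [lin_intros]: "lin (\<lambda>x. x)"
  and lin_const0 [lin_intros]: "lin (\<lambda>x. 0)"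
  by (auto simp: lin_iff)

lemma lin_plus [lin_intros]: "lin f \<Longrightarrow> lin g \<Longrightarrow> lin (\<lambda>x. f x + g x)"
  and lin_sub [lin_intros]: "lin f \<Longrightarrow> lin g \<Longrightarrow> lin (\<lambda>x. f x - g x)"
  and lin_smult [lin_intros]: "lin f \<Longrightarrow> lin (\<lambda>x. lg_scale c (f x))"
  by (auto simp: lin_iff lg.scale_right_distrib lg.scale_right_diff_distrib lg.scale_left_commute)

lemma lin_sums [lin_intros]: "(\<And>i. i \<in> I \<Longrightarrow> lin (f i)) \<Longrightarrow> lin (\<lambda>x. \<Sum>i\<in>I. f i x)"
  by (induction I rule: infinite_finite_induct) (auto intro!: lin_intros)

lemma lin_comp: "lin f \<Longrightarrow> lin g \<Longrightarrow> lin (\<lambda>x. f (g x))"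
  by (auto simp: lin_iff)

lemma lg_expand: "a = (\<Sum>k\<in>keys a. lg_scale (lookup a k) (mmon k))"
  by (rule poly_mapping_eqI)
    (auto simp: lookup_sum lookup_single when_def sum.delta' in_keys_iff cong: if_cong)

text \<open>Products, derivations, projections and \<open>t\<^sub>0\<close>-coefficients are all defined as sums over the monomials of
  their argument. Each is \<open>lext\<close> of its values on monomials, which makes it linear at once.\<close>

definition lext :: "(mon \<Rightarrow> lgr) \<Rightarrow> lgr \<Rightarrow> lgr" where
  "lext g a = (\<Sum>k\<in>keys a. lg_scale (lookup a k) (g k))"

lemma lext_superset:
  assumes "finite K" "keys a \<subseteq> K"
  shows "lext g a = (\<Sum>k\<in>K. lg_scale (lookup a k) (g k))"
  unfolding lext_def using assms
  by (intro sum.mono_neutral_left) (auto simp: in_keys_iff)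

lemma lin_lext: "lin (lext g)"
proof -
  have "lext g (a + b) = lext g a + lext g b" for a b
  proof -
    let ?K = "keys a \<union> keys b"
    have "keys (a + b) \<subseteq> ?K" by (rule Poly_Mapping.keys_add)
    then show ?thesis
      by (simp add: lext_superset[of ?K] lookup_add lg.scale_left_distrib sum.distrib)
  qed
  moreover have "lext g (lg_scale c a) = lg_scale c (lext g a)" for c a
    using keys_pm_scale[of "(*)" c a]
    by (simp add: lext_superset[of "keys a"] lg.scale_sum_right)
  ultimately show ?thesis by (simp add: lin_iff)
qed

lemma lext_single [simp]: "lext g (single k c) = lg_scale c (g k)"
  by (simp add: lext_superset[of "{k}"])

lemma lin_eqI:
  assumes "lin f" "lin g" "\<And>k. k \<in> keys a \<Longrightarrow> f (mmon k) = g (mmon k)"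
  shows "f a = g a"
proof -
  have *: "f a = (\<Sum>k\<in>keys a. lg_scale (lookup a k) (f (mmon k)))"
    if "lin f" for f
    by (subst lg_expand) (simp only: lin_sum[OF that] lin_scale[OF that])
  then show ?thesis unfolding *[OF assms(1)] *[OF assms(2)]
    by (intro sum.cong refl) (simp only: assms(3))
qed

lemma mult_rot: "x * y * z = z * x * (y :: complex)"
  by simp

definition smul :: "mon \<Rightarrow> mon \<Rightarrow> lgr" where
  "smul k l = (if snd k \<inter> snd l = {} then
     single (fst k + fst l, snd k \<union> snd l) ((-1) ^ tau (snd k) (snd l)) else 0)"

lemma lg_mult_lext: "a \<star> b = lext (\<lambda>k. lext (smul k) b) a"
  unfolding lg_mult_def lext_def lg.scale_sum_right
proof (rule sum.cong[OF refl], clarify, rule sum.cong[OF refl], clarify)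
  fix r I s J
  show "(if I \<inter> J = {} then single (r + s, I \<union> J)
       ((-1) ^ tau I J * lookup a (r, I) * lookup b (s, J)) else 0)
    = lg_scale (lookup a (r, I)) (lg_scale (lookup b (s, J)) (smul (r, I) (s, J)))"
    by (simp add: smul_def mult_rot[symmetric])
qed

lemma lin_lext_arg: "lin (\<lambda>b. lext (\<lambda>k. lext (g k) b) a)"
  unfolding lext_def[of _ a] by (intro lin_intros lin_lext)

lemma lin_mult_left [lin_intros]: "lin f \<Longrightarrow> lin (\<lambda>x. f x \<star> b)"
  unfolding lg_mult_lext by (rule lin_comp[OF lin_lext])

lemma lin_mult_right [lin_intros]: "lin f \<Longrightarrow> lin (\<lambda>x. a \<star> f x)"
  unfolding lg_mult_lext by (rule lin_comp[OF lin_lext_arg])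

lemma lg_mult_single: "single k c \<star> single l d = lg_scale (c * d) (smul k l)"
  by (simp add: lg_mult_lext)

lemmas lg_mult_lin_left = lin_mult_left[OF lin_id] and lg_mult_lin_right = lin_mult_right[OF lin_id]

lemma lg_mult_simps [simp]:
  "0 \<star> b = 0" "a \<star> 0 = 0" "(- a) \<star> b = - (a \<star> b)" "a \<star> (- b) = - (a \<star> b)"
  "lg_scale c a \<star> b = lg_scale c (a \<star> b)" "a \<star> lg_scale c b = lg_scale c (a \<star> b)"
  by (rule lin_0[OF lg_mult_lin_left] lin_0[OF lg_mult_lin_right]
     lin_minus[OF lg_mult_lin_left] lin_minus[OF lg_mult_lin_right]
     lin_scale[OF lg_mult_lin_left] lin_scale[OF lg_mult_lin_right])+

lemma lg_mult_distrib:
  "(a + a') \<star> b = a \<star> b + a' \<star> b" "a \<star> (b + b') = a \<star> b + a \<star> b'"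
  "(a - a') \<star> b = a \<star> b - a' \<star> b" "a \<star> (b - b') = a \<star> b - a \<star> b'"
  by (rule lin_add[OF lg_mult_lin_left] lin_add[OF lg_mult_lin_right]
     lin_diff[OF lg_mult_lin_left] lin_diff[OF lg_mult_lin_right])+

lemma tau_Un_right: "finite J \<Longrightarrow> finite K \<Longrightarrow> J \<inter> K = {} \<Longrightarrow> tau I (J \<union> K) = tau I J + tau I K"
  by (simp add: tau_def sum.union_disjoint)

lemma tau_Un_left:
  assumes "finite I" "finite J" "I \<inter> J = {}"
  shows "tau (I \<union> J) K = tau I K + tau J K"
proof -
  have "card {i \<in> I \<union> J. k < i} = card {i \<in> I. k < i} + card {i \<in> J. k < i}" for k
  proof -
    have "{i \<in> I \<union> J. k < i} = {i \<in> I. k < i} \<union> {i \<in> J. k < i}" by auto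
    then show ?thesis using assms by (simp add: card_Un_disjoint disjoint_iff)
  qed
  then show ?thesis by (simp add: tau_def sum.distrib)
qed

lemma tau_empty [simp]: "tau {} J = 0" "tau I {} = 0"
  by (simp_all add: tau_def)

lemma tau_sing: "tau I {k} = card {i \<in> I. k < i}"
  by (simp add: tau_def)

lemma tau_sing_left: "finite I \<Longrightarrow> tau {k} I = card {i \<in> I. i < k}"
proof -
  assume f: "finite I"
  have "tau {k} I = (\<Sum>j\<in>I. if j < k then 1 else 0)"
    unfolding tau_def by (intro sum.cong refl) (auto simp: card_1_singleton_iff card_eq_0_iff)
  also have "\<dots> = card {i \<in> I. i < k}" using f
    by (simp add: sum.If_cases) (metis Collect_conj_eq Collect_mem_eq)
  finally show ?thesis .
qed

text \<open>Of two distinct indices exactly one is the larger, so every pair in \<open>I \<times> J\<close> is counted once. This is the source of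
  supercommutativity.\<close>

lemma tau_commute:
  assumes "finite I" "finite J" "I \<inter> J = {}"
  shows "tau I J + tau J I = card I * card J"
  using assms(2,3)
proof (induction J)
  case (insert j J)
  have *: "tau I (insert j J) = tau I {j} + tau I J" "tau (insert j J) I = tau {j} I + tau J I"
    using insert tau_Un_right[of "{j}" J I] tau_Un_left[of "{j}" J I] by auto
  have "I = {i \<in> I. j < i} \<union> {i \<in> I. i < j}" using insert by auto
  then have "card I = card {i \<in> I. j < i} + card {i \<in> I. i < j}"
    using assms(1) by (metis (no_types, lifting) card_Un_disjoint disjoint_iff finite_Un mem_Collect_eq not_less_iff_gr_or_eq)
  then show ?case using insert * assms(1) by (simp add: tau_sing tau_sing_left)
qed simp

abbreviation "lgA \<equiv> \<lambda>S n. carr (lg_alg S n)"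
abbreviation "lgP \<equiv> \<lambda>S n. part (lg_alg S n)"

lemma lgP_def: "lgP S n p = {a. keys a \<subseteq> {k \<in> mons S n. mon_parity k = p}}"
  by (simp add: lg_alg_def)

lemma scal_lg_alg [simp]: "scal (lg_alg S n) = lg_scale"
  by (simp add: lg_alg_def)

lemma mons_finite: "k \<in> mons S n \<Longrightarrow> finite (snd k)"
  by (auto simp: mons_def finite_subset)

lemma ksign_simps [simp]: "ksign False q = 1" "ksign p False = 1" "ksign True True = -1"
  by (auto simp: ksign_def)

lemma ksign_power: "ksign (odd a) (odd b) = (-1) ^ (a * b)"
  by (auto simp: ksign_def)

definition lg_one :: lgr where "lg_one = lmono 0 {}"

lemma lg_filter_lext: "lg_filter P = lext (\<lambda>k. if P k then mmon k else 0)"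
proof
  fix a show "lg_filter P a = lext (\<lambda>k. if P k then mmon k else 0) a"
    unfolding lg_filter_def lext_def
    by (rule sum.mono_neutral_cong_left) auto
qed

lemma lin_lg_filter: "lin (lg_filter P)" by (simp add: lg_filter_lext lin_lext)
lemma lin_lg_part: "lin (lg_part p)" by (simp add: lg_part_def lin_lg_filter)

lemma lin_lg_part' [lin_intros]: "lin f \<Longrightarrow> lin (\<lambda>x. lg_part p (f x))"
  and lin_lg_filter' [lin_intros]: "lin f \<Longrightarrow> lin (\<lambda>x. lg_filter P (f x))"
  using lin_comp lin_lg_part lin_lg_filter by blast+

lemma lookup_lg_filter: "lookup (lg_filter P a) k = (if P k then lookup a k else 0)"
proof -
  have "lookup (lg_filter P a) k
    = (\<Sum>l\<in>{l\<in>keys a. P l}. if l = k then lookup a k else 0)"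
    by (auto simp: lg_filter_def lookup_sum lookup_single when_def intro!: sum.cong)
  also have "\<dots> = (if P k then lookup a k else 0)"
    by (simp add: sum.delta) (auto simp: in_keys_iff)
  finally show ?thesis .
qed

lemma lookup_lg_part: "lookup (lg_part p a) k = (if mon_parity k = p then lookup a k else 0)"
  by (simp add: lg_part_def lookup_lg_filter)

lemma lg_part_add: "lg_part False a + lg_part True a = a"
  by (rule poly_mapping_eqI) (simp add: lookup_add lookup_lg_part)

lemma lgA_iff: "a \<in> lgA S n \<longleftrightarrow> keys a \<subseteq> mons S n"
proof
  assume "a \<in> lgA S n"
  then show "keys a \<subseteq> mons S n"
    using Poly_Mapping.keys_add by (fastforce simp: carr_def lgP_def)
next
  assume a: "keys a \<subseteq> mons S n"
  then have "lg_part False a \<in> lgP S n False" "lg_part True a \<in> lgP S n True"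
    by (auto simp: lgP_def in_keys_iff lookup_lg_part split: if_splits)
  then show "a \<in> lgA S n" using lg_part_add[of a] by (force simp: carr_def)
qed

lemma lgP_A: "a \<in> lgP S n p \<Longrightarrow> a \<in> lgA S n"
  by (auto simp: lgP_def lgA_iff)

lemma lgP_iff0: "a \<in> lgP S n p \<longleftrightarrow> (\<forall>k. \<not> (k \<in> mons S n \<and> mon_parity k = p) \<longrightarrow> lookup a k = 0)"
  by (auto simp: lgP_def subset_iff in_keys_iff)

lemma lgA_iff0: "a \<in> lgA S n \<longleftrightarrow> (\<forall>k. k \<notin> mons S n \<longrightarrow> lookup a k = 0)"
  by (auto simp: lgA_iff subset_iff in_keys_iff)

lemma lgP_subspace: "lg.subspace (lgP S n p)"
  by (rule lg.subspaceI) (simp_all add: lgP_iff0 lookup_add)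

lemma lgA_subspace: "lg.subspace (lgA S n)"
  by (rule lg.subspaceI) (simp_all add: lgA_iff0 lookup_add)

lemmas lgP_closed [simp, intro] = lg.subspace_add[OF lgP_subspace] lg.subspace_scale[OF lgP_subspace]
   lg.subspace_diff[OF lgP_subspace] lg.subspace_0[OF lgP_subspace]
lemmas lgA_closed [simp, intro] = lg.subspace_add[OF lgA_subspace] lg.subspace_scale[OF lgA_subspace]
   lg.subspace_diff[OF lgA_subspace] lg.subspace_0[OF lgA_subspace]

lemma lg_part_lgP: "a \<in> lgP S n p \<Longrightarrow> lg_part q a = (if q = p then a else 0)"
  by (rule poly_mapping_eqI) (auto simp: lgP_def lookup_lg_part in_keys_iff)

lemma lg_part_in [simp, intro]: "a \<in> lgA S n \<Longrightarrow> lg_part p a \<in> lgP S n p"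
  by (auto simp: lgP_def in_keys_iff lookup_lg_part lgA_iff split: if_splits)

lemma single_lgP: "k \<in> mons S n \<Longrightarrow> mon_parity k = p \<Longrightarrow> single k c \<in> lgP S n p"
  by (auto simp: lgP_def)

lemma single_lgA: "k \<in> mons S n \<Longrightarrow> single k c \<in> lgA S n"
  by (auto simp: lgA_iff)

text \<open>Monomials span, so identities that are linear in each argument reduce to comparing exponents of \<open>-1\<close>.\<close>

lemma lgP_eqI:
  assumes "a \<in> lgP S n p" "lin f" "lin g"
    "\<And>k. k \<in> mons S n \<Longrightarrow> mon_parity k = p \<Longrightarrow> f (mmon k) = g (mmon k)"
  shows "f a = g a"
  using assms by (intro lin_eqI[of f g a]) (auto simp: lgP_def)

lemma lgA_eqI:
  assumes "a \<in> lgA S n" "lin f" "lin g"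
    "\<And>k. k \<in> mons S n \<Longrightarrow> f (mmon k) = g (mmon k)"
  shows "f a = g a"
  using assms by (intro lin_eqI[of f g a]) (auto simp: lgA_iff)

lemma lgP_mem:
  assumes "a \<in> lgP S n p" "lin f" "lg.subspace W"
    "\<And>k. k \<in> mons S n \<Longrightarrow> mon_parity k = p \<Longrightarrow> f (mmon k) \<in> W"
  shows "f a \<in> W"
  using assms(1)
  by (subst lg_expand) (auto simp only: lin_sum[OF assms(2)] lin_scale[OF assms(2)] lgP_def
      intro!: lg.subspace_sum[OF assms(3)] lg.subspace_scale[OF assms(3)] assms(4))

text \<open>On monomials both sides carry the sign with exponent \<open>\<tau>(I, J) + \<tau>(I, K) + \<tau>(J, K)\<close>, by additivity
  of \<open>\<tau>\<close>.\<close>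

lemma lg_mult_assoc:
  assumes "a \<in> lgA S n" "b \<in> lgA S n" "c \<in> lgA S n"
  shows "(a \<star> b) \<star> c = a \<star> (b \<star> c)"
proof (rule lgA_eqI[OF assms(1), where f="\<lambda>a. (a \<star> b) \<star> c"]; (intro lin_intros)?)
  fix k assume k: "k \<in> mons S n"
  show "(mmon k \<star> b) \<star> c = mmon k \<star> (b \<star> c)"
  proof (rule lgA_eqI[OF assms(2), where f="\<lambda>b. (_ \<star> b) \<star> c"]; (intro lin_intros)?)
    fix l assume l: "l \<in> mons S n"
    show "(mmon k \<star> mmon l) \<star> c = mmon k \<star> (mmon l \<star> c)"
    proof (rule lgA_eqI[OF assms(3), where f="\<lambda>c. _ \<star> c"]; (intro lin_intros)?)
      fix q assume q: "q \<in> mons S n"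
      have fin: "finite (snd k)" "finite (snd l)" "finite (snd q)" using k l q by (auto simp: mons_finite)
      show "(mmon k \<star> mmon l) \<star> mmon q
         = mmon k \<star> (mmon l \<star> mmon q)"
      proof (cases "snd k \<inter> snd l = {} \<and> snd k \<inter> snd q = {} \<and> snd l \<inter> snd q = {}")
        case True
        then have "tau (snd k \<union> snd l) (snd q) = tau (snd k) (snd q) + tau (snd l) (snd q)"
          "tau (snd k) (snd l \<union> snd q) = tau (snd k) (snd l) + tau (snd k) (snd q)"
          using fin by (auto simp: tau_Un_left tau_Un_right)
        with True show ?thesis
          by (simp add: lg_mult_single smul_def Int_Un_distrib Int_Un_distrib2 add.assoc Un_assoc power_add)
            (rule arg_cong[where f="single _"], rule mult_rot)
      next
        case False
        then show ?thesis
          by (simp add: lg_mult_single smul_def Int_Un_distrib Int_Un_distrib2)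
      qed
    qed
  qed
qed

lemma mon_parity_Un:
  "finite I \<Longrightarrow> finite J \<Longrightarrow> I \<inter> J = {} \<Longrightarrow> mon_parity (r, I \<union> J) = (mon_parity (s, I) \<noteq> mon_parity (u, J))"
  by (auto simp: mon_parity_def card_Un_disjoint)

lemma mons_Un: "k \<in> mons S n \<Longrightarrow> l \<in> mons S n \<Longrightarrow> (fst k + fst l, snd k \<union> snd l) \<in> mons S n"
  unfolding mons_def by (cases k, cases l, simp) (meson Poly_Mapping.keys_add Un_least subset_trans)

lemma smul_lgP:
  assumes "k \<in> mons S n" "l \<in> mons S n"
  shows "smul k l \<in> lgP S n (mon_parity k \<noteq> mon_parity l)"
  using mons_Un[OF assms] assms
  by (auto simp: smul_def intro!: single_lgP)
    (metis mon_parity_Un mons_finite prod.collapse)+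

lemma lg_mult_lgP [simp, intro]:
  assumes "a \<in> lgP S n p" "b \<in> lgP S n q"
  shows "a \<star> b \<in> lgP S n (p \<noteq> q)"
proof (rule lgP_mem[OF assms(1), where f="\<lambda>a. a \<star> b"]; (intro lin_intros lgP_subspace)?)
  fix k assume k: "k \<in> mons S n" "mon_parity k = p"
  show "mmon k \<star> b \<in> lgP S n (p \<noteq> q)"
  proof (rule lgP_mem[OF assms(2), where f="\<lambda>b. _ \<star> b"]; (intro lin_intros lgP_subspace)?)
    fix l assume l: "l \<in> mons S n" "mon_parity l = q"
    show "mmon k \<star> mmon l \<in> lgP S n (p \<noteq> q)"
      using smul_lgP[OF k(1) l(1)] k l by (simp add: lg_mult_single)
  qed
qed

lemma lg_mult_lgA [simp, intro]:
  assumes "a \<in> lgA S n" "b \<in> lgA S n"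
  shows "a \<star> b \<in> lgA S n"
proof -
  have "a \<star> b = (\<Sum>p\<in>UNIV. \<Sum>q\<in>UNIV. lg_part p a \<star> lg_part q b)"
    by (subst lg_part_add[of a, symmetric], subst lg_part_add[of b, symmetric])
      (simp add: UNIV_bool lg_mult_distrib)
  also have "\<dots> \<in> lgA S n"
    using assms by (intro lg.subspace_sum[OF lgA_subspace] lgP_A[OF lg_mult_lgP[OF lg_part_in lg_part_in]])
  finally show ?thesis .
qed

lemma lg_mult_commute:
  assumes "a \<in> lgP S n p" "b \<in> lgP S n q"
  shows "a \<star> b = lg_scale (ksign p q) (b \<star> a)"
proof (rule lgP_eqI[OF assms(1), where f="\<lambda>a. a \<star> b"]; (intro lin_intros)?)
  fix k assume k: "k \<in> mons S n" "mon_parity k = p"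
  show "mmon k \<star> b = lg_scale (ksign p q) (b \<star> mmon k)"
  proof (rule lgP_eqI[OF assms(2), where f="\<lambda>b. _ \<star> b"]; (intro lin_intros)?)
    fix l assume l: "l \<in> mons S n" "mon_parity l = q"
    have fin: "finite (snd k)" "finite (snd l)" using k l by (auto simp: mons_finite)
    have "((-1)::complex) ^ tau (snd k) (snd l) = ksign p q * (-1) ^ tau (snd l) (snd k)" if "snd k \<inter> snd l = {}"
    proof -
      have "ksign p q = (-1) ^ (tau (snd k) (snd l) + tau (snd l) (snd k))"
        using tau_commute[OF fin that] k l ksign_power[of "card (snd k)" "card (snd l)"] by (auto simp: mon_parity_def)
      then show ?thesis by (simp add: power_add mult.assoc flip: power_mult_distrib)
    qed
    then show "mmon k \<star> mmon l
      = lg_scale (ksign p q) (mmon l \<star> mmon k)"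
      by (auto simp: lg_mult_single smul_def add_ac Un_commute Int_commute)
  qed
qed

lemma lg_one_mult [simp]: "lg_one \<star> a = a" "a \<star> lg_one = a"
  by (rule lin_eqI[where f="\<lambda>a. lg_one \<star> a" and g="\<lambda>a. a"] lin_eqI[where f="\<lambda>a. a \<star> lg_one" and g="\<lambda>a. a"]; (intro lin_intros)?;
      simp add: lg_one_def lmono_def lg_mult_single smul_def)+

lemma lg_one_in [simp]: "lg_one \<in> lgP S n False" "lg_one \<in> lgA S n"
  by (auto simp: lg_one_def lmono_def mons_def mon_parity_def intro!: single_lgP single_lgA)

section \<open>Derivations of the coefficient algebra\<close>

(* Otherwise the bounds of index ranges such as {1..m} become Suc 0, and facts about them no longer match. *)
declare One_nat_def [simp del]

definition dt_mon :: "nat set \<Rightarrow> nat \<Rightarrow> nat \<Rightarrow> mon \<Rightarrow> lgr" where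
  "dt_mon S n i k = (if k \<in> mons S n then single k (of_int (lookup (fst k) i)) else 0)"

text \<open>The sign counts the factors that \<open>\<zeta>\<^sub>j\<close> passes on its way to the front, as \<open>\<tau>({j}, I)\<close>; in this form the
  additivity of \<open>\<tau>\<close> applies to it.\<close>

definition dzeta_mon :: "nat set \<Rightarrow> nat \<Rightarrow> nat \<Rightarrow> mon \<Rightarrow> lgr" where
  "dzeta_mon S n j k = (if k \<in> mons S n \<and> j \<in> snd k
     then single (fst k, snd k - {j}) ((-1) ^ tau {j} (snd k)) else 0)"

lemma dt_lext: "dt S n i = lext (dt_mon S n i)"
proof
  fix f show "dt S n i f = lext (dt_mon S n i) f"
    unfolding dt_def lext_def
    by (rule sum.mono_neutral_cong_left) (auto simp: dt_mon_def mult.commute split: prod.splits)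
qed

lemma dzeta_lext: "dzeta S n j = lext (dzeta_mon S n j)"
proof
  fix f show "dzeta S n j f = lext (dzeta_mon S n j) f"
    unfolding dzeta_def lext_def
  proof (rule sum.mono_neutral_cong_left)
    fix k assume "k \<in> keys f \<inter> mons S n"
    then show "(case k of (r, I) \<Rightarrow> if j \<in> I then single (r, I - {j})
       ((-1) ^ card {i\<in>I. i < j} * lookup f (r, I)) else 0)
      = lg_scale (lookup f k) (dzeta_mon S n j k)"
      using mons_finite[of k S n]
      by (auto simp: dzeta_mon_def tau_sing_left mult.commute split: prod.splits)
  qed (auto simp: dzeta_mon_def)
qed

lemma lin_dt: "lin (dt S n i)" and lin_dzeta: "lin (dzeta S n j)"
  by (simp_all add: dt_lext dzeta_lext lin_lext)

lemma dt_single: "dt S n i (single k c) = lg_scale c (dt_mon S n i k)"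
  and dzeta_single: "dzeta S n j (single k c) = lg_scale c (dzeta_mon S n j k)"
  by (simp_all add: dt_lext dzeta_lext)

lemma dt_lgP: "a \<in> lgP S n p \<Longrightarrow> dt S n i a \<in> lgP S n p"
  by (rule lgP_mem[where f="dt S n i"])
    (auto intro: lin_dt lgP_subspace single_lgP simp: dt_single dt_mon_def)

lemma mons_Diff: "k \<in> mons S n \<Longrightarrow> (fst k, snd k - J) \<in> mons S n"
  by (auto simp: mons_def)

lemma dzeta_lgP: "a \<in> lgP S n p \<Longrightarrow> dzeta S n j a \<in> lgP S n (\<not> p)"
proof (rule lgP_mem[where f="dzeta S n j"])
  fix k assume k: "k \<in> mons S n" "mon_parity k = p"
  have "mon_parity (fst k, snd k - {j}) = (\<not> p)" if "j \<in> snd k"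
    using k that mons_finite[OF k(1)] card_gt_0_iff[of "snd k"] by (auto simp: mon_parity_def card_Diff_singleton)
  then show "dzeta S n j (mmon k) \<in> lgP S n (\<not> p)"
    using k by (auto simp: dzeta_single dzeta_mon_def intro!: single_lgP mons_Diff)
qed (auto intro: lin_dzeta lgP_subspace)

lemma dt_leibniz:
  assumes "a \<in> lgA S n" "b \<in> lgA S n"
  shows "dt S n i (a \<star> b) = dt S n i a \<star> b + a \<star> dt S n i b"
proof (rule lgA_eqI[OF assms(1), where f="\<lambda>a. dt S n i (a \<star> b)"]; (intro lin_intros lin_dt lin_comp[OF lin_dt])?)
  fix k assume k: "k \<in> mons S n"
  show "dt S n i (mmon k \<star> b) = dt S n i (mmon k) \<star> b + mmon k \<star> dt S n i b"
  proof (rule lgA_eqI[OF assms(2), where f="\<lambda>b. dt S n i (_ \<star> b)"]; (intro lin_intros lin_dt lin_comp[OF lin_dt])?)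
    fix l assume l: "l \<in> mons S n"
    show "dt S n i (mmon k \<star> mmon l)
      = dt S n i (mmon k) \<star> mmon l + mmon k \<star> dt S n i (mmon l)"
      using k l mons_Un[OF k l]
      by (simp add: lg_mult_single smul_def dt_single dt_mon_def lookup_add lin_0[OF lin_dt] distrib_left mult.commute
          flip: single_add)
  qed
qed

lemma odd_sum_neg: "odd (a + b) \<Longrightarrow> (-1) ^ a + (-1) ^ b = (0 :: complex)"
  by (cases "even a") auto

lemma even_sum_eq: "even (a + b) \<Longrightarrow> (-1) ^ a = ((-1) ^ b :: complex)"
  by (cases "even a") auto

text \<open>On monomials there is at most one nonzero term on the right, and the signs agree by additivity of \<open>\<tau>\<close>, except if \<open>j\<close>
  is the only common index: then the left side vanishes and the two terms on the right cancel.\<close>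

lemma dzeta_leibniz:
  assumes "a \<in> lgP S n q" "b \<in> lgA S n"
  shows "dzeta S n j (a \<star> b) = dzeta S n j a \<star> b + lg_scale (ksign True q) (a \<star> dzeta S n j b)"
proof (rule lgP_eqI[OF assms(1), where f="\<lambda>a. dzeta S n j (a \<star> b)"]; (intro lin_intros lin_dzeta lin_comp[OF lin_dzeta])?)
  fix k assume k: "k \<in> mons S n" "mon_parity k = q"
  show "dzeta S n j (mmon k \<star> b) = dzeta S n j (mmon k) \<star> b +
     lg_scale (ksign True q) (mmon k \<star> dzeta S n j b)"
  proof (rule lgA_eqI[OF assms(2), where f="\<lambda>b. dzeta S n j (_ \<star> b)"]; (intro lin_intros lin_dzeta lin_comp[OF lin_dzeta])?)
    fix l assume l: "l \<in> mons S n"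
    obtain r I where kk: "k = (r, I)" by (cases k)
    obtain s J where ll: "l = (s, J)" by (cases l)
    have fin: "finite I" "finite J" using k l mons_finite kk ll by fastforce+
    have sg: "ksign True q = (-1) ^ card I" using k kk by (auto simp: mon_parity_def ksign_def)
    have D: "(r + s, I \<union> J) \<in> mons S n" using mons_Un[OF k(1) l] kk ll by simp
    have tI: "tau {j} I = tau {j} (I - {j})" "tau I J = tau (I - {j}) J + tau {j} J" if "j \<in> I" for J
    proof -
      have "I = insert j (I - {j})" using that by auto
      then have "tau {j} I = tau {j} ({j} \<union> (I - {j}))" "tau I J = tau ({j} \<union> (I - {j})) J" by auto
      then show "tau {j} I = tau {j} (I - {j})" "tau I J = tau (I - {j}) J + tau {j} J"
        using fin tau_Un_right[of "{j}" "I - {j}" "{j}"] tau_Un_left[of "{j}" "I - {j}" J] by (auto simp: tau_sing)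
    qed
    have tJ: "tau {j} J = tau {j} (J - {j})" "tau I J = tau I (J - {j}) + tau I {j}" if "j \<in> J" for I
    proof -
      have "J = insert j (J - {j})" using that by auto
      then have "tau {j} J = tau {j} ({j} \<union> (J - {j}))" "tau I J = tau I ({j} \<union> (J - {j}))" by auto
      then show "tau {j} J = tau {j} (J - {j})" "tau I J = tau I (J - {j}) + tau I {j}"
        using fin tau_Un_right[of "{j}" "J - {j}"] by (auto simp: tau_sing)
    qed
    have tc: "tau I {j} + tau {j} I = card I" if "j \<notin> I" using tau_commute[of I "{j}"] fin that by simp
    have tU: "tau {j} (I \<union> J) = tau {j} I + tau {j} J" if "I \<inter> J = {}" using tau_Un_right[OF fin that] .
    consider "j \<notin> I" "j \<notin> J" | "j \<in> I" "j \<notin> J" | "j \<notin> I" "j \<in> J" | "j \<in> I" "j \<in> J" by auto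
    then show "dzeta S n j (mmon k \<star> mmon l)
      = dzeta S n j (mmon k) \<star> mmon l
        + lg_scale (ksign True q) (mmon k \<star> dzeta S n j (mmon l))"
    proof cases
      case 1
      then show ?thesis
        by (simp add: lg_mult_single dzeta_single dzeta_mon_def smul_def kk ll lin_0[OF lin_dzeta])
    next
      case 2
      show ?thesis
      proof (cases "I \<inter> J = {}")
        case True
        have "(-1) ^ (tau I J + tau {j} (I \<union> J)) = ((-1) ^ (tau {j} I + tau (I - {j}) J) :: complex)"
          by (rule even_sum_eq) (auto simp: tU[OF True] tI(2)[OF 2(1)])
        moreover have "I \<union> J - {j} = (I - {j}) \<union> J" "(I - {j}) \<inter> J = {}" using 2 True by auto
        ultimately show ?thesis using 2 True D k l
          by (simp add: lg_mult_single dzeta_single dzeta_mon_def smul_def kk ll power_add)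
      next
        case False
        then have "(I - {j}) \<inter> J \<noteq> {}" using 2 by auto
        with False 2 show ?thesis
          by (simp add: lg_mult_single dzeta_single dzeta_mon_def smul_def kk ll lin_0[OF lin_dzeta])
      qed
    next
      case 3
      show ?thesis
      proof (cases "I \<inter> J = {}")
        case True
        have "(-1) ^ (tau I J + tau {j} (I \<union> J)) = ((-1) ^ (card I + (tau {j} J + tau I (J - {j}))) :: complex)"
          unfolding tU[OF True] tJ(2)[OF 3(2)] tc[OF 3(1), symmetric] by (rule even_sum_eq) auto
        moreover have "I \<union> J - {j} = I \<union> (J - {j})" "I \<inter> (J - {j}) = {}" using 3 True by auto
        ultimately show ?thesis using 3 True D k l
          by (simp add: lg_mult_single dzeta_single dzeta_mon_def smul_def kk ll power_add sg)
      next
        case False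
        then have "I \<inter> (J - {j}) \<noteq> {}" using 3 by auto
        with False 3 show ?thesis
          by (simp add: lg_mult_single dzeta_single dzeta_mon_def smul_def kk ll lin_0[OF lin_dzeta])
      qed
    next
      case 4
      then have ne: "I \<inter> J \<noteq> {}" by auto
      show ?thesis
      proof (cases "I \<inter> J = {j}")
        case True
        have u: "(I - {j}) \<union> J = I \<union> (J - {j})" "(I - {j}) \<inter> J = {}" "I \<inter> (J - {j}) = {}"
          using 4 True by auto
        have cI: "card I = Suc (card (I - {j}))" using 4 fin by (metis card.remove)
        have tc': "tau (I - {j}) {j} + tau {j} (I - {j}) = card (I - {j})"
          using tau_commute[of "I - {j}" "{j}"] fin by simp
        have "odd ((tau {j} I + tau (I - {j}) J) + (card I + (tau {j} J + tau I (J - {j}))))"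
          using tI(2)[OF 4(1), of "J - {j}"] tJ(2)[OF 4(2), of "I - {j}"] tI(1)[OF 4(1)] tJ(1)[OF 4(2)] tc' cI
          by presburger
        then have "(-1) ^ (tau {j} I + tau (I - {j}) J) + (-1) ^ (card I + (tau {j} J + tau I (J - {j}))) = (0::complex)"
          by (rule odd_sum_neg)
        then show ?thesis using 4 k l ne u
          by (simp add: lg_mult_single dzeta_single dzeta_mon_def smul_def kk ll power_add sg lin_0[OF lin_dzeta]
              flip: single_add)
      next
        case False
        then have "(I - {j}) \<inter> J \<noteq> {}" "I \<inter> (J - {j}) \<noteq> {}" using 4 by auto
        with ne show ?thesis
          by (simp add: lg_mult_single dzeta_single dzeta_mon_def smul_def kk ll lin_0[OF lin_dzeta])
      qed
    qed
  qed
qed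

subsection \<open>The derivations \<open>\<partial>\<^sub>\<alpha>\<close>\<close>

text \<open>The operator of \<open>\<partial>\<^sub>\<alpha>\<close> on the coefficient algebra. For \<open>\<alpha> = 0\<close> it is zero, since the unit of the algebra brackets
  to zero with every function; so all commutation rules below hold for \<open>\<alpha> = 0\<close> as well.\<close>

definition pd :: "nat \<Rightarrow> nat \<Rightarrow> nat \<Rightarrow> lgr \<Rightarrow> lgr" where
  "pd m n \<alpha> = snd (gen m n \<alpha>)"

lemma pd_alt: "pd m n \<alpha> = (if \<alpha> = 0 then (\<lambda>_. 0) else if \<alpha> \<le> m then dt {1..m} n \<alpha> else dzeta {1..m} n (\<alpha> - m))"
  by (auto simp: pd_def gen_def emb_def fun_eq_iff)

abbreviation "dA \<equiv> \<lambda>m n. lgA {1..m} n"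
abbreviation "dP \<equiv> \<lambda>m n. lgP {1..m} n"

lemma lin_pd: "lin (pd m n \<alpha>)"
  by (auto simp: pd_alt lin_dt lin_dzeta lin_intros)

lemma lin_pd' [lin_intros]: "lin f \<Longrightarrow> lin (\<lambda>x. pd m n \<alpha> (f x))"
  by (rule lin_comp[OF lin_pd])

lemmas pd_lin_simps [simp] = lin_0[OF lin_pd] lin_add[OF lin_pd] lin_scale[OF lin_pd] lin_minus[OF lin_pd] lin_diff[OF lin_pd]

lemma pd_dP [simp, intro]: "a \<in> dP m n p \<Longrightarrow> pd m n \<alpha> a \<in> dP m n ((m < \<alpha>) \<noteq> p)"
  using dt_lgP[of a "{1..m}" n p \<alpha>] dzeta_lgP[of a "{1..m}" n p "\<alpha> - m"] by (auto simp: pd_alt)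

lemma pd_leibniz:
  assumes "a \<in> dP m n q" "b \<in> dA m n"
  shows "pd m n \<alpha> (a \<star> b) = pd m n \<alpha> a \<star> b + lg_scale (ksign (m < \<alpha>) q) (a \<star> pd m n \<alpha> b)"
  using dt_leibniz[OF lgP_A[OF assms(1)] assms(2)] dzeta_leibniz[OF assms] by (auto simp: pd_alt)

lemma pd_outside: "k \<notin> mons {1..m} n \<Longrightarrow> pd m n \<alpha> (single k c) = 0"
  by (auto simp: pd_alt dt_single dzeta_single dt_mon_def dzeta_mon_def)

lemma pd_in [simp, intro]: "pd m n \<alpha> f \<in> dA m n"
proof -
  have "pd m n \<alpha> f = lext (\<lambda>k. pd m n \<alpha> (mmon k)) f"
    by (rule lin_eqI) (auto intro: lin_pd lin_lext)
  also have "\<dots> \<in> dA m n" unfolding lext_def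
  proof (intro lg.subspace_sum[OF lgA_subspace] lg.subspace_scale[OF lgA_subspace])
    fix k show "pd m n \<alpha> (mmon k) \<in> dA m n"
      by (cases "k \<in> mons {1..m} n") (auto simp: pd_outside intro!: lgP_A[OF pd_dP[OF single_lgP[OF _ refl]]])
  qed
  finally show ?thesis .
qed

lemma odd_rearranged: "c + d = (1::nat) \<Longrightarrow> odd ((p + d + q) + (q + c + p))"
  by presburger

text \<open>Removing \<open>j\<close> first or \<open>i\<close> first differs by whether one of them has to pass the other.\<close>

lemma dzeta_anticomm:
  assumes "a \<in> lgA S n"
  shows "dzeta S n i (dzeta S n j a) = - dzeta S n j (dzeta S n i a)"
proof -
  have "dzeta S n i (dzeta S n j a) = lg_scale (-1) (dzeta S n j (dzeta S n i a))"
  proof (rule lgA_eqI[OF assms]; (intro lin_intros lin_comp[OF lin_dzeta] lin_dzeta)?)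
    fix k assume k: "k \<in> mons S n"
    obtain r I where kk: "k = (r, I)" by (cases k)
    have fin: "finite I" using mons_finite[OF k] kk by simp
    have in1: "(r, I - {i}) \<in> mons S n" "(r, I - {j}) \<in> mons S n" using mons_Diff[OF k] kk by auto
    have t: "tau {i} I = tau {i} (I - {j}) + tau {i} {j}" if "i \<noteq> j" "j \<in> I" for i j
    proof -
      have "I = (I - {j}) \<union> {j}" using that by auto
      then show ?thesis using tau_Un_right[of "I - {j}" "{j}" "{i}"] fin by auto
    qed
    show "dzeta S n i (dzeta S n j (mmon k)) = lg_scale (-1) (dzeta S n j (dzeta S n i (mmon k)))"
    proof (cases "i \<in> I \<and> j \<in> I \<and> i \<noteq> j")
      case True
      have "tau {i} {j} + tau {j} {i} = 1" using tau_commute[of "{i}" "{j}"] True by simp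
      then have "odd ((tau {j} I + tau {i} (I - {j})) + (tau {i} I + tau {j} (I - {i})))"
        unfolding t[OF conjunct2[OF conjunct2[OF True]] conjunct1[OF conjunct2[OF True]]]
          t[OF conjunct2[OF conjunct2[OF True], symmetric] conjunct1[OF True]]
        by (rule odd_rearranged)
      then have "(-1) ^ (tau {j} I + tau {i} (I - {j})) = - ((-1) ^ (tau {i} I + tau {j} (I - {i})) :: complex)"
        using odd_sum_neg by (metis add_eq_0_iff2)
      moreover have "I - {i} - {j} = I - {j} - {i}" by auto
      ultimately show ?thesis using True in1 k
        by (simp add: dzeta_single dzeta_mon_def kk power_add)
    next
      case False
      then show ?thesis by (auto simp: dzeta_single dzeta_mon_def kk lin_0[OF lin_dzeta])
    qed
  qed
  then show ?thesis by simp
qed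

lemma dt_dt_comm: "a \<in> lgA S n \<Longrightarrow> dt S n i (dt S n j a) = dt S n j (dt S n i a)"
  by (rule lgA_eqI[where f="\<lambda>a. dt S n i (dt S n j a)"]) (auto intro!: lin_comp[OF lin_dt] lin_dt simp: dt_single dt_mon_def mult.commute)

lemma dt_dzeta_comm: "a \<in> lgA S n \<Longrightarrow> dt S n i (dzeta S n j a) = dzeta S n j (dt S n i a)"
  by (rule lgA_eqI[where f="\<lambda>a. dt S n i (dzeta S n j a)"]) (auto intro!: lin_comp[OF lin_dt] lin_comp[OF lin_dzeta] lin_dt lin_dzeta
     simp: dt_single dzeta_single dt_mon_def dzeta_mon_def lin_0[OF lin_dt] mult.commute dest: mons_Diff)

lemma pd_comm: "a \<in> dA m n \<Longrightarrow> pd m n \<alpha> (pd m n \<beta> a) = lg_scale (ksign (m < \<alpha>) (m < \<beta>)) (pd m n \<beta> (pd m n \<alpha> a))"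
  using dzeta_anticomm[of a "{1..m}" n "\<alpha> - m" "\<beta> - m"] dt_dt_comm[of a "{1..m}" n] dt_dzeta_comm[of a "{1..m}" n]
  by (auto simp: pd_alt lin_0[OF lin_dt] lin_0[OF lin_dzeta])

lemma pd_comm': "pd m n \<alpha> (pd m n \<beta> f) = lg_scale (ksign (m < \<alpha>) (m < \<beta>)) (pd m n \<beta> (pd m n \<alpha> f))"
proof (rule lin_eqI[where f="\<lambda>f. pd m n \<alpha> (pd m n \<beta> f)"]; (intro lin_intros)?)
  fix k show "pd m n \<alpha> (pd m n \<beta> (mmon k)) = lg_scale (ksign (m < \<alpha>) (m < \<beta>)) (pd m n \<beta> (pd m n \<alpha> (mmon k)))"
    by (cases "k \<in> mons {1..m} n") (auto simp: pd_outside intro: pd_comm single_lgA)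
qed

lemma superder_lin: "\<delta> \<in> superder S n p \<Longrightarrow> lin \<delta>"
  and superder_outside: "\<delta> \<in> superder S n p \<Longrightarrow> k \<notin> mons S n \<Longrightarrow> \<delta> (single k c) = 0"
  and superder_lgP: "\<delta> \<in> superder S n p \<Longrightarrow> a \<in> lgP S n q \<Longrightarrow> \<delta> a \<in> lgP S n (p \<noteq> q)"
  and superder_leibniz: "\<delta> \<in> superder S n p \<Longrightarrow> a \<in> lgP S n q \<Longrightarrow> b \<in> lgA S n \<Longrightarrow>
      \<delta> (a \<star> b) = \<delta> a \<star> b + lg_scale (ksign p q) (a \<star> \<delta> b)"
  unfolding superder_def by blast+

lemma lg_part_single: "lg_part p (single k c) = (if mon_parity k = p then single k c else 0)"
  by (rule poly_mapping_eqI) (auto simp: lookup_lg_part lookup_single when_def)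

text \<open>The product and the bracket of \<open>\<gg>\<close> are defined through homogeneous parts; this identifies the parts of a homogeneous
  derivation.\<close>

lemma der_part_superder:
  assumes "\<delta> \<in> superder S n p"
  shows "der_part q \<delta> = (if q = p then \<delta> else 0)"
proof
  fix f
  note l = superder_lin[OF assms]
  have lin_if: "lin f \<Longrightarrow> lin g \<Longrightarrow> lin (\<lambda>x. if q = p then f x else g x)" for f g
    by (cases "q = p") auto
  have "der_part q \<delta> f = (if q = p then \<delta> f else 0)"
    unfolding der_part_def
  proof (rule lin_eqI[where g="\<lambda>f. if q = p then \<delta> f else 0" and
       f="\<lambda>f. \<Sum>q'\<in>UNIV. lg_part (q \<noteq> q') (\<delta> (lg_part q' f))"]; (intro lin_intros lin_if lin_comp[OF l])?)
    fix k
    show "(\<Sum>q'\<in>UNIV. lg_part (q \<noteq> q') (\<delta> (lg_part q' (mmon k))))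
      = (if q = p then \<delta> (mmon k) else 0)"
    proof (cases "k \<in> mons S n")
      case True
      have "\<delta> (mmon k) \<in> lgP S n (p \<noteq> mon_parity k)"
        by (rule superder_lgP[OF assms single_lgP[OF True refl]])
      then show ?thesis
        by (cases q; cases p; cases "mon_parity k"; simp add: UNIV_bool lg_part_single lin_0[OF l] lg_part_lgP lin_0[OF lin_lg_part])
    next
      case False
      then show ?thesis
        by (simp add: lg_part_single lin_0[OF l] lin_0[OF lin_lg_part] superder_outside[OF assms] if_distrib cong: if_cong)
    qed
  qed
  then show "der_part q \<delta> f = (if q = p then \<delta> else 0) f" by (simp add: zero_fun_def)
qed

subsection \<open>Product and bracket of homogeneous elements\<close>

lemma part_gdot: "x \<in> part (gdot m n) p \<longleftrightarrow> fst x \<in> dP m n p \<and> snd x \<in> superder {1..m} n p"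
  by (auto simp: gdot_def Der_def mem_Times_iff)

lemma g_mult_hom:
  assumes x: "x \<in> part (gdot m n) p" and y: "y \<in> part (gdot m n) q"
  shows "g_mult x y = (fst x \<star> fst y, \<lambda>f. fst x \<star> snd y f + lg_scale (ksign p q) (fst y \<star> snd x f))"
proof -
  have 1: "lg_part p' (fst y) = (if p' = q then fst y else 0)" for p'
    using y lg_part_lgP by (auto simp: part_gdot)
  have 2: "der_part q' (snd x) = (if q' = p then snd x else 0)" for q'
    using x der_part_superder by (auto simp: part_gdot)
  have "(\<Sum>p'\<in>UNIV. \<Sum>q'\<in>UNIV. lg_scale (ksign p' q') (lg_part p' (fst y) \<star> der_part q' (snd x) f))
    = lg_scale (ksign p q) (fst y \<star> snd x f)" for f
    unfolding 1 2 by (cases p; cases q; simp add: UNIV_bool zero_fun_def)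
  then show ?thesis by (simp add: g_mult_def)
qed

lemma g_bracket_hom:
  assumes x: "x \<in> part (gdot m n) p" and y: "y \<in> part (gdot m n) q"
  shows "g_bracket x y = (snd x (fst y) - lg_scale (ksign p q) (snd y (fst x)),
     \<lambda>f. snd x (snd y f) - lg_scale (ksign p q) (snd y (snd x f)))"
proof -
  have 1: "lg_part p' (fst x) = (if p' = p then fst x else 0)" for p'
    using x lg_part_lgP by (auto simp: part_gdot)
  have 2: "der_part q' (snd y) = (if q' = q then snd y else 0)" for q'
    using y der_part_superder by (auto simp: part_gdot)
  have 3: "der_part q' (snd x) = (if q' = p then snd x else 0)" for q'
    using x der_part_superder by (auto simp: part_gdot)
  have 0: "snd y 0 = 0" using y superder_lin lin_0 by (auto simp: part_gdot)
  have "(\<Sum>p'\<in>UNIV. \<Sum>q'\<in>UNIV. lg_scale (ksign p' q') (der_part q' (snd y) (lg_part p' (fst x))))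
    = lg_scale (ksign p q) (snd y (fst x))"
    unfolding 1 2 by (cases p; cases q; simp add: UNIV_bool 0 zero_fun_def)
  moreover have "(\<Sum>p'\<in>UNIV. \<Sum>q'\<in>UNIV. lg_scale (ksign p' q') (der_part q' (snd y) (der_part p' (snd x) f)))
    = lg_scale (ksign p q) (snd y (snd x f))" for f
    unfolding 2 3 by (cases p; cases q; simp add: UNIV_bool 0 zero_fun_def)
  ultimately show ?thesis by (simp add: g_bracket_def der_bracket_def)
qed

text \<open>The element \<open>a \<partial>\<^sub>\<alpha>\<close>: it lies in the algebra for \<open>\<alpha> = 0\<close> and is a derivation for \<open>\<alpha> > 0\<close>.\<close>

definition el :: "nat \<Rightarrow> nat \<Rightarrow> lgr \<Rightarrow> nat \<Rightarrow> qp_el" where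
  "el m n a \<alpha> = (if \<alpha> = 0 then a else 0, \<lambda>f. a \<star> pd m n \<alpha> f)"

lemma fst_gen: "fst (gen m n \<alpha>) = (if \<alpha> = 0 then lg_one else 0)"
  by (simp add: gen_def emb_def lg_one_def)

lemma der_part_0 [simp]: "der_part q 0 = 0"
  by (auto simp: der_part_def fun_eq_iff zero_fun_def lin_0[OF lin_lg_part])

lemma g_mult_emb: "g_mult (emb a) y = (a \<star> fst y, \<lambda>f. a \<star> snd y f)"
  by (simp add: g_mult_def emb_def der_part_0)

lemma gen_mult: "g_mult (emb a) (gen m n \<alpha>) = el m n a \<alpha>"
  by (simp add: g_mult_emb fst_gen el_def pd_def)

lemma gen_el: "gen m n \<alpha> = el m n lg_one \<alpha>"
  by (rule prod_eqI) (auto simp: fst_gen el_def pd_def)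

lemma emb_el: "emb a = el m n a 0"
  by (auto simp: emb_def el_def pd_alt zero_fun_def)

lemma fst_el: "fst (el m n a \<alpha>) = (if \<alpha> = 0 then a else 0)"
  and snd_el: "snd (el m n a \<alpha>) f = a \<star> pd m n \<alpha> f"
  by (simp_all add: el_def)

lemma el_part [simp, intro]:
  assumes a: "a \<in> dP m n p"
  shows "el m n a \<alpha> \<in> part (gdot m n) (p \<noteq> (m < \<alpha>))"
proof -
  have "(\<lambda>f. a \<star> pd m n \<alpha> f) \<in> superder {1..m} n (p \<noteq> (m < \<alpha>))"
    unfolding superder_def
  proof (intro CollectI conjI allI ballI impI)
    show "lin (\<lambda>f. a \<star> pd m n \<alpha> f)" by (intro lin_intros)
    show "a \<star> pd m n \<alpha> (single k c) = 0" if "k \<notin> mons {1..m} n" for k c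
      using that by (simp add: pd_outside)
  next
    fix q b assume b: "b \<in> dP m n q"
    show "a \<star> pd m n \<alpha> b \<in> dP m n ((p \<noteq> (m < \<alpha>)) \<noteq> q)"
      by (rule back_subst[where P="\<lambda>r. _ \<in> dP m n r", OF lg_mult_lgP[OF a pd_dP[OF b]]]) blast
    fix c assume c: "c \<in> dA m n"
    have "a \<star> (b \<star> pd m n \<alpha> c) = lg_scale (ksign p q) (b \<star> (a \<star> pd m n \<alpha> c))"
      using lg_mult_commute[OF a b] lg_mult_assoc[OF lgP_A[OF a] lgP_A[OF b] pd_in]
        lg_mult_assoc[OF lgP_A[OF b] lgP_A[OF a] pd_in] by (metis lg_mult_simps(5))
    then show "a \<star> pd m n \<alpha> (b \<star> c) = a \<star> pd m n \<alpha> b \<star> c + lg_scale (ksign (p \<noteq> (m < \<alpha>)) q) (b \<star> (a \<star> pd m n \<alpha> c))"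
      using lg_mult_assoc[OF lgP_A[OF a] pd_in c] 
      by (cases p; cases "m < \<alpha>"; cases q; simp add: pd_leibniz[OF b c] lg_mult_distrib)
  qed
  then show ?thesis using a by (auto simp: part_gdot el_def)
qed

lemma emb_part [simp, intro]: "a \<in> dP m n p \<Longrightarrow> emb a \<in> part (gdot m n) p"
  using el_part[of a m n p 0] by (simp add: emb_el[of a m n])

lemma g_mult_el_emb:
  assumes "a \<in> dP m n p" "b \<in> dP m n q"
  shows "g_mult (el m n a \<alpha>) (emb b) = (let c = lg_scale (ksign (m < \<alpha>) q) (a \<star> b) in el m n c \<alpha>)"
proof -
  have "b \<star> (a \<star> pd m n \<alpha> f) = lg_scale (ksign p q) (a \<star> b \<star> pd m n \<alpha> f)" for f
    using lg_mult_commute[OF assms(2,1)] lg_mult_assoc[OF lgP_A[OF assms(2)] lgP_A[OF assms(1)] pd_in, of \<alpha> f]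
    by (cases p; cases q; simp)
  then show ?thesis
    unfolding g_mult_hom[OF el_part[OF assms(1)] emb_part[OF assms(2)]]
    by (cases p; cases q; cases "m < \<alpha>"; auto simp: el_def emb_def Let_def)
qed

text \<open>The terms with a composition \<open>\<partial>\<^sub>\<alpha> \<partial>\<^sub>\<beta>\<close> cancel because the \<open>\<partial>\<^sub>\<alpha>\<close> supercommute.\<close>

lemma el_bracket:
  assumes a: "a \<in> dP m n p" and b: "b \<in> dP m n q"
  shows "g_bracket (el m n a \<alpha>) (el m n b \<beta>) =
    el m n (a \<star> pd m n \<alpha> b) \<beta> -
    el m n (lg_scale (ksign (p \<noteq> (m < \<alpha>)) (q \<noteq> (m < \<beta>))) (b \<star> pd m n \<beta> a)) \<alpha>"
proof (rule prod_eqI)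
  show "fst (g_bracket (el m n a \<alpha>) (el m n b \<beta>)) = fst (el m n (a \<star> pd m n \<alpha> b) \<beta> -
    el m n (lg_scale (ksign (p \<noteq> (m < \<alpha>)) (q \<noteq> (m < \<beta>))) (b \<star> pd m n \<beta> a)) \<alpha>)"
    unfolding g_bracket_hom[OF el_part[OF a] el_part[OF b]] by (auto simp: fst_el snd_el pd_alt lin_0[OF lin_dt] lin_0[OF lin_dzeta])
  have "a \<star> pd m n \<alpha> (b \<star> pd m n \<beta> f) = a \<star> pd m n \<alpha> b \<star> pd m n \<beta> f
      + lg_scale (ksign (m < \<alpha>) q) (a \<star> b \<star> pd m n \<alpha> (pd m n \<beta> f))"
    if a: "a \<in> dP m n p" and b: "b \<in> dP m n q" for a b p q \<alpha> \<beta> f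
    using pd_leibniz[OF b pd_in] lg_mult_assoc[OF lgP_A[OF a] pd_in pd_in] lg_mult_assoc[OF lgP_A[OF a] lgP_A[OF b] pd_in]
    by (simp add: lg_mult_distrib)
  note * = this[OF a b] this[OF b a]
  show "snd (g_bracket (el m n a \<alpha>) (el m n b \<beta>)) = snd (el m n (a \<star> pd m n \<alpha> b) \<beta> -
    el m n (lg_scale (ksign (p \<noteq> (m < \<alpha>)) (q \<noteq> (m < \<beta>))) (b \<star> pd m n \<beta> a)) \<alpha>)"
    unfolding g_bracket_hom[OF el_part[OF a] el_part[OF b]]
    using lg_mult_commute[OF a b] pd_comm'[of m n \<alpha> \<beta>]
    by (cases p; cases q; cases "m < \<alpha>"; cases "m < \<beta>"; simp add: fun_eq_iff snd_el * lg_mult_distrib)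
qed

lemma g_act_el: "a \<in> dP m n p \<Longrightarrow> b \<in> dP m n q \<Longrightarrow> g_act (el m n a \<alpha>) b = a \<star> pd m n \<alpha> b"
  unfolding g_act_def emb_el[of b m n] by (subst el_bracket) (auto simp: fst_el pd_alt)

section \<open>Generators and coordinates\<close>

lemma lmono_lgP: "keys r \<subseteq> S \<Longrightarrow> I \<subseteq> {1..n} \<Longrightarrow> p = odd (card I) \<Longrightarrow> lmono r I \<in> lgP S n p"
  by (auto simp: lmono_def mons_def mon_parity_def intro!: single_lgP)

lemma lmono_mult: "I \<inter> J = {} \<Longrightarrow> lmono r I \<star> lmono s J = lg_scale ((-1) ^ tau I J) (lmono (r + s) (I \<union> J))"
  by (simp add: lmono_def lg_mult_single smul_def)

lemma tpow_dP [simp, intro]: "i \<in> {1..m} \<Longrightarrow> tpow i c \<in> dP m n False"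
  unfolding tpow_def by (rule lmono_lgP) auto

lemma zeta_dP [simp, intro]: "k \<in> {1..n} \<Longrightarrow> zeta k \<in> dP m n True"
  unfolding zeta_def by (rule lmono_lgP) auto

lemma tpow_mult: "tpow i c \<star> tpow i d = tpow i (c + d)"
  by (simp add: tpow_def lmono_mult single_add)

lemma tpow_0: "tpow i 0 = lg_one"
  by (simp add: tpow_def lg_one_def)

lemma tau_self: "tau {j} {j} = 0"
  by (simp add: tau_def)

text \<open>The generators \<open>t\<^sub>\<beta>\<close> and \<open>\<zeta>\<^sub>k\<close> under a uniform index. The derivative \<open>\<partial>\<^sub>\<alpha>\<close> kills the generator \<open>\<beta> \<noteq> \<alpha>\<close> and
  sends the generator \<open>\<alpha>\<close> to a unit, namely \<open>t\<^sub>\<alpha>\<close> for the Euler field \<open>d\<^sub>\<alpha>\<close> and \<open>1\<close> for an odd derivative; \<open>gu\<close> is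
  this unit and \<open>gi\<close> its inverse.\<close>

definition gv :: "nat \<Rightarrow> nat \<Rightarrow> lgr" where
  "gv m \<beta> = (if \<beta> \<le> m then tpow \<beta> 1 else zeta (\<beta> - m))"

definition gi :: "nat \<Rightarrow> nat \<Rightarrow> lgr" where
  "gi m \<beta> = (if \<beta> \<le> m then tpow \<beta> (-1) else lg_one)"

definition gu :: "nat \<Rightarrow> nat \<Rightarrow> lgr" where
  "gu m \<beta> = (if \<beta> \<le> m then tpow \<beta> 1 else lg_one)"

lemma odd_index: "(\<beta>::nat) \<in> {1..m+n} \<Longrightarrow> \<not> \<beta> \<le> m \<Longrightarrow> \<beta> - m \<in> {1..n}"
  by auto

lemma gv_dP [simp, intro]: "\<beta> \<in> {1..m+n} \<Longrightarrow> gv m \<beta> \<in> dP m n (m < \<beta>)"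
  using zeta_dP[OF odd_index, of \<beta> m n] by (cases "\<beta> \<le> m") (auto simp: gv_def)

lemma gi_dP [simp, intro]: "\<beta> \<in> {1..m+n} \<Longrightarrow> gi m \<beta> \<in> dP m n False"
  and gu_dP [simp, intro]: "\<beta> \<in> {1..m+n} \<Longrightarrow> gu m \<beta> \<in> dP m n False"
  by (auto simp: gi_def gu_def)

lemma gi_gu: "gi m \<beta> \<star> gu m \<beta> = lg_one" "gu m \<beta> \<star> gi m \<beta> = lg_one"
  by (simp_all add: gi_def gu_def tpow_mult tpow_0)

lemma pd_tpow: "i \<in> {1..m} \<Longrightarrow> pd m n \<beta> (tpow i c) = (if \<beta> = i then lg_scale (of_int c) (tpow i c) else 0)"
  by (auto simp: pd_alt tpow_def lmono_def dt_single dzeta_single dt_mon_def dzeta_mon_def mons_def lookup_single when_def)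

lemma pd_zeta: "k \<in> {1..n} \<Longrightarrow> pd m n \<beta> (zeta k) = (if \<beta> = m + k then lg_one else 0)"
  by (auto simp: pd_alt zeta_def lg_one_def lmono_def dt_single dzeta_single dt_mon_def dzeta_mon_def mons_def tau_self)

lemma pd_one [simp]: "pd m n \<alpha> lg_one = 0"
  by (auto simp: pd_alt lg_one_def lmono_def dt_single dzeta_single dt_mon_def dzeta_mon_def)

lemma pd_gv: "\<alpha> \<in> {1..m+n} \<Longrightarrow> pd m n \<beta> (gv m \<alpha>) = (if \<beta> = \<alpha> then gu m \<alpha> else 0)"
  using pd_zeta[OF odd_index, of \<alpha> m n m \<beta>] by (cases "\<alpha> \<le> m") (auto simp: gv_def gu_def pd_tpow)

text \<open>Induction on the sum of the absolute values of the exponents.\<close>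

lemma keys_induct_int:
  fixes r :: "nat \<Rightarrow>\<^sub>0 int"
  assumes r: "keys r \<subseteq> S" and 0: "P 0"
    and up: "\<And>r i. keys r \<subseteq> S \<Longrightarrow> i \<in> S \<Longrightarrow> P r \<Longrightarrow> P (r + single i 1)"
    and dn: "\<And>r i. keys r \<subseteq> S \<Longrightarrow> i \<in> S \<Longrightarrow> P r \<Longrightarrow> P (r + single i (-1))"
  shows "P r"
  using r
proof (induction "\<Sum>i\<in>keys r. nat \<bar>lookup r i\<bar>" arbitrary: r rule: less_induct)
  case less
  show ?case
  proof (cases "r = 0")
    case False
    then obtain i where i: "i \<in> keys r" by (metis keys_eq_empty ex_in_conv)
    \<comment> \<open>move one nonzero exponent one step towards zero\<close>
    define e where "e = sgn (lookup r i)"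
    define r' where "r' = r - single i e"
    have l: "lookup r i \<noteq> 0" using i by (simp add: in_keys_iff)
    have e: "e = 1 \<or> e = -1" using l by (auto simp: e_def sgn_if)
    have lk: "lookup r' j = (if j = i then lookup r i - e else lookup r j)" for j
      by (simp add: r'_def lookup_minus lookup_single when_def)
    have sub: "keys r' \<subseteq> keys r"
      using i by (auto simp: in_keys_iff lk split: if_splits)
    have "(\<Sum>j\<in>keys r'. nat \<bar>lookup r' j\<bar>)
        = (\<Sum>j\<in>keys r. nat \<bar>lookup r' j\<bar>)"
      by (rule sum.mono_neutral_left) (use sub in \<open>auto simp: in_keys_iff\<close>)
    also have "\<dots> < (\<Sum>j\<in>keys r. nat \<bar>lookup r j\<bar>)"
    proof (rule sum_strict_mono_ex1)
      show "\<exists>j\<in>keys r. nat \<bar>lookup r' j\<bar> < nat \<bar>lookup r j\<bar>"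
        by (rule bexI[OF _ i]) (use l in \<open>auto simp: lk e_def sgn_if\<close>)
    qed (use l in \<open>auto simp: lk e_def sgn_if\<close>)
    finally have "P r'" using less sub by auto
    moreover have "keys r' \<subseteq> S" "i \<in> S" using sub less.prems i by auto
    moreover have "r = r' + single i e" by (simp add: r'_def)
    ultimately show ?thesis using e up[of r' i] dn[of r' i] by auto
  qed (use 0 in simp)
qed

text \<open>Every monomial is a product of \<open>t\<^sub>i\<close>, \<open>t\<^sub>i\<^sup>-\<^sup>1\<close> and \<open>\<zeta>\<^sub>k\<close>. The product step only needs homogeneous factors, so that
  it applies to superderivations.\<close>

lemma mono_gen_induct:
  assumes k: "k \<in> mons {1..m} n" and one: "P lg_one"
    and t: "\<And>i. i \<in> {1..m} \<Longrightarrow> P (tpow i 1)" and ti: "\<And>i. i \<in> {1..m} \<Longrightarrow> P (tpow i (-1))"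
    and z: "\<And>k. k \<in> {1..n} \<Longrightarrow> P (zeta k)"
    and mult: "\<And>a b p q. a \<in> dP m n p \<Longrightarrow> b \<in> dP m n q \<Longrightarrow> P a \<Longrightarrow> P b \<Longrightarrow> P (a \<star> b)"
  shows "P (mmon k)"
proof -
  obtain r I where kk: "k = (r, I)" by (cases k)
  have r: "keys r \<subseteq> {1..m}" and I: "I \<subseteq> {1..n}" using k kk by (auto simp: mons_def)
  have step: "P (lmono (r + single i c) {})"
    if "keys r \<subseteq> {1..m}" "i \<in> {1..m}" "P (lmono r {})" "P (tpow i c)" for r i c
    using mult[OF lmono_lgP[OF that(1) _ refl, of "{}"] tpow_dP[OF that(2)] that(3,4)]
    by (simp add: tpow_def lmono_mult)
  have "P (lmono r {})"
    using r by (rule keys_induct_int) (use one step t ti in \<open>auto simp: lg_one_def\<close>)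
  have "finite I" using I finite_subset by blast
  then have "P (lmono 0 I)" using I
  proof (induction I rule: finite_linorder_max_induct)
    case empty then show ?case using one by (simp add: lg_one_def)
  next
    case (insert j J)
    have "tau J {j} = 0" using insert by (auto simp: tau_sing)
    then have "lmono 0 (insert j J) = lmono 0 J \<star> zeta j"
      using insert by (subst zeta_def, subst lmono_mult) auto
    then show ?case using mult[OF lmono_lgP[OF _ _ refl, of 0] zeta_dP, of J j] insert z by simp
  qed
  with \<open>P (lmono r {})\<close> have "P (lmono r {} \<star> lmono 0 I)"
    using mult[OF lmono_lgP[OF r _ refl] lmono_lgP[OF _ I refl], of "{}" 0] by simp
  then show ?thesis by (simp add: kk lmono_mult) (simp add: lmono_def)
qed

lemma superder_one:
  assumes "\<delta> \<in> superder {1..m} n p" shows "\<delta> lg_one = 0"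
  using superder_leibniz[OF assms lg_one_in(1) lg_one_in(2)] by simp

text \<open>Apply the derivation to \<open>t\<^sub>i t\<^sub>i\<^sup>-\<^sup>1 = 1\<close>.\<close>

lemma superder_tinv:
  assumes d: "\<delta> \<in> superder {1..m} n p" and i: "i \<in> {1..m}"
  shows "\<delta> (tpow i (-1)) = - (tpow i (-1) \<star> (\<delta> (tpow i 1) \<star> tpow i (-1)))"
proof -
  have t: "tpow i c \<in> dP m n False" for c using i by simp
  have "\<delta> (tpow i (-1)) \<in> dA m n" using superder_lgP[OF d t] lgP_A by blast
  have "0 = \<delta> (tpow i 1) \<star> tpow i (-1) + tpow i 1 \<star> \<delta> (tpow i (-1))"
    using superder_leibniz[OF d t lgP_A[OF t], of 1 "-1"] superder_one[OF d] by (simp add: tpow_mult tpow_0)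
  then have "0 = tpow i (-1) \<star> (\<delta> (tpow i 1) \<star> tpow i (-1)) + tpow i (-1) \<star> (tpow i 1 \<star> \<delta> (tpow i (-1)))"
    by (metis lg_mult_distrib(2) lg_mult_simps(2))
  also have "tpow i (-1) \<star> (tpow i 1 \<star> \<delta> (tpow i (-1))) = \<delta> (tpow i (-1))"
    using lg_mult_assoc[OF lgP_A[OF t] lgP_A[OF t] \<open>\<delta> (tpow i (-1)) \<in> dA m n\<close>, of "-1" 1]
    by (simp add: tpow_mult tpow_0)
  finally show ?thesis by (simp add: eq_neg_iff_add_eq_0 add.commute)
qed

lemma superder_eqI:
  assumes d: "\<delta> \<in> superder {1..m} n p" and e: "\<epsilon> \<in> superder {1..m} n p"
    and gens: "\<And>\<beta>. \<beta> \<in> {1..m+n} \<Longrightarrow> \<delta> (gv m \<beta>) = \<epsilon> (gv m \<beta>)"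
  shows "\<delta> = \<epsilon>"
proof
  fix f
  have *: "\<delta> (mmon k) = \<epsilon> (mmon k)" if "k \<in> mons {1..m} n" for k
    using that
  proof (rule mono_gen_induct)
    show t: "\<delta> (tpow i 1) = \<epsilon> (tpow i 1)" if "i \<in> {1..m}" for i using gens[of i] that by (auto simp: gv_def)
    show "\<delta> (zeta k) = \<epsilon> (zeta k)" if "k \<in> {1..n}" for k using gens[of "m + k"] that by (auto simp: gv_def)
    show "\<delta> (tpow i (-1)) = \<epsilon> (tpow i (-1))" if "i \<in> {1..m}" for i
      using t superder_tinv[OF d] superder_tinv[OF e] that by simp
    show "\<delta> (a \<star> b) = \<epsilon> (a \<star> b)" if "a \<in> dP m n p'" "b \<in> dP m n q" "\<delta> a = \<epsilon> a" "\<delta> b = \<epsilon> b" for a b p' q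
      using that superder_leibniz[OF d that(1) lgP_A[OF that(2)]] superder_leibniz[OF e that(1) lgP_A[OF that(2)]] by simp
  qed (simp add: superder_one[OF d] superder_one[OF e])
  show "\<delta> f = \<epsilon> f"
  proof (rule lin_eqI[OF superder_lin[OF d] superder_lin[OF e]])
    fix k show "\<delta> (mmon k) = \<epsilon> (mmon k)"
      by (cases "k \<in> mons {1..m} n") (auto simp: * superder_outside[OF d] superder_outside[OF e])
  qed
qed

lemma vector_space_der: "vector_space der_scale"
  by unfold_locales (auto simp: der_scale_def fun_eq_iff lg.scale_right_distrib lg.scale_left_distrib)

interpretation gs: vector_space g_scale
proof -
  interpret d: vector_space der_scale by (rule vector_space_der)
  show "vector_space g_scale"
    by unfold_locales (auto simp: g_scale_def prod_eq_iff lg.scale_right_distrib lg.scale_left_distrib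
      d.scale_right_distrib d.scale_left_distrib)
qed

lemma superder_subspace: "module.subspace der_scale (superder S n p)"
proof -
  interpret d: vector_space der_scale by (rule vector_space_der)
  have z: "0 \<in> superder S n p" unfolding superder_def by (auto intro: lin_intros simp: zero_fun_def)
  show ?thesis
  proof (rule d.subspaceI[OF z])
    fix \<delta> \<epsilon> c assume d: "\<delta> \<in> superder S n p" and e: "\<epsilon> \<in> superder S n p"
    show "\<delta> + \<epsilon> \<in> superder S n p" unfolding superder_def
    proof (intro CollectI conjI allI ballI impI)
      show "lin (\<delta> + \<epsilon>)" using lin_plus[OF superder_lin[OF d] superder_lin[OF e]] by (simp add: plus_fun_def)
      fix q a assume a: "a \<in> lgP S n q"
      show "(\<delta> + \<epsilon>) a \<in> lgP S n (p \<noteq> q)" using superder_lgP[OF d a] superder_lgP[OF e a] by (simp only: plus_fun_apply lgP_closed)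
      fix b assume b: "b \<in> lgA S n"
      show "(\<delta> + \<epsilon>) (a \<star> b) = (\<delta> + \<epsilon>) a \<star> b + lg_scale (ksign p q) (a \<star> (\<delta> + \<epsilon>) b)"
        by (simp add: superder_leibniz[OF d a b] superder_leibniz[OF e a b] lg_mult_distrib lg.scale_right_distrib)
    qed (simp add: superder_outside[OF d] superder_outside[OF e])
  next
    fix \<delta> c assume d: "\<delta> \<in> superder S n p"
    show "der_scale c \<delta> \<in> superder S n p" unfolding superder_def
    proof (intro CollectI conjI allI ballI impI)
      show "lin (der_scale c \<delta>)" using lin_smult[OF superder_lin[OF d]] by (simp add: der_scale_def)
      fix q a assume a: "a \<in> lgP S n q"
      show "der_scale c \<delta> a \<in> lgP S n (p \<noteq> q)" using superder_lgP[OF d a] by (simp only: der_scale_def lgP_closed)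
      fix b assume b: "b \<in> lgA S n"
      show "der_scale c \<delta> (a \<star> b) = der_scale c \<delta> a \<star> b + lg_scale (ksign p q) (a \<star> der_scale c \<delta> b)"
        by (simp add: der_scale_def superder_leibniz[OF d a b] lg.scale_right_distrib mult.commute)
    qed (simp add: der_scale_def superder_outside[OF d])
  qed
qed

lemma scal_gdot [simp]: "scal (gdot m n) = g_scale"
  by (simp add: gdot_def)

lemma gdot_part_subspace: "gs.subspace (part (gdot m n) p)"
proof -
  interpret d: vector_space der_scale by (rule vector_space_der)
  show ?thesis
    using d.subspace_0[OF superder_subspace, of "{1..m}" n p] d.subspace_add[OF superder_subspace, of _ "{1..m}" n p]
      d.subspace_scale[OF superder_subspace, of _ "{1..m}" n p]
    by (intro gs.subspaceI) (auto simp: part_gdot g_scale_def)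
qed

lemma el_lin:
  "el m n (a + b) \<alpha> = el m n a \<alpha> + el m n b \<alpha>" "el m n (lg_scale c a) \<alpha> = g_scale c (el m n a \<alpha>)" "el m n 0 \<alpha> = 0"
  by (auto simp: el_def g_scale_def der_scale_def fun_eq_iff lg_mult_distrib zero_prod_def)

lemma g_coord_dP:
  assumes x: "x \<in> part (gdot m n) p" and \<alpha>: "\<alpha> \<le> m + n"
  shows "g_coord m x \<alpha> \<in> dP m n (p \<noteq> (m < \<alpha>))"
proof -
  have s: "snd x \<in> superder {1..m} n p" and f: "fst x \<in> dP m n p" using x by (auto simp: part_gdot)
  consider "\<alpha> = 0" | "\<alpha> \<in> {1..m}" | "m < \<alpha>" "\<alpha> - m \<in> {1..n}" using \<alpha> by force
  then show ?thesis
  proof cases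
    case 2 
    then show ?thesis using lg_mult_lgP[OF tpow_dP superder_lgP[OF s tpow_dP], of \<alpha> \<alpha> "-1" 1]
      by (simp add: g_coord_def)
  next
    case 3
    then show ?thesis using superder_lgP[OF s zeta_dP, of "\<alpha> - m"] by (simp add: g_coord_def)
  qed (use f in \<open>simp add: g_coord_def\<close>)
qed

lemma sum_fst: "fst (sum f A) = (\<Sum>i\<in>A. fst (f i))" and sum_snd: "snd (sum f A) = (\<Sum>i\<in>A. snd (f i))"
  by (induction A rule: infinite_finite_induct) auto

lemma sum_fun_apply: "(\<Sum>i\<in>A. f i) x = (\<Sum>i\<in>A. f i x)"
  by (induction A rule: infinite_finite_induct) auto

text \<open>Both sides have the same part in the algebra, and their derivations agree on the generators, where the sum has a single
  nonzero term; a derivation is determined by its values there. Hence \<open>\<gg>\<close> is free over the algebra on the \<open>\<partial>\<^sub>\<alpha>\<close>.\<close>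

lemma g_expand:
  assumes x: "x \<in> part (gdot m n) p"
  shows "x = (\<Sum>\<alpha>\<le>m+n. el m n (g_coord m x \<alpha>) \<alpha>)"
proof (rule prod_eqI)
  show "fst x = fst (\<Sum>\<alpha>\<le>m+n. el m n (g_coord m x \<alpha>) \<alpha>)"
    by (simp add: sum_fst fst_el sum.delta g_coord_def cong: if_cong)
  let ?y = "\<Sum>\<alpha>\<le>m+n. el m n (g_coord m x \<alpha>) \<alpha>"
  have "el m n (g_coord m x \<alpha>) \<alpha> \<in> part (gdot m n) p" if "\<alpha> \<le> m + n" for \<alpha>
    using back_subst[where P="\<lambda>r. _ \<in> part (gdot m n) r" and b=p, OF el_part[OF g_coord_dP[OF x that]]] by blast
  then have "?y \<in> part (gdot m n) p" by (intro gs.subspace_sum[OF gdot_part_subspace]) auto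
  then have y: "snd ?y \<in> superder {1..m} n p" by (simp add: part_gdot)
  have s: "snd x \<in> superder {1..m} n p" using x by (auto simp: part_gdot)
  show "snd x = snd ?y"
  proof (rule superder_eqI[OF s y])
    fix \<beta> assume \<beta>: "\<beta> \<in> {1..m+n}"
    have "snd ?y (gv m \<beta>) = (\<Sum>\<alpha>\<le>m+n. g_coord m x \<alpha> \<star> pd m n \<alpha> (gv m \<beta>))"
      by (simp add: sum_snd sum_fun_apply snd_el)
    also have "\<dots> = (\<Sum>\<alpha>\<le>m+n. if \<alpha> = \<beta> then g_coord m x \<beta> \<star> gu m \<beta> else 0)"
      by (rule sum.cong[OF refl]) (use \<beta> in \<open>auto simp: pd_gv\<close>)
    also have "\<dots> = g_coord m x \<beta> \<star> gu m \<beta>" using \<beta> by simp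
    also have "\<dots> = snd x (gv m \<beta>)"
    proof (cases "\<beta> \<le> m")
      case True
      then have b: "\<beta> \<in> {1..m}" using \<beta> by auto
      have sd: "snd x (tpow \<beta> 1) \<in> dP m n p" using superder_lgP[OF s tpow_dP[OF b], of 1] by simp
      have "snd x (tpow \<beta> 1) \<star> tpow \<beta> 1 = tpow \<beta> 1 \<star> snd x (tpow \<beta> 1)"
        using lg_mult_commute[OF sd tpow_dP[OF b], of 1] by simp
      then have "(tpow \<beta> (-1) \<star> snd x (tpow \<beta> 1)) \<star> tpow \<beta> 1 = (tpow \<beta> (-1) \<star> tpow \<beta> 1) \<star> snd x (tpow \<beta> 1)"
        using lg_mult_assoc[OF lgP_A[OF tpow_dP[OF b]] lgP_A[OF sd] lgP_A[OF tpow_dP[OF b]], of "-1" 1]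
          lg_mult_assoc[OF lgP_A[OF tpow_dP[OF b]] lgP_A[OF tpow_dP[OF b]] lgP_A[OF sd], of "-1" 1] by simp
      then show ?thesis using True b by (simp add: g_coord_def gu_def gv_def tpow_mult tpow_0)
    qed (simp add: g_coord_def gu_def gv_def)
    finally show "snd x (gv m \<beta>) = snd ?y (gv m \<beta>)" by simp
  qed
qed

section \<open>The operators of a QP-module\<close>

text \<open>The linear part of \<open>is_superspace\<close>, in which the two parts may overlap; it already makes the carrier a
  subspace.\<close>

definition graded_space :: "('v::ab_group_add, 'z) superspace_scheme \<Rightarrow> bool" where
  "graded_space L \<longleftrightarrow> vector_space (scal L) \<and> (\<forall>p. module.subspace (scal L) (part L p))"

lemma is_superspace_graded: "is_superspace L \<Longrightarrow> graded_space L"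
  by (simp add: is_superspace_def graded_space_def)

lemma graded_gdot: "graded_space (gdot m n)"
  using gs.vector_space_axioms gdot_part_subspace by (auto simp: graded_space_def)

lemma graded_lg_alg: "graded_space (lg_alg S n)"
  using lg.vector_space_axioms lgP_subspace by (auto simp: graded_space_def)

lemma carr_subspace: "graded_space L \<Longrightarrow> module.subspace (scal L) (carr L)"
proof -
  assume g: "graded_space L"
  then interpret vector_space "scal L" by (simp add: graded_space_def)
  show ?thesis using g subspace_sums unfolding carr_def graded_space_def by blast
qed

lemma part_carr: "graded_space L \<Longrightarrow> x \<in> part L p \<Longrightarrow> x \<in> carr L"
proof -
  assume g: "graded_space L" and x: "x \<in> part L p"
  then interpret vector_space "scal L" by (simp add: graded_space_def)
  have "0 \<in> part L q" for q using g subspace_0 by (auto simp: graded_space_def)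
  then show ?thesis using x unfolding carr_def
    by (cases p) (force intro: exI[of _ 0] exI[of _ x])+
qed

lemma lin_on_sum:
  assumes "lin_on s1 s2 S f" "vector_space s1" "vector_space s2" "module.subspace s1 S" "\<And>i. i \<in> I \<Longrightarrow> g i \<in> S"
  shows "f (\<Sum>i\<in>I. g i) = (\<Sum>i\<in>I. f (g i))"
proof -
  interpret a: vector_space s1 by fact
  interpret b: vector_space s2 by fact
  have 0: "f 0 = 0" using assms(1) a.subspace_0[OF assms(4)] unfolding lin_on_def
    by (metis add_cancel_right_right)
  show ?thesis using assms(5)
  proof (induction I rule: infinite_finite_induct)
    case (insert i I)
    then have "g i \<in> S" "sum g I \<in> S" by (auto intro!: a.subspace_sum[OF assms(4)])
    then show ?case using insert assms(1) by (simp add: lin_on_def)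
  qed (simp_all add: 0)
qed

lemma super_map_carr:
  assumes r: "super_map L W \<rho>" and L: "graded_space L" and W: "graded_space W"
    and x: "x \<in> carr L" and v: "v \<in> carr W"
  shows "\<rho> x v \<in> carr W"
proof -
  interpret vector_space "scal W" using W by (simp add: graded_space_def)
  obtain x0 x1 where x01: "x = x0 + x1" "x0 \<in> part L False" "x1 \<in> part L True" using x by (auto simp: carr_def)
  obtain v0 v1 where v01: "v = v0 + v1" "v0 \<in> part W False" "v1 \<in> part W True" using v by (auto simp: carr_def)
  note c = part_carr[OF L x01(2)] part_carr[OF L x01(3)] part_carr[OF W v01(2)] part_carr[OF W v01(3)]
  have "\<rho> x v = \<rho> x0 v + \<rho> x1 v" using r c v x01 by (auto simp: super_map_def lin_on_def)
  also have "\<dots> = (\<rho> x0 v0 + \<rho> x0 v1) + (\<rho> x1 v0 + \<rho> x1 v1)" using r c v01 by (auto simp: super_map_def lin_on_def)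
  also have "\<dots> \<in> carr W"
    using r x01(2,3) v01(2,3)
    by (intro subspace_add[OF carr_subspace[OF W]]; intro part_carr[OF W]) (unfold super_map_def, blast+)
  finally show ?thesis .
qed

locale qp_mod =
  fixes m n :: nat and M :: "('v::ab_group_add) qp_data"
  assumes qp: "qp_module m n M"
begin

lemma superM: "is_superspace M" and gradedM: "graded_space M"
  using qp is_superspace_graded by (auto simp: qp_module_def)

sublocale vs: vector_space "scal M"
  using gradedM by (simp add: graded_space_def)

abbreviation "V \<equiv> carr M"
abbreviation "sc \<equiv> scal M"
abbreviation "\<phi> \<equiv> phi M"

definition \<psi> :: "lgr \<Rightarrow> nat \<Rightarrow> 'v \<Rightarrow> 'v" where "\<psi> a \<alpha> = psi M (el m n a \<alpha>)"
definition \<chi> :: "nat \<Rightarrow> 'v \<Rightarrow> 'v" where "\<chi> \<alpha> = psi M (gen m n \<alpha>)"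
definition \<eta> :: "nat \<Rightarrow> 'v \<Rightarrow> 'v" where "\<eta> \<alpha> = hphi M (gen m n \<alpha>)"
text \<open>The defect of linearity of \<open>\<psi>\<close> over the algebra.\<close>

definition T :: "lgr \<Rightarrow> nat \<Rightarrow> 'v \<Rightarrow> 'v" where "T a \<alpha> v = \<psi> a \<alpha> v - \<phi> a (\<chi> \<alpha> v)"

lemma \<chi>_\<psi>: "\<chi> \<alpha> = \<psi> lg_one \<alpha>" by (simp add: \<chi>_def \<psi>_def gen_el)

lemma V_sub: "vs.subspace V" by (rule carr_subspace[OF gradedM])
lemma P_sub: "vs.subspace (part M p)" using gradedM by (simp add: graded_space_def)

lemmas V_closed [simp, intro] = vs.subspace_add[OF V_sub] vs.subspace_scale[OF V_sub]
   vs.subspace_diff[OF V_sub] vs.subspace_0[OF V_sub] vs.subspace_neg[OF V_sub]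
lemmas P_closed = vs.subspace_add[OF P_sub] vs.subspace_scale[OF P_sub]
   vs.subspace_diff[OF P_sub] vs.subspace_0[OF P_sub] vs.subspace_neg[OF P_sub]

lemma sm: "super_map (Adot m n) M \<phi>" "super_map (gdot m n) M (hphi M)" "super_map (gdot m n) M (psi M)"
  using qp by (auto simp: qp_module_def super_rep_def)

lemma dP_dA: "a \<in> dP m n p \<Longrightarrow> a \<in> dA m n" by (rule lgP_A)

lemma gpart_carr: "x \<in> part (gdot m n) p \<Longrightarrow> x \<in> carr (gdot m n)"
  by (rule part_carr[OF graded_gdot])

lemma gcarr_sub: "gs.subspace (carr (gdot m n))"
  using carr_subspace[OF graded_gdot] by simp

lemma el_carr [simp, intro]: "a \<in> dA m n \<Longrightarrow> el m n a \<alpha> \<in> carr (gdot m n)"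
proof -
  assume a: "a \<in> dA m n"
  have "el m n a \<alpha> = el m n (lg_part False a) \<alpha> + el m n (lg_part True a) \<alpha>"
    by (metis el_lin(1) lg_part_add)
  then show ?thesis using a
    by (auto intro!: gs.subspace_add[OF gcarr_sub] gpart_carr[OF el_part[OF lg_part_in]])
qed

lemma \<phi>_V [simp, intro]: "a \<in> dA m n \<Longrightarrow> v \<in> V \<Longrightarrow> \<phi> a v \<in> V"
  and psi_V: "x \<in> carr (gdot m n) \<Longrightarrow> v \<in> V \<Longrightarrow> psi M x v \<in> V"
  and hphi_V: "x \<in> carr (gdot m n) \<Longrightarrow> v \<in> V \<Longrightarrow> hphi M x v \<in> V"
  by (rule super_map_carr[OF sm(1) graded_lg_alg gradedM] super_map_carr[OF sm(2) graded_gdot gradedM]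
      super_map_carr[OF sm(3) graded_gdot gradedM]; assumption)+

lemma \<psi>_V [simp, intro]: "a \<in> dA m n \<Longrightarrow> v \<in> V \<Longrightarrow> \<psi> a \<alpha> v \<in> V"
  and \<chi>_V [simp, intro]: "v \<in> V \<Longrightarrow> \<chi> \<alpha> v \<in> V"
  and \<eta>_V [simp, intro]: "v \<in> V \<Longrightarrow> \<eta> \<alpha> v \<in> V"
  by (auto simp: \<psi>_def \<chi>_def \<eta>_def gen_el intro!: psi_V hphi_V)

lemma T_V [simp, intro]: "a \<in> dA m n \<Longrightarrow> v \<in> V \<Longrightarrow> T a \<alpha> v \<in> V"
  by (auto simp: T_def)

lemma \<phi>_lin: "a \<in> dA m n \<Longrightarrow> lin_on sc sc V (\<phi> a)"
  and psi_lin: "x \<in> carr (gdot m n) \<Longrightarrow> lin_on sc sc V (psi M x)"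
  and hphi_lin: "x \<in> carr (gdot m n) \<Longrightarrow> lin_on sc sc V (hphi M x)"
  and \<phi>_lin_left: "v \<in> V \<Longrightarrow> lin_on lg_scale sc (dA m n) (\<lambda>a. \<phi> a v)"
  and psi_lin_left: "v \<in> V \<Longrightarrow> lin_on g_scale sc (carr (gdot m n)) (\<lambda>x. psi M x v)"
  and hphi_lin_left: "v \<in> V \<Longrightarrow> lin_on g_scale sc (carr (gdot m n)) (\<lambda>x. hphi M x v)"
  using sm by (auto simp: super_map_def)

lemma \<psi>_lin: "a \<in> dA m n \<Longrightarrow> lin_on sc sc V (\<psi> a \<alpha>)"
  and \<chi>_lin: "lin_on sc sc V (\<chi> \<alpha>)" and \<eta>_lin: "lin_on sc sc V (\<eta> \<alpha>)"
  by (auto simp: \<psi>_def \<chi>_def \<eta>_def gen_el intro!: psi_lin hphi_lin)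

lemma \<psi>_lin_left: "v \<in> V \<Longrightarrow> lin_on lg_scale sc (dA m n) (\<lambda>a. \<psi> a \<alpha> v)"
  using psi_lin_left[of v] by (auto simp: lin_on_def \<psi>_def el_lin)

lemma T_lin: "a \<in> dA m n \<Longrightarrow> lin_on sc sc V (T a \<alpha>)"
  using \<psi>_lin[of a \<alpha>] \<phi>_lin[of a] \<chi>_lin[of \<alpha>]
  by (auto simp: lin_on_def T_def vs.scale_right_diff_distrib)

lemma T_lin_left: "v \<in> V \<Longrightarrow> lin_on lg_scale sc (dA m n) (\<lambda>a. T a \<alpha> v)"
  using \<psi>_lin_left[of v \<alpha>] \<phi>_lin_left[of "\<chi> \<alpha> v"]
  by (auto simp: lin_on_def T_def vs.scale_right_diff_distrib)

lemma lin_on_simps: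
  assumes "lin_on sc sc V f"
  shows "v \<in> V \<Longrightarrow> w \<in> V \<Longrightarrow> f (v + w) = f v + f w" "v \<in> V \<Longrightarrow> f (sc c v) = sc c (f v)"
    "v \<in> V \<Longrightarrow> w \<in> V \<Longrightarrow> f (v - w) = f v - f w" "v \<in> V \<Longrightarrow> f (- v) = - f v" "f 0 = 0"
    "(\<And>i. i \<in> I \<Longrightarrow> g i \<in> V) \<Longrightarrow> f (\<Sum>i\<in>I. g i) = (\<Sum>i\<in>I. f (g i))"
proof -
  show a: "v \<in> V \<Longrightarrow> w \<in> V \<Longrightarrow> f (v + w) = f v + f w" and s: "v \<in> V \<Longrightarrow> f (sc c v) = sc c (f v)" for v w c
    using assms by (auto simp: lin_on_def)
  show m: "v \<in> V \<Longrightarrow> f (- v) = - f v" for v using s[of v "-1"] by simp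
  show "v \<in> V \<Longrightarrow> w \<in> V \<Longrightarrow> f (v - w) = f v - f w" using a[of v "-w"] m[of w] by simp
  show "f 0 = 0" using a[of 0 0] by simp
  show "(\<And>i. i \<in> I \<Longrightarrow> g i \<in> V) \<Longrightarrow> f (\<Sum>i\<in>I. g i) = (\<Sum>i\<in>I. f (g i))"
    by (rule lin_on_sum[OF assms vs.vector_space_axioms vs.vector_space_axioms V_sub])
qed

lemma lin_left_simps:
  assumes "lin_on lg_scale sc (dA m n) f"
  shows "a \<in> dA m n \<Longrightarrow> b \<in> dA m n \<Longrightarrow> f (a + b) = f a + f b" "a \<in> dA m n \<Longrightarrow> f (lg_scale c a) = sc c (f a)"
    "a \<in> dA m n \<Longrightarrow> f (- a) = - f a" "f 0 = 0"
    "(\<And>i. i \<in> I \<Longrightarrow> g i \<in> dA m n) \<Longrightarrow> f (\<Sum>i\<in>I. g i) = (\<Sum>i\<in>I. f (g i))"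
proof -
  show a: "a \<in> dA m n \<Longrightarrow> b \<in> dA m n \<Longrightarrow> f (a + b) = f a + f b" and s: "a \<in> dA m n \<Longrightarrow> f (lg_scale c a) = sc c (f a)" for a b c
    using assms by (auto simp: lin_on_def)
  show "a \<in> dA m n \<Longrightarrow> f (- a) = - f a" using s[of a "-1"] by simp
  show "f 0 = 0" using s[of 0 0] by simp
  show "(\<And>i. i \<in> I \<Longrightarrow> g i \<in> dA m n) \<Longrightarrow> f (\<Sum>i\<in>I. g i) = (\<Sum>i\<in>I. f (g i))"
    by (rule lin_on_sum[OF assms lg.vector_space_axioms vs.vector_space_axioms lgA_subspace])
qed

lemmas op_simps [simp] =
  lin_on_simps[OF \<phi>_lin] lin_on_simps[OF \<psi>_lin] lin_on_simps[OF \<chi>_lin] lin_on_simps[OF \<eta>_lin] lin_on_simps[OF T_lin]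
lemmas left_simps [simp] =
  lin_left_simps[OF \<phi>_lin_left] lin_left_simps[OF \<psi>_lin_left] lin_left_simps[OF T_lin_left]

lemmas sc_simps = vs.scale_right_distrib vs.scale_right_diff_distrib vs.scale_left_distrib vs.scale_left_diff_distrib

lemma \<phi>_one [simp]: "v \<in> V \<Longrightarrow> \<phi> lg_one v = v"
  using qp by (simp add: qp_module_def lg_one_def)

lemma \<phi>_mult: "a \<in> dA m n \<Longrightarrow> b \<in> dA m n \<Longrightarrow> v \<in> V \<Longrightarrow> \<phi> (a \<star> b) v = \<phi> a (\<phi> b v)"
  using qp by (simp add: qp_module_def)

lemma \<phi>_comm:
  assumes "a \<in> dP m n p" "b \<in> dP m n q" "v \<in> V"
  shows "\<phi> a (\<phi> b v) = sc (ksign p q) (\<phi> b (\<phi> a v))"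
  using assms lg_mult_commute[OF assms(1,2)]
    \<phi>_mult[OF dP_dA[OF assms(1)] dP_dA[OF assms(2)] assms(3)]
    \<phi>_mult[OF dP_dA[OF assms(2)] dP_dA[OF assms(1)] assms(3)]
    left_simps(2)[of v "b \<star> a" "ksign p q"] by (simp add: dP_dA)

lemma gen_part: "gen m n \<alpha> \<in> part (gdot m n) (m < \<alpha>)"
  using el_part[OF lg_one_in(1), of m n \<alpha>] by (simp add: gen_el)

lemma ax:
  assumes "x \<in> part (gdot m n) p" "v \<in> V"
  shows psi_psi: "y \<in> part (gdot m n) q \<Longrightarrow> psi M (g_bracket x y) v = supercomm M p q (psi M x) (psi M y) v"
    and hphi_hphi: "y \<in> part (gdot m n) q \<Longrightarrow> supercomm M p q (hphi M x) (hphi M y) v =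
          hphi M (g_mult x (emb (fst y))) v - hphi M (g_mult (emb (fst x)) y) v"
    and hphi_mult: "a \<in> dA m n \<Longrightarrow> hphi M (g_mult (emb a) x) v = \<phi> a (hphi M x v)"
    and hphi_phi: "a \<in> dP m n q \<Longrightarrow> supercomm M p q (hphi M x) (\<phi> a) v = 0"
    and hphi_psi: "y \<in> part (gdot m n) q \<Longrightarrow> supercomm M p q (hphi M x) (psi M y) v =
          hphi M (g_bracket x y) v - sc (ksign p q) (\<phi> (fst y) (psi M x v))
          + psi M (g_mult x (emb (fst y))) v"
    and psi_phi: "a \<in> dP m n q \<Longrightarrow> supercomm M p q (psi M x) (\<phi> a) v = \<phi> (g_act x a) v"
  using qp assms gpart_carr[OF assms(1)] unfolding qp_module_def super_rep_def by simp_all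

lemma \<eta>_\<phi>:
  assumes "a \<in> dP m n p" "v \<in> V"
  shows "\<eta> \<alpha> (\<phi> a v) = sc (ksign (m < \<alpha>) p) (\<phi> a (\<eta> \<alpha> v))"
proof -
  have "supercomm M (m < \<alpha>) p (\<eta> \<alpha>) (\<phi> a) v = 0"
    unfolding \<eta>_def by (rule hphi_phi[OF gen_part assms(2,1)])
  then show ?thesis by (simp add: supercomm_def)
qed

lemma hphi_el: "a \<in> dA m n \<Longrightarrow> v \<in> V \<Longrightarrow> hphi M (el m n a \<alpha>) v = \<phi> a (\<eta> \<alpha> v)"
  unfolding \<eta>_def gen_mult[symmetric] by (rule hphi_mult[OF gen_part])

lemma \<psi>_\<phi>:
  assumes "a \<in> dP m n p" "b \<in> dP m n q" "v \<in> V"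
  shows "\<psi> a \<alpha> (\<phi> b v) = sc (ksign (p \<noteq> (m < \<alpha>)) q) (\<phi> b (\<psi> a \<alpha> v)) + \<phi> (a \<star> pd m n \<alpha> b) v"
proof -
  have "supercomm M (p \<noteq> (m < \<alpha>)) q (psi M (el m n a \<alpha>)) (\<phi> b) v = \<phi> (g_act (el m n a \<alpha>) b) v"
    by (rule psi_phi[OF el_part[OF assms(1)] assms(3,2)])
  then show ?thesis by (simp add: supercomm_def g_act_el[OF assms(1,2)] \<psi>_def algebra_simps)
qed

lemma \<chi>_\<phi>:
  assumes "b \<in> dP m n q" "v \<in> V"
  shows "\<chi> \<alpha> (\<phi> b v) = sc (ksign (m < \<alpha>) q) (\<phi> b (\<chi> \<alpha> v)) + \<phi> (pd m n \<alpha> b) v"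
  using \<psi>_\<phi>[OF lg_one_in(1) assms, of \<alpha>] by (simp add: \<chi>_\<psi>)

lemma \<psi>_\<psi>:
  assumes a: "a \<in> dP m n p" and b: "b \<in> dP m n q" and v: "v \<in> V"
  shows "\<psi> a \<alpha> (\<psi> b \<beta> v) = sc (ksign (p \<noteq> (m < \<alpha>)) (q \<noteq> (m < \<beta>))) (\<psi> b \<beta> (\<psi> a \<alpha> v))
    + \<psi> (a \<star> pd m n \<alpha> b) \<beta> v - sc (ksign (p \<noteq> (m < \<alpha>)) (q \<noteq> (m < \<beta>))) (\<psi> (b \<star> pd m n \<beta> a) \<alpha> v)"
proof -
  have A: "a \<in> dA m n" "b \<in> dA m n" using a b dP_dA by auto
  let ?k = "ksign (p \<noteq> (m < \<alpha>)) (q \<noteq> (m < \<beta>))"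
  have "psi M (g_bracket (el m n a \<alpha>) (el m n b \<beta>)) v = \<psi> a \<alpha> (\<psi> b \<beta> v) - sc ?k (\<psi> b \<beta> (\<psi> a \<alpha> v))"
    using psi_psi[OF el_part[OF a] v el_part[OF b], of \<alpha> \<beta>] by (simp add: supercomm_def \<psi>_def)
  moreover have "psi M (x - y) v = psi M x v - psi M y v" if "x \<in> carr (gdot m n)" "y \<in> carr (gdot m n)" for x y
    using lin_on_def[of g_scale sc "carr (gdot m n)" "\<lambda>x. psi M x v"] psi_lin_left[OF v] that
      gs.subspace_diff[OF gcarr_sub that] by (metis diff_add_cancel eq_diff_eq)
  ultimately show ?thesis
    unfolding el_bracket[OF a b] using A v by (simp add: \<psi>_def[symmetric] algebra_simps)
qed

lemma \<eta>_\<psi>: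
  assumes a: "a \<in> dP m n p" and v: "v \<in> V"
  shows "\<eta> \<delta> (\<psi> a \<alpha> v) = sc (ksign (m < \<delta>) (p \<noteq> (m < \<alpha>))) (\<psi> a \<alpha> (\<eta> \<delta> v))
    + \<phi> (pd m n \<delta> a) (\<eta> \<alpha> v) + (if \<alpha> = 0 then sc (ksign (m < \<delta>) p) (T a \<delta> v) else 0)"
proof -
  have A: "a \<in> dA m n" using a dP_dA by auto
  have 1: "supercomm M (m < \<delta>) (p \<noteq> (m < \<alpha>)) (\<eta> \<delta>) (\<psi> a \<alpha>) v =
          hphi M (g_bracket (gen m n \<delta>) (el m n a \<alpha>)) v
          - sc (ksign (m < \<delta>) (p \<noteq> (m < \<alpha>))) (\<phi> (fst (el m n a \<alpha>)) (\<chi> \<delta> v))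
          + psi M (g_mult (gen m n \<delta>) (emb (fst (el m n a \<alpha>)))) v"
    unfolding \<eta>_def \<psi>_def \<chi>_def by (rule hphi_psi[OF gen_part v el_part[OF a]])
  have "g_bracket (gen m n \<delta>) (el m n a \<alpha>) = el m n (pd m n \<delta> a) \<alpha>"
    unfolding gen_el el_bracket[OF lg_one_in(1) a] by (simp add: el_lin)
  then have 2: "hphi M (g_bracket (gen m n \<delta>) (el m n a \<alpha>)) v = \<phi> (pd m n \<delta> a) (\<eta> \<alpha> v)"
    using hphi_el v by simp
  have 3: "g_mult (gen m n \<delta>) (emb a) = el m n (lg_scale (ksign (m < \<delta>) p) a) \<delta>"
    unfolding gen_el g_mult_el_emb[OF lg_one_in(1) a] by simp
  have 4: "g_mult (gen m n \<delta>) (emb 0) = 0"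
    unfolding gen_el using g_mult_el_emb[OF lg_one_in(1) lgP_closed(4)[of "{1..m}" n False]] by (simp add: el_lin)
  have psi0: "psi M 0 v = 0" "psi M (el m n (lg_scale c a) \<delta>) v = sc c (\<psi> a \<delta> v)" for c
    using \<psi>_lin_left[OF v, of \<delta>] A left_simps(10)[OF v] left_simps(9)[OF v]
    by (auto simp: \<psi>_def el_lin(3) lin_on_def)
  show ?thesis
  proof (cases "\<alpha> = 0")
    case True
    then show ?thesis using 1 A v unfolding 2 by (simp add: supercomm_def fst_el 3 psi0 T_def sc_simps algebra_simps)
  next
    case False
    then show ?thesis using 1 A v unfolding 2 by (simp add: supercomm_def fst_el 4 psi0 algebra_simps)
  qed
qed

lemma \<eta>_\<chi>: "v \<in> V \<Longrightarrow> \<eta> \<delta> (\<chi> \<alpha> v) = sc (ksign (m < \<delta>) (m < \<alpha>)) (\<chi> \<alpha> (\<eta> \<delta> v))"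
  using \<eta>_\<psi>[OF lg_one_in(1), of v \<delta> \<alpha>] by (auto simp: \<chi>_\<psi>[symmetric] T_def)

lemma \<eta>_\<eta>:
  assumes v: "v \<in> V"
  shows "\<eta> \<alpha> (\<eta> \<beta> v) = sc (ksign (m < \<alpha>) (m < \<beta>)) (\<eta> \<beta> (\<eta> \<alpha> v))
     + (if \<beta> = 0 then \<eta> \<alpha> v else 0) - (if \<alpha> = 0 then \<eta> \<beta> v else 0)"
proof -
  have 1: "supercomm M (m < \<alpha>) (m < \<beta>) (\<eta> \<alpha>) (\<eta> \<beta>) v =
      hphi M (g_mult (gen m n \<alpha>) (emb (fst (gen m n \<beta>)))) v - hphi M (g_mult (emb (fst (gen m n \<alpha>))) (gen m n \<beta>)) v"
    unfolding \<eta>_def by (rule hphi_hphi[OF gen_part v gen_part])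
  have h: "hphi M (el m n a \<gamma>) v = \<phi> a (\<eta> \<gamma> v)" if "a \<in> dA m n" for a \<gamma> using hphi_el that v by simp
  have 2: "g_mult (gen m n \<alpha>) (emb (fst (gen m n \<beta>))) = el m n (if \<beta> = 0 then lg_one else 0) \<alpha>"
    unfolding gen_el using g_mult_el_emb[OF lg_one_in(1) lg_one_in(1), of m n \<alpha>] 
      g_mult_el_emb[OF lg_one_in(1) lgP_closed(4)[of "{1..m}" n False], of \<alpha>]
    by (simp add: fst_el)
  have 3: "g_mult (emb (fst (gen m n \<alpha>))) (gen m n \<beta>) = el m n (if \<alpha> = 0 then lg_one else 0) \<beta>"
    unfolding gen_mult by (simp add: fst_gen)
  show ?thesis using 1 v unfolding 2 3 by (auto simp: supercomm_def h algebra_simps)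
qed

text \<open>The commutator rule for \<open>\<phi>\<close>-hat and \<open>\<psi>\<close> contains \<open>\<psi>(x \<cdot> \<pi>(y))\<close>, which for \<open>x = a \<partial>\<^sub>\<alpha>\<close> and \<open>y = b\<close> is
  \<open>\<plusminus>\<psi>(ab \<partial>\<^sub>\<alpha>)\<close>. Since \<open>\<phi>\<close>-hat is linear over the algebra, the left side can be computed from the case \<open>a = 1\<close>, and
  the comparison expresses \<open>\<psi>(ab \<partial>\<^sub>\<alpha>)\<close> through \<open>\<psi>(a \<partial>\<^sub>\<alpha>)\<close> and \<open>\<psi>(b \<partial>\<^sub>\<alpha>)\<close>.\<close>

lemma T_mult:
  assumes a: "a \<in> dP m n p" and b: "b \<in> dP m n q" and v: "v \<in> V"
  shows "T (a \<star> b) \<alpha> v = \<phi> a (T b \<alpha> v) + sc (ksign p q) (\<phi> b (T a \<alpha> v))"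
proof -
  have A: "a \<in> dA m n" "b \<in> dA m n" using a b dP_dA by auto
  have \<phi>p: "\<phi> (lg_scale c (x \<star> y)) w = sc c (\<phi> x (\<phi> y w))" if "x \<in> dA m n" "y \<in> dA m n" "w \<in> V" for c x y w
    using that by (simp add: \<phi>_mult)
  let ?P = "p \<noteq> (m < \<alpha>)"
  have 1: "supercomm M ?P q (hphi M (el m n a \<alpha>)) (psi M (emb b)) v =
          hphi M (g_bracket (el m n a \<alpha>) (emb b)) v - sc (ksign ?P q) (\<phi> (fst (emb b)) (\<psi> a \<alpha> v))
          + psi M (g_mult (el m n a \<alpha>) (emb (fst (emb b)))) v"
    unfolding \<psi>_def by (rule hphi_psi[OF el_part[OF a] v emb_part[OF b]])
  have 2: "g_bracket (el m n a \<alpha>) (emb b) = el m n (a \<star> pd m n \<alpha> b) 0"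
    unfolding emb_el[of b m n] el_bracket[OF a b] by (simp add: pd_alt el_lin)
  have 3: "psi M (g_mult (el m n a \<alpha>) (emb b)) v = sc (ksign (m < \<alpha>) q) (\<psi> (a \<star> b) \<alpha> v)"
    unfolding g_mult_el_emb[OF a b] using A v by (simp add: \<psi>_def[symmetric])
  have fe: "fst (emb b) = b" by (simp add: emb_def)
  have pe: "psi M (emb b) = \<psi> b 0" by (simp add: \<psi>_def emb_el[of b m n])
  have 4: "hphi M (el m n (a \<star> pd m n \<alpha> b) 0) v = \<phi> a (\<phi> (pd m n \<alpha> b) (\<eta> 0 v))"
    using hphi_el[of "a \<star> pd m n \<alpha> b" v 0] A v by (simp add: \<phi>_mult)
  have 5: "supercomm M ?P q (hphi M (el m n a \<alpha>)) (psi M (emb b)) v =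
     \<phi> a (\<eta> \<alpha> (\<psi> b 0 v)) - sc (ksign ?P q) (\<psi> b 0 (\<phi> a (\<eta> \<alpha> v)))"
    using A v by (simp add: supercomm_def pe hphi_el)
  have 6: "\<psi> b 0 (\<phi> a (\<eta> \<alpha> v)) = sc (ksign q p) (\<phi> a (\<psi> b 0 (\<eta> \<alpha> v)))"
    using \<psi>_\<phi>[OF b a, of "\<eta> \<alpha> v" 0] v by (simp add: pd_alt)
  have 7: "\<eta> \<alpha> (\<psi> b 0 v) = sc (ksign (m < \<alpha>) q) (\<psi> b 0 (\<eta> \<alpha> v)) + \<phi> (pd m n \<alpha> b) (\<eta> 0 v) + sc (ksign (m < \<alpha>) q) (T b \<alpha> v)"
    using \<eta>_\<psi>[OF b v, of \<alpha> 0] by simp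
  have 8: "sc (ksign (m < \<alpha>) q) (\<phi> a (T b \<alpha> v)) = - sc (ksign ?P q) (\<phi> b (\<psi> a \<alpha> v)) + sc (ksign (m < \<alpha>) q) (\<psi> (a \<star> b) \<alpha> v)"
    using 1 A v unfolding 5 6 7 2 4 fe 3
    by (cases p; cases q; cases "m < \<alpha>"; simp add: sc_simps algebra_simps)
  have 9: "\<phi> (a \<star> b) (\<chi> \<alpha> v) = sc (ksign p q) (\<phi> b (\<phi> a (\<chi> \<alpha> v)))"
    using \<phi>_comm[OF a b, of "\<chi> \<alpha> v"] v A by (simp add: \<phi>_mult)
  have "\<psi> (a \<star> b) \<alpha> v = \<phi> a (T b \<alpha> v) + sc (ksign p q) (\<phi> b (\<psi> a \<alpha> v))"
    using 8 by (cases p; cases q; cases "m < \<alpha>"; simp add: algebra_simps)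
  then show ?thesis unfolding T_def[of "a \<star> b"] T_def[of a] 9 using A v
    by (simp add: sc_simps)
qed

lemma \<psi>_eq: "\<psi> a \<alpha> v = \<phi> a (\<chi> \<alpha> v) + T a \<alpha> v"
  by (simp add: T_def)

lemma T_one [simp]: "v \<in> V \<Longrightarrow> T lg_one \<alpha> v = 0"
  by (simp add: T_def \<chi>_\<psi>[symmetric])

lemma \<chi>_\<chi>: "v \<in> V \<Longrightarrow> \<chi> \<alpha> (\<chi> \<beta> v) = sc (ksign (m < \<alpha>) (m < \<beta>)) (\<chi> \<beta> (\<chi> \<alpha> v))"
  using \<psi>_\<psi>[OF lg_one_in(1) lg_one_in(1), of v \<alpha> \<beta>] by (simp add: \<chi>_\<psi>)

lemma T_\<phi>:
  assumes a: "a \<in> dP m n p" and c: "c \<in> dP m n r" and v: "v \<in> V"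
  shows "T a \<alpha> (\<phi> c v) = sc (ksign (p \<noteq> (m < \<alpha>)) r) (\<phi> c (T a \<alpha> v))"
proof -
  have A: "a \<in> dA m n" "c \<in> dA m n" using a c dP_dA by auto
  have 1: "\<phi> a (\<phi> c w) = sc (ksign p r) (\<phi> c (\<phi> a w))" if "w \<in> V" for w using \<phi>_comm[OF a c that] .
  show ?thesis unfolding T_def using A v
    by (simp add: \<psi>_\<phi>[OF a c v] \<chi>_\<phi>[OF c v] \<phi>_mult 1)
      (cases p; cases r; cases "m < \<alpha>"; simp add: sc_simps algebra_simps)
qed

lemma \<chi>_T:
  assumes b: "b \<in> dP m n q" and v: "v \<in> V"
  shows "\<chi> \<alpha> (T b \<beta> v) = sc (ksign (m < \<alpha>) (q \<noteq> (m < \<beta>))) (T b \<beta> (\<chi> \<alpha> v)) + T (pd m n \<alpha> b) \<beta> v"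
proof -
  have A: "b \<in> dA m n" using b dP_dA by auto
  have 1: "\<chi> \<alpha> (\<psi> b \<beta> v) = sc (ksign (m < \<alpha>) (q \<noteq> (m < \<beta>))) (\<psi> b \<beta> (\<chi> \<alpha> v)) + \<psi> (pd m n \<alpha> b) \<beta> v"
    using \<psi>_\<psi>[OF lg_one_in(1) b v, of \<alpha> \<beta>] v by (simp add: \<chi>_\<psi>)
  have 2: "\<chi> \<alpha> (\<phi> b (\<chi> \<beta> v)) = sc (ksign (m < \<alpha>) q) (\<phi> b (sc (ksign (m < \<alpha>) (m < \<beta>)) (\<chi> \<beta> (\<chi> \<alpha> v)))) + \<phi> (pd m n \<alpha> b) (\<chi> \<beta> v)"
    using \<chi>_\<phi>[OF b, of "\<chi> \<beta> v" \<alpha>] \<chi>_\<chi>[OF v, of \<alpha> \<beta>] v by simp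
  show ?thesis unfolding T_def using A v
    by (simp add: 1 2) (cases q; cases "m < \<beta>"; cases "m < \<alpha>"; simp add: sc_simps algebra_simps)
qed

lemma \<eta>_T:
  assumes a: "a \<in> dP m n p" and v: "v \<in> V"
  shows "\<eta> \<delta> (T a \<alpha> v) = sc (ksign (m < \<delta>) (p \<noteq> (m < \<alpha>))) (T a \<alpha> (\<eta> \<delta> v))
    + \<phi> (pd m n \<delta> a) (\<eta> \<alpha> v) + (if \<alpha> = 0 then sc (ksign (m < \<delta>) p) (T a \<delta> v) else 0)"
proof -
  have A: "a \<in> dA m n" using a dP_dA by auto
  have 2: "\<eta> \<delta> (\<phi> a (\<chi> \<alpha> v)) = sc (ksign (m < \<delta>) p) (\<phi> a (sc (ksign (m < \<delta>) (m < \<alpha>)) (\<chi> \<alpha> (\<eta> \<delta> v))))"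
    using \<eta>_\<phi>[OF a, of "\<chi> \<alpha> v" \<delta>] \<eta>_\<chi>[OF v, of \<delta> \<alpha>] v by simp
  show ?thesis unfolding T_def[of a \<alpha>] using A v
    by (simp add: 2 \<eta>_\<psi>[OF a v, of \<delta> \<alpha>]) (cases p; cases "m < \<delta>"; cases "m < \<alpha>"; simp add: sc_simps algebra_simps)
qed

text \<open>The commutator of two operators \<open>\<psi>\<close> is known; the derivation property \<open>T_mult\<close> turns the two terms
  \<open>T(a \<partial>\<^sub>\<alpha> b, \<beta>)\<close> and \<open>T(b \<partial>\<^sub>\<beta> a, \<alpha>)\<close> that it produces into multiples of \<open>T(a, \<beta>)\<close> and \<open>T(b, \<alpha>)\<close>.\<close>

lemma T_T:
  fixes \<alpha> \<beta> :: nat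
  assumes a: "a \<in> dP m n p" and b: "b \<in> dP m n q" and v: "v \<in> V"
  defines "k \<equiv> ksign (p \<noteq> (m < \<alpha>)) (q \<noteq> (m < \<beta>))"
  shows "T a \<alpha> (T b \<beta> v) = sc k (T b \<beta> (T a \<alpha> v))
    + sc (ksign p (q \<noteq> (m < \<alpha>))) (\<phi> (pd m n \<alpha> b) (T a \<beta> v))
    - sc (k * ksign q (p \<noteq> (m < \<beta>))) (\<phi> (pd m n \<beta> a) (T b \<alpha> v))"
proof -
  have A [simp]: "a \<in> dA m n" "b \<in> dA m n" using a b dP_dA by auto
  note v [simp]
  let ?P = "p \<noteq> (m < \<alpha>)"
  have c1: "\<psi> a \<alpha> (\<psi> b \<beta> v) = sc k (\<psi> b \<beta> (\<psi> a \<alpha> v)) + \<psi> (a \<star> pd m n \<alpha> b) \<beta> v - sc k (\<psi> (b \<star> pd m n \<beta> a) \<alpha> v)"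
    using \<psi>_\<psi>[OF a b v, of \<alpha> \<beta>] by (simp add: k_def)
  have c2: "\<psi> a \<alpha> (\<chi> \<beta> v) = sc (ksign ?P (m < \<beta>)) (\<chi> \<beta> (\<psi> a \<alpha> v)) - sc (ksign ?P (m < \<beta>)) (\<psi> (pd m n \<beta> a) \<alpha> v)"
    using \<psi>_\<psi>[OF a lg_one_in(1) v, of \<alpha> \<beta>] by (simp add: \<chi>_\<psi>)
  have c3: "\<psi> a \<alpha> (\<phi> b (\<chi> \<beta> v)) = sc (ksign ?P q) (\<phi> b (\<psi> a \<alpha> (\<chi> \<beta> v))) + \<phi> a (\<phi> (pd m n \<alpha> b) (\<chi> \<beta> v))"
    using \<psi>_\<phi>[OF a b, of "\<chi> \<beta> v" \<alpha>] by (simp add: \<phi>_mult)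
  have c4: "\<phi> a (\<chi> \<alpha> (T b \<beta> v)) = sc (ksign (m < \<alpha>) (q \<noteq> (m < \<beta>))) (\<phi> a (T b \<beta> (\<chi> \<alpha> v))) + \<phi> a (T (pd m n \<alpha> b) \<beta> v)"
    using \<chi>_T[OF b v, of \<alpha> \<beta>] by simp
  have c5: "T b \<beta> (\<phi> a (\<chi> \<alpha> v)) = sc (ksign (q \<noteq> (m < \<beta>)) p) (\<phi> a (T b \<beta> (\<chi> \<alpha> v)))"
    using T_\<phi>[OF b a, of "\<chi> \<alpha> v" \<beta>] by simp
  have c6: "T (a \<star> pd m n \<alpha> b) \<beta> v = \<phi> a (T (pd m n \<alpha> b) \<beta> v) + sc (ksign p ((m < \<alpha>) \<noteq> q)) (\<phi> (pd m n \<alpha> b) (T a \<beta> v))"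
    by (rule T_mult[OF a pd_dP[OF b] v])
  have c7: "T (b \<star> pd m n \<beta> a) \<alpha> v = \<phi> b (T (pd m n \<beta> a) \<alpha> v) + sc (ksign q ((m < \<beta>) \<noteq> p)) (\<phi> (pd m n \<beta> a) (T b \<alpha> v))"
    by (rule T_mult[OF b pd_dP[OF a] v])
  have "T a \<alpha> (T b \<beta> v) = \<psi> a \<alpha> (\<psi> b \<beta> v) - \<psi> a \<alpha> (\<phi> b (\<chi> \<beta> v)) - \<phi> a (\<chi> \<alpha> (T b \<beta> v))"
    by (simp add: T_def)
  also have "\<dots> = sc k (T b \<beta> (\<psi> a \<alpha> v)) + T (a \<star> pd m n \<alpha> b) \<beta> v
      - sc k (T (b \<star> pd m n \<beta> a) \<alpha> v - \<phi> b (T (pd m n \<beta> a) \<alpha> v)) - \<phi> a (\<chi> \<alpha> (T b \<beta> v))"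
    unfolding c1 c3 c2 k_def
    by (simp add: T_def[of "b \<star> pd m n \<beta> a"] T_def[of "a \<star> pd m n \<alpha> b"] T_def[of "pd m n \<beta> a"] T_def[of b \<beta> "\<psi> a \<alpha> v"] \<phi>_mult)
      (cases p; cases q; cases "m < \<beta>"; cases "m < \<alpha>"; simp add: sc_simps algebra_simps)
  also have "T b \<beta> (\<psi> a \<alpha> v) = T b \<beta> (\<phi> a (\<chi> \<alpha> v)) + T b \<beta> (T a \<alpha> v)"
    by (subst \<psi>_eq) simp
  finally show ?thesis unfolding c4 c5 c6 c7 k_def
    by (cases p; cases q; cases "m < \<beta>"; cases "m < \<alpha>"; simp add: sc_simps algebra_simps)
qed

section \<open>The action of \<open>\<gg>\<ll>(m+1,n)\<close>\<close>

text \<open>The operator of \<open>E\<^sub>\<alpha>\<^sub>\<beta>\<close> on all of \<open>M\<close>. For \<open>\<alpha> > 0\<close> it is the value of \<open>T\<close> at the generator \<open>g\<^sub>\<alpha>\<close>, divided by the unit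
  \<open>\<partial>\<^sub>\<alpha> g\<^sub>\<alpha>\<close>, which makes \<open>T(g\<^sub>\<alpha>, \<beta>) = \<phi>(\<partial>\<^sub>\<alpha> g\<^sub>\<alpha>) E\<^sub>\<alpha>\<^sub>\<beta>\<close>.\<close>

definition E :: "nat \<Rightarrow> nat \<Rightarrow> 'v \<Rightarrow> 'v" where
  "E \<alpha> \<beta> v = (if \<alpha> = 0 then - \<eta> \<beta> v else \<phi> (gi m \<alpha>) (T (gv m \<alpha>) \<beta> v))"

lemma gv_dA [simp, intro]: "\<beta> \<in> {1..m+n} \<Longrightarrow> gv m \<beta> \<in> dA m n"
  and gi_dA [simp, intro]: "\<beta> \<in> {1..m+n} \<Longrightarrow> gi m \<beta> \<in> dA m n"
  and gu_dA [simp, intro]: "\<beta> \<in> {1..m+n} \<Longrightarrow> gu m \<beta> \<in> dA m n"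
  using gv_dP gi_dP gu_dP dP_dA by blast+

lemma E_V [simp, intro]: "\<alpha> \<le> m + n \<Longrightarrow> v \<in> V \<Longrightarrow> E \<alpha> \<beta> v \<in> V"
  by (auto simp: E_def)

lemma E_lin: "\<alpha> \<le> m + n \<Longrightarrow> lin_on sc sc V (E \<alpha> \<beta>)"
  by (auto simp: E_def lin_on_def sc_simps)

lemmas E_simps [simp] = lin_on_simps[OF E_lin]

lemma Phi_E_eq:
  assumes "\<alpha> \<le> m + n" "v \<in> V"
  shows "Phi_E m n M \<alpha> \<beta> v = E \<alpha> \<beta> v"
proof (cases "\<alpha> = 0")
  case False
  then have \<alpha>: "\<alpha> \<in> {1..m+n}" using assms by auto
  have g: "\<phi> (gi m \<alpha>) (\<phi> (gu m \<alpha>) (\<chi> \<beta> v)) = \<chi> \<beta> v"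
    using \<alpha> assms \<phi>_mult[of "gi m \<alpha>" "gu m \<alpha>" "\<chi> \<beta> v"] by (simp add: gi_gu)
  show ?thesis
  proof (cases "\<alpha> \<le> m")
    case True
    then have t: "tpow \<alpha> 1 \<in> dA m n" "tpow \<alpha> (-1) \<in> dA m n" using False dP_dA[OF tpow_dP] by auto
    then show ?thesis using False True g assms
      by (simp add: Phi_E_def E_def T_def gi_def gv_def gu_def gen_mult \<psi>_def[symmetric] \<chi>_def[symmetric])
  next
    case F2: False
    then have t: "zeta (\<alpha> - m) \<in> dA m n" using \<alpha> dP_dA[OF zeta_dP[OF odd_index]] by auto
    then show ?thesis using False F2 assms
      by (simp add: Phi_E_def E_def T_def gi_def gv_def gen_mult \<psi>_def[symmetric] \<chi>_def[symmetric])
  qed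
qed (simp add: Phi_E_def E_def \<eta>_def)

lemma gi_comm:
  assumes "\<alpha> \<in> {1..m+n}" "c \<in> dP m n r" "v \<in> V"
  shows "\<phi> (gi m \<alpha>) (\<phi> c v) = \<phi> c (\<phi> (gi m \<alpha>) v)"
  using \<phi>_comm[OF gi_dP[OF assms(1)] assms(2,3)] assms dP_dA[OF assms(2)] by simp

lemma E_\<phi>:
  assumes \<alpha>: "\<alpha> \<le> m + n" and c: "c \<in> dP m n r" and v: "v \<in> V"
  shows "E \<alpha> \<beta> (\<phi> c v) = sc (ksign ((m < \<alpha>) \<noteq> (m < \<beta>)) r) (\<phi> c (E \<alpha> \<beta> v))"
proof (cases "\<alpha> = 0")
  case True then show ?thesis using \<eta>_\<phi>[OF c v, of \<beta>] v dP_dA[OF c] by (simp add: E_def)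
next
  case False
  then have \<alpha>: "\<alpha> \<in> {1..m+n}" using \<alpha> by auto
  then show ?thesis using False T_\<phi>[OF gv_dP[OF \<alpha>] c v, of \<beta>] gi_comm[OF \<alpha> c, of "T (gv m \<alpha>) \<beta> v"] v dP_dA[OF c]
    by (simp add: E_def)
qed

lemma gi_gu_\<phi>: "\<alpha> \<in> {1..m+n} \<Longrightarrow> v \<in> V \<Longrightarrow> \<phi> (gi m \<alpha>) (\<phi> (gu m \<alpha>) v) = v"
  using \<phi>_mult[of "gi m \<alpha>" "gu m \<alpha>" v] by (simp add: gi_gu)

text \<open>For even \<open>\<alpha>\<close> the derivatives of \<open>t\<^sub>\<alpha>\<^sup>-\<^sup>1\<close> and of \<open>t\<^sub>\<alpha>\<close> contribute opposite terms; an odd generator has the constant derivative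
  \<open>1\<close>, and \<open>T(1, \<beta>) = 0\<close>.\<close>

lemma E_\<chi>:
  assumes \<alpha>: "\<alpha> \<le> m + n" and v: "v \<in> V"
  shows "\<chi> \<gamma> (E \<alpha> \<beta> v) = sc (ksign (m < \<gamma>) ((m < \<alpha>) \<noteq> (m < \<beta>))) (E \<alpha> \<beta> (\<chi> \<gamma> v))"
proof (cases "\<alpha> = 0")
  case True then show ?thesis using \<eta>_\<chi>[OF v, of \<beta> \<gamma>] v 
    by (cases "m < \<gamma>"; cases "m < \<beta>") (simp_all add: E_def)
next
  case False
  then have \<alpha>: "\<alpha> \<in> {1..m+n}" using \<alpha> by auto
  have 1: "\<chi> \<gamma> (\<phi> (gi m \<alpha>) (T (gv m \<alpha>) \<beta> v)) = \<phi> (gi m \<alpha>) (\<chi> \<gamma> (T (gv m \<alpha>) \<beta> v)) + \<phi> (pd m n \<gamma> (gi m \<alpha>)) (T (gv m \<alpha>) \<beta> v)"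
    using \<chi>_\<phi>[OF gi_dP[OF \<alpha>], of "T (gv m \<alpha>) \<beta> v" \<gamma>] v \<alpha> by simp
  have 2: "\<phi> (gi m \<alpha>) (T (pd m n \<gamma> (gv m \<alpha>)) \<beta> v) + \<phi> (pd m n \<gamma> (gi m \<alpha>)) (T (gv m \<alpha>) \<beta> v) = 0"
  proof (cases "\<alpha> \<le> m")
    case True
    then have "\<alpha> \<in> {1..m}" using \<alpha> by auto
    then show ?thesis using \<alpha> v True by (simp add: pd_gv gi_def pd_tpow gu_def gv_def dP_dA[OF tpow_dP])
  next
    case False then show ?thesis using \<alpha> v by (simp add: pd_gv gi_def gu_def)
  qed
  show ?thesis using False 2 v \<alpha> unfolding E_def
    by (simp add: 1 \<chi>_T[OF gv_dP[OF \<alpha>] v] algebra_simps)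
qed

lemma E_E_0:
  assumes \<gamma>: "\<gamma> \<in> {1..m+n}" and v: "v \<in> V"
  shows "E 0 \<beta> (E \<gamma> \<delta> v) = sc (ksign (m < \<beta>) ((m < \<gamma>) \<noteq> (m < \<delta>))) (E \<gamma> \<delta> (E 0 \<beta> v))
    + (if \<beta> = \<gamma> then E 0 \<delta> v else 0) - sc (ksign (m < \<beta>) ((m < \<gamma>) \<noteq> (m < \<delta>))) (if \<delta> = 0 then E \<gamma> \<beta> v else 0)"
proof -
  have 1: "\<eta> \<beta> (\<phi> (gi m \<gamma>) w) = \<phi> (gi m \<gamma>) (\<eta> \<beta> w)" if "w \<in> V" for w
    using \<eta>_\<phi>[OF gi_dP[OF \<gamma>] that, of \<beta>] that \<gamma> by simp
  have 2: "\<eta> \<beta> (\<phi> (gi m \<gamma>) (T (gv m \<gamma>) \<delta> v)) = \<phi> (gi m \<gamma>) (\<eta> \<beta> (T (gv m \<gamma>) \<delta> v))"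
    using 1 v \<gamma> by simp
  have 3: "\<phi> (gi m \<gamma>) (\<phi> (pd m n \<beta> (gv m \<gamma>)) (\<eta> \<delta> v)) = (if \<beta> = \<gamma> then \<eta> \<delta> v else 0)"
    using v \<gamma> gi_gu_\<phi>[of \<gamma> "\<eta> \<delta> v"] by (simp add: pd_gv)
  show ?thesis using \<gamma> v unfolding E_def
    by (simp add: 2 \<eta>_T[OF gv_dP[OF \<gamma>] v] 3)
qed

text \<open>For \<open>\<alpha>, \<gamma> > 0\<close> this is \<open>T_T\<close> for two generators, since \<open>\<partial>\<^sub>\<beta> g\<^sub>\<gamma>\<close> is zero or the unit cancelled by the prefactor. The row
  \<open>0\<close> comes from the relations of \<open>\<phi>\<close>-hat with itself and with \<open>\<psi>\<close>.\<close>

lemma E_E: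
  assumes i: "\<alpha> \<le> m + n" "\<gamma> \<le> m + n" and v: "v \<in> V"
  shows "E \<alpha> \<beta> (E \<gamma> \<delta> v) = sc (ksign ((m < \<alpha>) \<noteq> (m < \<beta>)) ((m < \<gamma>) \<noteq> (m < \<delta>))) (E \<gamma> \<delta> (E \<alpha> \<beta> v))
    + (if \<beta> = \<gamma> then E \<alpha> \<delta> v else 0)
    - sc (ksign ((m < \<alpha>) \<noteq> (m < \<beta>)) ((m < \<gamma>) \<noteq> (m < \<delta>))) (if \<delta> = \<alpha> then E \<gamma> \<beta> v else 0)"
proof -
  consider "\<alpha> = 0" "\<gamma> = 0" | "\<alpha> = 0" "\<gamma> \<in> {1..m+n}" | "\<gamma> = 0" "\<alpha> \<in> {1..m+n}" | "\<alpha> \<in> {1..m+n}" "\<gamma> \<in> {1..m+n}"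
    using i by fastforce
  then show ?thesis
  proof cases
    case 1
    then show ?thesis using v by (auto simp: E_def \<eta>_\<eta>[OF v, of \<beta> \<delta>])
  next
    case 2
    then show ?thesis using E_E_0[OF 2(2) v, of \<beta> \<delta>] by simp
  next
    case 3
    show ?thesis using E_E_0[OF 3(2) v, of \<delta> \<beta>] 3 v
      by (cases "m < \<alpha>"; cases "m < \<beta>"; cases "m < \<delta>"; auto simp: sc_simps algebra_simps)
  next
    case 4
    note \<alpha> = 4(1) and \<gamma> = 4(2)
    have g: "\<phi> (gi m \<gamma>) (\<phi> (gi m \<alpha>) w) = \<phi> (gi m \<alpha>) (\<phi> (gi m \<gamma>) w)" if "w \<in> V" for w
      using gi_comm[OF \<gamma> gi_dP[OF \<alpha>] that] .
    have tg: "T (gv m \<alpha>') \<beta>' (\<phi> (gi m \<gamma>') w) = \<phi> (gi m \<gamma>') (T (gv m \<alpha>') \<beta>' w)"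
      if "\<alpha>' \<in> {1..m+n}" "\<gamma>' \<in> {1..m+n}" "w \<in> V" for \<alpha>' \<beta>' \<gamma>' w
      using T_\<phi>[OF gv_dP[OF that(1)] gi_dP[OF that(2)] that(3), of \<beta>'] that by simp
    have p1: "\<phi> (gi m \<gamma>) (\<phi> (pd m n \<beta> (gv m \<gamma>)) w) = (if \<beta> = \<gamma> then w else 0)" if "w \<in> V" for w
      using that \<gamma> gi_gu_\<phi>[OF \<gamma> that] by (simp add: pd_gv)
    have p2: "\<phi> (gi m \<alpha>) (\<phi> (gi m \<gamma>) (\<phi> (pd m n \<delta> (gv m \<alpha>)) w)) = (if \<delta> = \<alpha> then \<phi> (gi m \<gamma>) w else 0)" if "w \<in> V" for w
      using that \<alpha> \<gamma> gi_gu_\<phi>[OF \<alpha>, of "\<phi> (gi m \<gamma>) w"] gi_comm[OF \<gamma> gu_dP[OF \<alpha>] that] by (simp add: pd_gv)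
    have e: "E \<alpha>' \<beta>' w = \<phi> (gi m \<alpha>') (T (gv m \<alpha>') \<beta>' w)" if "\<alpha>' \<in> {1..m+n}" for \<alpha>' \<beta>' w
      using that by (auto simp: E_def)
    have 1: "E \<alpha> \<beta> (E \<gamma> \<delta> v) = \<phi> (gi m \<alpha>) (\<phi> (gi m \<gamma>) (T (gv m \<alpha>) \<beta> (T (gv m \<gamma>) \<delta> v)))"
      using \<alpha> \<gamma> v by (simp add: e tg)
    have 2: "E \<gamma> \<delta> (E \<alpha> \<beta> v) = \<phi> (gi m \<alpha>) (\<phi> (gi m \<gamma>) (T (gv m \<gamma>) \<delta> (T (gv m \<alpha>) \<beta> v)))"
      using \<alpha> \<gamma> v by (simp add: e tg g)
    show ?thesis unfolding 1 2
      using \<alpha> \<gamma> v T_T[OF gv_dP[OF \<alpha>] gv_dP[OF \<gamma>] v, of \<beta> \<delta>]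
      by (simp add: p1 p2 sc_simps e)
  qed
qed

section \<open>The structure formula for \<open>\<psi>\<close>\<close>

text \<open>The derivation in \<open>a\<close> that takes the same values as \<open>T\<close> on the generators; \<open>p\<close> is the parity of \<open>a\<close>.\<close>

definition F :: "bool \<Rightarrow> lgr \<Rightarrow> nat \<Rightarrow> 'v \<Rightarrow> 'v" where
  "F p a \<alpha> v = (\<Sum>\<beta>\<in>{1..m+n}. sc (ksign (m < \<beta>) (\<not> p)) (\<phi> (pd m n \<beta> a) (E \<beta> \<alpha> v)))"

lemma F_V [simp, intro]: "v \<in> V \<Longrightarrow> F p a \<alpha> v \<in> V"
  unfolding F_def by (intro vs.subspace_sum[OF V_sub]) auto

lemma F_mult:
  assumes a: "a \<in> dP m n p" and b: "b \<in> dP m n q" and v: "v \<in> V"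
  shows "F (p \<noteq> q) (a \<star> b) \<alpha> v = \<phi> a (F q b \<alpha> v) + sc (ksign p q) (\<phi> b (F p a \<alpha> v))"
proof -
  have A [simp]: "a \<in> dA m n" "b \<in> dA m n" using a b dP_dA by auto
  note v [simp]
  have "sc (ksign (m < \<beta>) (\<not> (p \<noteq> q))) (\<phi> (pd m n \<beta> (a \<star> b)) w) =
      \<phi> a (sc (ksign (m < \<beta>) (\<not> q)) (\<phi> (pd m n \<beta> b) w))
      + sc (ksign p q) (\<phi> b (sc (ksign (m < \<beta>) (\<not> p)) (\<phi> (pd m n \<beta> a) w)))"
    if w [simp]: "w \<in> V" for w \<beta>
    using \<phi>_comm[OF pd_dP[OF a] b w, of \<beta>]
    by (simp add: pd_leibniz[OF a A(2)] \<phi>_mult) (cases p; cases q; cases "m < \<beta>"; simp add: sc_simps algebra_simps)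
  then have "F (p \<noteq> q) (a \<star> b) \<alpha> v = (\<Sum>\<beta>\<in>{1..m+n}. \<phi> a (sc (ksign (m < \<beta>) (\<not> q)) (\<phi> (pd m n \<beta> b) (E \<beta> \<alpha> v)))
      + sc (ksign p q) (\<phi> b (sc (ksign (m < \<beta>) (\<not> p)) (\<phi> (pd m n \<beta> a) (E \<beta> \<alpha> v)))))"
    unfolding F_def by (intro sum.cong refl) auto
  also have "\<dots> = \<phi> a (F q b \<alpha> v) + sc (ksign p q) (\<phi> b (F p a \<alpha> v))"
  proof -
    have s: "\<phi> c (F r x \<alpha> v) = (\<Sum>\<beta>\<in>{1..m+n}. \<phi> c (sc (ksign (m < \<beta>) (\<not> r)) (\<phi> (pd m n \<beta> x) (E \<beta> \<alpha> v))))"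
      if "c \<in> dA m n" for c r x
      unfolding F_def by (rule lin_on_simps(6)[OF \<phi>_lin[OF that]]) auto
    show ?thesis unfolding s[OF A(1)] s[OF A(2)] by (simp only: sum.distrib vs.scale_sum_right)
  qed
  finally show ?thesis .
qed

lemma F_gv:
  assumes \<beta>: "\<beta> \<in> {1..m+n}" and v: "v \<in> V"
  shows "F (m < \<beta>) (gv m \<beta>) \<alpha> v = T (gv m \<beta>) \<alpha> v"
proof -
  have "F (m < \<beta>) (gv m \<beta>) \<alpha> v = (\<Sum>\<gamma>\<in>{1..m+n}. if \<gamma> = \<beta> then \<phi> (gu m \<beta>) (E \<beta> \<alpha> v) else 0)"
    unfolding F_def by (intro sum.cong refl) (use \<beta> v in \<open>auto simp: pd_gv ksign_def\<close>)
  also have "\<dots> = \<phi> (gu m \<beta>) (\<phi> (gi m \<beta>) (T (gv m \<beta>) \<alpha> v))" using \<beta> by (simp add: E_def)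
  also have "\<dots> = T (gv m \<beta>) \<alpha> v" using \<phi>_mult[of "gu m \<beta>" "gi m \<beta>" "T (gv m \<beta>) \<alpha> v"] \<beta> v by (simp add: gi_gu)
  finally show ?thesis .
qed

text \<open>Two derivations that agree on the generators agree. The argument runs over the difference of the two sides, and passes
  from \<open>t\<^sub>i\<close> to \<open>t\<^sub>i\<^sup>-\<^sup>1\<close> through \<open>t\<^sub>i t\<^sub>i\<^sup>-\<^sup>1 = 1\<close>.\<close>

lemma T_F:
  assumes a: "a \<in> dP m n p" and v: "v \<in> V"
  shows "T a \<alpha> v = F p a \<alpha> v"
proof -
  have mono: "T (mmon k) \<alpha> v = F (mon_parity k) (mmon k) \<alpha> v"
    if k: "k \<in> mons {1..m} n" for k
  proof -
    \<comment> \<open>the difference of the two derivations; \<open>p\<close> is the parity of \<open>a\<close>\<close>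
    define H where "H p a = T a \<alpha> v - F p a \<alpha> v" for p a
    have Hm: "H (p \<noteq> q) (a \<star> b) = \<phi> a (H q b) + sc (ksign p q) (\<phi> b (H p a))"
      if "a \<in> dP m n p" "b \<in> dP m n q" for a b p q
      unfolding H_def F_mult[OF that v] T_mult[OF that v] using that v dP_dA by (simp add: sc_simps)
    have HV: "a \<in> dA m n \<Longrightarrow> H p a \<in> V" for p a using v by (simp add: H_def)
    have H1: "H False lg_one = 0" using v by (simp add: H_def F_def)
    have "\<exists>p. mmon k \<in> dP m n p \<and> H p (mmon k) = 0"
      using k
    proof (rule mono_gen_induct)
      show "\<exists>p. lg_one \<in> dP m n p \<and> H p lg_one = 0" using H1 by (intro exI[of _ False]) simp
      have t: "H False (tpow i 1) = 0" if "i \<in> {1..m}" for i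
        using F_gv[OF _ v, of i \<alpha>] that by (simp add: H_def gv_def)
      then show "\<exists>p. tpow i 1 \<in> dP m n p \<and> H p (tpow i 1) = 0" if "i \<in> {1..m}" for i
        using that by blast
      show "\<exists>p. tpow i (-1) \<in> dP m n p \<and> H p (tpow i (-1)) = 0" if i: "i \<in> {1..m}" for i
      proof -
        have tA: "tpow i c \<in> dA m n" for c using i dP_dA[OF tpow_dP] by auto
        have "\<phi> (tpow i 1) (H False (tpow i (-1))) = 0"
          using Hm[OF tpow_dP[OF i] tpow_dP[OF i], of 1 "-1"] t[OF i] H1 tA by (simp add: tpow_mult tpow_0)
        then have "\<phi> (tpow i (-1)) (\<phi> (tpow i 1) (H False (tpow i (-1)))) = 0" using tA by simp
        then have "H False (tpow i (-1)) = 0"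
          using \<phi>_mult[OF tA tA HV[OF tA], of "-1" 1] HV[OF tA] by (simp add: tpow_mult tpow_0)
        then show ?thesis using i by blast
      qed
      show "\<exists>p. zeta k \<in> dP m n p \<and> H p (zeta k) = 0" if "k \<in> {1..n}" for k
        using F_gv[OF _ v, of "m + k" \<alpha>] that by (intro exI[of _ True]) (auto simp: H_def gv_def)
      show "\<exists>p. a \<star> b \<in> dP m n p \<and> H p (a \<star> b) = 0"
        if ex: "\<exists>p. a \<in> dP m n p \<and> H p a = 0" "\<exists>p. b \<in> dP m n p \<and> H p b = 0" for a b
      proof -
        obtain p q where pq: "a \<in> dP m n p" "H p a = 0" "b \<in> dP m n q" "H q b = 0" using ex by auto
        then show ?thesis using Hm[of a p b q] dP_dA lg_mult_lgP[OF pq(1,3)] by (intro exI[of _ "p \<noteq> q"]) auto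
      qed
    qed
    then obtain p where "single k (1::complex) \<in> dP m n p" "H p (mmon k) = 0" by auto
    then show ?thesis by (auto simp: H_def lgP_def)
  qed
  let ?s = "\<lambda>k. lg_scale (lookup a k) (mmon k)"
  have k: "k \<in> mons {1..m} n" "mon_parity k = p" if "k \<in> keys a" for k
    using a that by (auto simp: lgP_def)
  have sA: "mmon k \<in> dA m n" if "k \<in> keys a" for k
    by (rule single_lgA[OF k(1)[OF that]])
  have "T a \<alpha> v = T (\<Sum>k\<in>keys a. ?s k) \<alpha> v" by (subst lg_expand) simp
  also have "\<dots> = (\<Sum>k\<in>keys a. sc (lookup a k) (T (mmon k) \<alpha> v))"
    using v sA by (subst left_simps) (auto intro!: sum.cong simp del: lg_scale_single)
  also have "\<dots> = (\<Sum>k\<in>keys a. sc (lookup a k) (F p (mmon k) \<alpha> v))"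
    using mono k by (intro sum.cong) auto
  also have "\<dots> = (\<Sum>\<beta>\<in>{1..m+n}. sc (ksign (m < \<beta>) (\<not> p))
       (\<Sum>k\<in>keys a. sc (lookup a k) (\<phi> (pd m n \<beta> (mmon k)) (E \<beta> \<alpha> v))))"
    unfolding F_def vs.scale_sum_right by (subst sum.swap) (simp add: mult.commute)
  also have "\<dots> = F p a \<alpha> v"
    unfolding F_def
  proof (intro sum.cong refl arg_cong[where f="sc _"])
    fix \<beta> assume \<beta>: "\<beta> \<in> {1..m+n}"
    have "\<phi> (pd m n \<beta> a) (E \<beta> \<alpha> v) = \<phi> (pd m n \<beta> (\<Sum>k\<in>keys a. ?s k)) (E \<beta> \<alpha> v)" by (subst lg_expand) simp
    also have "\<dots> = (\<Sum>k\<in>keys a. sc (lookup a k) (\<phi> (pd m n \<beta> (mmon k)) (E \<beta> \<alpha> v)))"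
      unfolding lin_sum[OF lin_pd] using \<beta> v by (subst left_simps) (auto intro!: sum.cong simp del: lg_scale_single)
    finally show "(\<Sum>k\<in>keys a. sc (lookup a k) (\<phi> (pd m n \<beta> (mmon k)) (E \<beta> \<alpha> v)))
      = \<phi> (pd m n \<beta> a) (E \<beta> \<alpha> v)" by simp
  qed
  finally show ?thesis .
qed

lemma \<psi>_formula:
  assumes "a \<in> dP m n p" and "v \<in> V"
  shows "\<psi> a \<alpha> v = \<phi> a (\<chi> \<alpha> v) + (\<Sum>\<beta>\<in>{1..m+n}. sc (ksign (m < \<beta>) (\<not> p)) (\<phi> (pd m n \<beta> a) (E \<beta> \<alpha> v)))"
  using T_F[OF assms, of \<alpha>] by (simp add: \<psi>_eq F_def)

end

section \<open>Simultaneous eigenvectors\<close>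

lemma (in vector_space) span_family_sum:
  assumes F: "\<And>i. i \<in> K \<Longrightarrow> subspace (F i)" and x: "x \<in> span (\<Union>i\<in>K. F i)"
  shows "\<exists>J f. finite J \<and> J \<subseteq> K \<and> (\<forall>j\<in>J. f j \<in> F j) \<and> x = (\<Sum>j\<in>J. f j)"
  using x
proof (induction rule: span_induct_alt)
  case base show ?case by (rule exI[of _ "{}"]) simp
next
  case (step c x y)
  then obtain J f where J: "finite J" "J \<subseteq> K" "\<forall>j\<in>J. f j \<in> F j" "y = (\<Sum>j\<in>J. f j)" by auto
  obtain i where i: "i \<in> K" "x \<in> F i" using step by auto
  define g where "g = (\<lambda>j. (if j = i then scale c x else 0) + (if j \<in> J then f j else 0))"
  have "(\<Sum>j\<in>insert i J. g j) = scale c x + y"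
    unfolding g_def sum.distrib using J
    by (simp add: sum.delta sum.inter_restrict[symmetric] Int_absorb1 subset_insertI)
  moreover have "\<forall>j\<in>insert i J. g j \<in> F j"
    using J i F subspace_0 subspace_add subspace_scale unfolding g_def by auto
  ultimately show ?case using J i by (intro exI[of _ "insert i J"] exI[of _ g]) auto
qed

text \<open>Eigenvectors for pairwise different systems of eigenvalues can be separated by polynomials in the operators, which preserve
  \<open>U\<close>. In the induction, subtracting the eigenvalue of the last summand removes that summand and rescales the others.\<close>

lemma eigen_component:
  fixes \<rho> :: "'h \<Rightarrow> 'v::ab_group_add \<Rightarrow> 'v" and l :: "'i \<Rightarrow> 'h \<Rightarrow> complex"
  assumes vs: "vector_space s" and W: "module.subspace s W" and lin: "\<And>h. h \<in> H \<Longrightarrow> lin_on s s W (\<rho> h)"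
    and U: "module.subspace s U" and stable: "\<And>h u. h \<in> H \<Longrightarrow> u \<in> U \<Longrightarrow> \<rho> h u \<in> U"
    and J: "finite J" and f: "\<And>j. j \<in> J \<Longrightarrow> f j \<in> W"
    and ev: "\<And>j h. j \<in> J \<Longrightarrow> h \<in> H \<Longrightarrow> \<rho> h (f j) = s (l j h) (f j)"
    and sep: "\<And>i j. i \<in> J \<Longrightarrow> j \<in> J \<Longrightarrow> i \<noteq> j \<Longrightarrow> \<exists>h\<in>H. l i h \<noteq> l j h"
    and sum: "(\<Sum>j\<in>J. f j) \<in> U" and j: "j \<in> J"
  shows "f j \<in> U"
proof -
  interpret vector_space s by (rule vs)
  have "\<forall>j\<in>J. f j \<in> U"
    using J f ev sep sum
  proof (induction J arbitrary: f rule: finite_induct)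
    case (insert a J)
    have "f b \<in> U" if b: "b \<in> J" for b
    proof -
      have "a \<noteq> b" using insert b by auto
      then obtain h where h: "h \<in> H" "l b h \<noteq> l a h" using insert.prems(3)[of b a] b by auto
      \<comment> \<open>the summands of the image of the sum under \<open>\<rho> h - l a h\<close>, which kills \<open>f a\<close>\<close>
      define g where "g = (\<lambda>j. s (l j h - l a h) (f j))"
      have "\<rho> h (\<Sum>j\<in>insert a J. f j) = (\<Sum>j\<in>insert a J. \<rho> h (f j))"
        by (rule lin_on_sum[OF lin[OF h(1)] vs vs W]) (use insert in auto)
      also have "\<dots> = (\<Sum>j\<in>insert a J. s (l j h) (f j))"
        by (intro sum.cong refl) (use insert.prems(2) h in auto)
      finally have "\<rho> h (\<Sum>j\<in>insert a J. f j) - s (l a h) (\<Sum>j\<in>insert a J. f j)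
        = (\<Sum>j\<in>insert a J. g j)"
        by (simp add: g_def scale_left_diff_distrib scale_sum_right sum_subtractf)
      also have "\<dots> = (\<Sum>j\<in>J. g j)" using insert by (simp add: g_def)
      finally have "(\<Sum>j\<in>J. g j) \<in> U"
        using stable[OF h(1) insert.prems(4)] insert.prems(4) U subspace_diff subspace_scale by metis
      moreover have "g j \<in> W" if "j \<in> J" for j using insert.prems(1) that W by (auto simp: g_def subspace_scale)
      moreover have "\<rho> h' (g j) = s (l j h') (g j)" if "j \<in> J" "h' \<in> H" for j h'
        using lin[OF that(2)] insert.prems(1,2) that by (auto simp: g_def lin_on_def)
      ultimately have "g b \<in> U" using insert.IH[of g] insert.prems(3) b by blast
      then have "s (inverse (l b h - l a h)) (g b) \<in> U" by (rule subspace_scale[OF U])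
      then show "f b \<in> U" using h by (simp add: g_def)
    qed
    moreover have "f a = (\<Sum>j\<in>insert a J. f j) - (\<Sum>j\<in>J. f j)" using insert by simp
    then have "f a \<in> U" using insert.prems(4) calculation U subspace_diff[OF U] subspace_sum[OF U] by metis
    ultimately show ?case by auto
  qed simp
  then show ?thesis using j by auto
qed

lemma dual_ext: "l \<in> dual s H \<Longrightarrow> l' \<in> dual s H \<Longrightarrow> l \<noteq> l' \<Longrightarrow> \<exists>h\<in>H. l h \<noteq> l' h"
  unfolding dual_def by (auto simp: fun_eq_iff) metis

lemma weight_space_subspace:
  assumes vs: "vector_space s" and W: "module.subspace s W" and lin: "\<And>h. h \<in> H \<Longrightarrow> lin_on s s W (\<rho> h)"
  shows "module.subspace s (weight_space s W H \<rho> l)"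
proof -
  interpret vector_space s by (rule vs)
  have z: "\<rho> h 0 = 0" if "h \<in> H" for h
    using lin[OF that] subspace_0[OF W] unfolding lin_on_def by (metis add_cancel_right_right)
  show ?thesis
    using lin W by (intro subspaceI) (auto simp: weight_space_def lin_on_def z scale_right_distrib mult.commute
       subspace_0 subspace_add subspace_scale)
qed

text \<open>The weight components of a vector can be separated inside any stable subspace that contains it.\<close>

lemma weight_decomposition_subspace:
  fixes s :: "complex \<Rightarrow> 'v::ab_group_add \<Rightarrow> 'v"
  assumes vs: "vector_space s" and W: "module.subspace s W" and lin: "\<And>h. h \<in> H \<Longrightarrow> lin_on s s W (\<rho> h)"
    and ds: "direct_sum s W (dual sH H) (weight_space s W H \<rho>)"
    and U: "module.subspace s U" "U \<subseteq> W" and stable: "\<And>h u. h \<in> H \<Longrightarrow> u \<in> U \<Longrightarrow> \<rho> h u \<in> U"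
    and u: "u \<in> U"
  shows "\<exists>J f. finite J \<and> J \<subseteq> dual sH H \<and> (\<forall>l\<in>J. f l \<in> U \<inter> weight_space s W H \<rho> l) \<and> u = (\<Sum>l\<in>J. f l)"
proof -
  interpret vector_space s by (rule vs)
  have subs: "subspace (weight_space s W H \<rho> l)" for l by (rule weight_space_subspace[OF vs W lin])
  have "W = span (\<Union>l\<in>dual sH H. weight_space s W H \<rho> l)" using ds unfolding direct_sum_def by (elim conjE)
  then have "u \<in> span (\<Union>l\<in>dual sH H. weight_space s W H \<rho> l)" by (rule subsetD[OF equalityD1 subsetD[OF U(2) u]])
  from span_family_sum[OF subs this]
  obtain J f where J: "finite J" "J \<subseteq> dual sH H" "\<forall>l\<in>J. f l \<in> weight_space s W H \<rho> l" "u = (\<Sum>l\<in>J. f l)"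
    by (elim exE conjE) blast
  have sep: "\<exists>h\<in>H. i h \<noteq> j h" if "i \<in> J" "j \<in> J" "i \<noteq> j" for i j
    by (rule dual_ext[OF _ _ that(3)]) (use that J in auto)
  have fJ: "f l \<in> W" "\<And>h. h \<in> H \<Longrightarrow> \<rho> h (f l) = s (l h) (f l)" if "l \<in> J" for l
    using J(3) that by (simp_all add: weight_space_def)
  have "f l \<in> U" if l: "l \<in> J" for l
    by (rule eigen_component[OF vs W lin U(1) stable J(1) fJ sep _ l])
      (simp_all only: u J(4)[symmetric])
  then show ?thesis by (intro exI[of _ J] exI[of _ f] conjI J ballI IntI) (use J(3) in simp_all)
qed

text \<open>Independence is the separation of eigenvectors inside the stable subspace \<open>{0}\<close>, so that only spanning has to be checked.\<close>

lemma direct_sumI: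
  assumes vs: "vector_space s" and W: "module.subspace s W" and lin: "\<And>h. h \<in> H \<Longrightarrow> lin_on s s W (\<rho> h)"
    and span: "W \<subseteq> module.span s (\<Union>l\<in>dual sH H. weight_space s W H \<rho> l)"
  shows "direct_sum s W (dual sH H) (weight_space s W H \<rho>)"
proof -
  interpret vector_space s by (rule vs)
  have z: "\<rho> h 0 = 0" if "h \<in> H" for h
    using lin[OF that] subspace_0[OF W] unfolding lin_on_def by (metis add_cancel_right_right)
  have "f j \<in> {0}" if "finite J" "J \<subseteq> dual sH H" "\<forall>j\<in>J. f j \<in> weight_space s W H \<rho> j" "(\<Sum>j\<in>J. f j) = 0" "j \<in> J" for J f j
  proof -
    have sep: "\<exists>h\<in>H. i h \<noteq> j h" if "i \<in> J" "j \<in> J" "i \<noteq> j" for i j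
      by (rule dual_ext[OF _ _ that(3)]) (use that \<open>J \<subseteq> dual sH H\<close> in auto)
    show ?thesis
      by (rule eigen_component[OF vs W lin, where l="\<lambda>l. l" and J=J])
        (use that sep z in \<open>auto simp: weight_space_def subspace_0\<close>)
  qed
  note indep = this
  have sub: "module.span s (\<Union>l\<in>dual sH H. weight_space s W H \<rho> l) \<subseteq> W"
    by (rule span_minimal[OF _ W]) (auto simp: weight_space_def)
  show ?thesis
    unfolding direct_sum_def
  proof (intro conjI ballI allI impI)
    show "subspace (weight_space s W H \<rho> l)" for l by (rule weight_space_subspace[OF vs W lin])
    show "W = span (\<Union>l\<in>dual sH H. weight_space s W H \<rho> l)" using sub span by (rule equalityI[rotated])
    show "f j = 0" if "finite J \<and> J \<subseteq> dual sH H \<and> (\<forall>j\<in>J. f j \<in> weight_space s W H \<rho> j) \<and> sum f J = 0" "j \<in> J" for J f j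
      using indep[of J f j] that by simp
  qed
qed

text \<open>The bound on the larger space alone would not do, since \<open>dim\<close> is \<open>0\<close> for infinite dimensional spaces.\<close>

lemma fin_dim_subspace:
  assumes vs: "vector_space s" and F: "F \<subseteq> F'" and B: "finite B" "F' \<subseteq> module.span s B" and K: "vector_space.dim s F' \<le> K"
  shows "vector_space.dim s F \<le> K"
proof -
  interpret vector_space s by (rule vs)
  obtain B' where B': "B' \<subseteq> F'" "independent B'" "F' \<subseteq> span B'" "card B' = dim F'"
    using basis_exists by blast
  have "finite B'" using independent_span_bound[OF B(1) B'(2)] B' B by auto
  then have "dim F \<le> card B'" using dim_le_card[of F B'] F B' by auto
  then show ?thesis using B' K by simp
qed

section \<open>Weights of a QP-module\<close>

context qp_mod begin

lemma gen_carr: "gen m n \<alpha> \<in> carr (gdot m n)" by (rule gpart_carr[OF gen_part])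

lemma zd_eq: "zeta_dzeta m n = (\<lambda>k. el m n (zeta k) (m + k)) ` {1..n}"
  by (auto simp: zeta_dzeta_def gen_mult)

lemma zeta_dA [simp, intro]: "k \<in> {1..n} \<Longrightarrow> zeta k \<in> dA m n"
  using dP_dA[OF zeta_dP] by auto

lemma zd_carr: "h \<in> zeta_dzeta m n \<Longrightarrow> h \<in> carr (gdot m n)"
  by (auto simp: zd_eq)

lemma cartan_carr: "cartan m n \<subseteq> carr (gdot m n)"
  unfolding cartan_def by (rule gs.span_minimal[OF _ gcarr_sub]) (use gen_carr zd_carr in auto)

lemma cartan'_sub: "cartan' m n \<subseteq> cartan m n"
  unfolding cartan_def cartan'_def by (rule gs.span_mono) auto

lemma gen_cartan': "i \<le> m \<Longrightarrow> gen m n i \<in> cartan' m n"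
  unfolding cartan'_def by (rule gs.span_base) auto

lemma zd_cartan: "gs.span (zeta_dzeta m n) \<subseteq> cartan m n"
  unfolding cartan_def by (rule gs.span_mono) auto

lemma psi_on_span:
  assumes B: "B \<subseteq> carr (gdot m n)" and U: "vs.subspace U" "U \<subseteq> V"
    and st: "\<And>b u. b \<in> B \<Longrightarrow> u \<in> U \<Longrightarrow> psi M b u \<in> U" and h: "h \<in> gs.span B" and u: "u \<in> U"
  shows "psi M h u \<in> U"
proof -
  have z: "psi M 0 u = 0" if "u \<in> V" for u using left_simps(9)[OF that, of 0] by (simp add: \<psi>_def el_lin)
  have "gs.subspace {h \<in> carr (gdot m n). \<forall>u\<in>U. psi M h u \<in> U}"
    using U psi_lin_left gs.subspace_add[OF gcarr_sub] gs.subspace_scale[OF gcarr_sub] gs.subspace_0[OF gcarr_sub]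
    by (intro gs.subspaceI) (auto simp: lin_on_def z vs.subspace_0 vs.subspace_add vs.subspace_scale subset_iff)
  then have "gs.span B \<subseteq> {h \<in> carr (gdot m n). \<forall>u\<in>U. psi M h u \<in> U}"
    by (rule gs.span_minimal[rotated]) (use B st in auto)
  then show ?thesis using h u by auto
qed

lemma eigen_on_span:
  assumes B: "B \<subseteq> carr (gdot m n)" and v: "v \<in> V" and l: "lin_on g_scale (*) (gs.span B) l"
    and ev: "\<And>b. b \<in> B \<Longrightarrow> psi M b v = sc (l b) v" and h: "h \<in> gs.span B"
  shows "psi M h v = sc (l h) v"
proof -
  have z: "psi M 0 v = 0" using left_simps(9)[OF v, of 0] by (simp add: \<psi>_def el_lin)
  have l0: "l 0 = 0" using l gs.span_zero unfolding lin_on_def by (metis add_cancel_right_right)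
  have c: "gs.span B \<subseteq> carr (gdot m n)" by (rule gs.span_minimal[OF B gcarr_sub])
  have "gs.subspace {h \<in> gs.span B. psi M h v = sc (l h) v}"
  proof (rule gs.subspaceI)
    show "0 \<in> {h \<in> gs.span B. psi M h v = sc (l h) v}" using z l0 gs.span_zero by auto
    show "x + y \<in> {h \<in> gs.span B. psi M h v = sc (l h) v}"
      if "x \<in> {h \<in> gs.span B. psi M h v = sc (l h) v}" "y \<in> {h \<in> gs.span B. psi M h v = sc (l h) v}" for x y
      using that l psi_lin_left[OF v] gs.span_add[of x B y] subsetD[OF c, of x] subsetD[OF c, of y]
      by (simp add: lin_on_def vs.scale_left_distrib del: split_paired_All split_paired_all)
    show "g_scale k x \<in> {h \<in> gs.span B. psi M h v = sc (l h) v}"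
      if "x \<in> {h \<in> gs.span B. psi M h v = sc (l h) v}" for k x
      using that l psi_lin_left[OF v] gs.span_scale[of x B k] subsetD[OF c, of x]
      by (simp add: lin_on_def del: split_paired_All split_paired_all)
  qed
  then have "gs.span B \<subseteq> {h \<in> gs.span B. psi M h v = sc (l h) v}"
    by (rule gs.span_minimal[rotated]) (use ev gs.span_base in auto)
  then show ?thesis using h by auto
qed

lemma psi_parity: "x \<in> part (gdot m n) p \<Longrightarrow> v \<in> part M q \<Longrightarrow> psi M x v \<in> part M (p \<noteq> q)"
  and hphi_parity: "x \<in> part (gdot m n) p \<Longrightarrow> v \<in> part M q \<Longrightarrow> hphi M x v \<in> part M (p \<noteq> q)"
  and \<phi>_parity: "a \<in> dP m n p \<Longrightarrow> v \<in> part M q \<Longrightarrow> \<phi> a v \<in> part M (p \<noteq> q)"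
  using sm unfolding super_map_def by blast+

lemma \<chi>_parity: "v \<in> part M q \<Longrightarrow> \<chi> \<alpha> v \<in> part M ((m < \<alpha>) \<noteq> q)"
  unfolding \<chi>_def by (rule psi_parity[OF gen_part])

lemma \<eta>_parity: "v \<in> part M q \<Longrightarrow> \<eta> \<alpha> v \<in> part M ((m < \<alpha>) \<noteq> q)"
  unfolding \<eta>_def by (rule hphi_parity[OF gen_part])

lemma T_parity: 
  assumes a: "a \<in> dP m n p" and v: "v \<in> part M q"
  shows "T a \<alpha> v \<in> part M (((m < \<alpha>) \<noteq> p) \<noteq> q)"
proof -
  have "\<psi> a \<alpha> v \<in> part M ((p \<noteq> (m < \<alpha>)) \<noteq> q)" unfolding \<psi>_def by (rule psi_parity[OF el_part[OF a] v])
  moreover have "\<phi> a (\<chi> \<alpha> v) \<in> part M (p \<noteq> ((m < \<alpha>) \<noteq> q))" by (rule \<phi>_parity[OF a \<chi>_parity[OF v]])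
  ultimately show ?thesis unfolding T_def
    by (cases p; cases q; cases "m < \<alpha>"; simp add: P_closed)
qed

lemma E_parity: 
  assumes \<alpha>: "\<alpha> \<le> m + n" and v: "v \<in> part M q"
  shows "E \<alpha> \<beta> v \<in> part M (((m < \<alpha>) \<noteq> (m < \<beta>)) \<noteq> q)"
proof (cases "\<alpha> = 0")
  case True
  then show ?thesis using \<eta>_parity[OF v, of \<beta>] by (simp add: E_def P_closed)
next
  case False
  then have \<alpha>: "\<alpha> \<in> {1..m+n}" using \<alpha> by auto
  show ?thesis using False \<phi>_parity[OF gi_dP[OF \<alpha>] T_parity[OF gv_dP[OF \<alpha>] v, of \<beta>]]
    by (cases q; cases "m < \<alpha>"; cases "m < \<beta>"; simp add: E_def)
qed

lemma V_split: "v \<in> V \<Longrightarrow> \<exists>x y. v = x + y \<and> x \<in> part M False \<and> y \<in> part M True"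
  by (auto simp: carr_def)

lemma part_V [intro]: "x \<in> part M p \<Longrightarrow> x \<in> V"
  by (rule part_carr[OF gradedM])

lemma parts_zero:
  assumes "x \<in> part M p" "y \<in> part M (\<not> p)" "x + y = 0"
  shows "x = 0" "y = 0"
proof -
  have "x = - y" using assms by (simp add: eq_neg_iff_add_eq_0)
  then have "x \<in> part M (\<not> p)" using assms P_closed by auto
  then have "x \<in> part M False \<inter> part M True" using assms by (cases p) auto
  then show "x = 0" using superM by (auto simp: is_superspace_def)
  then show "y = 0" using assms by auto
qed

text \<open>The space \<open>N\<close>, described by the eigenvalues of \<open>\<psi>(1), \<psi>(d\<^sub>1), \<dots>, \<psi>(d\<^sub>m)\<close> instead of as a sum of weight spaces.\<close>

definition wt :: "(nat \<Rightarrow> complex) \<Rightarrow> 'v set" where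
  "wt \<mu> = {v \<in> V. \<forall>i\<le>m. \<chi> i v = sc (\<mu> i) v}"

definition Om :: "(nat \<Rightarrow> complex) \<Rightarrow> 'v set" where
  "Om \<mu> = {v \<in> wt \<mu>. \<forall>k\<in>{1..n}. \<chi> (m + k) v = 0}"

lemma wt_V [intro]: "v \<in> wt \<mu> \<Longrightarrow> v \<in> V" and Om_wt [intro]: "v \<in> Om \<mu> \<Longrightarrow> v \<in> wt \<mu>"
  and Om_V [intro]: "v \<in> Om \<mu> \<Longrightarrow> v \<in> V"
  by (auto simp: wt_def Om_def)

lemma Om_iff: "v \<in> Om \<mu> \<longleftrightarrow> v \<in> V \<and> (\<forall>\<alpha>\<le>m+n. \<chi> \<alpha> v = sc (if \<alpha> \<le> m then \<mu> \<alpha> else 0) v)"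
proof -
  have "(\<forall>k\<in>{1..n}. \<chi> (m + k) v = 0) \<longleftrightarrow> (\<forall>\<alpha>\<le>m+n. m < \<alpha> \<longrightarrow> \<chi> \<alpha> v = 0)"
  proof safe
    fix \<alpha> assume "\<forall>k\<in>{1..n}. \<chi> (m + k) v = 0" "\<alpha> \<le> m + n" "m < \<alpha>"
    then have "\<chi> (m + (\<alpha> - m)) v = 0" using odd_index[of \<alpha> m n] by fastforce
    then show "\<chi> \<alpha> v = 0" using \<open>m < \<alpha>\<close> by simp
  qed auto
  then show ?thesis unfolding Om_def wt_def by (auto simp: not_le)
qed

lemma wt_subspace: "vs.subspace (wt \<mu>)"
  by (rule vs.subspaceI) (auto simp: wt_def sc_simps mult.commute)

lemma Om_subspace: "vs.subspace (Om \<mu>)"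
  by (rule vs.subspaceI) (auto simp: Om_iff sc_simps mult.commute)

lemma E_Om: 
  assumes "\<alpha> \<le> m + n" "v \<in> Om \<mu>"
  shows "E \<alpha> \<beta> v \<in> Om \<mu>"
  using assms by (auto simp: Om_iff E_\<chi> mult.commute)

lemma \<chi>_Om: "\<alpha> \<le> m + n \<Longrightarrow> v \<in> Om \<mu> \<Longrightarrow> \<chi> \<alpha> v = sc (if \<alpha> \<le> m then \<mu> \<alpha> else 0) v"
  by (simp add: Om_iff)

text \<open>The defining operators are homogeneous, so they annihilate a vector only if they annihilate its two parts.\<close>

lemma Om_graded: "sub_superspace M (Om \<mu>)"
  unfolding sub_superspace_def
proof (intro conjI equalityI subsetI)
  show "vs.subspace (Om \<mu>)" by (rule Om_subspace)
  fix u assume u: "u \<in> Om \<mu>"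
  then obtain x y where xy: "u = x + y" "x \<in> part M False" "y \<in> part M True" using V_split by blast
  then have V: "x \<in> V" "y \<in> V" by auto
  have *: "\<chi> \<alpha> x = sc (if \<alpha> \<le> m then \<mu> \<alpha> else 0) x \<and> \<chi> \<alpha> y = sc (if \<alpha> \<le> m then \<mu> \<alpha> else 0) y" if \<alpha>: "\<alpha> \<le> m + n" for \<alpha>
  proof (cases "\<alpha> \<le> m")
    case True
    then have p: "\<chi> \<alpha> x - sc (\<mu> \<alpha>) x \<in> part M False" "\<chi> \<alpha> y - sc (\<mu> \<alpha>) y \<in> part M (\<not> False)"
      using \<chi>_parity[OF xy(2), of \<alpha>] \<chi>_parity[OF xy(3), of \<alpha>] xy P_closed by auto
    have "(\<chi> \<alpha> x - sc (\<mu> \<alpha>) x) + (\<chi> \<alpha> y - sc (\<mu> \<alpha>) y) = 0"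
      using \<chi>_Om[OF \<alpha> u] xy V True by (simp add: sc_simps algebra_simps)
    then show ?thesis using parts_zero[OF p] True by simp
  next
    case False
    then have p: "\<chi> \<alpha> x \<in> part M True" "\<chi> \<alpha> y \<in> part M (\<not> True)"
      using \<chi>_parity[OF xy(2), of \<alpha>] \<chi>_parity[OF xy(3), of \<alpha>] by auto
    have "\<chi> \<alpha> x + \<chi> \<alpha> y = 0" using \<chi>_Om[OF \<alpha> u] xy V False by simp
    then show ?thesis using parts_zero[OF p] False by simp
  qed
  then have "x \<in> Om \<mu>" "y \<in> Om \<mu>" using V by (auto simp: Om_iff)
  then show "u \<in> {x + y |x y. x \<in> Om \<mu> \<inter> part M False \<and> y \<in> Om \<mu> \<inter> part M True}" using xy by auto
qed (auto intro: vs.subspace_add[OF Om_subspace])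

lemma \<chi>_wt: "v \<in> wt \<mu> \<Longrightarrow> \<chi> \<alpha> v \<in> wt \<mu>"
  by (auto simp: wt_def \<chi>_\<chi>[of v _ \<alpha>])

lemma \<chi>_sq: "m < \<alpha> \<Longrightarrow> v \<in> V \<Longrightarrow> \<chi> \<alpha> (\<chi> \<alpha> v) = 0"
proof -
  assume a: "m < \<alpha>" "v \<in> V"
  then have "\<chi> \<alpha> (\<chi> \<alpha> v) = - \<chi> \<alpha> (\<chi> \<alpha> v)" using \<chi>_\<chi>[of v \<alpha> \<alpha>] by simp
  then have "sc 2 (\<chi> \<alpha> (\<chi> \<alpha> v)) = 0" by (metis add.right_inverse vs.scale_left_distrib vs.scale_one one_add_one)
  then show ?thesis by (simp add: vs.scale_eq_0_iff)
qed

text \<open>Applying odd derivatives as long as possible leads from a nonzero vector of \<open>N\<close> to one of \<open>\<Omega>\<close>: each of them squares to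
  zero, preserves \<open>N\<close> and does not destroy what the earlier ones achieved, since they anticommute.\<close>

lemma Om_nonzero:
  assumes "wt \<mu> \<noteq> {0}"
  shows "Om \<mu> \<noteq> {0}"
proof -
  have "\<exists>v\<in>wt \<mu>. v \<noteq> 0 \<and> (\<forall>j\<in>{1..k}. \<chi> (m + j) v = 0)" for k
  proof (induction k)
    case 0
    have "0 \<in> wt \<mu>" by (rule vs.subspace_0[OF wt_subspace])
    then show ?case using assms by auto
  next
    case (Suc k)
    then obtain v where v: "v \<in> wt \<mu>" "v \<noteq> 0" "\<forall>j\<in>{1..k}. \<chi> (m + j) v = 0" by auto
    show ?case
    proof (cases "\<chi> (m + Suc k) v = 0")
      case True
      then show ?thesis using v by (intro bexI[of _ v]) (auto simp: le_Suc_eq)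
    next
      case False
      have "\<chi> (m + j) (\<chi> (m + Suc k) v) = 0" if "j \<in> {1..Suc k}" for j
      proof (cases "j = Suc k")
        case True then show ?thesis using \<chi>_sq[of "m + Suc k" v] v by auto
      next
        case False
        then have "\<chi> (m + j) v = 0" using v that by auto
        then show ?thesis using \<chi>_\<chi>[of v "m + j" "m + Suc k"] v by auto
      qed
      then show ?thesis using v False \<chi>_wt by (intro bexI[of _ "\<chi> (m + Suc k) v"]) auto
    qed
  qed
  then show ?thesis unfolding Om_def by blast
qed

end

section \<open>Submodules generated from \<open>\<Omega>\<close>\<close>

lemma tau_remove: "finite I \<Longrightarrow> j \<in> I \<Longrightarrow> tau {j} (I - {j}) = tau {j} I"
  using tau_Un_right[of "{j}" "I - {j}" "{j}"] by (simp add: tau_self insert_absorb)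

lemma pd_mono_even: "i \<in> {1..m} \<Longrightarrow> k \<in> mons {1..m} n \<Longrightarrow>
    pd m n i (mmon k) = lg_scale (of_int (lookup (fst k) i)) (mmon k)"
  by (auto simp: pd_alt dt_single dt_mon_def)

lemma zeta_pd_mono:
  assumes "j \<in> {1..n}" "k \<in> mons {1..m} n"
  shows "zeta j \<star> pd m n (m + j) (mmon k) = (if j \<in> snd k then mmon k else 0)"
proof (cases "j \<in> snd k")
  case True
  obtain r I where k: "k = (r, I)" by (cases k)
  have "insert j I = I" using True k by auto
  then show ?thesis
    using assms True mons_finite[OF assms(2)] tau_remove[of I j]
    by (simp add: pd_alt dzeta_single dzeta_mon_def zeta_def lmono_def lg_mult_single smul_def k flip: power_mult_distrib)
next
  case False
  then show ?thesis using assms by (auto simp: pd_alt dzeta_single dzeta_mon_def)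
qed

lemma mono_dP: "k \<in> mons S n \<Longrightarrow> mmon k \<in> lgP S n (mon_parity k)"
  by (rule single_lgP) auto

lemma mono_dA [simp, intro]: "k \<in> mons S n \<Longrightarrow> mmon k \<in> lgA S n"
  by (rule single_lgA)

context qp_mod begin

text \<open>The diagonal operators that separate the monomials: \<open>\<psi>(d\<^sub>i)\<close> sees the exponent of \<open>t\<^sub>i\<close> and \<open>\<phi>(\<zeta>\<^sub>k) \<psi>(\<partial>\<^sub>k)\<close> sees
  whether \<open>\<zeta>\<^sub>k\<close> occurs.\<close>

definition rho :: "nat \<Rightarrow> 'v \<Rightarrow> 'v" where
  "rho \<alpha> v = (if \<alpha> \<le> m then \<chi> \<alpha> v else \<phi> (zeta (\<alpha> - m)) (\<chi> \<alpha> v))"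

text \<open>The eigenvalue of \<open>rho\<close> on \<open>\<phi>(t\<^sup>r \<zeta>\<^sub>I) u\<close> for \<open>u \<in> \<Omega>\<close>.\<close>

definition evl :: "(nat \<Rightarrow> complex) \<Rightarrow> mon \<Rightarrow> nat \<Rightarrow> complex" where
  "evl \<mu> k \<alpha> = (if \<alpha> \<le> m then \<mu> \<alpha> + of_int (lookup (fst k) \<alpha>) else if \<alpha> - m \<in> snd k then 1 else 0)"

lemma rho_lin: "\<alpha> \<in> {1..m+n} \<Longrightarrow> lin_on sc sc V (rho \<alpha>)"
  using odd_index[of \<alpha> m n] by (cases "\<alpha> \<le> m") (auto simp: lin_on_def rho_def)

lemma rho_mono:
  assumes \<alpha>: "\<alpha> \<in> {1..m+n}" and k: "k \<in> mons {1..m} n" and u: "u \<in> Om \<mu>"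
  shows "rho \<alpha> (\<phi> (mmon k) u) = sc (evl \<mu> k \<alpha>) (\<phi> (mmon k) u)"
proof -
  have uV: "u \<in> V" using u by auto
  have kA: "mmon k \<in> dA m n" using k by simp
  have 1: "\<chi> \<alpha> (\<phi> (mmon k) u) = sc (ksign (m < \<alpha>) (mon_parity k)) (\<phi> (mmon k) (\<chi> \<alpha> u)) + \<phi> (pd m n \<alpha> (mmon k)) u"
    by (rule \<chi>_\<phi>[OF mono_dP[OF k] uV])
  show ?thesis
  proof (cases "\<alpha> \<le> m")
    case True
    then show ?thesis using \<alpha> uV kA k
      by (simp add: rho_def 1 \<chi>_Om[OF _ u] evl_def pd_mono_even vs.scale_left_distrib del: lg_scale_single)
  next
    case False
    then have j: "\<alpha> - m \<in> {1..n}" using odd_index \<alpha> by blast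
    have "\<phi> (zeta (\<alpha> - m)) (\<phi> (pd m n \<alpha> (mmon k)) u) = \<phi> (if \<alpha> - m \<in> snd k then mmon k else 0) u"
      using zeta_pd_mono[OF j k] False j uV \<phi>_mult[of "zeta (\<alpha> - m)" "pd m n \<alpha> (mmon k)" u] by simp
    then show ?thesis using False j uV kA \<alpha> by (auto simp: rho_def 1 \<chi>_Om[OF _ u] evl_def)
  qed
qed

lemma evl_sep:
  assumes "k \<in> mons {1..m} n" "l \<in> mons {1..m} n" "k \<noteq> l"
  shows "\<exists>\<alpha>\<in>{1..m+n}. evl \<mu> k \<alpha> \<noteq> evl \<mu> l \<alpha>"
proof -
  have lk: "lookup (fst q) i = 0" if "q \<in> mons {1..m} n" "i \<notin> {1..m}" for q i
    using that by (auto simp: mons_def in_keys_iff subset_iff)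
  consider "fst k \<noteq> fst l" | "snd k \<noteq> snd l" using assms(3) by (auto simp: prod_eq_iff)
  then show ?thesis
  proof cases
    case 1
    then obtain i where i: "lookup (fst k) i \<noteq> lookup (fst l) i" by (meson poly_mapping_eqI)
    then have "i \<in> {1..m}" using lk assms by metis
    then show ?thesis using i by (intro bexI[of _ i]) (auto simp: evl_def)
  next
    case 2
    then obtain j where j: "(j \<in> snd k) \<noteq> (j \<in> snd l)" by blast
    then have "j \<in> {1..n}" using assms by (auto simp: mons_def)
    then show ?thesis using j by (intro bexI[of _ "m + j"]) (auto simp: evl_def)
  qed
qed

lemma rho_wt: "\<alpha> \<in> {1..m+n} \<Longrightarrow> v \<in> wt \<mu> \<Longrightarrow> rho \<alpha> v \<in> wt \<mu>"
proof (cases "\<alpha> \<le> m")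
  case False
  assume a: "\<alpha> \<in> {1..m+n}" "v \<in> wt \<mu>"
  then have j: "\<alpha> - m \<in> {1..n}" using False odd_index by blast
  have "\<chi> i (\<phi> (zeta (\<alpha> - m)) w) = \<phi> (zeta (\<alpha> - m)) (\<chi> i w)" if "i \<le> m" "w \<in> V" for i w
    using \<chi>_\<phi>[OF zeta_dP[OF j] that(2), of i] that j by (simp add: pd_zeta)
  then show ?thesis using False \<chi>_wt[OF a(2), of \<alpha>] j unfolding wt_def rho_def by auto
qed (simp add: rho_def \<chi>_wt)

lemma rho_Om: "\<alpha> \<in> {1..m+n} \<Longrightarrow> v \<in> Om \<mu> \<Longrightarrow> rho \<alpha> v \<in> Om \<mu>"
  using odd_index[of \<alpha> m n] vs.subspace_scale[OF Om_subspace] vs.subspace_0[OF Om_subspace]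
  by (cases "\<alpha> \<le> m") (auto simp: rho_def \<chi>_Om)

text \<open>Odd derivatives strip off the factors \<open>\<zeta>\<^sub>j\<close> one by one, and the remaining \<open>t\<^sup>r\<close> is invertible.\<close>

lemma \<phi>_mono_inj:
  assumes k: "k \<in> mons {1..m} n" and u: "u \<in> Om \<mu>" and 0: "\<phi> (mmon k) u = 0"
  shows "u = 0"
proof -
  obtain r I where kk: "k = (r, I)" by (cases k)
  have r: "keys r \<subseteq> {1..m}" and I: "I \<subseteq> {1..n}" using k kk by (auto simp: mons_def)
  have uV: "u \<in> V" using u by auto
  have "finite I" using I finite_subset by blast
  then have "\<phi> (mmon (r, {})) u = 0" using I 0[unfolded kk]
  proof (induction I rule: finite_induct)
    case (insert j I)
    have kI: "(r, insert j I) \<in> mons {1..m} n" "(r, I) \<in> mons {1..m} n" using r insert by (auto simp: mons_def)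
    have "\<chi> (m + j) (\<phi> (mmon (r, insert j I)) u) = 0" using insert by simp
    moreover have "\<chi> (m + j) u = 0" using u insert by (auto simp: Om_def)
    moreover have "pd m n (m + j) (mmon (r, insert j I)) = lg_scale ((-1) ^ tau {j} (insert j I)) (mmon (r, I))"
      using kI insert by (simp add: pd_alt dzeta_single dzeta_mon_def)
    ultimately have "sc ((-1) ^ tau {j} (insert j I)) (\<phi> (mmon (r, I)) u) = 0"
      using \<chi>_\<phi>[OF mono_dP[OF kI(1)] uV, of "m + j"] kI uV by (simp del: lg_scale_single)
    then have "\<phi> (mmon (r, I)) u = 0" by (simp add: vs.scale_eq_0_iff)
    then show ?case using insert by simp
  qed simp
  moreover have m: "(r, {}) \<in> mons {1..m} n" "(-r, {}) \<in> mons {1..m} n" using r by (auto simp: mons_def)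
  moreover have "mmon (-r, {}) \<star> mmon (r, {}) = lg_one" by (simp add: lg_mult_single smul_def lg_one_def lmono_def)
  ultimately show ?thesis using \<phi>_mult[OF mono_dA[OF m(2)] mono_dA[OF m(1)] uV] uV by simp
qed

text \<open>The image of the tensor product of the algebra with \<open>U\<close>.\<close>

definition gspan :: "'v set \<Rightarrow> 'v set" where
  "gspan U = vs.span (\<Union>k\<in>mons {1..m} n. \<phi> (mmon k) ` U)"

lemma gspan_V: "U \<subseteq> V \<Longrightarrow> gspan U \<subseteq> V"
  unfolding gspan_def by (rule vs.span_minimal[OF _ V_sub]) auto

lemma gspan_gen:
  assumes "U \<subseteq> V" "a \<in> dA m n" "u \<in> U"
  shows "\<phi> a u \<in> gspan U"
proof -
  have uV: "u \<in> V" using assms by auto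
  have k: "k \<in> mons {1..m} n" if "k \<in> keys a" for k using assms(2) that by (auto simp: lgA_iff)
  have "\<phi> a u = \<phi> (\<Sum>k\<in>keys a. lg_scale (lookup a k) (mmon k)) u" by (subst lg_expand) simp
  also have "\<dots> = (\<Sum>k\<in>keys a. sc (lookup a k) (\<phi> (mmon k) u))"
    using uV k by (subst left_simps) (auto intro!: sum.cong simp del: lg_scale_single)
  also have "\<dots> \<in> gspan U" unfolding gspan_def
    using k assms by (intro vs.span_sum vs.span_scale vs.span_base) auto
  finally show ?thesis .
qed

lemma gspan_op:
  assumes U: "U \<subseteq> V" and f: "lin_on sc sc V f"
    and g: "\<And>k u. k \<in> mons {1..m} n \<Longrightarrow> u \<in> U \<Longrightarrow> f (\<phi> (mmon k) u) \<in> gspan U"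
    and v: "v \<in> gspan U"
  shows "f v \<in> gspan U"
proof -
  have s: "vs.subspace {v \<in> V. f v \<in> gspan U}"
    using lin_on_simps(1,2,5)[OF f] unfolding gspan_def
    by (intro vs.subspaceI) (auto simp: vs.span_zero vs.span_add vs.span_scale)
  have "gspan U \<subseteq> {v \<in> V. f v \<in> gspan U}"
    by (subst gspan_def, rule vs.span_minimal[OF _ s]) (use U g in auto)
  then show ?thesis using v by auto
qed

lemma psi_expand:
  assumes x: "x \<in> carr (gdot m n)" and v: "v \<in> V" and W: "vs.subspace W"
    and h: "\<And>a \<alpha> p. a \<in> dP m n p \<Longrightarrow> \<alpha> \<le> m + n \<Longrightarrow> f (el m n a \<alpha>) v \<in> W"
    and f: "f = psi M \<or> f = hphi M"
  shows "f x v \<in> W"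
proof -
  have l: "lin_on g_scale sc (carr (gdot m n)) (\<lambda>x. f x v)" using f psi_lin_left[OF v] hphi_lin_left[OF v] by auto
  have *: "f x v \<in> W" if x: "x \<in> part (gdot m n) p" for x p
  proof -
    have "f x v = f (\<Sum>\<alpha>\<le>m+n. el m n (g_coord m x \<alpha>) \<alpha>) v" using g_expand[OF x] by simp
    also have "\<dots> = (\<Sum>\<alpha>\<le>m+n. f (el m n (g_coord m x \<alpha>) \<alpha>) v)"
      by (rule lin_on_sum[OF l gs.vector_space_axioms vs.vector_space_axioms gcarr_sub])
        (use dP_dA[OF g_coord_dP[OF x]] in auto)
    also have "\<dots> \<in> W" using h g_coord_dP[OF x] by (intro vs.subspace_sum[OF W]) auto
    finally show ?thesis .
  qed
  obtain x0 x1 where "x = x0 + x1" "x0 \<in> part (gdot m n) False" "x1 \<in> part (gdot m n) True"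
    using x by (auto simp: carr_def)
  moreover from this have "f x v = f x0 v + f x1 v" using l gpart_carr unfolding lin_on_def by blast
  ultimately show ?thesis using * vs.subspace_add[OF W] by auto
qed

definition E_stable :: "'v set \<Rightarrow> bool" where
  "E_stable U \<longleftrightarrow> (\<forall>\<alpha>\<le>m+n. \<forall>\<beta>\<le>m+n. \<forall>u\<in>U. E \<alpha> \<beta> u \<in> U)"

text \<open>The operators \<open>E\<^sub>\<alpha>\<^sub>\<beta>\<close> supercommute with \<open>\<phi>(t\<^sup>r \<zeta>\<^sub>I)\<close>, and \<open>\<psi>(\<partial>\<^sub>\<alpha>)\<close> does so up to \<open>\<phi>(\<partial>\<^sub>\<alpha>(t\<^sup>r \<zeta>\<^sub>I))\<close>, so they
  preserve the span. By the structure formula they yield, together with the \<open>\<phi>(a)\<close>, all \<open>\<psi>(x)\<close> and all values of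
  \<open>\<phi>\<close>-hat.\<close>

lemma gspan_submodule:
  assumes U: "U \<subseteq> Om \<mu>" "sub_superspace M U" "E_stable U"
  shows "qp_submodule m n M (gspan U)"
proof -
  have UV: "U \<subseteq> V" using U by auto
  note SV = gspan_V[OF UV] and gg = gspan_gen[OF UV]
  have Us: "vs.subspace U" using U by (simp add: sub_superspace_def)
  have S: "vs.subspace (gspan U)" unfolding gspan_def by (rule vs.subspace_span)
  note Sc = vs.subspace_add[OF S] vs.subspace_scale[OF S] vs.subspace_neg[OF S] vs.subspace_diff[OF S] vs.subspace_0[OF S]
  have phi: "\<phi> a v \<in> gspan U" if a: "a \<in> dA m n" and v: "v \<in> gspan U" for a v
    by (rule gspan_op[OF UV \<phi>_lin[OF a] _ v]) (use gg a UV \<phi>_mult[OF a, symmetric] in auto)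
  have EU: "E \<alpha> \<beta> u \<in> U" if "\<alpha> \<le> m + n" "\<beta> \<le> m + n" "u \<in> U" for \<alpha> \<beta> u
    using U that by (auto simp: E_stable_def)
  have E: "E \<alpha> \<beta> v \<in> gspan U" if "\<alpha> \<le> m + n" "\<beta> \<le> m + n" "v \<in> gspan U" for \<alpha> \<beta> v
  proof (rule gspan_op[OF UV E_lin[OF that(1)] _ that(3)])
    fix k u assume k: "k \<in> mons {1..m} n" and u: "u \<in> U"
    then have "u \<in> V" using UV by auto
    then show "E \<alpha> \<beta> (\<phi> (mmon k) u) \<in> gspan U"
      unfolding E_\<phi>[OF that(1) mono_dP[OF k] \<open>u \<in> V\<close>]
      by (intro Sc(2) gg mono_dA[OF k] EU[OF that(1,2) u])
  qed
  have eta: "\<eta> \<alpha> v \<in> gspan U" if "\<alpha> \<le> m + n" "v \<in> gspan U" for \<alpha> v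
    using E[of 0 \<alpha> v] that Sc(3)[of "E 0 \<alpha> v"] by (simp add: E_def)
  have chi: "\<chi> \<alpha> v \<in> gspan U" if \<alpha>: "\<alpha> \<le> m + n" and v: "v \<in> gspan U" for \<alpha> v
  proof (rule gspan_op[OF UV \<chi>_lin _ v])
    fix k u assume k: "k \<in> mons {1..m} n" and u: "u \<in> U"
    have "\<chi> \<alpha> u \<in> U" using \<chi>_Om[OF \<alpha>, of u \<mu>] U(1) u vs.subspace_scale[OF Us] by auto
    then show "\<chi> \<alpha> (\<phi> (mmon k) u) \<in> gspan U"
      unfolding \<chi>_\<phi>[OF mono_dP[OF k] subsetD[OF UV u]]
      by (intro Sc(1,2) gg mono_dA[OF k] pd_in u)
  qed
  have psi1: "\<psi> a \<alpha> v \<in> gspan U" if "a \<in> dP m n p" "\<alpha> \<le> m + n" "v \<in> gspan U" for a \<alpha> v p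
    unfolding \<psi>_formula[OF that(1) subsetD[OF SV that(3)]]
    using that(2) by (intro Sc(1,2) phi chi E vs.subspace_sum[OF S] dP_dA[OF that(1)] that(2,3) pd_in) auto
  have psi: "psi M x v \<in> gspan U" if "x \<in> carr (gdot m n)" "v \<in> gspan U" for x v
    by (rule psi_expand[OF that(1) _ S]) (use psi1 that SV in \<open>auto simp: \<psi>_def\<close>)
  have hphi: "hphi M x v \<in> gspan U" if "x \<in> carr (gdot m n)" "v \<in> gspan U" for x v
    by (rule psi_expand[OF that(1) _ S]) (use phi eta that SV dP_dA in \<open>auto simp: hphi_el\<close>)
  \<comment> \<open>the sum of the homogeneous parts of the span contains its generators, as \<open>U\<close> is graded\<close>
  let ?D = "{x + y |x y. x \<in> gspan U \<inter> part M False \<and> y \<in> gspan U \<inter> part M True}"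
  have D: "vs.subspace ?D"
    by (rule vs.subspace_sums[OF vs.subspace_inter[OF S P_sub] vs.subspace_inter[OF S P_sub]])
  have "gspan U \<subseteq> ?D"
  proof (subst gspan_def, rule vs.span_minimal[OF _ D], safe)
    fix r I u assume k: "(r, I) \<in> mons {1..m} n" and u: "u \<in> U"
    let ?k = "(r, I)"
    obtain x y where xy: "u = x + y" "x \<in> U" "x \<in> part M False" "y \<in> U" "y \<in> part M True"
      using U(2) u unfolding sub_superspace_def by blast
    have "\<phi> (mmon ?k) u = \<phi> (mmon ?k) x + \<phi> (mmon ?k) y" using xy k UV by (auto simp: subset_iff)
    moreover have "\<phi> (mmon ?k) x \<in> gspan U" "\<phi> (mmon ?k) y \<in> gspan U" using gg k xy by auto
    moreover have "\<phi> (mmon ?k) x \<in> part M (mon_parity ?k \<noteq> False)" "\<phi> (mmon ?k) y \<in> part M (mon_parity ?k \<noteq> True)"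
      using \<phi>_parity[OF mono_dP[OF k]] xy by blast+
    ultimately show "\<exists>x y. \<phi> (mmon ?k) u = x + y \<and> x \<in> gspan U \<inter> part M False \<and> y \<in> gspan U \<inter> part M True"
      by (cases "mon_parity ?k")
       (force intro: exI[of _ "\<phi> (mmon ?k) x"] exI[of _ "\<phi> (mmon ?k) y"] simp: add.commute)+
  qed
  moreover have "?D \<subseteq> gspan U" using Sc by auto
  ultimately have "sub_superspace M (gspan U)" using S unfolding sub_superspace_def by auto
  then show ?thesis unfolding qp_submodule_def using phi psi hphi by auto
qed

end

locale simple_qp_mod = qp_mod m n M for m n :: nat and M :: "('v::ab_group_add) qp_data" +
  assumes simple: "qp_simple m n M"
begin

lemma gspan_all:
  assumes U: "U \<subseteq> Om \<mu>" "sub_superspace M U" "E_stable U" "U \<noteq> {0}"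
  shows "gspan U = V"
proof -
  have UV: "U \<subseteq> V" using U by auto
  have "0 \<in> U" using U(2) vs.subspace_0 by (auto simp: sub_superspace_def)
  then obtain u where u: "u \<in> U" "u \<noteq> 0" using U(4) by auto
  have "\<phi> lg_one u \<in> gspan U" using gspan_gen[OF UV _ u(1)] by simp
  then have "gspan U \<noteq> {0}" using u UV by auto
  then show ?thesis using gspan_submodule[OF U(1-3)] simple by (auto simp: qp_simple_def)
qed

lemma Om_expand:
  assumes U: "U \<subseteq> Om \<mu>" "sub_superspace M U" "E_stable U" "U \<noteq> {0}" and v: "v \<in> V"
  shows "\<exists>K u. finite K \<and> K \<subseteq> mons {1..m} n \<and> (\<forall>k\<in>K. u k \<in> U) \<and> v = (\<Sum>k\<in>K. \<phi> (mmon k) (u k))"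
proof -
  have UV: "U \<subseteq> V" using U by auto
  have Us: "vs.subspace U" using U by (simp add: sub_superspace_def)
  have sub: "vs.subspace (\<phi> (mmon k) ` U)" if k: "k \<in> mons {1..m} n" for k
  proof (rule vs.subspaceI)
    have kA: "mmon k \<in> dA m n" using k by simp
    show "0 \<in> \<phi> (mmon k) ` U" using vs.subspace_0[OF Us] kA by (auto intro!: image_eqI[of _ _ 0])
    show "x + y \<in> \<phi> (mmon k) ` U" if xy: "x \<in> \<phi> (mmon k) ` U" "y \<in> \<phi> (mmon k) ` U" for x y
    proof -
      obtain a b where "x = \<phi> (mmon k) a" "y = \<phi> (mmon k) b" "a \<in> U" "b \<in> U" using xy by blast
      then show ?thesis using vs.subspace_add[OF Us] kA subsetD[OF UV, of a] subsetD[OF UV, of b]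
        by (intro image_eqI[of _ _ "a + b"]) auto
    qed
    show "sc c x \<in> \<phi> (mmon k) ` U" if x: "x \<in> \<phi> (mmon k) ` U" for x c
    proof -
      obtain a where "x = \<phi> (mmon k) a" "a \<in> U" using x by blast
      then show ?thesis using vs.subspace_scale[OF Us] kA subsetD[OF UV, of a]
        by (intro image_eqI[of _ _ "sc c a"]) auto
    qed
  qed
  have "v \<in> vs.span (\<Union>k\<in>mons {1..m} n. \<phi> (mmon k) ` U)" using gspan_all[OF U] v by (simp add: gspan_def)
  from vs.span_family_sum[OF sub this]
  obtain K f where K: "finite K" "K \<subseteq> mons {1..m} n" "\<forall>k\<in>K. f k \<in> \<phi> (mmon k) ` U" "v = (\<Sum>k\<in>K. f k)" by auto
  then have "\<forall>k\<in>K. \<exists>u\<in>U. f k = \<phi> (mmon k) u" by auto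
  then obtain u where u: "\<forall>k\<in>K. u k \<in> U \<and> f k = \<phi> (mmon k) (u k)" by metis
  then have v': "v = (\<Sum>k\<in>K. \<phi> (mmon k) (u k))" using K by simp
  show ?thesis by (intro exI[of _ K] exI[of _ u] conjI K(1,2) v') (use u in auto)
qed

text \<open>For \<open>W = {0}\<close> this gives uniqueness of the expansion, for \<open>W = N\<close> and \<open>W = \<Omega>\<close> it tells which monomials occur.\<close>

lemma mono_sum_component:
  assumes K: "finite K" "K \<subseteq> mons {1..m} n" and u: "\<forall>k\<in>K. u k \<in> Om \<mu>"
    and W: "vs.subspace W" "\<And>\<alpha> w. \<alpha> \<in> {1..m+n} \<Longrightarrow> w \<in> W \<Longrightarrow> rho \<alpha> w \<in> W"
    and s: "(\<Sum>k\<in>K. \<phi> (mmon k) (u k)) \<in> W" and k: "k \<in> K"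
  shows "\<phi> (mmon k) (u k) \<in> W"
proof (rule eigen_component[OF vs.vector_space_axioms V_sub rho_lin W K(1) _ _ _ s k, where l="evl \<mu>"])
  show "\<phi> (mmon j) (u j) \<in> V" if "j \<in> K" for j
    using that K u by (intro \<phi>_V mono_dA) auto
  show "rho h (\<phi> (mmon j) (u j)) = sc (evl \<mu> j h) (\<phi> (mmon j) (u j))" if "j \<in> K" "h \<in> {1..m+n}" for j h
    by (rule rho_mono[OF that(2)]) (use that K u in auto)
  show "\<exists>h\<in>{1..m+n}. evl \<mu> i h \<noteq> evl \<mu> j h" if "i \<in> K" "j \<in> K" "i \<noteq> j" for i j
    by (rule evl_sep[OF _ _ that(3)]) (use that K in auto)
qed

text \<open>In the expansion of a vector of \<open>N\<close> each nonzero component lies in \<open>N\<close>, so its eigenvalues under the \<open>\<psi>(d\<^sub>i)\<close> leave only the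
  exponent \<open>r = 0\<close>.\<close>

lemma wt_expand:
  assumes U: "U \<subseteq> Om \<mu>" "sub_superspace M U" "E_stable U" "U \<noteq> {0}"
  shows "vs.span {\<phi> (lmono 0 I) u |I u. I \<subseteq> {1..n} \<and> u \<in> U} = wt \<mu>"
proof
  have lm: "lmono 0 I = mmon (0, I)" "(0, I) \<in> mons {1..m} n" if "I \<subseteq> {1..n}" for I
    using that by (auto simp: lmono_def mons_def)
  have wt_iff: "\<chi> i (\<phi> (lmono 0 I) u) = sc (\<mu> i) (\<phi> (lmono 0 I) u)" if "i \<le> m" "u \<in> U" "I \<subseteq> {1..n}" for i u I
  proof -
    have "pd m n i (mmon (0, I)) = 0"
      using that lm(2)[OF that(3)] pd_mono_even[of i m "(0, I)" n] by (cases "i = 0") (auto simp: pd_alt)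
    then show ?thesis
      using that U(1) lm[OF that(3)] \<chi>_\<phi>[OF mono_dP[OF lm(2)[OF that(3)]], of u i] \<chi>_Om[of i u \<mu>] Om_V[of u \<mu>] by auto
  qed
  show "vs.span {\<phi> (lmono 0 I) u |I u. I \<subseteq> {1..n} \<and> u \<in> U} \<subseteq> wt \<mu>"
  proof (rule vs.span_minimal[OF _ wt_subspace], safe)
    fix I u assume I: "I \<subseteq> {1..n}" and u: "u \<in> U"
    have "\<phi> (lmono 0 I) u \<in> V" using lm[OF I] subsetD[OF U(1) u] by auto
    then show "\<phi> (lmono 0 I) u \<in> wt \<mu>" using wt_iff[OF _ u I] by (simp add: wt_def)
  qed
  show "wt \<mu> \<subseteq> vs.span {\<phi> (lmono 0 I) u |I u. I \<subseteq> {1..n} \<and> u \<in> U}"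
  proof
    fix v assume v: "v \<in> wt \<mu>"
    then obtain K u where K: "finite K" "K \<subseteq> mons {1..m} n" "\<forall>k\<in>K. u k \<in> U" "v = (\<Sum>k\<in>K. \<phi> (mmon k) (u k))"
      using Om_expand[OF U, of v] by auto
    have "\<phi> (mmon k) (u k) \<in> vs.span {\<phi> (lmono 0 I) u |I u. I \<subseteq> {1..n} \<and> u \<in> U}" if k: "k \<in> K" for k
    proof (cases "\<phi> (mmon k) (u k) = 0")
      case True then show ?thesis using vs.span_zero by simp
    next
      case False
      have uk: "u k \<in> Om \<mu>" and km: "k \<in> mons {1..m} n" using K U(1) k by auto
      have w: "\<phi> (mmon k) (u k) \<in> wt \<mu>"
        by (rule mono_sum_component[OF K(1,2) _ wt_subspace rho_wt _ k, of _ \<mu>]) (use K U(1) v in auto)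
      have "lookup (fst k) i = 0" if "i \<in> {1..m}" for i
      proof -
        have "sc (evl \<mu> k i) (\<phi> (mmon k) (u k)) = sc (\<mu> i) (\<phi> (mmon k) (u k))"
          using rho_mono[OF _ km uk, of i] w that by (auto simp: rho_def wt_def)
        then have "evl \<mu> k i = \<mu> i" using False by (simp only: vs.scale_cancel_right) simp
        then show ?thesis using that by (simp add: evl_def)
      qed
      moreover have "lookup (fst k) i = 0" if "i \<notin> {1..m}" for i
        using km that by (auto simp: mons_def in_keys_iff subset_iff)
      ultimately have "fst k = 0" by (metis lookup_zero poly_mapping_eqI)
      then have "mmon k = lmono 0 (snd k)" by (metis lmono_def prod.collapse)
      moreover have "snd k \<subseteq> {1..n}" using km by (auto simp: mons_def)
      ultimately show ?thesis using K(3) k by (intro vs.span_base) auto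
    qed
    then show "v \<in> vs.span {\<phi> (lmono 0 I) u |I u. I \<subseteq> {1..n} \<and> u \<in> U}"
      unfolding K(4) by (rule vs.span_sum)
  qed
qed

lemma all_expand:
  assumes U: "U \<subseteq> Om \<mu>" "sub_superspace M U" "E_stable U" "U \<noteq> {0}"
  shows "vs.span {\<phi> a u |a u. a \<in> dA m n \<and> u \<in> U} = V"
proof
  show "vs.span {\<phi> a u |a u. a \<in> dA m n \<and> u \<in> U} \<subseteq> V"
    by (rule vs.span_minimal[OF _ V_sub]) (use U(1) in auto)
  have "gspan U \<subseteq> vs.span {\<phi> a u |a u. a \<in> dA m n \<and> u \<in> U}"
    unfolding gspan_def by (rule vs.span_mono) auto
  then show "V \<subseteq> vs.span {\<phi> a u |a u. a \<in> dA m n \<and> u \<in> U}" using gspan_all[OF U] by simp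
qed

text \<open>In the expansion of a vector of \<open>\<Omega>\<close> over \<open>U\<close> each nonzero component lies in \<open>\<Omega>\<close>, where \<open>rho\<close> has the eigenvalues of the monomial
  \<open>1\<close>. So only this monomial occurs, and the vector lies in \<open>U\<close>.\<close>

lemma Om_simple:
  assumes U: "U \<subseteq> Om \<mu>" "sub_superspace M U" "E_stable U" "U \<noteq> {0}"
  shows "U = Om \<mu>"
proof
  show "Om \<mu> \<subseteq> U"
  proof
    fix v assume v: "v \<in> Om \<mu>"
    then obtain K u where K: "finite K" "K \<subseteq> mons {1..m} n" "\<forall>k\<in>K. u k \<in> U" "v = (\<Sum>k\<in>K. \<phi> (mmon k) (u k))"
      using Om_expand[OF U, of v] by auto
    have Us: "vs.subspace U" using U by (simp add: sub_superspace_def)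
    have "\<phi> (mmon k) (u k) \<in> U" if k: "k \<in> K" for k
    proof (cases "\<phi> (mmon k) (u k) = 0")
      case True then show ?thesis using vs.subspace_0[OF Us] by simp
    next
      case False
      have uk: "u k \<in> Om \<mu>" and km: "k \<in> mons {1..m} n" using K U(1) k by auto
      have w: "\<phi> (mmon k) (u k) \<in> Om \<mu>"
        by (rule mono_sum_component[OF K(1,2) _ Om_subspace rho_Om _ k, of _ \<mu>]) (use K U(1) v in auto)
      have "(0, {}) \<in> mons {1..m} n" by (auto simp: mons_def)
      moreover have "evl \<mu> k \<alpha> = evl \<mu> (0, {}) \<alpha>" if \<alpha>: "\<alpha> \<in> {1..m+n}" for \<alpha>
      proof -
        have "rho \<alpha> (\<phi> (mmon k) (u k)) = sc (evl \<mu> (0, {}) \<alpha>) (\<phi> (mmon k) (u k))"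
          using w \<alpha> \<chi>_Om[OF _ w, of \<alpha>] odd_index[of \<alpha> m n] by (cases "\<alpha> \<le> m") (auto simp: rho_def evl_def)
        then show ?thesis using rho_mono[OF \<alpha> km uk] False by (simp add: vs.scale_cancel_right)
      qed
      ultimately have "k = (0, {})" using evl_sep[OF km] by blast
      then have "mmon k = lg_one" by (simp add: lg_one_def lmono_def)
      then show ?thesis using K k Om_V[OF uk] by auto
    qed
    then show "v \<in> U" unfolding K(4) by (rule vs.subspace_sum[OF Us])
  qed
qed (rule U)

lemma mono_sum_inj:
  assumes K: "finite K" "K \<subseteq> mons {1..m} n" and u: "\<forall>k\<in>K. u k \<in> Om \<mu>"
    and s: "(\<Sum>k\<in>K. \<phi> (mmon k) (u k)) = 0" and k: "k \<in> K"
  shows "u k = 0"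
proof -
  have "\<phi> (mmon k) (u k) \<in> {0}"
    by (rule mono_sum_component[OF K u _ _ _ k]) (use s in \<open>auto simp: vs.subspace_0 lin_on_simps(5)[OF rho_lin]\<close>)
  then show ?thesis using \<phi>_mono_inj[of k "u k" \<mu>] K u k by auto
qed

end

section \<open>The action of \<open>\<T>\<close>\<close>

subsection \<open>Signed sums over subsets\<close>

lemma sum_Pow_insert:
  assumes "finite J" "j \<notin> J"
  shows "(\<Sum>I\<in>Pow (insert j J). g I) = (\<Sum>I\<in>Pow J. g I + g (insert j I))"
proof -
  have "Pow J \<inter> insert j ` Pow J = {}" using assms by auto
  moreover have "inj_on (insert j) (Pow J)" using assms by (auto simp: inj_on_def)
  ultimately show ?thesis using assms
    by (simp add: Pow_insert sum.union_disjoint sum.reindex sum.distrib)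
qed

text \<open>The pairs \<open>I\<close>, \<open>I \<union> {j}\<close> cancel.\<close>

lemma alternating_Pow: "finite J \<Longrightarrow> (\<Sum>I\<in>Pow J. (-1) ^ card I) = (if J = {} then 1 else 0 :: complex)"
proof (cases "J = {}")
  case False
  assume f: "finite J"
  obtain j where "j \<in> J" using False by auto
  then have J: "J = insert j (J - {j})" by auto
  have "(\<Sum>I\<in>Pow J. (-1) ^ card I) = (\<Sum>I\<in>Pow (J - {j}). (-1) ^ card I + (-1) ^ card (insert j I) :: complex)"
    by (subst J, rule sum_Pow_insert) (use f in auto)
  also have "\<dots> = 0"
  proof (rule sum.neutral, safe)
    fix I assume I: "I \<subseteq> J - {j}"
    then have "card (insert j I) = Suc (card I)" using f by (subst card_insert_disjoint) (auto intro: finite_subset)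
    then show "(-1) ^ card I + (-1) ^ card (insert j I) = (0::complex)" by simp
  qed
  finally show ?thesis using False by simp
qed simp

subsection \<open>Coefficients of derivations of \<open>A\<close>\<close>

lemma tcoeff_lext: "tcoeff r = lext (\<lambda>k. if lookup (fst k) 0 = r
    then single (fst k - single 0 r, snd k) 1 else 0)"
proof
  fix f show "tcoeff r f = lext (\<lambda>k. if lookup (fst k) 0 = r
    then single (fst k - single 0 r, snd k) 1 else 0) f"
    unfolding tcoeff_def lext_def
    by (rule sum.mono_neutral_cong_left) (auto split: prod.splits)
qed

lemma lin_tcoeff: "lin (tcoeff r)" by (simp add: tcoeff_lext lin_lext)

lemma lin_tcoeff' [lin_intros]: "lin f \<Longrightarrow> lin (\<lambda>x. tcoeff r (f x))"
  by (rule lin_comp[OF lin_tcoeff])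

lemma tcoeff_single: "tcoeff s (single k c) =
    (if lookup (fst k) 0 = s then single (fst k - single 0 s, snd k) c else 0)"
  by (simp add: tcoeff_lext)

text \<open>The exponent vector with its \<open>t\<^sub>0\<close>-part removed.\<close>

definition red :: "(nat \<Rightarrow>\<^sub>0 int) \<Rightarrow> (nat \<Rightarrow>\<^sub>0 int)" where
  "red r = r - single 0 (lookup r 0)"

lemma lookup_red: "lookup (red r) i = (if i = 0 then 0 else lookup r i)"
  by (simp add: red_def lookup_minus lookup_single when_def)

lemma red_keys: "keys r \<subseteq> {0..m} \<Longrightarrow> keys (red r) \<subseteq> {1..m}"
  by (auto simp: in_keys_iff lookup_red subset_iff split: if_splits)

lemma red_uminus: "red (- r) = - red r"
  by (rule poly_mapping_eqI) (simp add: lookup_red)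

lemma tcoeff_mono: "tcoeff s (mmon (r, I)) = (if lookup r 0 = s then mmon (red r, I) else 0)"
  by (auto simp: tcoeff_single red_def)

lemma tcoeff_mult:
  assumes "b \<in> dA m n"
  shows "tcoeff s (lmono r K \<star> b) = (if s = lookup r 0 then lmono (red r) K \<star> b else 0)"
proof -
  have lif: "lin (\<lambda>b. if s = lookup r 0 then lmono (red r) K \<star> b else 0)"
    by (cases "s = lookup r 0") (auto intro: lin_intros)
  show ?thesis
  proof (rule lgA_eqI[OF assms, where f="\<lambda>b. tcoeff s (lmono r K \<star> b)"]; (intro lin_intros lif)?)
    fix k assume k: "k \<in> mons {1..m} n"
    then have "lookup (fst k) 0 = 0" by (auto simp: mons_def in_keys_iff subset_iff)
    then show "tcoeff s (lmono r K \<star> mmon k) = (if s = lookup r 0 then lmono (red r) K \<star> mmon k else 0)"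
      by (simp add: lmono_def lg_mult_single smul_def tcoeff_single lookup_add red_def lin_0[OF lin_tcoeff] algebra_simps)
  qed
qed

text \<open>The derivation \<open>t\<^sup>r \<zeta>\<^sub>K \<partial>\<^sub>\<alpha>\<close> of \<open>A\<close>.\<close>

definition kd :: "nat \<Rightarrow> nat \<Rightarrow> (nat \<Rightarrow>\<^sub>0 int) \<Rightarrow> nat set \<Rightarrow> nat \<Rightarrow> lgr \<Rightarrow> lgr" where
  "kd m n r K \<alpha> = (\<lambda>f. lmono r K \<star> kgen m n \<alpha> f)"

lemma lin_kgen: "lin (kgen m n \<alpha>)"
  by (auto simp: kgen_def lin_dt lin_dzeta)

lemma kgen_mono:
  assumes "k \<in> mons {1..m} n" "\<alpha> \<le> m + n"
  shows "kgen m n \<alpha> (mmon k) = pd m n \<alpha> (mmon k)"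
proof -
  have "k \<in> mons {0..m} n" "lookup (fst k) 0 = 0"
    using assms by (auto simp: mons_def subset_iff in_keys_iff)
  then show ?thesis using assms
    by (auto simp: kgen_def pd_alt dt_single dzeta_single dt_mon_def dzeta_mon_def)
qed

text \<open>Under the identification of the derivations of \<open>A\<close> with Laurent polynomials in \<open>t\<^sub>0\<close> over \<open>\<gg>\<close>, the derivation
  \<open>d\<^sub>0\<close> becomes the unit of the algebra, which is \<open>\<partial>\<^sub>0\<close>.\<close>

lemma kcoeff_kd:
  assumes r: "keys r \<subseteq> {0..m}" and K: "K \<subseteq> {1..n}" and \<alpha>: "\<alpha> \<le> m + n"
  shows "kcoeff m n s (kd m n r K \<alpha>) = (if s = lookup r 0 then el m n (lmono (red r) K) \<alpha> else 0)"
proof (rule prod_eqI)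
  have "(single 0 1, {}) \<in> mons {0..m} n" by (auto simp: mons_def)
  then have t: "kgen m n \<alpha> (tpow 0 1) = (if \<alpha> = 0 then tpow 0 1 else 0)"
    by (auto simp: kgen_def tpow_def lmono_def dt_single dzeta_single dt_mon_def dzeta_mon_def lookup_single when_def simp del: single_one)
  have "tpow 0 (-1) \<star> (lmono r K \<star> tpow 0 1) = lmono r K"
    by (simp add: tpow_def lmono_mult single_uminus algebra_simps)
  then show "fst (kcoeff m n s (kd m n r K \<alpha>)) = fst (if s = lookup r 0 then el m n (lmono (red r) K) \<alpha> else 0)"
    by (auto simp: kcoeff_def kd_def t fst_el lin_0[OF lin_tcoeff] lmono_def tcoeff_mono)
  show "snd (kcoeff m n s (kd m n r K \<alpha>)) = snd (if s = lookup r 0 then el m n (lmono (red r) K) \<alpha> else 0)"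
  proof
    fix b
    have lif: "lin (\<lambda>b. if s = lookup r 0 then lmono (red r) K \<star> pd m n \<alpha> b else 0)"
      by (cases "s = lookup r 0"; simp; intro lin_intros)
    have "tcoeff s (lmono r K \<star> kgen m n \<alpha> (lg_filter (\<lambda>k. k \<in> mons {1..m} n) b))
      = (if s = lookup r 0 then lmono (red r) K \<star> pd m n \<alpha> b else 0)"
    proof (rule lin_eqI[OF _ lif, where f="\<lambda>b. tcoeff s (lmono r K \<star> kgen m n \<alpha> (lg_filter (\<lambda>k. k \<in> mons {1..m} n) b))"])
      show "lin (\<lambda>b. tcoeff s (lmono r K \<star> kgen m n \<alpha> (lg_filter (\<lambda>k. k \<in> mons {1..m} n) b)))"
        by (intro lin_intros lin_comp[OF lin_kgen])
      fix k
      show "tcoeff s (lmono r K \<star> kgen m n \<alpha> (lg_filter (\<lambda>k. k \<in> mons {1..m} n) (mmon k)))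
      = (if s = lookup r 0 then lmono (red r) K \<star> pd m n \<alpha> (mmon k) else 0)"
        by (cases "k \<in> mons {1..m} n")
          (simp_all add: lg_filter_lext kgen_mono \<alpha> tcoeff_mult[OF pd_in] lin_0[OF lin_kgen] lin_0[OF lin_tcoeff] pd_outside)
    qed
    then show "snd (kcoeff m n s (kd m n r K \<alpha>)) b = snd (if s = lookup r 0 then el m n (lmono (red r) K) \<alpha> else 0) b"
      by (simp add: kcoeff_def kd_def snd_el)
  qed
qed

lemma kcoeff_lin:
  "kcoeff m n r (D + D') = kcoeff m n r D + kcoeff m n r D'"
  "kcoeff m n r (der_scale c D) = g_scale c (kcoeff m n r D)"
  by (simp_all add: kcoeff_def g_scale_def der_scale_def fun_eq_iff lg_mult_distrib lin_add[OF lin_tcoeff] lin_scale[OF lin_tcoeff])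

lemma kcoeff_0 [simp]: "kcoeff m n r 0 = 0"
  by (simp add: kcoeff_def zero_prod_def zero_fun_def lin_0[OF lin_tcoeff])

lemma hash_lmono: "hash (lmono r I) D = single (r, I) D"
  by (simp add: tens_def lmono_def der_scale_def)

interpretation sm: vector_space smash_scale
  by (rule vector_space_pm_scale) (rule vector_space_der)

lemma lookup_smash_scale [simp]: "lookup (smash_scale c X) k = der_scale c (lookup X k)"
  by (rule lookup_pm_scale) (simp add: der_scale_def zero_fun_def)

context qp_mod begin

lemma psi_0 [simp]: "v \<in> V \<Longrightarrow> psi M 0 v = 0" and hphi_0 [simp]: "v \<in> V \<Longrightarrow> hphi M 0 v = 0"
proof -
  assume v: "v \<in> V"
  have "psi M (g_scale 0 0) v = sc 0 (psi M 0 v)" "hphi M (g_scale 0 0) v = sc 0 (hphi M 0 v)"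
    using psi_lin_left[OF v] hphi_lin_left[OF v] gs.subspace_0[OF gcarr_sub] unfolding lin_on_def by blast+
  then show "psi M 0 v = 0" "hphi M 0 v = 0" by simp_all
qed

text \<open>The action of a derivation on \<open>L(M)\<close> is a sum over its coefficients, which is meaningful only if finitely many of them are
  nonzero and all lie in \<open>\<gg>\<close>.\<close>

definition good :: "(lgr \<Rightarrow> lgr) \<Rightarrow> bool" where
  "good D \<longleftrightarrow> finite {r. kcoeff m n r D \<noteq> 0} \<and> (\<forall>r. kcoeff m n r D \<in> carr (gdot m n))"

lemma good_0: "good 0" and good_add: "good D \<Longrightarrow> good D' \<Longrightarrow> good (D + D')" and good_scale: "good D \<Longrightarrow> good (der_scale c D)"
proof -
  show "good 0" using gs.subspace_0[OF gcarr_sub] by (simp add: good_def)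
  show "good (D + D')" if "good D" "good D'"
  proof -
    have "{r. kcoeff m n r (D + D') \<noteq> 0} \<subseteq> {r. kcoeff m n r D \<noteq> 0} \<union> {r. kcoeff m n r D' \<noteq> 0}"
      by (auto simp: kcoeff_lin)
    moreover have "finite ({r. kcoeff m n r D \<noteq> 0} \<union> {r. kcoeff m n r D' \<noteq> 0})" using that by (simp add: good_def)
    ultimately show ?thesis using that gs.subspace_add[OF gcarr_sub] unfolding good_def
      by (metis finite_subset kcoeff_lin(1))
  qed
  show "good (der_scale c D)" if "good D"
  proof -
    have "{r. kcoeff m n r (der_scale c D) \<noteq> 0} \<subseteq> {r. kcoeff m n r D \<noteq> 0}"
      by (auto simp: kcoeff_lin)
    then show ?thesis using that gs.subspace_scale[OF gcarr_sub] unfolding good_def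
      by (metis finite_subset kcoeff_lin(2))
  qed
qed

text \<open>The coefficient of \<open>t\<^sub>0\<^sup>t\<close> in \<open>D (1 \<otimes> u)\<close>; the third term of the action vanishes in degree \<open>0\<close>.\<close>

definition Q :: "'v \<Rightarrow> int \<Rightarrow> (lgr \<Rightarrow> lgr) \<Rightarrow> 'v" where
  "Q u t D = psi M (kcoeff m n t D) u - sc (of_int t) (hphi M (kcoeff m n t D) u)"

lemma Q_V: "u \<in> V \<Longrightarrow> good D \<Longrightarrow> Q u t D \<in> V"
  unfolding Q_def good_def by (intro V_closed psi_V hphi_V) auto

lemma Q_lin:
  assumes "u \<in> V" "good D"
  shows "good D' \<Longrightarrow> Q u t (D + D') = Q u t D + Q u t D'" "Q u t (der_scale c D) = sc c (Q u t D)"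
  using psi_lin_left[OF assms(1)] hphi_lin_left[OF assms(1)] assms(2)
  by (simp_all add: Q_def kcoeff_lin good_def lin_on_def sc_simps mult.commute)

lemma lookup_loop_k:
  assumes u: "u \<in> V" and D: "good D"
  shows "lookup (loop_k m n M D (one_tens u)) t = Q u t D"
proof (cases "u = 0")
  case True
  have "psi M x 0 = 0" "hphi M x 0 = 0" if "x \<in> carr (gdot m n)" for x
    using lin_on_simps(5)[OF psi_lin[OF that]] lin_on_simps(5)[OF hphi_lin[OF that]] by auto
  then show ?thesis using True D by (simp add: loop_k_def one_tens_def Q_def good_def)
next
  case False
  have "loop_k m n M D (one_tens u) = (\<Sum>r\<in>{r. kcoeff m n r D \<noteq> 0}. single r (Q u r D))"
    unfolding loop_k_def by (rule sum.cong) (simp_all add: one_tens_def False Q_def Let_def)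
  then show ?thesis using D u by (simp add: sum_single_lookup good_def Q_def)
qed

lemma lookup_loop_A:
  assumes k: "k \<in> mons {0..m} n" and w: "\<And>s. lookup w s \<in> V"
  shows "lookup (loop_A M (mmon k) w) t
    = \<phi> (mmon (red (fst k), snd k)) (lookup w (t - lookup (fst k) 0))"
proof -
  obtain r I where kk: "k = (r, I)" by (cases k)
  let ?c = "lookup r 0"
  have m1: "(red r, I) \<in> mons {1..m} n" using k kk red_keys[of r m] by (auto simp: mons_def)
  have "mmon (red r, I) \<noteq> 0" by (metis lookup_single_eq lookup_zero zero_neq_one)
  then have s: "{s. tcoeff s (mmon k) \<noteq> 0} = {?c}" by (auto simp: tcoeff_mono kk)
  have "loop_A M (mmon k) w = (\<Sum>s\<in>keys w. single (?c + s) (\<phi> (mmon (red r, I)) (lookup w s)))"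
    unfolding loop_A_def s by (simp add: tcoeff_mono kk)
  then have "lookup (loop_A M (mmon k) w) t
     = (\<Sum>s\<in>keys w. if s = t - ?c then \<phi> (mmon (red r, I)) (lookup w s) else 0)"
    by (simp add: lookup_sum lookup_single when_def algebra_simps)
  also have "\<dots> = \<phi> (mmon (red r, I)) (lookup w (t - ?c))"
    using lin_on_simps(5)[OF \<phi>_lin[OF mono_dA[OF m1]]] by (auto simp: in_keys_iff)
  finally show ?thesis by (simp add: kk)
qed

text \<open>A subspace that contains \<open>\<T>\<close> and acts linearly on the vectors \<open>1 \<otimes> u\<close>.\<close>

definition gsm :: "smash set" where
  "gsm = {X. keys X \<subseteq> mons {0..m} n \<and> (\<forall>k. good (lookup X k))}"

text \<open>The coefficients are expressed as a sum over an arbitrary finite set of monomials that contains the support, so that the supports of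
  two summands may differ in the proof of linearity.\<close>

lemma lookup_smash_act:
  assumes u: "u \<in> V" and X: "X \<in> gsm" and K: "finite K" "keys X \<subseteq> K" "K \<subseteq> mons {0..m} n"
  shows "lookup (smash_act m n M X (one_tens u)) t
    = (\<Sum>k\<in>K. \<phi> (mmon (red (fst k), snd k)) (Q u (t - lookup (fst k) 0) (lookup X k)))"
proof -
  have g: "good (lookup X k)" for k using X unfolding gsm_def by blast
  have "lookup (smash_act m n M X (one_tens u)) t
    = (\<Sum>k\<in>keys X. \<phi> (mmon (red (fst k), snd k)) (Q u (t - lookup (fst k) 0) (lookup X k)))"
    unfolding smash_act_def lookup_sum
    by (rule sum.cong[OF refl], subst lookup_loop_A) (use X in \<open>auto simp: lookup_loop_k[OF u g] Q_V[OF u g] gsm_def\<close>)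
  also have "\<dots> = (\<Sum>k\<in>K. \<phi> (mmon (red (fst k), snd k)) (Q u (t - lookup (fst k) 0) (lookup X k)))"
  proof (rule sum.mono_neutral_left[OF K(1,2)], safe)
    fix r I assume k: "(r, I) \<in> K" "(r, I) \<notin> keys X"
    then have "(red r, I) \<in> mons {1..m} n" using K(3) red_keys[of r m] by (auto simp: mons_def)
    then have "\<phi> (mmon (red r, I)) 0 = 0" using lin_on_simps(5)[OF \<phi>_lin[OF mono_dA]] by blast
    then show "\<phi> (mmon (red (fst (r, I)), snd (r, I))) (Q u (t - lookup (fst (r, I)) 0) (lookup X (r, I))) = 0"
      using k u by (simp add: in_keys_iff Q_def)
  qed
  finally show ?thesis .
qed

lemma gsm_subspace: "sm.subspace gsm"
proof (rule sm.subspaceI)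
  show "0 \<in> gsm" by (simp add: gsm_def good_0)
  show "X + Y \<in> gsm" if "X \<in> gsm" "Y \<in> gsm" for X Y
    using that Poly_Mapping.keys_add[of X Y] good_add by (auto simp: gsm_def lookup_add)
  show "smash_scale c X \<in> gsm" if "X \<in> gsm" for c X
    using that keys_pm_scale[of der_scale c X] good_scale by (auto simp: gsm_def der_scale_def zero_fun_def)
qed

abbreviation "ls \<equiv> pm_scale sc"

lemma vector_space_ls: "vector_space ls" by (rule vector_space_pm_scale) (rule vs.vector_space_axioms)

lemma lookup_ls [simp]: "lookup (ls c f) k = sc c (lookup f k)"
  by (rule lookup_pm_scale) simp

lemma smash_act_lin:
  assumes u: "u \<in> V" and X: "X \<in> gsm" 
  shows "Y \<in> gsm \<Longrightarrow> smash_act m n M (X + Y) (one_tens u) = smash_act m n M X (one_tens u) + smash_act m n M Y (one_tens u)"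
    "smash_act m n M (smash_scale c X) (one_tens u) = ls c (smash_act m n M X (one_tens u))"
proof -
  have md: "mmon (red (fst k), snd k) \<in> dA m n" if "k \<in> mons {0..m} n" for k
  proof (rule mono_dA)
    have k: "keys (fst k) \<subseteq> {0..m}" "snd k \<subseteq> {1..n}" using that by (cases k; simp add: mons_def)+
    show "(red (fst k), snd k) \<in> mons {1..m} n" using red_keys[OF k(1)] k(2) by (simp only: mons_def mem_Collect_eq prod.case simp_thms)
  qed
  have g: "X \<in> gsm \<Longrightarrow> good (lookup X k)" for X k unfolding gsm_def by blast
  show "smash_act m n M (X + Y) (one_tens u) = smash_act m n M X (one_tens u) + smash_act m n M Y (one_tens u)" if Y: "Y \<in> gsm"
  proof (rule poly_mapping_eqI)
    fix t
    let ?K = "keys X \<union> keys Y"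
    have K: "finite ?K" "keys (X + Y) \<subseteq> ?K" "keys X \<subseteq> ?K" "keys Y \<subseteq> ?K" "?K \<subseteq> mons {0..m} n"
      using Poly_Mapping.keys_add[of X Y] X Y by (auto simp: gsm_def)
    have XY: "X + Y \<in> gsm" by (rule sm.subspace_add[OF gsm_subspace X Y])
    show "lookup (smash_act m n M (X + Y) (one_tens u)) t
      = lookup (smash_act m n M X (one_tens u) + smash_act m n M Y (one_tens u)) t"
      unfolding lookup_add lookup_smash_act[OF u XY K(1,2,5)] lookup_smash_act[OF u X K(1,3,5)] lookup_smash_act[OF u Y K(1,4,5)] sum.distrib[symmetric]
    proof (rule sum.cong[OF refl])
      fix k assume "k \<in> ?K"
      then have "mmon (red (fst k), snd k) \<in> dA m n" by (intro md subsetD[OF K(5)])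
      then show "\<phi> (mmon (red (fst k), snd k)) (Q u (t - lookup (fst k) 0) (lookup X k + lookup Y k))
        = \<phi> (mmon (red (fst k), snd k)) (Q u (t - lookup (fst k) 0) (lookup X k))
        + \<phi> (mmon (red (fst k), snd k)) (Q u (t - lookup (fst k) 0) (lookup Y k))"
        by (simp add: Q_lin(1)[OF u g[OF X] g[OF Y]] Q_V[OF u g[OF X]] Q_V[OF u g[OF Y]])
    qed
  qed
  show "smash_act m n M (smash_scale c X) (one_tens u) = ls c (smash_act m n M X (one_tens u))"
  proof (rule poly_mapping_eqI)
    fix t
    let ?K = "keys X"
    have K: "finite ?K" "keys (smash_scale c X) \<subseteq> ?K" "?K \<subseteq> ?K" "?K \<subseteq> mons {0..m} n"
      using keys_pm_scale[of der_scale c X] X by (auto simp: gsm_def der_scale_def zero_fun_def)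
    have cX: "smash_scale c X \<in> gsm" by (rule sm.subspace_scale[OF gsm_subspace X])
    show "lookup (smash_act m n M (smash_scale c X) (one_tens u)) t
      = lookup (ls c (smash_act m n M X (one_tens u))) t"
      unfolding lookup_ls lookup_smash_act[OF u cX K(1,2,4)] lookup_smash_act[OF u X K(1,3,4)] vs.scale_sum_right
    proof (rule sum.cong[OF refl])
      fix k assume "k \<in> ?K"
      then have "mmon (red (fst k), snd k) \<in> dA m n" by (intro md subsetD[OF K(4)])
      then show "\<phi> (mmon (red (fst k), snd k)) (Q u (t - lookup (fst k) 0) (lookup (smash_scale c X) k))
        = sc c (\<phi> (mmon (red (fst k), snd k)) (Q u (t - lookup (fst k) 0) (lookup X k)))"
        by (simp add: Q_lin(2)[OF u g[OF X]] Q_V[OF u g[OF X]])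
    qed
  qed
qed

lemma smash_act_0: "u \<in> V \<Longrightarrow> smash_act m n M 0 (one_tens u) = 0"
  by (simp add: smash_act_def)

lemma smash_act_sum:
  assumes u: "u \<in> V" and X: "\<And>i. i \<in> A \<Longrightarrow> X i \<in> gsm"
  shows "smash_act m n M (\<Sum>i\<in>A. X i) (one_tens u) = (\<Sum>i\<in>A. smash_act m n M (X i) (one_tens u))"
  using X
proof (induction A rule: infinite_finite_induct)
  case (insert i A)
  then have "(\<Sum>i\<in>A. X i) \<in> gsm" by (intro sm.subspace_sum[OF gsm_subspace]) auto
  then show ?case using insert smash_act_lin(1)[OF u, of "X i" "sum X A"] by simp
qed (simp_all add: smash_act_0 u)

lemma good_kd:
  assumes r: "keys r \<subseteq> {0..m}" and K: "K \<subseteq> {1..n}" and \<alpha>: "\<alpha> \<le> m + n"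
  shows "good (kd m n r K \<alpha>)"
proof -
  have "lmono (red r) K \<in> dA m n" using red_keys[OF r] K dP_dA[OF lmono_lgP] by blast
  then have "el m n (lmono (red r) K) \<alpha> \<in> carr (gdot m n)" by auto
  moreover have "{s. kcoeff m n s (kd m n r K \<alpha>) \<noteq> 0} \<subseteq> {lookup r 0}" by (auto simp: kcoeff_kd assms)
  ultimately show ?thesis unfolding good_def
    using gs.subspace_0[OF gcarr_sub] by (auto simp: kcoeff_kd assms intro: finite_subset)
qed

lemma smash_kd:
  assumes r: "keys r \<subseteq> {0..m}" and I: "I \<subseteq> {1..n}" and K: "K \<subseteq> {1..n}" and \<alpha>: "\<alpha> \<le> m + n" and u: "u \<in> V"
  shows "hash (lmono (- r) I) (kd m n r K \<alpha>) \<in> gsm"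
    and "smash_act m n M (hash (lmono (- r) I) (kd m n r K \<alpha>)) (one_tens u) =
      one_tens (\<phi> (lmono (- red r) I) (\<psi> (lmono (red r) K) \<alpha> u - sc (of_int (lookup r 0)) (\<phi> (lmono (red r) K) (\<eta> \<alpha> u))))"
proof -
  have k: "(- r, I) \<in> mons {0..m} n" using r I by (auto simp: mons_def)
  show X: "hash (lmono (- r) I) (kd m n r K \<alpha>) \<in> gsm"
    using k good_kd[OF r K \<alpha>] good_0 by (auto simp: hash_lmono gsm_def lookup_single when_def)
  have m1: "(- red r, I) \<in> mons {1..m} n" using red_keys[OF r] I by (auto simp: mons_def)
  have lA: "lmono (red r) K \<in> dA m n" using red_keys[OF r] K dP_dA[OF lmono_lgP] by blast
  have Q: "Q u t (kd m n r K \<alpha>) = (if t = lookup r 0 then \<psi> (lmono (red r) K) \<alpha> u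
      - sc (of_int (lookup r 0)) (\<phi> (lmono (red r) K) (\<eta> \<alpha> u)) else 0)" for t
    using u by (simp add: Q_def kcoeff_kd[OF r K \<alpha>] hphi_el[OF lA u]) (simp add: \<psi>_def)
  show "smash_act m n M (hash (lmono (- r) I) (kd m n r K \<alpha>)) (one_tens u) =
      one_tens (\<phi> (lmono (- red r) I) (\<psi> (lmono (red r) K) \<alpha> u - sc (of_int (lookup r 0)) (\<phi> (lmono (red r) K) (\<eta> \<alpha> u))))"
  proof (rule poly_mapping_eqI)
    fix t
    have "lookup (smash_act m n M (hash (lmono (- r) I) (kd m n r K \<alpha>)) (one_tens u)) t
      = \<phi> (mmon (- red r, I)) (Q u (t + lookup r 0) (kd m n r K \<alpha>))"
      by (subst lookup_smash_act[OF u X, of "{(- r, I)}"]) (use k in \<open>auto simp: hash_lmono red_uminus\<close>)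
    then show "lookup (smash_act m n M (hash (lmono (- r) I) (kd m n r K \<alpha>)) (one_tens u)) t
      = lookup (one_tens (\<phi> (lmono (- red r) I) (\<psi> (lmono (red r) K) \<alpha> u - sc (of_int (lookup r 0)) (\<phi> (lmono (red r) K) (\<eta> \<alpha> u))))) t"
      using lin_on_simps(5)[OF \<phi>_lin[OF mono_dA[OF m1]]]
      by (auto simp: Q one_tens_def lookup_single when_def lmono_def)
  qed
qed

subsection \<open>The operators \<open>X\<^sub>r\<^sub>,\<^sub>J\<^sub>,\<^sub>\<partial>\<close>\<close>

lemma lmono_dA [intro]: "keys r \<subseteq> {1..m} \<Longrightarrow> I \<subseteq> {1..n} \<Longrightarrow> lmono r I \<in> dA m n"
  using dP_dA[OF lmono_lgP] by blast

text \<open>The structure formula for \<open>a = t\<^sup>r\<close>, where \<open>d\<^sub>i a = r\<^sub>i a\<close>.\<close>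

lemma T_tpow:
  assumes r: "keys r \<subseteq> {1..m}" and u: "u \<in> V"
  shows "\<phi> (lmono (- r) {}) (T (lmono r {}) \<alpha> u) = (\<Sum>i\<in>{1..m}. sc (of_int (lookup r i)) (E i \<alpha> u))"
proof -
  have t: "lmono r {} \<in> dP m n False" "lmono (- r) {} \<in> dP m n False" using r by (auto intro!: lmono_lgP)
  note tA = dP_dA[OF t(1)] dP_dA[OF t(2)]
  have m1: "(r, {}) \<in> mons {1..m} n" using r by (auto simp: mons_def)
  have "T (lmono r {}) \<alpha> u = (\<Sum>\<beta>\<in>{1..m+n}. sc (ksign (m < \<beta>) True) (\<phi> (pd m n \<beta> (lmono r {})) (E \<beta> \<alpha> u)))"
    using T_F[OF t(1) u, of \<alpha>] by (simp add: F_def)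
  also have "\<dots> = (\<Sum>\<beta>\<in>{1..m}. sc (ksign (m < \<beta>) True) (\<phi> (pd m n \<beta> (lmono r {})) (E \<beta> \<alpha> u)))"
    by (rule sum.mono_neutral_right) (use u in \<open>auto simp: pd_alt lmono_def dzeta_single dzeta_mon_def\<close>)
  also have "\<dots> = (\<Sum>\<beta>\<in>{1..m}. \<phi> (lmono r {}) (sc (of_int (lookup r \<beta>)) (E \<beta> \<alpha> u)))"
    by (intro sum.cong refl) (use u m1 tA in \<open>auto simp: lmono_def pd_mono_even simp del: lg_scale_single\<close>)
  also have "\<dots> = \<phi> (lmono r {}) (\<Sum>\<beta>\<in>{1..m}. sc (of_int (lookup r \<beta>)) (E \<beta> \<alpha> u))"
    by (rule lin_on_simps(6)[OF \<phi>_lin[OF tA(1)], symmetric]) (use u in auto)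
  finally have *: "T (lmono r {}) \<alpha> u = \<phi> (lmono r {}) (\<Sum>\<beta>\<in>{1..m}. sc (of_int (lookup r \<beta>)) (E \<beta> \<alpha> u))" .
  have "(\<Sum>\<beta>\<in>{1..m}. sc (of_int (lookup r \<beta>)) (E \<beta> \<alpha> u)) \<in> V"
    by (rule vs.subspace_sum[OF V_sub]) (use u in auto)
  from \<phi>_mult[OF tA(2,1) this] this show ?thesis
    unfolding * by (simp add: lmono_mult lg_one_def[symmetric])
qed

text \<open>The term \<open>r\<^sub>0 E\<^sub>0\<^sub>\<alpha>\<close> comes from \<open>\<phi>\<close>-hat in the action on \<open>L(M)\<close>, the others from \<open>T(t\<^sup>r, \<alpha>)\<close>.\<close>

definition XE :: "(nat \<Rightarrow>\<^sub>0 int) \<Rightarrow> nat \<Rightarrow> 'v \<Rightarrow> 'v" where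
  "XE r \<alpha> u = (\<Sum>i\<le>m. sc (of_int (lookup r i)) (E i \<alpha> u))"

lemma XE_V: "u \<in> V \<Longrightarrow> XE r \<alpha> u \<in> V"
  unfolding XE_def by (intro vs.subspace_sum[OF V_sub]) auto

text \<open>The powers of \<open>t\<close> on both sides of \<open>#\<close> cancel, and what remains depends on \<open>r\<close> only through the linear term \<open>XE\<close>. The
  left side is the action of \<open>t\<^sup>-\<^sup>r \<zeta>\<^sub>I # t\<^sup>r \<zeta>\<^sub>K \<partial>\<^sub>\<alpha>\<close> on \<open>1 \<otimes> u\<close>.\<close>

lemma hash_action:
  assumes r: "keys r \<subseteq> {0..m}" and I: "I \<subseteq> {1..n}" and K: "K \<subseteq> {1..n}" and u: "u \<in> V"
  shows "\<phi> (lmono (- red r) I) (\<psi> (lmono (red r) K) \<alpha> u - sc (of_int (lookup r 0)) (\<phi> (lmono (red r) K) (\<eta> \<alpha> u)))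
    = \<phi> (lmono 0 I) (\<phi> (lmono 0 K) (\<chi> \<alpha> u + XE r \<alpha> u)) + \<phi> (lmono 0 I) (T (lmono 0 K) \<alpha> u)"
proof -
  note rr = red_keys[OF r]
  have t: "lmono (red r) {} \<in> dP m n False" "lmono (- red r) {} \<in> dP m n False" using rr by (auto intro!: lmono_lgP)
  note tA [simp] = dP_dA[OF t(1)] dP_dA[OF t(2)]
  have zP: "lmono 0 K \<in> dP m n (odd (card K))" "lmono 0 I \<in> dP m n (odd (card I))" using I K by (auto intro!: lmono_lgP)
  note zA [simp] = dP_dA[OF zP(1)] dP_dA[OF zP(2)]
  note u [simp]
  have 1: "lmono (red r) K = lmono (red r) {} \<star> lmono 0 K" "lmono (- red r) I = lmono 0 I \<star> lmono (- red r) {}"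
    by (simp_all add: lmono_mult)
  have c: "\<phi> (lmono (- red r) {}) (\<phi> (lmono (red r) {}) w) = w" if "w \<in> V" for w
    using \<phi>_mult[OF tA(2,1) that] that by (simp add: lmono_mult lg_one_def[symmetric])
  have c2: "\<phi> (lmono (- red r) {}) (\<phi> (lmono 0 K) w) = \<phi> (lmono 0 K) (\<phi> (lmono (- red r) {}) w)" if "w \<in> V" for w
    using \<phi>_comm[OF t(2) zP(1) that] that by simp
  have X: "XE r \<alpha> u = (\<Sum>i\<in>{1..m}. sc (of_int (lookup (red r) i)) (E i \<alpha> u)) - sc (of_int (lookup r 0)) (\<eta> \<alpha> u)"
  proof -
    have "{..m} = insert 0 {1..m}" by auto
    then show ?thesis by (simp add: XE_def E_def[of 0] lookup_red)
  qed
  have T: "\<phi> (lmono (- red r) {}) (T (lmono (red r) {} \<star> lmono 0 K) \<alpha> u) = T (lmono 0 K) \<alpha> u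
     + \<phi> (lmono 0 K) (\<Sum>i\<in>{1..m}. sc (of_int (lookup (red r) i)) (E i \<alpha> u))"
    using T_mult[OF t(1) zP(1) u, of \<alpha>] by (simp add: c c2 T_tpow[OF rr u])
  have "\<phi> (lmono (- red r) {}) (\<psi> (lmono (red r) K) \<alpha> u - sc (of_int (lookup r 0)) (\<phi> (lmono (red r) K) (\<eta> \<alpha> u)))
     = \<phi> (lmono 0 K) (\<chi> \<alpha> u) + T (lmono 0 K) \<alpha> u
     + \<phi> (lmono 0 K) (\<Sum>i\<in>{1..m}. sc (of_int (lookup (red r) i)) (E i \<alpha> u))
     - sc (of_int (lookup r 0)) (\<phi> (lmono 0 K) (\<eta> \<alpha> u))"
    unfolding 1(1) \<psi>_eq by (simp add: \<phi>_mult T c)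
  also have "\<dots> = \<phi> (lmono 0 K) (\<chi> \<alpha> u + XE r \<alpha> u) + T (lmono 0 K) \<alpha> u"
    unfolding X using T_tpow[OF rr u, of \<alpha>, symmetric] by (simp add: algebra_simps)
  moreover have "lmono (red r) K \<in> dA m n" using rr K by blast
  ultimately show ?thesis
    unfolding 1(2) using XE_V[OF u, of r \<alpha>]
    by (subst \<phi>_mult) (auto intro!: V_closed)
qed

lemma zeta_split:
  assumes "finite K" "\<forall>i\<in>K. j < i"
  shows "lmono 0 (insert j K) = zeta j \<star> lmono 0 K"
proof -
  have "{i \<in> K. i < j} = {}" using assms by force
  then have "tau {j} K = 0" using assms by (simp add: tau_sing_left)
  moreover have "j \<notin> K" using assms by auto
  ultimately show ?thesis by (simp add: zeta_def lmono_mult)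
qed

text \<open>Pair \<open>I\<close> with \<open>I \<union> {j}\<close> for the least element \<open>j\<close> of \<open>J\<close>. Splitting \<open>\<zeta>\<^sub>j\<close> off by the derivation property,
  the terms with \<open>\<phi>(\<zeta>\<^sub>j)\<close> cancel in each pair, and \<open>\<plusminus>\<phi>(\<zeta>\<^sub>K) T(\<zeta>\<^sub>j, \<alpha>)\<close> with \<open>K = J - {j}\<close> is left with a sign that alternates
  with \<open>I\<close>. The sum of these vanishes unless \<open>J = {j}\<close>.\<close>

lemma T_alternating:
  assumes J: "J \<subseteq> {1..n}" "J \<noteq> {}" and u: "u \<in> V"
  shows "(\<Sum>I\<in>Pow J. sc ((-1) ^ (card I + tau I (J - I))) (\<phi> (lmono 0 I) (T (lmono 0 (J - I)) \<alpha> u)))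
    = (if card J = 1 then T (zeta (Min J)) \<alpha> u else 0)"
proof -
  have fJ: "finite J" using J finite_subset by blast
  define j where "j = Min J"
  define J' where "J' = J - {j}"
  have j: "j \<in> J" using fJ J by (simp add: j_def)
  have JJ: "J = insert j J'" "j \<notin> J'" "finite J'" using j fJ by (auto simp: J'_def)
  have jl: "j < i" if "i \<in> J'" for i
    using that Min_le[OF fJ, of i] unfolding j_def[symmetric] by (auto simp: J'_def le_neq_implies_less)
  have jn: "j \<in> {1..n}" using j J by auto
  note jP = zeta_dP[OF jn, of m]
  have jA [simp]: "zeta j \<in> dA m n" using jn by auto
  note u [simp]
  have zP: "lmono 0 I \<in> dP m n (odd (card I))" if "I \<subseteq> J'" for I
    using that J JJ by (intro lmono_lgP) auto
  have pair: "sc ((-1) ^ (card I + tau I (J - I))) (\<phi> (lmono 0 I) (T (lmono 0 (J - I)) \<alpha> u))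
     + sc ((-1) ^ (card (insert j I) + tau (insert j I) (J - insert j I))) (\<phi> (lmono 0 (insert j I)) (T (lmono 0 (J - insert j I)) \<alpha> u))
     = sc ((-1) ^ card J' * (-1) ^ card I) (\<phi> (lmono 0 J') (T (zeta j) \<alpha> u))" if I: "I \<subseteq> J'" for I
  proof -
    define K where "K = J' - I"
    have fin: "finite I" "finite K" using I JJ by (auto simp: K_def intro: finite_subset)
    have KJ: "K \<subseteq> J'" by (auto simp: K_def)
    have s1: "J - I = insert j K" "J - insert j I = K" using I JJ by (auto simp: K_def)
    have jI: "j \<notin> I" "j \<notin> K" using I KJ JJ by auto
    have c: "card (insert j I) = Suc (card I)" using fin jI by simp
    have cJ: "card J' = card I + card K" using card_Un_disjoint[of I K] fin I by (simp add: K_def Un_absorb1)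
    have "{i \<in> I. j < i} = I" using I jl by auto
    then have tI: "tau I (insert j K) = card I + tau I K"
      using tau_Un_right[of "{j}" K I] fin jI by (simp add: tau_sing)
    have "{i \<in> K. i < j} = {}" using KJ jl by force
    then have "tau {j} K = 0" using fin by (simp add: tau_sing_left)
    then have tI': "tau (insert j I) K = tau I K" using tau_Un_left[of "{j}" I K] fin jI by simp
    have z1: "lmono 0 (insert j K) = zeta j \<star> lmono 0 K" "lmono 0 (insert j I) = zeta j \<star> lmono 0 I"
      using fin KJ I jl by (auto intro!: zeta_split)
    note A [simp] = dP_dA[OF zP[OF I]] dP_dA[OF zP[OF KJ]]
    have T1: "T (zeta j \<star> lmono 0 K) \<alpha> u = \<phi> (zeta j) (T (lmono 0 K) \<alpha> u) + sc (ksign True (odd (card K))) (\<phi> (lmono 0 K) (T (zeta j) \<alpha> u))"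
      by (rule T_mult[OF jP zP[OF KJ] u])
    have cm: "\<phi> (lmono 0 I) (\<phi> (zeta j) w) = sc (ksign (odd (card I)) True) (\<phi> (zeta j) (\<phi> (lmono 0 I) w))" if "w \<in> V" for w
      by (rule \<phi>_comm[OF zP[OF I] jP that])
    have zz: "\<phi> (lmono 0 I) (\<phi> (lmono 0 K) w) = sc ((-1) ^ tau I K) (\<phi> (lmono 0 J') w)" if "w \<in> V" for w
    proof -
      have "I \<inter> K = {}" "I \<union> K = J'" using I by (auto simp: K_def)
      then have "lmono 0 I \<star> lmono 0 K = lg_scale ((-1) ^ tau I K) (lmono 0 J')" by (simp add: lmono_mult)
      then show ?thesis using \<phi>_mult[OF A that] dP_dA[OF zP[of J']] that by simp
    qed
    have k: "ksign True (odd x) = (-1) ^ x" "ksign (odd x) True = (-1) ^ x" for x by (auto simp: ksign_def)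
    have L1: "\<phi> (lmono 0 I) (\<phi> (zeta j) (T (lmono 0 K) \<alpha> u) + sc (ksign True (odd (card K))) (\<phi> (lmono 0 K) (T (zeta j) \<alpha> u)))
      = sc ((-1) ^ card I) (\<phi> (zeta j) (\<phi> (lmono 0 I) (T (lmono 0 K) \<alpha> u)))
        + sc ((-1) ^ card K * (-1) ^ tau I K) (\<phi> (lmono 0 J') (T (zeta j) \<alpha> u))"
      by (simp add: cm zz k)
    have L2: "\<phi> (zeta j \<star> lmono 0 I) (T (lmono 0 K) \<alpha> u) = \<phi> (zeta j) (\<phi> (lmono 0 I) (T (lmono 0 K) \<alpha> u))"
      by (simp add: \<phi>_mult)
    show ?thesis unfolding s1 c tI tI' z1 T1 cJ L1 L2
      by (cases "even (card I)"; cases "even (card K)"; cases "even (tau I K)";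
          simp add: minus_one_power_iff vs.scale_right_distrib)
  qed
  have "(\<Sum>I\<in>Pow J. sc ((-1) ^ (card I + tau I (J - I))) (\<phi> (lmono 0 I) (T (lmono 0 (J - I)) \<alpha> u)))
     = (\<Sum>I\<in>Pow J'. sc ((-1) ^ card J' * (-1) ^ card I) (\<phi> (lmono 0 J') (T (zeta j) \<alpha> u)))"
    by (subst JJ(1), subst sum_Pow_insert[OF JJ(3,2)], rule sum.cong[OF refl]) (use pair JJ(1) in auto)
  also have "\<dots> = sc ((-1) ^ card J' * (\<Sum>I\<in>Pow J'. (-1) ^ card I)) (\<phi> (lmono 0 J') (T (zeta j) \<alpha> u))"
    by (simp add: vs.scale_sum_left[symmetric] sum_distrib_left)
  also have "\<dots> = (if J' = {} then T (zeta j) \<alpha> u else 0)"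
    unfolding alternating_Pow[OF JJ(3)] by (auto simp: lg_one_def[symmetric])
  also have "J' = {} \<longleftrightarrow> card J = 1" using JJ by (simp add: One_nat_def)
  finally show ?thesis by (simp add: j_def)
qed

text \<open>All terms are \<open>\<plusminus>\<phi>(\<zeta>\<^sub>J) w\<close>, with signs that sum to zero.\<close>

lemma phi_alternating:
  assumes J: "J \<subseteq> {1..n}" "J \<noteq> {}" and w: "w \<in> V"
  shows "(\<Sum>I\<in>Pow J. sc ((-1) ^ (card I + tau I (J - I))) (\<phi> (lmono 0 I) (\<phi> (lmono 0 (J - I)) w))) = 0"
proof -
  have fJ: "finite J" using J finite_subset by blast
  have zA: "lmono 0 I \<in> dA m n" if "I \<subseteq> J" for I
    using that J by (intro lmono_dA) auto
  have "sc ((-1) ^ (card I + tau I (J - I))) (\<phi> (lmono 0 I) (\<phi> (lmono 0 (J - I)) w)) = sc ((-1) ^ card I) (\<phi> (lmono 0 J) w)"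
    if I: "I \<in> Pow J" for I
  proof -
    have "I \<inter> (J - I) = {}" "I \<union> (J - I) = J" using I by auto
    then have "lmono 0 I \<star> lmono 0 (J - I) = lg_scale ((-1) ^ tau I (J - I)) (lmono 0 J)" by (simp add: lmono_mult)
    then have "\<phi> (lmono 0 I) (\<phi> (lmono 0 (J - I)) w) = sc ((-1) ^ tau I (J - I)) (\<phi> (lmono 0 J) w)"
      using \<phi>_mult[OF zA zA w, of I "J - I"] I zA[of J] w by simp
    then show ?thesis by (simp add: power_add mult.assoc flip: power_mult_distrib)
  qed
  then have "(\<Sum>I\<in>Pow J. sc ((-1) ^ (card I + tau I (J - I))) (\<phi> (lmono 0 I) (\<phi> (lmono 0 (J - I)) w)))
    = sc (\<Sum>I\<in>Pow J. (-1) ^ card I) (\<phi> (lmono 0 J) w)"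
    by (simp add: vs.scale_sum_left)
  then show ?thesis using alternating_Pow[OF fJ] J by simp
qed

text \<open>The action of \<open>X\<^sub>r\<^sub>,\<^sub>J\<^sub>,\<^sub>\<alpha>\<close> on \<open>M\<close>, embedded in degree \<open>0\<close> of \<open>L(M)\<close>.\<close>

definition Xop :: "(nat \<Rightarrow>\<^sub>0 int) \<Rightarrow> nat set \<Rightarrow> nat \<Rightarrow> 'v \<Rightarrow> 'v" where
  "Xop r J \<alpha> u = (if J = {} then XE r \<alpha> u else if card J = 1 then E (m + Min J) \<alpha> u else 0)"

lemma one_tens_lin: "one_tens (u + v) = one_tens u + one_tens v" "one_tens (sc c u) = ls c (one_tens u)" "one_tens (0::'v) = 0"
  by (simp_all add: one_tens_def single_add pm_scale_single[OF vs.vector_space_axioms])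

lemma one_tens_sum: "one_tens (\<Sum>i\<in>A. f i) = (\<Sum>i\<in>A. one_tens (f i :: 'v))"
  by (induction A rule: infinite_finite_induct) (simp_all add: one_tens_lin)

lemma X_action:
  assumes r: "keys r \<subseteq> {0..m}" and J: "J \<subseteq> {1..n}" and \<alpha>: "\<alpha> \<le> m + n" and u: "u \<in> V"
  shows "X_el m n r J \<alpha> \<in> gsm" "smash_act m n M (X_el m n r J \<alpha>) (one_tens u) = one_tens (Xop r J \<alpha> u)"
proof -
  note sk = smash_kd[OF r _ _ \<alpha> u]
  have "X_el m n r J \<alpha> \<in> gsm \<and> smash_act m n M (X_el m n r J \<alpha>) (one_tens u) = one_tens (Xop r J \<alpha> u)"
  proof (cases "J = {}")
    case False
    let ?w = "\<chi> \<alpha> u + XE r \<alpha> u"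
    have w: "?w \<in> V" using u XE_V by auto
    have X: "X_el m n r J \<alpha> = (\<Sum>I\<in>Pow J. smash_scale ((-1) ^ (card I + tau I (J - I))) (hash (lmono (- r) I) (kd m n r (J - I) \<alpha>)))"
      using False by (simp add: X_el_def kd_def)
    have IJ: "I \<subseteq> {1..n}" "J - I \<subseteq> {1..n}" if "I \<in> Pow J" for I using that J by auto
    have g: "smash_scale c (hash (lmono (- r) I) (kd m n r (J - I) \<alpha>)) \<in> gsm" if "I \<in> Pow J" for I c
      by (rule sm.subspace_scale[OF gsm_subspace sk(1)[OF IJ[OF that]]])
    have "smash_act m n M (X_el m n r J \<alpha>) (one_tens u) = (\<Sum>I\<in>Pow J. one_tens (sc ((-1) ^ (card I + tau I (J - I)))
        (\<phi> (lmono 0 I) (\<phi> (lmono 0 (J - I)) ?w) + \<phi> (lmono 0 I) (T (lmono 0 (J - I)) \<alpha> u))))"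
      unfolding X
      by (subst smash_act_sum[OF u], rule g, assumption, rule sum.cong[OF refl]) (use IJ in \<open>simp only: smash_act_lin(2)[OF u sk(1)] sk(2) hash_action[OF r _ _ u] one_tens_lin\<close>)
    also have "\<dots> = one_tens ((\<Sum>I\<in>Pow J. sc ((-1) ^ (card I + tau I (J - I))) (\<phi> (lmono 0 I) (\<phi> (lmono 0 (J - I)) ?w)))
       + (\<Sum>I\<in>Pow J. sc ((-1) ^ (card I + tau I (J - I))) (\<phi> (lmono 0 I) (T (lmono 0 (J - I)) \<alpha> u))))"
      by (simp only: one_tens_sum[symmetric] vs.scale_right_distrib sum.distrib)
    also have "\<dots> = one_tens (if card J = 1 then T (zeta (Min J)) \<alpha> u else 0)"
      by (simp only: phi_alternating[OF J False w] T_alternating[OF J False u] add_0)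
    also have "\<dots> = one_tens (Xop r J \<alpha> u)"
    proof (cases "card J = 1")
      case True
      then obtain j where "J = {j}" by (auto simp: One_nat_def card_Suc_eq)
      then show ?thesis using J True u by (auto simp: Xop_def E_def gi_def gv_def)
    qed (use False in \<open>simp add: Xop_def\<close>)
    finally have "smash_act m n M (X_el m n r J \<alpha>) (one_tens u) = one_tens (Xop r J \<alpha> u)" .
    moreover have "X_el m n r J \<alpha> \<in> gsm" unfolding X by (rule sm.subspace_sum[OF gsm_subspace]) (rule g)
    ultimately show ?thesis by simp
  next
    case True
    have X: "X_el m n r J \<alpha> = hash (lmono (- r) {}) (kd m n r {} \<alpha>) + smash_scale (-1) (hash (lmono (- 0) {}) (kd m n 0 {} \<alpha>))"
      using True by (simp add: X_el_def kd_def lg_one_def[symmetric])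
    have k0: "keys (0 :: nat \<Rightarrow>\<^sub>0 int) \<subseteq> {0..m}" by simp
    note s0 = smash_kd[OF k0 _ _ \<alpha> u, of "{}" "{}"]
    have z: "lmono 0 {} = lg_one" by (simp add: lg_one_def)
    have h: "smash_act m n M (hash (lmono (- r) {}) (kd m n r {} \<alpha>)) (one_tens u) = one_tens (\<chi> \<alpha> u + XE r \<alpha> u)"
      if r: "keys r \<subseteq> {0..m}" for r
      using smash_kd(2)[OF r _ _ \<alpha> u, of "{}" "{}"] hash_action[OF r _ _ u, of "{}" "{}" \<alpha>] u XE_V[OF u, of r \<alpha>]
      by (simp add: z)
    have "XE 0 \<alpha> u = 0" by (simp add: XE_def)
    then have "smash_act m n M (X_el m n r J \<alpha>) (one_tens u) = one_tens (\<chi> \<alpha> u + XE r \<alpha> u) + ls (-1) (one_tens (\<chi> \<alpha> u))"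
      unfolding X using h[OF r] h[OF k0] sk(1)[of "{}" "{}"] s0(1) sm.subspace_scale[OF gsm_subspace s0(1)]
      by (simp only: smash_act_lin[OF u] empty_subsetI add_0_right)
    also have "\<dots> = one_tens (Xop r J \<alpha> u)"
      unfolding one_tens_lin(2)[symmetric] one_tens_lin(1)[symmetric] using True by (simp add: Xop_def)
    finally have "smash_act m n M (X_el m n r J \<alpha>) (one_tens u) = one_tens (Xop r J \<alpha> u)" .
    moreover have "X_el m n r J \<alpha> \<in> gsm" unfolding X
      by (intro sm.subspace_add[OF gsm_subspace] sm.subspace_scale[OF gsm_subspace] sk(1) s0(1)) auto
    ultimately show ?thesis by simp
  qed
  then show "X_el m n r J \<alpha> \<in> gsm" "smash_act m n M (X_el m n r J \<alpha>) (one_tens u) = one_tens (Xop r J \<alpha> u)" by auto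
qed

subsection \<open>\<open>\<T>\<close>-submodules\<close>

lemma one_tens_inj [simp]: "one_tens u = one_tens (v::'v) \<longleftrightarrow> u = v"
  by (simp add: one_tens_def inj_eq)

lemma one_tens_mem [simp]: "one_tens (u::'v) \<in> one_tens ` U \<longleftrightarrow> u \<in> U"
  by auto

lemma one_tens_part: "one_tens u \<in> part (loop_space M) p \<longleftrightarrow> u \<in> part M p"
  using P_closed(4)[of p] by (auto simp: loop_space_def one_tens_def lookup_single when_def split: if_splits)

lemma scal_loop [simp]: "scal (loop_space M) = ls" by (simp add: loop_space_def)

lemma one_tens_subspace: "module.subspace ls (one_tens ` U) \<longleftrightarrow> vs.subspace U"
proof -
  interpret lv: vector_space ls by (rule vector_space_ls)
  have l: "one_tens u + one_tens v = one_tens (u + v)" "ls c (one_tens u) = one_tens (sc c u)" "0 = one_tens (0::'v)" for u v c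
    by (simp_all only: one_tens_lin)
  show ?thesis unfolding lv.subspace_def vs.subspace_def by (simp only: ball_simps l one_tens_mem)
qed

lemma sub_loop: "sub_superspace (loop_space M) (one_tens ` U) \<longleftrightarrow> sub_superspace M U"
proof -
  have l: "one_tens u + one_tens v = one_tens (u + v)" for u v :: 'v by (simp only: one_tens_lin)
  have im: "one_tens ` U \<inter> part (loop_space M) p = one_tens ` (U \<inter> part M p)" for p
    using one_tens_part by auto
  have "{x + y |x y. x \<in> one_tens ` U \<inter> part (loop_space M) False \<and> y \<in> one_tens ` U \<inter> part (loop_space M) True}
    = one_tens ` {x + y |x y. x \<in> U \<inter> part M False \<and> y \<in> U \<inter> part M True}"
    unfolding im by (auto simp: l) (metis IntI image_eqI l)+
  moreover have "inj (one_tens :: 'v \<Rightarrow> _)" by (auto simp: inj_on_def)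
  ultimately show ?thesis unfolding sub_superspace_def by (simp add: one_tens_subspace inj_image_eq_iff)
qed

text \<open>The operators of \<open>\<T>\<close> are combinations of the \<open>E\<^sub>\<alpha>\<^sub>\<beta>\<close>. Conversely \<open>E\<^sub>\<alpha>\<^sub>\<beta>\<close> is obtained from the \<open>\<alpha>\<close>-th unit vector \<open>r\<close>
  and \<open>J = {}\<close> for \<open>\<alpha> \<le> m\<close>, and from \<open>J = {\<alpha> - m}\<close> for odd \<open>\<alpha>\<close>.\<close>

lemma T_submodule_iff:
  assumes UV: "U \<subseteq> V"
  shows "T_submodule m n M (one_tens ` U) \<longleftrightarrow> sub_superspace M U \<and> E_stable U"
proof
  assume T: "T_submodule m n M (one_tens ` U)"
  then have s: "sub_superspace M U" using sub_loop by (simp add: T_submodule_def)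
  have X: "Xop r J \<alpha> u \<in> U" if "keys r \<subseteq> {0..m}" "J \<subseteq> {1..n}" "\<alpha> \<le> m + n" "J \<noteq> {} \<or> r \<noteq> 0" "u \<in> U" for r J \<alpha> u
  proof -
    have "X_el m n r J \<alpha> \<in> T_alg m n" unfolding T_alg_def by (rule sm.span_base) (use that in blast)
    then have "smash_act m n M (X_el m n r J \<alpha>) (one_tens u) \<in> one_tens ` U"
      using T that(5) unfolding T_submodule_def by blast
    moreover have "u \<in> V" using that UV by auto
    ultimately show ?thesis using X_action(2)[OF that(1-3)] by simp
  qed
  have "E \<alpha> \<beta> u \<in> U" if \<alpha>: "\<alpha> \<le> m + n" and \<beta>: "\<beta> \<le> m + n" and u: "u \<in> U" for \<alpha> \<beta> u
  proof (cases "\<alpha> \<le> m")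
    case True
    have "lookup (single \<alpha> (1::int)) \<alpha> \<noteq> lookup 0 \<alpha>" by simp
    then have "single \<alpha> (1::int) \<noteq> 0" by metis
    moreover have "XE (single \<alpha> 1) \<beta> u = E \<alpha> \<beta> u"
    proof -
      have "XE (single \<alpha> 1) \<beta> u = (\<Sum>i\<le>m. if i = \<alpha> then E \<alpha> \<beta> u else 0)"
        unfolding XE_def by (rule sum.cong) (auto simp: lookup_single when_def)
      then show ?thesis using True by simp
    qed
    ultimately show ?thesis using X[of "single \<alpha> 1" "{}" \<beta> u] True \<beta> u by (simp add: Xop_def)
  next
    case False
    then have "\<alpha> - m \<in> {1..n}" using \<alpha> by (intro odd_index) auto
    then show ?thesis using X[of 0 "{\<alpha> - m}" \<beta> u] False \<beta> u by (simp add: Xop_def)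
  qed
  then show "sub_superspace M U \<and> E_stable U" using s by (simp add: E_stable_def)
next
  assume s: "sub_superspace M U \<and> E_stable U"
  interpret lv: vector_space ls by (rule vector_space_ls)
  have Us: "vs.subspace U" using s by (simp add: sub_superspace_def)
  have lU: "lv.subspace (one_tens ` U)" using Us one_tens_subspace by simp
  have uV: "u \<in> U \<Longrightarrow> u \<in> V" for u using UV by auto
  let ?S = "{X \<in> gsm. \<forall>u\<in>U. smash_act m n M X (one_tens u) \<in> one_tens ` U}"
  have "sm.subspace ?S"
    by (rule sm.subspaceI)
      (use sm.subspace_0[OF gsm_subspace] sm.subspace_add[OF gsm_subspace] sm.subspace_scale[OF gsm_subspace]
        lv.subspace_0[OF lU] lv.subspace_add[OF lU] lv.subspace_scale[OF lU] uV in
        \<open>simp_all add: smash_act_0 smash_act_lin del: one_tens_mem\<close>)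
  moreover have "{X_el m n r J \<alpha> | r J \<alpha>. keys r \<subseteq> {0..m} \<and> J \<subseteq> {1..n} \<and> \<alpha> \<le> m + n \<and> (J \<noteq> {} \<or> r \<noteq> 0)} \<subseteq> ?S"
  proof
    fix X assume "X \<in> {X_el m n r J \<alpha> | r J \<alpha>. keys r \<subseteq> {0..m} \<and> J \<subseteq> {1..n} \<and> \<alpha> \<le> m + n \<and> (J \<noteq> {} \<or> r \<noteq> 0)}"
    then obtain r J \<alpha> where X: "X = X_el m n r J \<alpha>" and r: "keys r \<subseteq> {0..m}"
      and J: "J \<subseteq> {1..n}" and \<alpha>: "\<alpha> \<le> m + n" by blast
    have "X \<in> gsm" unfolding X by (rule X_action(1)[OF r J \<alpha> V_closed(4)])
    moreover have "smash_act m n M X (one_tens u) \<in> one_tens ` U" if u: "u \<in> U" for u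
    proof -
    have E: "E \<gamma> \<alpha> u \<in> U" if "\<gamma> \<le> m + n" for \<gamma> using s that \<alpha> u by (simp add: E_stable_def)
    have "Xop r J \<alpha> u \<in> U"
    proof -
      have "Min J \<in> J" if "J \<noteq> {}" using that J finite_subset by (intro Min_in) auto
      then have "m + Min J \<le> m + n" if "J \<noteq> {}" using that J by auto
      then show ?thesis unfolding Xop_def XE_def
        using E vs.subspace_0[OF Us] by (auto intro!: vs.subspace_sum[OF Us] vs.subspace_scale[OF Us])
    qed
    then show ?thesis using X_action(2)[OF r J \<alpha> uV[OF u]] by (simp add: X)
    qed
    ultimately show "X \<in> ?S" by simp
  qed
  ultimately have "T_alg m n \<subseteq> ?S" unfolding T_alg_def by (rule sm.span_minimal[rotated])
  then show "T_submodule m n M (one_tens ` U)" unfolding T_submodule_def using s sub_loop by auto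
qed

lemma E_stable_Om: "E_stable (Om \<mu>)"
  by (simp add: E_stable_def E_Om)

section \<open>The weights of \<open>\<Omega>\<close>\<close>

text \<open>The eigenvalues of a fixed nonzero vector depend linearly on the operator. Functionals are normalised to vanish outside the
  span, which the default value \<open>0\<close> achieves.\<close>

lemma eigen_dual:
  assumes B: "B \<subseteq> carr (gdot m n)" and u: "u \<in> V" "u \<noteq> 0" and ev: "\<And>b. b \<in> B \<Longrightarrow> \<exists>c. psi M b u = sc c u"
  shows "\<exists>l\<in>dual g_scale (gs.span B). \<forall>h\<in>gs.span B. psi M h u = sc (l h) u"
proof -
  have c: "gs.span B \<subseteq> carr (gdot m n)" by (rule gs.span_minimal[OF B gcarr_sub])
  note pl = psi_lin_left[OF u(1), unfolded lin_on_def]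
  have add: "psi M (x + y) u = psi M x u + psi M y u" if "x \<in> carr (gdot m n)" "y \<in> carr (gdot m n)" for x y
    using pl that by blast
  have scl: "psi M (g_scale k x) u = sc k (psi M x u)" if "x \<in> carr (gdot m n)" for k x using pl that by blast
  let ?S = "{h \<in> carr (gdot m n). \<exists>c. psi M h u = sc c u}"
  have "gs.subspace ?S"
  proof (rule gs.subspaceI)
    show "0 \<in> ?S" using gs.subspace_0[OF gcarr_sub] u by (auto intro: exI[of _ 0])
    show "x + y \<in> ?S" if xy: "x \<in> ?S" "y \<in> ?S" for x y
    proof -
      obtain c d where "psi M x u = sc c u" "psi M y u = sc d u" using xy by blast
      then have "psi M (x + y) u = sc (c + d) u" using add xy by (simp add: vs.scale_left_distrib)
      then show ?thesis using xy gs.subspace_add[OF gcarr_sub] by blast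
    qed
    show "g_scale k x \<in> ?S" if x: "x \<in> ?S" for k x
    proof -
      obtain c where "psi M x u = sc c u" using x by blast
      then have "psi M (g_scale k x) u = sc (k * c) u" using scl x by simp
      then show ?thesis using x gs.subspace_scale[OF gcarr_sub] by blast
    qed
  qed
  then have S: "gs.span B \<subseteq> ?S" by (rule gs.span_minimal[rotated]) (use B ev in auto)
  define l where "l h = (if h \<in> gs.span B then (THE c. psi M h u = sc c u) else 0)" for h
  have uniq: "sc c u = sc d u \<longleftrightarrow> c = d" for c d using u by (simp add: vs.scale_cancel_right)
  have l: "psi M h u = sc (l h) u" if h: "h \<in> gs.span B" for h
  proof -
    obtain c where c: "psi M h u = sc c u" using S h by blast
    then have "l h = c" using h u(2) by (simp add: l_def)
    then show ?thesis using c by simp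
  qed
  have "lin_on g_scale (*) (gs.span B) l" unfolding lin_on_def
  proof (intro conjI ballI allI)
    fix x y assume xy: "x \<in> gs.span B" "y \<in> gs.span B"
    have "sc (l (x + y)) u = sc (l x + l y) u"
      using l[OF gs.span_add[OF xy]] l[OF xy(1)] l[OF xy(2)] add[OF subsetD[OF c xy(1)] subsetD[OF c xy(2)]]
      by (simp add: vs.scale_left_distrib)
    then show "l (x + y) = l x + l y" by (simp only: uniq)
  next
    fix k x assume x: "x \<in> gs.span B"
    have "sc (l (g_scale k x)) u = sc (k * l x) u"
      unfolding l[OF gs.span_scale[OF x], symmetric] scl[OF subsetD[OF c x]] l[OF x] by simp
    then show "l (g_scale k x) = k * l x" by (simp only: uniq)
  qed
  then have "l \<in> dual g_scale (gs.span B)" by (auto simp: dual_def l_def)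
  then show ?thesis using l by blast
qed

text \<open>On \<open>\<Omega>\<close> the correction term \<open>\<phi>(\<zeta>\<^sub>k) \<psi>(\<partial>\<^sub>k)\<close> vanishes.\<close>

lemma zeta_op_Om:
  assumes "u \<in> Om \<mu>" "k \<in> {1..n}"
  shows "psi M (el m n (zeta k) (m + k)) u = E (m + k) (m + k) u"
proof -
  have "u \<in> V" "\<chi> (m + k) u = 0" using assms by (auto simp: Om_def)
  then show ?thesis using assms by (simp add: E_def gi_def gv_def T_def \<psi>_def[symmetric])
qed

lemma cartan_gens: "cartan m n = gs.span (gen m n ` {0..m} \<union> zeta_dzeta m n)"
  by (simp add: cartan_def)

lemma gens_carr: "gen m n ` {0..m} \<union> zeta_dzeta m n \<subseteq> carr (gdot m n)"
  using gen_carr zd_carr by auto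

lemma psi_cartan_Om: "h \<in> cartan m n \<Longrightarrow> u \<in> Om \<mu> \<Longrightarrow> psi M h u \<in> Om \<mu>"
  unfolding cartan_gens
proof (rule psi_on_span[OF gens_carr Om_subspace])
  show "Om \<mu> \<subseteq> V" by auto
  show "psi M b u \<in> Om \<mu>" if "b \<in> gen m n ` {0..m} \<union> zeta_dzeta m n" "u \<in> Om \<mu>" for b u
    using that \<chi>_Om[of _ u \<mu>] vs.subspace_scale[OF Om_subspace]
    by (auto simp: zd_eq zeta_op_Om E_Om \<chi>_def[symmetric])
qed

lemma psi_zeta_wt: 
  assumes "v \<in> wt \<mu>" "k \<in> {1..n}"
  shows "psi M (el m n (zeta k) (m + k)) v \<in> wt \<mu>"
proof -
  have v: "v \<in> V" using assms by auto
  have "\<chi> i (\<psi> (zeta k) (m + k) v) = \<psi> (zeta k) (m + k) (\<chi> i v)" if "i \<le> m" for i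
    using \<psi>_\<psi>[OF lg_one_in(1) zeta_dP[OF assms(2)] v, of i "m + k"] that assms(2) v by (simp add: \<chi>_\<psi>[symmetric] pd_zeta)
  then show ?thesis using assms v unfolding wt_def \<psi>_def[symmetric] by auto
qed

lemma psi_cartan_wt: "h \<in> cartan m n \<Longrightarrow> u \<in> wt \<mu> \<Longrightarrow> psi M h u \<in> wt \<mu>"
  unfolding cartan_gens
proof (rule psi_on_span[OF gens_carr wt_subspace])
  show "wt \<mu> \<subseteq> V" by auto
  show "psi M b u \<in> wt \<mu>" if "b \<in> gen m n ` {0..m} \<union> zeta_dzeta m n" "u \<in> wt \<mu>" for b u
    using that psi_zeta_wt \<chi>_wt by (auto simp: zd_eq \<chi>_def)
qed

end

locale cuspidal_qp_mod = simple_qp_mod m n M for m n :: nat and M :: "('v::ab_group_add) qp_data" +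
  assumes cusp: "cuspidal m n M"
begin

lemma M_direct: "direct_sum sc V (dual g_scale (cartan m n)) (weight_space sc V (cartan m n) (psi M))"
  using cusp by (simp add: cuspidal_def bounded_weight_def)

lemma cartan_lin: "h \<in> cartan m n \<Longrightarrow> lin_on sc sc V (psi M h)"
  using cartan_carr psi_lin by blast

text \<open>The joint eigenspace is stable under the Cartan subalgebra, so it is the sum of the weight spaces that it meets, and their
  weights restrict to \<open>\<mu>0\<close>.\<close>

lemma weight_sum_eq:
  assumes \<mu>0: "\<mu>0 \<in> dual g_scale (cartan' m n)"
  shows "qp_weight_sum m n M \<mu>0 = wt (\<lambda>i. \<mu>0 (gen m n i))"
proof
  let ?\<mu> = "\<lambda>i. \<mu>0 (gen m n i)"
  show "qp_weight_sum m n M \<mu>0 \<subseteq> wt ?\<mu>"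
    unfolding qp_weight_sum_def
  proof (rule vs.span_minimal[OF _ wt_subspace], safe)
    fix l v assume l: "\<forall>h\<in>cartan' m n. l h = \<mu>0 h" and v: "v \<in> weight_space sc V (cartan m n) (psi M) l"
    have "\<chi> i v = sc (\<mu>0 (gen m n i)) v" if "i \<le> m" for i
      using v l gen_cartan'[OF that] cartan'_sub unfolding weight_space_def \<chi>_def by auto
    then show "v \<in> wt ?\<mu>" using v by (auto simp: wt_def weight_space_def)
  qed
  show "wt ?\<mu> \<subseteq> qp_weight_sum m n M \<mu>0"
  proof
    fix v assume v: "v \<in> wt ?\<mu>"
    obtain J f where J: "finite J" "J \<subseteq> dual g_scale (cartan m n)"
      "\<forall>l\<in>J. f l \<in> wt ?\<mu> \<inter> weight_space sc V (cartan m n) (psi M) l" "v = (\<Sum>l\<in>J. f l)"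
      using weight_decomposition_subspace[OF vs.vector_space_axioms V_sub cartan_lin M_direct wt_subspace _ psi_cartan_wt v]
      by blast
    have "f l \<in> qp_weight_sum m n M \<mu>0" if l: "l \<in> J" for l
    proof (cases "f l = 0")
      case True then show ?thesis by (simp add: qp_weight_sum_def vs.span_zero)
    next
      case False
      have fl: "f l \<in> wt ?\<mu>" "f l \<in> weight_space sc V (cartan m n) (psi M) l" using J l by auto
      have "l h = \<mu>0 h" if h: "h \<in> cartan' m n" for h
      proof -
        have "psi M h (f l) = sc (\<mu>0 h) (f l)"
        proof (rule eigen_on_span[of "gen m n ` {0..m}"])
          show "lin_on g_scale (*) (gs.span (gen m n ` {0..m})) \<mu>0" using \<mu>0 by (simp add: dual_def cartan'_def)
          show "psi M b (f l) = sc (\<mu>0 b) (f l)" if "b \<in> gen m n ` {0..m}" for b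
            using that fl(1) by (auto simp: wt_def \<chi>_def)
          show "gen m n ` {0..m} \<subseteq> carr (gdot m n)" using gen_carr by blast
          show "f l \<in> V" using fl(1) by (rule wt_V)
          show "h \<in> gs.span (gen m n ` {0..m})" using h by (simp add: cartan'_def)
        qed
        moreover have "psi M h (f l) = sc (l h) (f l)" using fl(2) h cartan'_sub by (auto simp: weight_space_def)
        ultimately show ?thesis using False by (simp add: vs.scale_cancel_right)
      qed
      then show ?thesis unfolding qp_weight_sum_def using fl J l by (intro vs.span_base) auto
    qed
    then show "v \<in> qp_weight_sum m n M \<mu>0" unfolding J(4)
      by (simp add: qp_weight_sum_def vs.span_sum)
  qed
qed

abbreviation "Z \<equiv> gs.span (zeta_dzeta m n)"

text \<open>The elements \<open>1\<close> and \<open>d\<^sub>i\<close> act on \<open>\<Omega>\<close> by scalars, so a nonzero weight space of \<open>\<Omega>\<close> for the span of the \<open>\<zeta>\<^sub>k \<partial>\<^sub>k\<close>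
  lies in one weight space of \<open>M\<close> and inherits its bounds.\<close>

lemma Om_zeta_weights: "bounded_weight g_scale Z sc (Om \<mu>) (psi M)"
proof -
  let ?F = "weight_space sc (Om \<mu>) Z (psi M)"
  let ?W = "weight_space sc V (cartan m n) (psi M)"
  have ZV: "lin_on sc sc (Om \<mu>) (psi M h)" if "h \<in> Z" for h
    using cartan_lin[of h] zd_cartan that Om_V unfolding lin_on_def by (meson subsetD)
  have zc: "zeta_dzeta m n \<subseteq> carr (gdot m n)" using zd_carr by auto
  have span: "Om \<mu> \<subseteq> vs.span (\<Union>l\<in>dual g_scale Z. ?F l)"
  proof
    fix u assume u: "u \<in> Om \<mu>"
    obtain J f where J: "finite J" "J \<subseteq> dual g_scale (cartan m n)" "\<forall>l\<in>J. f l \<in> Om \<mu> \<inter> ?W l" "u = (\<Sum>l\<in>J. f l)"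
      using weight_decomposition_subspace[OF vs.vector_space_axioms V_sub cartan_lin M_direct Om_subspace _ psi_cartan_Om u] 
      by blast
    have "f l \<in> vs.span (\<Union>l\<in>dual g_scale Z. ?F l)" if l: "l \<in> J" for l
    proof -
      \<comment> \<open>the restriction of \<open>l\<close>, with the normalisation required of elements of \<open>dual\<close>\<close>
      define l' where "l' h = (if h \<in> Z then l h else 0)" for h
      have "lin_on g_scale (*) (cartan m n) l" using J l by (auto simp: dual_def)
      then have "lin_on g_scale (*) Z l'" using zd_cartan gs.span_add[of _ "zeta_dzeta m n"] gs.span_scale[of _ "zeta_dzeta m n"]
        unfolding lin_on_def l'_def by (simp add: subset_iff del: split_paired_All)
      then have "l' \<in> dual g_scale Z" by (auto simp: dual_def l'_def)
      moreover have "f l \<in> ?F l'" using J l zd_cartan by (auto simp: weight_space_def l'_def)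
      ultimately show ?thesis by (intro vs.span_base UN_I)
    qed
    then show "u \<in> vs.span (\<Union>l\<in>dual g_scale Z. ?F l)" unfolding J(4) by (rule vs.span_sum)
  qed
  have sub: "?F l = {0} \<or> (\<exists>l'\<in>dual g_scale (cartan m n). ?F l \<subseteq> ?W l')" if l: "l \<in> dual g_scale Z" for l
  proof (cases "?F l \<subseteq> {0}")
    case True
    moreover have "0 \<in> ?F l" using vs.subspace_0[OF weight_space_subspace[OF vs.vector_space_axioms Om_subspace ZV, of Z]] by auto
    ultimately show ?thesis by auto
  next
    case False
    then obtain u where u: "u \<in> ?F l" "u \<noteq> 0" by auto
    have "\<exists>c. \<forall>v\<in>?F l. psi M b v = sc c v" if b: "b \<in> gen m n ` {0..m} \<union> zeta_dzeta m n" for b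
    proof (cases "b \<in> zeta_dzeta m n")
      case True
      then have "b \<in> Z" by (rule gs.span_base)
      then show ?thesis by (intro exI[of _ "l b"]) (simp add: weight_space_def)
    next
      case False
      then obtain i where i: "i \<le> m" "b = gen m n i" using b by auto
      then show ?thesis by (intro exI[of _ "\<mu> i"]) (auto simp: weight_space_def Om_def wt_def \<chi>_def)
    qed
    then obtain c where gen: "\<And>b v. b \<in> gen m n ` {0..m} \<union> zeta_dzeta m n \<Longrightarrow> v \<in> ?F l \<Longrightarrow> psi M b v = sc (c b) v"
      by metis
    have "u \<in> V" using u by (auto simp: weight_space_def)
    then obtain l' where l': "l' \<in> dual g_scale (cartan m n)" "\<forall>h\<in>cartan m n. psi M h u = sc (l' h) u"
      using eigen_dual[OF gens_carr _ u(2)] gen[OF _ u(1)] unfolding cartan_gens by blast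
    have "?F l \<subseteq> ?W l'"
    proof
      fix v assume v: "v \<in> ?F l"
      have vV: "v \<in> V" using v by (auto simp: weight_space_def)
      have "psi M h v = sc (l' h) v" if h: "h \<in> cartan m n" for h
      proof (rule eigen_on_span[OF gens_carr vV])
        show "lin_on g_scale (*) (gs.span (gen m n ` {0..m} \<union> zeta_dzeta m n)) l'" using l'(1) by (simp add: dual_def cartan_gens)
        show "h \<in> gs.span (gen m n ` {0..m} \<union> zeta_dzeta m n)" using h by (simp add: cartan_gens)
        fix b assume b: "b \<in> gen m n ` {0..m} \<union> zeta_dzeta m n"
        then have "b \<in> cartan m n" unfolding cartan_gens by (rule gs.span_base)
        then have "sc (l' b) u = psi M b u" using l'(2) by simp
        then have "sc (l' b) u = sc (c b) u" using gen[OF b u(1)] by simp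
        then have "l' b = c b" by (rule vs.scale_right_imp_eq[OF u(2)])
        then show "psi M b v = sc (l' b) v" using gen[OF b v] by simp
      qed
      then show "v \<in> ?W l'" using vV by (simp add: weight_space_def)
    qed
    then show ?thesis using l' by blast
  qed
  obtain K where K: "\<forall>l\<in>dual g_scale (cartan m n). vs.dim (?W l) \<le> K"
    and fd: "\<forall>l\<in>dual g_scale (cartan m n). \<exists>B. finite B \<and> ?W l \<subseteq> vs.span B"
    using cusp by (auto simp: cuspidal_def bounded_weight_def)
  have d0: "vs.dim {0} \<le> K" using vs.dim_le_card[of "{0}" "{}"] by simp
  have fin: "(\<exists>B. finite B \<and> ?F l \<subseteq> vs.span B) \<and> vs.dim (?F l) \<le> K" if l: "l \<in> dual g_scale Z" for l
    using sub[OF l]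
  proof
    assume "?F l = {0}"
    then show ?thesis using d0 by (intro conjI exI[of _ "{}"]) simp_all
  next
    assume "\<exists>l'\<in>dual g_scale (cartan m n). ?F l \<subseteq> ?W l'"
    then obtain l' where l': "l' \<in> dual g_scale (cartan m n)" "?F l \<subseteq> ?W l'" by blast
    then obtain B where B: "finite B" "?W l' \<subseteq> vs.span B" using fd by blast
    have "vs.dim (?W l') \<le> K" using K l'(1) by blast
    then have "vs.dim (?F l) \<le> K" by (rule fin_dim_subspace[OF vs.vector_space_axioms l'(2) B])
    then show ?thesis using B l'(2) by (intro conjI exI[of _ B]) simp_all
  qed
  show ?thesis unfolding bounded_weight_def
  proof (intro conjI exI[of _ K])
    show "direct_sum sc (Om \<mu>) (dual g_scale Z) ?F" by (rule direct_sumI[OF vs.vector_space_axioms Om_subspace ZV span])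
    show "\<forall>l\<in>dual g_scale Z. \<exists>B. finite B \<and> ?F l \<subseteq> vs.span B" using fin by blast
    show "\<forall>l\<in>dual g_scale Z. vs.dim (?F l) \<le> K" using fin by blast
  qed
qed

end

section \<open>Common eigenvectors of commuting operators\<close>

text \<open>The sequence may have repetitions, so dependence is stated for indices rather than for the set of values.\<close>

lemma (in vector_space) dependent_sequence:
  fixes w :: "nat \<Rightarrow> 'b"
  assumes B: "finite B" and w: "\<And>i. w i \<in> span B"
  shows "\<exists>c. (\<exists>i\<le>card B. c i \<noteq> 0) \<and> (\<Sum>i\<le>card B. scale (c i) (w i)) = 0"
proof (cases "inj_on w {..card B}")
  case True
  have "dependent (w ` {..card B})"
  proof (rule ccontr, simp)
    assume "independent (w ` {..card B})"
    then have "card (w ` {..card B}) \<le> card B" using independent_span_bound[OF B] w by blast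
    then show False using card_image[OF True] by simp
  qed
  then obtain u where u: "\<exists>v\<in>w ` {..card B}. u v \<noteq> 0" "(\<Sum>v\<in>w ` {..card B}. scale (u v) v) = 0"
    by (auto simp: dependent_finite)
  then show ?thesis using True by (intro exI[of _ "u \<circ> w"]) (auto simp: sum.reindex)
next
  case False
  then obtain i j where ij: "i \<le> card B" "j \<le> card B" "i \<noteq> j" "w i = w j" by (auto simp: inj_on_def)
  define c :: "nat \<Rightarrow> 'a" where "c k = (if k = i then 1 else if k = j then -1 else 0)" for k
  have "(\<Sum>k\<le>card B. scale (c k) (w k)) = (\<Sum>k\<in>{i, j}. scale (c k) (w k))"
    by (rule sum.mono_neutral_right) (use ij in \<open>auto simp: c_def\<close>)
  also have "\<dots> = 0" using ij by (simp add: c_def)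
  finally show ?thesis using ij by (intro exI[of _ c]) (auto simp: c_def)
qed

text \<open>Some nonzero polynomial in the operator kills \<open>v\<close>. Splitting off a linear factor \<open>X - z\<close>, either \<open>f - z\<close> kills \<open>v\<close>, or
  the quotient kills the nonzero vector \<open>(f - z) v\<close> and has smaller degree.\<close>

lemma eigenvector_exists:
  fixes s :: "complex \<Rightarrow> 'v::ab_group_add \<Rightarrow> 'v"
  assumes vs: "vector_space s" and F: "module.subspace s F" and B: "finite B" "F \<subseteq> module.span s B"
    and f: "lin_on s s F f" and st: "\<And>u. u \<in> F \<Longrightarrow> f u \<in> F" and v: "v \<in> F" "v \<noteq> 0"
  shows "\<exists>u\<in>F. u \<noteq> 0 \<and> (\<exists>c. f u = s c u)"
proof -
  interpret vector_space s by (rule vs)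
  have iter: "(f ^^ i) u \<in> F" if "u \<in> F" for i u using that st by (induction i) auto
  have iter_lin: "(f ^^ i) (f u - s z u) = (f ^^ i) (f u) - s z ((f ^^ i) u)" if u: "u \<in> F" for i u z
  proof (induction i)
    case (Suc i)
    have fd: "f (x - s z y) = f x - s z (f y)" if "x \<in> F" "y \<in> F" for x y
    proof -
      have "f (x + s (- z) y) = f x + s (- z) (f y)" using f that subspace_scale[OF F] unfolding lin_on_def by metis
      then show ?thesis by simp
    qed
    show ?case using Suc fd[OF iter iter] u st by simp
  qed simp
  have ev: "\<exists>u\<in>F. u \<noteq> 0 \<and> (\<exists>c. f u = s c u)"
    if "p \<noteq> 0" "v \<in> F" "v \<noteq> 0" "(\<Sum>i\<le>degree p. s (coeff p i) ((f ^^ i) v)) = 0" for p :: "complex poly" and v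
    using that
  proof (induction "degree p" arbitrary: p v)
    case 0
    then obtain c where "p = [:c:]" by (metis degree_eq_zeroE)
    then show ?case using 0 by (simp add: scale_eq_0_iff)
  next
    case (Suc N)
    have "\<not> constant (poly p)" using Suc(2) by (simp add: constant_degree)
    then obtain z where "poly p z = 0" using fundamental_theorem_of_algebra by blast
    then obtain q where pq: "p = [:- z, 1:] * q" by (metis dvdE poly_eq_0_iff_dvd)
    have q0: "q \<noteq> 0" using Suc.prems pq by auto
    have dq: "degree q = N" using Suc(2) degree_mult_eq[of "[:- z, 1:]" q] q0 unfolding pq by simp
    define w where "w = f v - s z v"
    have w: "w \<in> F" unfolding w_def using Suc.prems st F by (intro subspace_diff subspace_scale) auto
    have cp: "coeff p i = coeff (pCons 0 q) i - z * coeff q i" for i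
      unfolding pq by (simp add: algebra_simps)
    have "0 = (\<Sum>i\<le>Suc N. s (coeff (pCons 0 q) i) ((f ^^ i) v)) - (\<Sum>i\<le>Suc N. s (z * coeff q i) ((f ^^ i) v))"
      using Suc.prems(4) unfolding Suc(2)[symmetric] cp by (simp only: scale_left_diff_distrib sum_subtractf)
    also have "(\<Sum>i\<le>Suc N. s (coeff (pCons 0 q) i) ((f ^^ i) v)) = (\<Sum>i\<le>N. s (coeff q i) ((f ^^ i) (f v)))"
      by (subst sum.atMost_Suc_shift) (simp add: funpow_swap1)
    also have "(\<Sum>i\<le>Suc N. s (z * coeff q i) ((f ^^ i) v)) = (\<Sum>i\<le>N. s (coeff q i) (s z ((f ^^ i) v)))"
      using dq coeff_eq_0[of q "Suc N"] by (simp add: mult.commute)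
    finally have "(\<Sum>i\<le>degree q. s (coeff q i) ((f ^^ i) w)) = 0"
      unfolding dq w_def using iter_lin[OF Suc.prems(2)] by (simp add: scale_right_diff_distrib sum_subtractf)
    then show ?case
      using Suc(1)[of q w] dq q0 w Suc.prems(2,3) unfolding w_def by (cases "f v - s z v = 0") auto
  qed
  obtain c where c: "\<exists>i\<le>card B. c i \<noteq> 0" "(\<Sum>i\<le>card B. s (c i) ((f ^^ i) v)) = 0"
    using dependent_sequence[OF B(1), of "\<lambda>i. (f ^^ i) v"] iter[OF v(1)] B(2) by blast
  \<comment> \<open>the linear dependence of \<open>v, f v, f\<^sup>2 v, \<dots>\<close>, read as a polynomial in \<open>f\<close>\<close>
  define p where "p = (\<Sum>i\<le>card B. monom (c i) i)"
  have cf: "coeff p i = (if i \<le> card B then c i else 0)" for i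
    by (simp add: p_def coeff_sum)
  have "p \<noteq> 0" using c(1) cf by (metis coeff_0)
  moreover have "(\<Sum>i\<le>degree p. s (coeff p i) ((f ^^ i) v)) = (\<Sum>i\<le>card B. s (c i) ((f ^^ i) v))"
  proof -
    have "degree p \<le> card B" by (rule degree_le) (simp add: cf)
    then have "(\<Sum>i\<le>degree p. s (coeff p i) ((f ^^ i) v)) = (\<Sum>i\<le>card B. s (coeff p i) ((f ^^ i) v))"
      by (intro sum.mono_neutral_left) (auto simp: coeff_eq_0)
    then show ?thesis by (simp add: cf)
  qed
  ultimately show ?thesis using ev[of p v] v c(2) by simp
qed

text \<open>An eigenspace of one operator is stable under those that commute with it, so the operators can be treated one after the
  other.\<close>

lemma common_eigenvector:
  fixes s :: "complex \<Rightarrow> 'v::ab_group_add \<Rightarrow> 'v"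
  assumes vs: "vector_space s" and A: "finite A" and F: "module.subspace s F" and B: "finite B" "F \<subseteq> module.span s B"
    and f: "\<And>a. a \<in> A \<Longrightarrow> lin_on s s F (f a)" and st: "\<And>a u. a \<in> A \<Longrightarrow> u \<in> F \<Longrightarrow> f a u \<in> F"
    and comm: "\<And>a b u. a \<in> A \<Longrightarrow> b \<in> A \<Longrightarrow> u \<in> F \<Longrightarrow> f a (f b u) = f b (f a u)" and v: "v \<in> F" "v \<noteq> 0"
  shows "\<exists>u\<in>F. u \<noteq> 0 \<and> (\<forall>a\<in>A. \<exists>c. f a u = s c u)"
  using A F B f st comm v
proof (induction A arbitrary: F v rule: finite_induct)
  case (insert a A)
  interpret vector_space s by (rule vs)
  obtain u c where u: "u \<in> F" "u \<noteq> 0" "f a u = s c u"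
    using eigenvector_exists[OF vs insert.prems(1-3) insert.prems(4)[of a] insert.prems(5)[of a] insert.prems(7,8)] by auto
  define G where "G = {x \<in> F. f a x = s c x}"
  have lin: "f b (x + y) = f b x + f b y" "f b (s k x) = s k (f b x)" if "b \<in> insert a A" "x \<in> F" "y \<in> F" for b x y k
    using insert.prems(4)[OF that(1)] that by (auto simp: lin_on_def)
  have f0: "f a 0 = 0" using lin(2)[of a 0 0 0] subspace_0[OF insert.prems(1)] by simp
  have G: "subspace G"
    using insert.prems(1) unfolding G_def
    by (intro subspaceI) (auto simp: subspace_0 subspace_add subspace_scale f0 lin scale_right_distrib mult.commute)
  have "\<exists>u\<in>G. u \<noteq> 0 \<and> (\<forall>a\<in>A. \<exists>c. f a u = s c u)"
  proof (rule insert.IH[OF G insert.prems(2)])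
    show "G \<subseteq> span B" using insert.prems(3) by (auto simp: G_def)
    show "lin_on s s G (f b)" if "b \<in> A" for b using insert.prems(4)[of b] that by (auto simp: lin_on_def G_def)
    show "f b x \<in> G" if "b \<in> A" "x \<in> G" for b x
      using insert.prems(5)[of b x] insert.prems(6)[of a b x] lin(2)[of b x x c] that by (auto simp: G_def)
    show "f b (f d x) = f d (f b x)" if "b \<in> A" "d \<in> A" "x \<in> G" for b d x
      using insert.prems(6)[of b d x] that by (auto simp: G_def)
    show "u \<in> G" "u \<noteq> 0" using u by (auto simp: G_def)
  qed
  then show ?case by (auto simp: G_def)
qed auto

section \<open>\<open>\<Omega>\<close> as a \<open>\<gg>\<ll>(m+1,n)\<close>-module\<close>

lemma scal_gl: "scal (gl m n) = (\<lambda>c X \<alpha> \<beta>. c * X \<alpha> \<beta>)" by (simp add: gl_def)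

lemma vector_space_gl: "vector_space (scal (gl m n))"
  by unfold_locales (simp_all add: scal_gl fun_eq_iff distrib_left distrib_right)

lemma part_gl: "X \<in> part (gl m n) p \<longleftrightarrow> (\<forall>\<alpha> \<beta>. X \<alpha> \<beta> \<noteq> 0 \<longrightarrow> \<alpha> \<le> m + n \<and> \<beta> \<le> m + n \<and> ((m < \<alpha>) \<noteq> (m < \<beta>)) = p)"
  by (simp add: gl_def)

lemma graded_gl: "graded_space (gl m n)"
proof -
  interpret vector_space "scal (gl m n)" by (rule vector_space_gl)
  have "subspace (part (gl m n) p)" for p
    by (rule subspaceI) (auto simp: part_gl scal_gl, (metis add.right_neutral)+)
  then show ?thesis using vector_space_gl by (simp add: graded_space_def)
qed

lemma Emat_part: "\<alpha> \<le> m + n \<Longrightarrow> \<beta> \<le> m + n \<Longrightarrow> Emat \<alpha> \<beta> \<in> part (gl m n) ((m < \<alpha>) \<noteq> (m < \<beta>))"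
  by (auto simp: part_gl Emat_def)

lemma add_diff_diff_cancel: "a + b - c - a = b - (c :: 'a::ab_group_add)"
  by simp

context qp_mod begin

abbreviation "\<Phi> \<equiv> Phi m n M"
abbreviation "Ix \<equiv> {..m+n} \<times> {..m+n}"

lemma Phi_pairs: "v \<in> V \<Longrightarrow> \<Phi> X v = (\<Sum>x\<in>Ix. sc (X (fst x) (snd x)) (E (fst x) (snd x) v))"
  unfolding Phi_def by (simp add: Phi_E_eq sum.cartesian_product case_prod_beta)

lemma Phi_V: "v \<in> V \<Longrightarrow> \<Phi> X v \<in> V"
  by (simp add: Phi_pairs) (auto intro!: vs.subspace_sum[OF V_sub])

lemma Phi_lin: "lin_on sc sc V (\<Phi> X)"
proof -
  have "\<Phi> X (u + v) = \<Phi> X u + \<Phi> X v" if "u \<in> V" "v \<in> V" for u v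
  proof -
    have "\<Phi> X (u + v) = (\<Sum>x\<in>Ix. sc (X (fst x) (snd x)) (E (fst x) (snd x) u) + sc (X (fst x) (snd x)) (E (fst x) (snd x) v))"
      unfolding Phi_pairs[OF V_closed(1)[OF that]] by (rule sum.cong[OF refl]) (use that in \<open>auto simp: sc_simps\<close>)
    then show ?thesis using that by (simp add: Phi_pairs sum.distrib)
  qed
  moreover have "\<Phi> X (sc c v) = sc c (\<Phi> X v)" if "v \<in> V" for c v
    unfolding Phi_pairs[OF that] Phi_pairs[OF V_closed(2)[OF that]] vs.scale_sum_right
    by (rule sum.cong[OF refl]) (use that in \<open>auto simp: mult.commute\<close>)
  ultimately show ?thesis by (simp add: lin_on_def)
qed

lemma Phi_lin_left: "v \<in> V \<Longrightarrow> lin_on (scal (gl m n)) sc S (\<lambda>X. \<Phi> X v)"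
  by (simp add: lin_on_def Phi_pairs scal_gl vs.scale_left_distrib sum.distrib vs.scale_sum_right)

lemma Phi_Emat: "\<alpha> \<le> m + n \<Longrightarrow> \<beta> \<le> m + n \<Longrightarrow> v \<in> V \<Longrightarrow> \<Phi> (Emat \<alpha> \<beta>) v = E \<alpha> \<beta> v"
proof -
  assume a: "\<alpha> \<le> m + n" "\<beta> \<le> m + n" "v \<in> V"
  have "\<Phi> (Emat \<alpha> \<beta>) v = (\<Sum>x\<in>Ix. if x = (\<alpha>, \<beta>) then E \<alpha> \<beta> v else 0)"
    unfolding Phi_pairs[OF a(3)] by (rule sum.cong[OF refl]) (auto simp: Emat_def)
  then show ?thesis using a by simp
qed

text \<open>Both sides are bilinear in the matrices. Expanding over the entries, the relation \<open>E_E\<close> applies to each pair of entries; the two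
  fourfold sums that remain are contracted to the matrix products.\<close>

lemma Phi_bracket:
  assumes X: "X \<in> part (gl m n) p" and Y: "Y \<in> part (gl m n) q" and v: "v \<in> V"
  shows "\<Phi> (gl_bracket m n X Y) v = \<Phi> X (\<Phi> Y v) - sc (ksign p q) (\<Phi> Y (\<Phi> X v))"
proof -
  let ?s = "ksign p q" and ?I = "{..m+n}"
  have comp: "\<Phi> X (\<Phi> Y v) = (\<Sum>x\<in>Ix. \<Sum>y\<in>Ix. sc (X (fst x) (snd x) * Y (fst y) (snd y)) (E (fst x) (snd x) (E (fst y) (snd y) v)))" for X Y
  proof -
    have "E (fst x) (snd x) (\<Phi> Y v) = (\<Sum>y\<in>Ix. sc (Y (fst y) (snd y)) (E (fst x) (snd x) (E (fst y) (snd y) v)))"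
      if x: "x \<in> Ix" for x
    proof -
      have x1: "fst x \<le> m + n" using x by auto
      have "E (fst x) (snd x) (\<Phi> Y v) = (\<Sum>y\<in>Ix. E (fst x) (snd x) (sc (Y (fst y) (snd y)) (E (fst y) (snd y) v)))"
        unfolding Phi_pairs[OF v] by (rule lin_on_simps(6)[OF E_lin[OF x1]]) (use v in auto)
      also have "\<dots> = (\<Sum>y\<in>Ix. sc (Y (fst y) (snd y)) (E (fst x) (snd x) (E (fst y) (snd y) v)))"
        by (rule sum.cong[OF refl]) (use v x1 in auto)
      finally show ?thesis .
    qed
    then show ?thesis unfolding Phi_pairs[OF Phi_V[OF v]] by (simp add: vs.scale_sum_right)
  qed
  have "\<Phi> X (\<Phi> Y v) - sc ?s (\<Phi> Y (\<Phi> X v)) = (\<Sum>x\<in>Ix. \<Sum>y\<in>Ix.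
      sc (X (fst x) (snd x) * Y (fst y) (snd y)) (E (fst x) (snd x) (E (fst y) (snd y) v))
      - sc (?s * (X (fst x) (snd x) * Y (fst y) (snd y))) (E (fst y) (snd y) (E (fst x) (snd x) v)))"
  proof -
    have "sc ?s (\<Phi> Y (\<Phi> X v)) = (\<Sum>x\<in>Ix. \<Sum>y\<in>Ix.
        sc (?s * (X (fst x) (snd x) * Y (fst y) (snd y))) (E (fst y) (snd y) (E (fst x) (snd x) v)))"
      unfolding comp[of Y X] vs.scale_sum_right vs.scale_scale mult.commute[of "Y _ _"] by (rule sum.swap)
    then show ?thesis unfolding comp[of X Y] sum_subtractf by simp
  qed
  also have "\<dots> = (\<Sum>x\<in>Ix. \<Sum>y\<in>Ix.
      sc (X (fst x) (snd x) * Y (fst y) (snd y)) (if snd x = fst y then E (fst x) (snd y) v else 0)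
      - sc (?s * (X (fst x) (snd x) * Y (fst y) (snd y))) (if snd y = fst x then E (fst y) (snd x) v else 0))"
  proof (rule sum.cong[OF refl], rule sum.cong[OF refl])
    fix x y assume x: "x \<in> Ix" and y: "y \<in> Ix"
    show "sc (X (fst x) (snd x) * Y (fst y) (snd y)) (E (fst x) (snd x) (E (fst y) (snd y) v))
      - sc (?s * (X (fst x) (snd x) * Y (fst y) (snd y))) (E (fst y) (snd y) (E (fst x) (snd x) v))
      = sc (X (fst x) (snd x) * Y (fst y) (snd y)) (if snd x = fst y then E (fst x) (snd y) v else 0)
      - sc (?s * (X (fst x) (snd x) * Y (fst y) (snd y))) (if snd y = fst x then E (fst y) (snd x) v else 0)"
    proof (cases "X (fst x) (snd x) = 0 \<or> Y (fst y) (snd y) = 0")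
      case False
      then have "p = ((m < fst x) \<noteq> (m < snd x))" "q = ((m < fst y) \<noteq> (m < snd y))"
        using X Y unfolding part_gl by blast+
      then have "E (fst x) (snd x) (E (fst y) (snd y) v) = sc ?s (E (fst y) (snd y) (E (fst x) (snd x) v))
         + (if snd x = fst y then E (fst x) (snd y) v else 0) - sc ?s (if snd y = fst x then E (fst y) (snd x) v else 0)"
        using E_E[of "fst x" "fst y" v "snd x" "snd y"] x y v by (simp only: mem_Times_iff atMost_iff)
      then show ?thesis
        by (simp only: vs.scale_right_distrib vs.scale_right_diff_distrib vs.scale_scale mult.commute[of ?s])
          (rule add_diff_diff_cancel)
    qed auto
  qed
  also have "\<dots> = (\<Sum>\<alpha>\<in>?I. \<Sum>\<beta>\<in>?I. \<Sum>\<gamma>\<in>?I. \<Sum>\<delta>\<in>?I. sc (X \<alpha> \<beta> * Y \<gamma> \<delta>) (if \<beta> = \<gamma> then E \<alpha> \<delta> v else 0))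
      - (\<Sum>\<alpha>\<in>?I. \<Sum>\<beta>\<in>?I. \<Sum>\<gamma>\<in>?I. \<Sum>\<delta>\<in>?I. sc (?s * (X \<alpha> \<beta> * Y \<gamma> \<delta>)) (if \<delta> = \<alpha> then E \<gamma> \<beta> v else 0))"
  proof -
    have 2: "(\<Sum>x\<in>Ix. h (fst x) (snd x)) = (\<Sum>\<alpha>\<in>?I. \<Sum>\<beta>\<in>?I. h \<alpha> \<beta>)" for h :: "nat \<Rightarrow> nat \<Rightarrow> 'v"
      by (simp add: sum.cartesian_product case_prod_beta)
    have 4: "(\<Sum>x\<in>Ix. \<Sum>y\<in>Ix. g (fst x) (snd x) (fst y) (snd y)) = (\<Sum>\<alpha>\<in>?I. \<Sum>\<beta>\<in>?I. \<Sum>\<gamma>\<in>?I. \<Sum>\<delta>\<in>?I. g \<alpha> \<beta> \<gamma> \<delta>)"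
      for g :: "nat \<Rightarrow> nat \<Rightarrow> nat \<Rightarrow> nat \<Rightarrow> 'v"
      unfolding 2[of "\<lambda>\<alpha> \<beta>. \<Sum>y\<in>Ix. g \<alpha> \<beta> (fst y) (snd y)"] by (intro sum.cong refl) (rule 2)
    show ?thesis unfolding sum_subtractf
      by (simp only: 4[of "\<lambda>\<alpha> \<beta> \<gamma> \<delta>. sc (X \<alpha> \<beta> * Y \<gamma> \<delta>) (if \<beta> = \<gamma> then E \<alpha> \<delta> v else 0)"]
         4[of "\<lambda>\<alpha> \<beta> \<gamma> \<delta>. sc (?s * (X \<alpha> \<beta> * Y \<gamma> \<delta>)) (if \<delta> = \<alpha> then E \<gamma> \<beta> v else 0)"])
  qed
  also have "(\<Sum>\<alpha>\<in>?I. \<Sum>\<beta>\<in>?I. \<Sum>\<gamma>\<in>?I. \<Sum>\<delta>\<in>?I. sc (X \<alpha> \<beta> * Y \<gamma> \<delta>) (if \<beta> = \<gamma> then E \<alpha> \<delta> v else 0))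
      = (\<Sum>\<alpha>\<in>?I. \<Sum>\<delta>\<in>?I. \<Sum>\<beta>\<in>?I. sc (X \<alpha> \<beta> * Y \<beta> \<delta>) (E \<alpha> \<delta> v))"
  proof (rule sum.cong[OF refl])
    fix \<alpha> assume "\<alpha> \<in> ?I"
    have "(\<Sum>\<gamma>\<in>?I. \<Sum>\<delta>\<in>?I. sc (X \<alpha> \<beta> * Y \<gamma> \<delta>) (if \<beta> = \<gamma> then E \<alpha> \<delta> v else 0))
      = (\<Sum>\<delta>\<in>?I. sc (X \<alpha> \<beta> * Y \<beta> \<delta>) (E \<alpha> \<delta> v))" if \<beta>: "\<beta> \<in> ?I" for \<beta>
    proof -
      have "(\<Sum>\<gamma>\<in>?I. \<Sum>\<delta>\<in>?I. sc (X \<alpha> \<beta> * Y \<gamma> \<delta>) (if \<beta> = \<gamma> then E \<alpha> \<delta> v else 0))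
        = (\<Sum>\<gamma>\<in>?I. if \<gamma> = \<beta> then (\<Sum>\<delta>\<in>?I. sc (X \<alpha> \<beta> * Y \<beta> \<delta>) (E \<alpha> \<delta> v)) else 0)"
        by (rule sum.cong[OF refl]) auto
      then show ?thesis using \<beta> by simp
    qed
    then have "(\<Sum>\<beta>\<in>?I. \<Sum>\<gamma>\<in>?I. \<Sum>\<delta>\<in>?I. sc (X \<alpha> \<beta> * Y \<gamma> \<delta>) (if \<beta> = \<gamma> then E \<alpha> \<delta> v else 0))
       = (\<Sum>\<beta>\<in>?I. \<Sum>\<delta>\<in>?I. sc (X \<alpha> \<beta> * Y \<beta> \<delta>) (E \<alpha> \<delta> v))" by simp
    also have "\<dots> = (\<Sum>\<delta>\<in>?I. \<Sum>\<beta>\<in>?I. sc (X \<alpha> \<beta> * Y \<beta> \<delta>) (E \<alpha> \<delta> v))" by (rule sum.swap)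
    finally show "(\<Sum>\<beta>\<in>?I. \<Sum>\<gamma>\<in>?I. \<Sum>\<delta>\<in>?I. sc (X \<alpha> \<beta> * Y \<gamma> \<delta>) (if \<beta> = \<gamma> then E \<alpha> \<delta> v else 0))
      = (\<Sum>\<delta>\<in>?I. \<Sum>\<beta>\<in>?I. sc (X \<alpha> \<beta> * Y \<beta> \<delta>) (E \<alpha> \<delta> v))" .
  qed
  also have "(\<Sum>\<alpha>\<in>?I. \<Sum>\<beta>\<in>?I. \<Sum>\<gamma>\<in>?I. \<Sum>\<delta>\<in>?I. sc (?s * (X \<alpha> \<beta> * Y \<gamma> \<delta>)) (if \<delta> = \<alpha> then E \<gamma> \<beta> v else 0))
      = (\<Sum>\<gamma>\<in>?I. \<Sum>\<beta>\<in>?I. \<Sum>\<alpha>\<in>?I. sc (?s * (X \<alpha> \<beta> * Y \<gamma> \<alpha>)) (E \<gamma> \<beta> v))"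
  proof -
    have "(\<Sum>\<alpha>\<in>?I. \<Sum>\<beta>\<in>?I. \<Sum>\<gamma>\<in>?I. \<Sum>\<delta>\<in>?I. sc (?s * (X \<alpha> \<beta> * Y \<gamma> \<delta>)) (if \<delta> = \<alpha> then E \<gamma> \<beta> v else 0))
      = (\<Sum>\<alpha>\<in>?I. \<Sum>\<beta>\<in>?I. \<Sum>\<gamma>\<in>?I. sc (?s * (X \<alpha> \<beta> * Y \<gamma> \<alpha>)) (E \<gamma> \<beta> v))"
    proof (intro sum.cong refl)
      fix \<alpha> \<beta> \<gamma> assume \<alpha>: "\<alpha> \<in> ?I"
      have "(\<Sum>\<delta>\<in>?I. sc (?s * (X \<alpha> \<beta> * Y \<gamma> \<delta>)) (if \<delta> = \<alpha> then E \<gamma> \<beta> v else 0))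
        = (\<Sum>\<delta>\<in>?I. if \<delta> = \<alpha> then sc (?s * (X \<alpha> \<beta> * Y \<gamma> \<alpha>)) (E \<gamma> \<beta> v) else 0)"
        by (rule sum.cong[OF refl]) auto
      then show "(\<Sum>\<delta>\<in>?I. sc (?s * (X \<alpha> \<beta> * Y \<gamma> \<delta>)) (if \<delta> = \<alpha> then E \<gamma> \<beta> v else 0))
        = sc (?s * (X \<alpha> \<beta> * Y \<gamma> \<alpha>)) (E \<gamma> \<beta> v)" using \<alpha> by simp
    qed
    also have "\<dots> = (\<Sum>\<alpha>\<in>?I. \<Sum>\<gamma>\<in>?I. \<Sum>\<beta>\<in>?I. sc (?s * (X \<alpha> \<beta> * Y \<gamma> \<alpha>)) (E \<gamma> \<beta> v))"
      by (rule sum.cong[OF refl], rule sum.swap)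
    also have "\<dots> = (\<Sum>\<gamma>\<in>?I. \<Sum>\<alpha>\<in>?I. \<Sum>\<beta>\<in>?I. sc (?s * (X \<alpha> \<beta> * Y \<gamma> \<alpha>)) (E \<gamma> \<beta> v))" by (rule sum.swap)
    also have "\<dots> = (\<Sum>\<gamma>\<in>?I. \<Sum>\<beta>\<in>?I. \<Sum>\<alpha>\<in>?I. sc (?s * (X \<alpha> \<beta> * Y \<gamma> \<alpha>)) (E \<gamma> \<beta> v))"
      by (rule sum.cong[OF refl], rule sum.swap)
    finally show ?thesis .
  qed
  also have "(\<Sum>\<alpha>\<in>?I. \<Sum>\<delta>\<in>?I. \<Sum>\<beta>\<in>?I. sc (X \<alpha> \<beta> * Y \<beta> \<delta>) (E \<alpha> \<delta> v))
     - (\<Sum>\<gamma>\<in>?I. \<Sum>\<beta>\<in>?I. \<Sum>\<alpha>\<in>?I. sc (?s * (X \<alpha> \<beta> * Y \<gamma> \<alpha>)) (E \<gamma> \<beta> v))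
     = (\<Sum>\<alpha>\<in>?I. \<Sum>\<delta>\<in>?I. sc (\<Sum>\<beta>\<in>?I. X \<alpha> \<beta> * Y \<beta> \<delta> - ?s * (X \<beta> \<delta> * Y \<alpha> \<beta>)) (E \<alpha> \<delta> v))"
    by (simp only: sum_subtractf[symmetric] vs.scale_sum_left vs.scale_left_diff_distrib)
  also have "\<dots> = \<Phi> (gl_bracket m n X Y) v"
  proof -
    have "X \<alpha> \<gamma> * Y \<gamma> \<beta> - ksign ((m < \<gamma>) \<noteq> (m < \<beta>)) ((m < \<alpha>) \<noteq> (m < \<gamma>)) * Y \<alpha> \<gamma> * X \<gamma> \<beta>
       = X \<alpha> \<gamma> * Y \<gamma> \<beta> - ?s * (X \<gamma> \<beta> * Y \<alpha> \<gamma>)" for \<alpha> \<beta> \<gamma>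
    proof (cases "X \<gamma> \<beta> = 0 \<or> Y \<alpha> \<gamma> = 0")
      case False
      then have "p = ((m < \<gamma>) \<noteq> (m < \<beta>))" "q = ((m < \<alpha>) \<noteq> (m < \<gamma>))"
        using X Y unfolding part_gl by blast+
      then show ?thesis by (simp add: mult.commute mult.left_commute)
    qed auto
    note t = this
    have "(\<Sum>\<beta>\<in>?I. X \<alpha> \<beta> * Y \<beta> \<delta> - ?s * (X \<beta> \<delta> * Y \<alpha> \<beta>)) = gl_bracket m n X Y \<alpha> \<delta>" for \<alpha> \<delta>
      unfolding gl_bracket_def by (rule sum.cong[OF refl], rule t[symmetric])
    then show ?thesis unfolding Phi_pairs[OF v] by (simp add: sum.cartesian_product case_prod_beta)
  qed
  finally show ?thesis by simp
qed

lemma Phi_parity: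
  assumes X: "X \<in> part (gl m n) p" and v: "v \<in> part M q"
  shows "\<Phi> X v \<in> part M (p \<noteq> q)"
proof -
  have vV: "v \<in> V" using v by auto
  have "sc (X (fst x) (snd x)) (E (fst x) (snd x) v) \<in> part M (p \<noteq> q)" if x: "x \<in> Ix" for x
  proof (cases "X (fst x) (snd x) = 0")
    case True then show ?thesis by (simp add: P_closed)
  next
    case False
    then have "((m < fst x) \<noteq> (m < snd x)) = p" using X unfolding part_gl by blast
    then show ?thesis using E_parity[of "fst x" v q "snd x"] x v by (auto intro: P_closed(2))
  qed
  then show ?thesis unfolding Phi_pairs[OF vV] by (rule vs.subspace_sum[OF P_sub])
qed

lemma Phi_stable: 
  assumes U: "vs.subspace U" "U \<subseteq> V" "E_stable U" and u: "u \<in> U"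
  shows "\<Phi> X u \<in> U"
proof -
  have uV: "u \<in> V" using U u by auto
  show ?thesis unfolding Phi_pairs[OF uV]
    using U u by (intro vs.subspace_sum[OF U(1)] vs.subspace_scale[OF U(1)]) (auto simp: E_stable_def)
qed

abbreviation "OG \<mu> \<equiv> Omega_gl m n M (Om \<mu>)"

lemma OG_simps [simp]: "scal (OG \<mu>) = sc" "part (OG \<mu>) p = Om \<mu> \<inter> part M p" "glact (OG \<mu>) = \<Phi>"
  by (simp_all add: Omega_gl_def)

lemma carr_OG [simp]: "carr (OG \<mu>) = Om \<mu>"
  using Om_graded[of \<mu>] unfolding carr_def sub_superspace_def by simp

lemma OG_superspace: "is_superspace (OG \<mu>)"
  using superM vs.subspace_inter[OF Om_subspace P_sub] vs.subspace_0[OF Om_subspace] unfolding is_superspace_def by auto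

lemma OG_module: "gl_module m n (OG \<mu>)"
proof -
  have sub: "lin_on s1 s2 S f" if "lin_on s1 s2 S' f" "S \<subseteq> S'" for s1 s2 S S' and f :: "'v \<Rightarrow> 'v"
    using that unfolding lin_on_def by blast
  have "super_map (gl m n) (OG \<mu>) \<Phi>"
    unfolding super_map_def
  proof (intro conjI ballI allI)
    show "lin_on (scal (gl m n)) (scal (OG \<mu>)) (carr (gl m n)) (\<lambda>x. \<Phi> x v)" if "v \<in> carr (OG \<mu>)" for v
      using that by (auto intro!: Phi_lin_left)
    show "lin_on (scal (OG \<mu>)) (scal (OG \<mu>)) (carr (OG \<mu>)) (\<Phi> x)" for x
      by (simp, rule sub[OF Phi_lin]) auto
    show "\<Phi> x v \<in> part (OG \<mu>) (p \<noteq> q)" if "x \<in> part (gl m n) p" "v \<in> part (OG \<mu>) q" for x v p q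
      using that Phi_parity[OF that(1), of v q] Phi_stable[OF Om_subspace _ E_stable_Om, of \<mu> v x] by auto
  qed
  moreover have "\<Phi> (gl_bracket m n X Y) v = supercomm (OG \<mu>) p q (\<Phi> X) (\<Phi> Y) v"
    if "X \<in> part (gl m n) p" "Y \<in> part (gl m n) q" "v \<in> Om \<mu>" for X Y p q v
    using Phi_bracket[OF that(1,2) Om_V[OF that(3)]] by (simp add: supercomm_def)
  ultimately show ?thesis unfolding gl_module_def super_rep_def
    by (simp add: OG_superspace)
qed

end

context simple_qp_mod begin

text \<open>A \<open>\<gg>\<ll>\<close>-submodule is stable under the \<open>E\<^sub>\<alpha>\<^sub>\<beta>\<close>, as these are the actions of the elementary matrices.\<close>

lemma OG_simple:
  assumes "Om \<mu> \<noteq> {0}"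
  shows "gl_simple m n (OG \<mu>)"
  unfolding gl_simple_def
proof (intro conjI allI impI)
  show "gl_module m n (OG \<mu>)" by (rule OG_module)
  show "carr (OG \<mu>) \<noteq> {0}" using assms by simp
  fix U assume U: "sub_superspace (OG \<mu>) U \<and> (\<forall>X\<in>carr (gl m n). \<forall>u\<in>U. glact (OG \<mu>) X u \<in> U)"
  have UO: "U \<subseteq> Om \<mu>"
  proof
    fix u assume "u \<in> U"
    then obtain x y where "u = x + y" "x \<in> Om \<mu>" "y \<in> Om \<mu>"
      using U unfolding sub_superspace_def by auto blast
    then show "u \<in> Om \<mu>" by (auto intro: vs.subspace_add[OF Om_subspace])
  qed
  have "U \<inter> (Om \<mu> \<inter> part M p) = U \<inter> part M p" for p using UO by auto
  then have sU: "sub_superspace M U" using U by (simp add: sub_superspace_def)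
  have "E \<alpha> \<beta> u \<in> U" if "\<alpha> \<le> m + n" "\<beta> \<le> m + n" "u \<in> U" for \<alpha> \<beta> u
  proof -
    have "u \<in> V" using that UO by auto
    have "Emat \<alpha> \<beta> \<in> carr (gl m n)" by (rule part_carr[OF graded_gl Emat_part[OF that(1,2)]])
    then have "\<Phi> (Emat \<alpha> \<beta>) u \<in> U" using U that(3) by simp
    then show ?thesis using Phi_Emat[OF that(1,2) \<open>u \<in> V\<close>] by simp
  qed
  then have "E_stable U" by (simp add: E_stable_def)
  then show "U = {0} \<or> U = carr (OG \<mu>)" using Om_simple[OF UO sU] by auto
qed

end

context cuspidal_qp_mod begin

text \<open>Eigenvalues are left unspecified: the set is a union of eigenspaces and need not be a subspace.\<close>

definition diag_eig :: "(nat \<Rightarrow> complex) \<Rightarrow> 'v set" where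
  "diag_eig \<mu> = {u \<in> Om \<mu>. \<forall>\<gamma>\<le>m+n. \<exists>c. E \<gamma> \<gamma> u = sc c u}"

text \<open>The joint eigenspace of the \<open>\<zeta>\<^sub>k \<partial>\<^sub>k\<close> is the one of the diagonal operators with odd index, so it is stable under the other
  diagonal operators; being finite dimensional it contains a common eigenvector.\<close>

lemma diag_eig_nonzero:
  assumes "Om \<mu> \<noteq> {0}"
  shows "\<exists>u\<in>diag_eig \<mu>. u \<noteq> 0"
proof -
  let ?F = "weight_space sc (Om \<mu>) Z (psi M)"
  note bw = Om_zeta_weights[of \<mu>, unfolded bounded_weight_def direct_sum_def]
  have "\<exists>l\<in>dual g_scale Z. \<exists>v\<in>?F l. v \<noteq> 0"
  proof (rule ccontr)
    assume "\<not> (\<exists>l\<in>dual g_scale Z. \<exists>v\<in>?F l. v \<noteq> 0)"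
    then have "(\<Union>l\<in>dual g_scale Z. ?F l) \<subseteq> {0}" by auto
    then have "vs.span (\<Union>l\<in>dual g_scale Z. ?F l) \<subseteq> vs.span {0}" by (rule vs.span_mono)
    moreover have "vs.span {0} = {0}" using vs.span_eq_iff vs.subspace_single_0 by blast
    ultimately have "Om \<mu> \<subseteq> {0}" using bw by simp
    moreover have "0 \<in> Om \<mu>" by (rule vs.subspace_0[OF Om_subspace])
    ultimately show False using assms by auto
  qed
  then obtain l v where l: "l \<in> dual g_scale Z" and v: "v \<in> ?F l" "v \<noteq> 0" by auto
  obtain B where B: "finite B" "?F l \<subseteq> vs.span B" using bw l by auto
  have zc: "zeta_dzeta m n \<subseteq> carr (gdot m n)" using zd_carr by auto
  have F: "vs.subspace (?F l)" using bw l by auto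
  \<comment> \<open>in this form the weight space is seen to be stable under the diagonal operators\<close>
  have Fiff: "u \<in> ?F l \<longleftrightarrow> u \<in> Om \<mu> \<and> (\<forall>k\<in>{1..n}. E (m + k) (m + k) u = sc (l (el m n (zeta k) (m + k))) u)" for u
  proof
    assume u: "u \<in> ?F l"
    have "E (m + k) (m + k) u = sc (l (el m n (zeta k) (m + k))) u" if k: "k \<in> {1..n}" for k
    proof -
      have "el m n (zeta k) (m + k) \<in> Z" using k by (intro gs.span_base) (auto simp: zd_eq)
      then show ?thesis using u zeta_op_Om[of u \<mu> k] k by (simp add: weight_space_def)
    qed
    then show "u \<in> Om \<mu> \<and> (\<forall>k\<in>{1..n}. E (m + k) (m + k) u = sc (l (el m n (zeta k) (m + k))) u)"
      using u by (simp add: weight_space_def)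
  next
    assume u: "u \<in> Om \<mu> \<and> (\<forall>k\<in>{1..n}. E (m + k) (m + k) u = sc (l (el m n (zeta k) (m + k))) u)"
    then have uO: "u \<in> Om \<mu>" and uV: "u \<in> V" by auto
    have "psi M h u = sc (l h) u" if h: "h \<in> Z" for h
    proof (rule eigen_on_span[OF zc uV _ _ h])
      show "lin_on g_scale (*) Z l" using l by (simp add: dual_def)
      show "psi M b u = sc (l b) u" if "b \<in> zeta_dzeta m n" for b
        using that u zeta_op_Om[OF uO] by (auto simp: zd_eq)
    qed
    then show "u \<in> ?F l" using uO by (simp add: weight_space_def)
  qed
  have ED: "E \<gamma> \<gamma> (E \<delta> \<delta> u) = E \<delta> \<delta> (E \<gamma> \<gamma> u)" if "\<gamma> \<le> m + n" "\<delta> \<le> m + n" "u \<in> V" for \<gamma> \<delta> u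
    using E_E[OF that, of \<gamma> \<delta>] by auto
  have lin: "lin_on sc sc (?F l) (E \<gamma> \<gamma>)" if "\<gamma> \<in> {..m+n}" for \<gamma>
    using E_lin[of \<gamma> \<gamma>] that Fiff Om_V unfolding lin_on_def by (metis atMost_iff)
  have "\<exists>u\<in>?F l. u \<noteq> 0 \<and> (\<forall>\<gamma>\<in>{..m+n}. \<exists>c. E \<gamma> \<gamma> u = sc c u)"
  proof (rule common_eigenvector[OF vs.vector_space_axioms _ F B lin _ _ v])
    show "E \<gamma> \<gamma> u \<in> ?F l" if \<gamma>: "\<gamma> \<in> {..m+n}" and u: "u \<in> ?F l" for \<gamma> u
    proof -
      have uO: "u \<in> Om \<mu>" and uV: "u \<in> V" using u Fiff by auto
      have "E (m + k) (m + k) (E \<gamma> \<gamma> u) = sc (l (el m n (zeta k) (m + k))) (E \<gamma> \<gamma> u)" if k: "k \<in> {1..n}" for k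
        using ED[of "m + k" \<gamma> u] k \<gamma> uV u Fiff by simp
      then show ?thesis using Fiff E_Om[OF _ uO] \<gamma> by auto
    qed
    show "E \<gamma> \<gamma> (E \<delta> \<delta> u) = E \<delta> \<delta> (E \<gamma> \<gamma> u)" if "\<gamma> \<in> {..m+n}" "\<delta> \<in> {..m+n}" "u \<in> ?F l" for \<gamma> \<delta> u
      using ED[of \<gamma> \<delta> u] that Fiff by auto
  qed auto
  then show ?thesis using Fiff by (auto simp: diag_eig_def)
qed

text \<open>The operator \<open>E\<^sub>\<alpha>\<^sub>\<beta>\<close> shifts the eigenvalues of the diagonal operators, hence preserves common eigenvectors. Their span is
  therefore a nonzero graded stable subspace of \<open>\<Omega>\<close>.\<close>

lemma diag_eig_span:
  assumes "Om \<mu> \<noteq> {0}"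
  shows "vs.span (diag_eig \<mu>) = Om \<mu>"
proof -
  let ?U = "vs.span (diag_eig \<mu>)"
  have UO: "?U \<subseteq> Om \<mu>" by (rule vs.span_minimal[OF _ Om_subspace]) (auto simp: diag_eig_def)
  have D: "E \<alpha> \<beta> u \<in> diag_eig \<mu>" if "\<alpha> \<le> m + n" "\<beta> \<le> m + n" "u \<in> diag_eig \<mu>" for \<alpha> \<beta> u
  proof -
    have uO: "u \<in> Om \<mu>" using that by (simp add: diag_eig_def)
    then have uV: "u \<in> V" by auto
    have "\<exists>c. E \<gamma> \<gamma> (E \<alpha> \<beta> u) = sc c (E \<alpha> \<beta> u)" if \<gamma>: "\<gamma> \<le> m + n" for \<gamma>
    proof -
      obtain c where c: "E \<gamma> \<gamma> u = sc c u" using \<open>u \<in> diag_eig \<mu>\<close> \<gamma> by (auto simp: diag_eig_def)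
      have "E \<gamma> \<gamma> (E \<alpha> \<beta> u) = sc (c + (if \<gamma> = \<alpha> then 1 else 0) - (if \<beta> = \<gamma> then 1 else 0)) (E \<alpha> \<beta> u)"
        using E_E[OF \<gamma> \<open>\<alpha> \<le> m + n\<close> uV, of \<gamma> \<beta>] c \<open>\<alpha> \<le> m + n\<close> uV by (auto simp: sc_simps)
      then show ?thesis by blast
    qed
    then show ?thesis using E_Om[OF that(1) uO] by (simp add: diag_eig_def)
  qed
  have "E \<alpha> \<beta> u \<in> ?U" if ab: "\<alpha> \<le> m + n" "\<beta> \<le> m + n" and u: "u \<in> ?U" for \<alpha> \<beta> u
  proof -
    have "vs.subspace {u \<in> V. E \<alpha> \<beta> u \<in> ?U}"
      using ab by (intro vs.subspaceI) (auto simp: vs.span_zero vs.span_add vs.span_scale)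
    then have "?U \<subseteq> {u \<in> V. E \<alpha> \<beta> u \<in> ?U}"
      by (rule vs.span_minimal[rotated]) (use D[OF ab] vs.span_base in \<open>auto simp: diag_eig_def\<close>)
    then show ?thesis using u by auto
  qed
  then have st: "E_stable ?U" by (simp add: E_stable_def)
  \<comment> \<open>the homogeneous parts of a common eigenvector are common eigenvectors, as the \<open>E\<^sub>\<gamma>\<^sub>\<gamma>\<close> are even\<close>
  let ?D = "{x + y |x y. x \<in> ?U \<inter> part M False \<and> y \<in> ?U \<inter> part M True}"
  have sD: "vs.subspace ?D"
    by (rule vs.subspace_sums[OF vs.subspace_inter[OF vs.subspace_span P_sub] vs.subspace_inter[OF vs.subspace_span P_sub]])
  have "?U \<subseteq> ?D"
  proof (rule vs.span_minimal[OF _ sD], rule subsetI)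
    fix u assume u: "u \<in> diag_eig \<mu>"
    then have uO: "u \<in> Om \<mu>" by (simp add: diag_eig_def)
    then obtain x y where xy: "u = x + y" "x \<in> Om \<mu>" "x \<in> part M False" "y \<in> Om \<mu>" "y \<in> part M True"
      using Om_graded[of \<mu>] unfolding sub_superspace_def by blast
    have "\<exists>c. E \<gamma> \<gamma> x = sc c x \<and> E \<gamma> \<gamma> y = sc c y" if \<gamma>: "\<gamma> \<le> m + n" for \<gamma>
    proof -
      obtain c where c: "E \<gamma> \<gamma> u = sc c u" using u \<gamma> by (auto simp: diag_eig_def)
      have p: "E \<gamma> \<gamma> x - sc c x \<in> part M False" "E \<gamma> \<gamma> y - sc c y \<in> part M (\<not> False)"
        using E_parity[OF \<gamma> xy(3), of \<gamma>] E_parity[OF \<gamma> xy(5), of \<gamma>] xy P_closed by auto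
      have "(E \<gamma> \<gamma> x - sc c x) + (E \<gamma> \<gamma> y - sc c y) = 0"
        using c xy \<gamma> Om_V by (simp add: sc_simps algebra_simps)
      then show ?thesis using parts_zero[OF p] by auto
    qed
    then have "x \<in> diag_eig \<mu>" "y \<in> diag_eig \<mu>" using xy unfolding diag_eig_def by blast+
    then show "u \<in> ?D" using xy vs.span_base by blast
  qed
  moreover have "?D \<subseteq> ?U" by (auto intro: vs.span_add)
  ultimately have gr: "sub_superspace M ?U" unfolding sub_superspace_def by auto
  obtain u where "u \<in> diag_eig \<mu>" "u \<noteq> 0" using diag_eig_nonzero[OF assms] by auto
  then have "?U \<noteq> {0}" using vs.span_base by blast
  then show ?thesis by (rule Om_simple[OF UO gr st])
qed

text \<open>The weight spaces for the diagonal matrices span, because common eigenvectors do. Each of them lies in a joint eigenspace of the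
  \<open>\<zeta>\<^sub>k \<partial>\<^sub>k\<close>, whose dimension is finite and bounded.\<close>

lemma OG_admissible:
  assumes nz: "Om \<mu> \<noteq> {0}"
  shows "gl_admissible m n (OG \<mu>)"
proof -
  let ?H = "gl_diag m n" and ?s = "scal (gl m n)"
  interpret g: vector_space ?s by (rule vector_space_gl)
  let ?F = "weight_space sc (Om \<mu>) ?H \<Phi>"
  let ?G = "weight_space sc (Om \<mu>) Z (psi M)"
  have lin: "lin_on sc sc (Om \<mu>) (\<Phi> X)" for X
    using Phi_lin[of X] Om_V unfolding lin_on_def by blast
  have span: "Om \<mu> \<subseteq> vs.span (\<Union>l\<in>dual ?s ?H. ?F l)"
  proof -
    have "diag_eig \<mu> \<subseteq> (\<Union>l\<in>dual ?s ?H. ?F l)"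
    proof
      fix u assume u: "u \<in> diag_eig \<mu>"
      then obtain c where c: "\<And>\<gamma>. \<gamma> \<le> m + n \<Longrightarrow> E \<gamma> \<gamma> u = sc (c \<gamma>) u" unfolding diag_eig_def by (auto, metis)
      have uO: "u \<in> Om \<mu>" and uV: "u \<in> V" using u by (auto simp: diag_eig_def)
      define l where "l X = (if X \<in> ?H then \<Sum>\<gamma>\<le>m+n. X \<gamma> \<gamma> * c \<gamma> else 0)" for X :: mat
      have gla: "X + Y \<in> ?H" "?s k X \<in> ?H" if "X \<in> ?H" "Y \<in> ?H" for X Y k
        using that g.subspace_add[OF carr_subspace[OF graded_gl], of X Y] g.subspace_scale[OF carr_subspace[OF graded_gl], of X k]
        by (auto simp: gl_diag_def scal_gl)
      have l_out: "X \<notin> ?H \<Longrightarrow> l X = 0" for X by (simp add: l_def)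
      have "l (X + Y) = l X + l Y" if "X \<in> ?H" "Y \<in> ?H" for X Y
        unfolding l_def if_P[OF that(1)] if_P[OF that(2)] if_P[OF gla(1)[OF that]]
        by (simp add: distrib_right sum.distrib)
      moreover have "l (?s k X) = k * l X" if "X \<in> ?H" for X k
        unfolding l_def if_P[OF that] if_P[OF gla(2)[OF that that]]
        unfolding scal_gl sum_distrib_left by (rule sum.cong[OF refl], rule mult.assoc)
      ultimately have "l \<in> dual ?s ?H" unfolding dual_def lin_on_def using l_out by blast
      moreover have "u \<in> ?F l"
      proof -
        have "\<Phi> X u = sc (l X) u" if X: "X \<in> ?H" for X
        proof -
          have "\<Phi> X u = (\<Sum>\<alpha>\<le>m+n. \<Sum>\<beta>\<le>m+n. if \<beta> = \<alpha> then sc (X \<alpha> \<alpha> * c \<alpha>) u else 0)"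
            unfolding Phi_def using X uV c by (intro sum.cong refl) (auto simp: Phi_E_eq gl_diag_def)
          also have "\<dots> = sc (l X) u" using X by (simp add: l_def vs.scale_sum_left)
          finally show ?thesis .
        qed
        then show ?thesis using uO by (simp add: weight_space_def)
      qed
      ultimately show "u \<in> (\<Union>l\<in>dual ?s ?H. ?F l)" by blast
    qed
    then have "vs.span (diag_eig \<mu>) \<subseteq> vs.span (\<Union>l\<in>dual ?s ?H. ?F l)" by (rule vs.span_mono)
    then show ?thesis using diag_eig_span[OF nz] by simp
  qed
  note bw = Om_zeta_weights[of \<mu>, unfolded bounded_weight_def]
  obtain K where K: "\<forall>l\<in>dual g_scale Z. vs.dim (?G l) \<le> K" using bw by auto
  have zc: "zeta_dzeta m n \<subseteq> carr (gdot m n)" using zd_carr by auto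
  have sub: "?F l \<subseteq> {0} \<or> (\<exists>l'\<in>dual g_scale Z. ?F l \<subseteq> ?G l')" for l
  proof (cases "?F l \<subseteq> {0}")
    case False
    then obtain u where u: "u \<in> ?F l" "u \<noteq> 0" by auto
    have ev: "psi M (el m n (zeta k) (m + k)) v = sc (l (Emat (m + k) (m + k))) v" if v: "v \<in> ?F l" and k: "k \<in> {1..n}" for v k
    proof -
      have vO: "v \<in> Om \<mu>" and vV: "v \<in> V" using v by (auto simp: weight_space_def)
      have i: "m + k \<le> m + n" using k by simp
      have "Emat (m + k) (m + k) \<in> ?H" using part_carr[OF graded_gl Emat_part[OF i i]]
        by (auto simp: gl_diag_def Emat_def)
      then have "\<Phi> (Emat (m + k) (m + k)) v = sc (l (Emat (m + k) (m + k))) v" using v by (simp add: weight_space_def)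
      then show ?thesis using zeta_op_Om[OF vO k] Phi_Emat[OF i i vV] by simp
    qed
    have "u \<in> V" using u by (auto simp: weight_space_def)
    have "\<exists>c. psi M b u = sc c u" if "b \<in> zeta_dzeta m n" for b using that ev[OF u(1)] by (auto simp: zd_eq)
    then obtain l' where l': "l' \<in> dual g_scale Z" "\<forall>h\<in>Z. psi M h u = sc (l' h) u"
      using eigen_dual[OF zc \<open>u \<in> V\<close> u(2)] by blast
    have "?F l \<subseteq> ?G l'"
    proof
      fix v assume v: "v \<in> ?F l"
      have vO: "v \<in> Om \<mu>" and vV: "v \<in> V" using v by (auto simp: weight_space_def)
      have "psi M h v = sc (l' h) v" if h: "h \<in> Z" for h
      proof (rule eigen_on_span[OF zc vV _ _ h])
        show "lin_on g_scale (*) Z l'" using l' by (simp add: dual_def)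
        fix b assume b: "b \<in> zeta_dzeta m n"
        then obtain k where k: "k \<in> {1..n}" "b = el m n (zeta k) (m + k)" by (auto simp: zd_eq)
        have "b \<in> Z" using b by (rule gs.span_base)
        then have "sc (l' b) u = sc (l (Emat (m + k) (m + k))) u" using l'(2) ev[OF u(1) k(1)] k(2) by simp
        then have "l' b = l (Emat (m + k) (m + k))" by (rule vs.scale_right_imp_eq[OF u(2)])
        then show "psi M b v = sc (l' b) v" using ev[OF v k(1)] k(2) by simp
      qed
      then show "v \<in> ?G l'" using vO by (simp add: weight_space_def)
    qed
    then show ?thesis using l' by blast
  qed simp
  have fin: "(\<exists>B. finite B \<and> ?F l \<subseteq> vs.span B) \<and> vs.dim (?F l) \<le> K" for l
    using sub[of l]
  proof
    assume z: "?F l \<subseteq> {0}"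
    have "{0} \<subseteq> vs.span {}" by simp
    then have "?F l \<subseteq> vs.span {}" using z by (rule order_trans[rotated])
    then show ?thesis using vs.dim_le_card[of "?F l" "{}"] by (intro conjI exI[of _ "{}"]) simp_all
  next
    assume "\<exists>l'\<in>dual g_scale Z. ?F l \<subseteq> ?G l'"
    then obtain l' where l': "l' \<in> dual g_scale Z" "?F l \<subseteq> ?G l'" by blast
    then obtain B where B: "finite B" "?G l' \<subseteq> vs.span B" using bw by blast
    have "vs.dim (?G l') \<le> K" using K l'(1) by blast
    then have "vs.dim (?F l) \<le> K" by (rule fin_dim_subspace[OF vs.vector_space_axioms l'(2) B])
    then show ?thesis using B l'(2) by (intro conjI exI[of _ B]) simp_all
  qed
  have "bounded_weight ?s ?H sc (Om \<mu>) \<Phi>"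
    unfolding bounded_weight_def
  proof (intro conjI exI[of _ K])
    show "direct_sum sc (Om \<mu>) (dual ?s ?H) ?F" by (rule direct_sumI[OF vs.vector_space_axioms Om_subspace lin span])
    show "\<forall>l\<in>dual ?s ?H. \<exists>B. finite B \<and> ?F l \<subseteq> vs.span B" using fin by blast
    show "\<forall>l\<in>dual ?s ?H. vs.dim (?F l) \<le> K" using fin by blast
  qed
  then show ?thesis unfolding gl_admissible_def using OG_simple[OF nz] by simp
qed

end

section \<open>The isomorphism with a Shen-Larsson module\<close>

lemma lookup_tens:
  assumes "vector_space s"
  shows "lookup (tens s b v) k = s (lookup b k) v"
proof -
  interpret vector_space s by fact
  have "lookup (tens s b v) k
    = (\<Sum>l\<in>keys b. if l = k then s (lookup b k) v else 0)"
    unfolding tens_def lookup_sum by (rule sum.cong) (auto simp: lookup_single when_def)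
  also have "\<dots> = s (lookup b k) v" by (auto simp: in_keys_iff)
  finally show ?thesis .
qed

lemma g_coord_add: "g_coord m (x + y) \<alpha> = g_coord m x \<alpha> + g_coord m y \<alpha>"
  by (simp add: g_coord_def lg_mult_distrib)

context qp_mod begin

lemma g_coord_dA:
  assumes x: "x \<in> carr (gdot m n)" and \<alpha>: "\<alpha> \<le> m + n"
  shows "g_coord m x \<alpha> \<in> dA m n"
proof -
  obtain x0 x1 where "x = x0 + x1" "x0 \<in> part (gdot m n) False" "x1 \<in> part (gdot m n) True"
    using x by (auto simp: carr_def)
  then show ?thesis using dP_dA[OF g_coord_dP[OF _ \<alpha>]] by (auto simp: g_coord_add)
qed

lemma g_expand_carr:
  assumes x: "x \<in> carr (gdot m n)"
  shows "x = (\<Sum>\<alpha>\<le>m+n. el m n (g_coord m x \<alpha>) \<alpha>)"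
proof -
  obtain x0 x1 where "x = x0 + x1" "x0 \<in> part (gdot m n) False" "x1 \<in> part (gdot m n) True"
    using x by (auto simp: carr_def)
  then show ?thesis using g_expand[of x0 m n False] g_expand[of x1 m n True]
    by (simp only: g_coord_add el_lin sum.distrib)
qed

lemma psi_coord:
  assumes x: "x \<in> carr (gdot m n)" and v: "v \<in> V"
  shows "psi M x v = (\<Sum>\<alpha>\<le>m+n. \<psi> (g_coord m x \<alpha>) \<alpha> v)" "hphi M x v = (\<Sum>\<alpha>\<le>m+n. \<phi> (g_coord m x \<alpha>) (\<eta> \<alpha> v))"
proof -
  have g: "el m n (g_coord m x \<alpha>) \<alpha> \<in> carr (gdot m n)" if "\<alpha> \<in> {..m+n}" for \<alpha>
    using g_coord_dA[OF x] that by auto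
  have "psi M x v = psi M (\<Sum>\<alpha>\<le>m+n. el m n (g_coord m x \<alpha>) \<alpha>) v" using g_expand_carr[OF x] by simp
  also have "\<dots> = (\<Sum>\<alpha>\<le>m+n. psi M (el m n (g_coord m x \<alpha>) \<alpha>) v)"
    by (rule lin_on_sum[OF psi_lin_left[OF v] gs.vector_space_axioms vs.vector_space_axioms gcarr_sub g])
  finally show "psi M x v = (\<Sum>\<alpha>\<le>m+n. \<psi> (g_coord m x \<alpha>) \<alpha> v)" by (simp add: \<psi>_def)
  have "hphi M x v = hphi M (\<Sum>\<alpha>\<le>m+n. el m n (g_coord m x \<alpha>) \<alpha>) v" using g_expand_carr[OF x] by simp
  also have "\<dots> = (\<Sum>\<alpha>\<le>m+n. hphi M (el m n (g_coord m x \<alpha>) \<alpha>) v)"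
    by (rule lin_on_sum[OF hphi_lin_left[OF v] gs.vector_space_axioms vs.vector_space_axioms gcarr_sub g])
  also have "\<dots> = (\<Sum>\<alpha>\<le>m+n. \<phi> (g_coord m x \<alpha>) (\<eta> \<alpha> v))"
    using g_coord_dA[OF x] v by (intro sum.cong refl) (simp add: hphi_el)
  finally show "hphi M x v = (\<Sum>\<alpha>\<le>m+n. \<phi> (g_coord m x \<alpha>) (\<eta> \<alpha> v))" .
qed

text \<open>The carrier of the Shen-Larsson module, as finitely supported families of vectors of \<open>\<Omega>\<close> without reference to parity.\<close>

definition SLc :: "(nat \<Rightarrow> complex) \<Rightarrow> (mon \<Rightarrow>\<^sub>0 'v) set" where
  "SLc \<mu> = {fm. keys fm \<subseteq> mons {1..m} n \<and> (\<forall>k. lookup fm k \<in> Om \<mu>)}"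

text \<open>The map \<open>b \<otimes> v \<mapsto> \<phi>(b) v\<close>.\<close>

definition \<theta> :: "(mon \<Rightarrow>\<^sub>0 'v) \<Rightarrow> 'v" where
  "\<theta> fm = (\<Sum>k\<in>keys fm. \<phi> (mmon k) (lookup fm k))"

abbreviation "ms \<equiv> (pm_scale sc :: complex \<Rightarrow> (mon \<Rightarrow>\<^sub>0 'v) \<Rightarrow> _)"

lemma vector_space_ms: "vector_space ms" by (rule vector_space_pm_scale) (rule vs.vector_space_axioms)

lemma lookup_ms [simp]: "lookup (ms c f) k = sc c (lookup f k)"
  by (rule lookup_pm_scale) simp

lemma SLc_subspace: "module.subspace ms (SLc \<mu>)"
proof -
  interpret ms: vector_space ms by (rule vector_space_ms)
  show ?thesis
  proof (rule ms.subspaceI)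
    show "0 \<in> SLc \<mu>" using vs.subspace_0[OF Om_subspace] by (simp add: SLc_def)
    show "fm + G \<in> SLc \<mu>" if "fm \<in> SLc \<mu>" "G \<in> SLc \<mu>" for fm G
      using that Poly_Mapping.keys_add[of fm G] vs.subspace_add[OF Om_subspace] by (auto simp: SLc_def lookup_add)
    show "ms c fm \<in> SLc \<mu>" if "fm \<in> SLc \<mu>" for c fm
      using that keys_pm_scale[of sc c fm] vs.subspace_scale[OF Om_subspace] by (auto simp: SLc_def)
  qed
qed

lemma \<theta>_superset:
  assumes K: "finite K" "keys fm \<subseteq> K" "K \<subseteq> mons {1..m} n"
  shows "\<theta> fm = (\<Sum>k\<in>K. \<phi> (mmon k) (lookup fm k))"
  unfolding \<theta>_def
proof (rule sum.mono_neutral_left[OF K(1,2)], rule ballI)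
  fix k assume k: "k \<in> K - keys fm"
  then have "mmon k \<in> dA m n" using K(3) by (intro mono_dA) auto
  then show "\<phi> (mmon k) (lookup fm k) = 0"
    using k lin_on_simps(5)[OF \<phi>_lin] by (simp add: in_keys_iff)
qed

lemma \<theta>_lin: "lin_on ms sc (SLc \<mu>) \<theta>"
proof -
  have mk: "mmon k \<in> dA m n" if "k \<in> K" "K \<subseteq> mons {1..m} n" for k K using that by (intro mono_dA) auto
  have lV: "lookup fm k \<in> V" if "fm \<in> SLc \<mu>" for fm k using that Om_V unfolding SLc_def by blast
  have "\<theta> (fm + G) = \<theta> fm + \<theta> G" if fm: "fm \<in> SLc \<mu>" and G: "G \<in> SLc \<mu>" for fm G
  proof -
    let ?K = "keys fm \<union> keys G"
    have K: "finite ?K" "keys (fm + G) \<subseteq> ?K" "keys fm \<subseteq> ?K" "keys G \<subseteq> ?K" "?K \<subseteq> mons {1..m} n"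
      using Poly_Mapping.keys_add[of fm G] fm G by (auto simp: SLc_def)
    show ?thesis unfolding \<theta>_superset[OF K(1,2,5)] \<theta>_superset[OF K(1,3,5)] \<theta>_superset[OF K(1,4,5)] lookup_add sum.distrib[symmetric]
      by (rule sum.cong[OF refl]) (rule lin_on_simps(1)[OF \<phi>_lin[OF mk[OF _ K(5)]] lV[OF fm] lV[OF G]])
  qed
  moreover have "\<theta> (ms c fm) = sc c (\<theta> fm)" if fm: "fm \<in> SLc \<mu>" for c fm
  proof -
    let ?K = "keys fm"
    have K: "finite ?K" "keys (ms c fm) \<subseteq> ?K" "?K \<subseteq> ?K" "?K \<subseteq> mons {1..m} n"
      using keys_pm_scale[of sc c fm] fm by (auto simp: SLc_def)
    show ?thesis unfolding \<theta>_superset[OF K(1,2,4)] \<theta>_superset[OF K(1,3,4)] lookup_ms vs.scale_sum_right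
      by (rule sum.cong[OF refl]) (rule lin_on_simps(2)[OF \<phi>_lin[OF mk[OF _ K(4)]] lV[OF fm]])
  qed
  ultimately show ?thesis by (simp add: lin_on_def)
qed

lemma \<theta>_add: "fm \<in> SLc \<mu> \<Longrightarrow> gm \<in> SLc \<mu> \<Longrightarrow> \<theta> (fm + gm) = \<theta> fm + \<theta> gm"
  and \<theta>_scale: "fm \<in> SLc \<mu> \<Longrightarrow> \<theta> (ms c fm) = sc c (\<theta> fm)"
  using \<theta>_lin[of \<mu>] unfolding lin_on_def by blast+

lemma \<theta>_V: "fm \<in> SLc \<mu> \<Longrightarrow> \<theta> fm \<in> V"
  unfolding \<theta>_def SLc_def by (intro vs.subspace_sum[OF V_sub] \<phi>_V mono_dA Om_V) auto

lemma \<theta>_sum: "(\<And>i. i \<in> I \<Longrightarrow> G i \<in> SLc \<mu>) \<Longrightarrow> \<theta> (\<Sum>i\<in>I. G i) = (\<Sum>i\<in>I. \<theta> (G i))"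
  by (rule lin_on_sum[OF \<theta>_lin vector_space_ms vs.vector_space_axioms SLc_subspace])

lemma SLc_D:
  assumes "fm \<in> SLc \<mu>"
  shows "lookup fm k \<in> Om \<mu>" "lookup fm k \<in> V"
    "k \<in> keys fm \<Longrightarrow> k \<in> mons {1..m} n" "k \<in> keys fm \<Longrightarrow> mmon k \<in> dA m n"
proof -
  show l: "lookup fm k \<in> Om \<mu>" using assms unfolding SLc_def by blast
  show "lookup fm k \<in> V" by (rule Om_V[OF l])
  show k: "k \<in> mons {1..m} n" if "k \<in> keys fm" using assms that unfolding SLc_def by blast
  show "mmon k \<in> dA m n" if "k \<in> keys fm" by (rule mono_dA[OF k[OF that]])
qed

lemma tens_SL:
  assumes b: "b \<in> dA m n" and v: "v \<in> Om \<mu>"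
  shows "tens sc b v \<in> SLc \<mu>" "\<theta> (tens sc b v) = \<phi> b v"
proof -
  note l = lookup_tens[OF vs.vector_space_axioms]
  have k: "keys (tens sc b v) \<subseteq> keys b" by (auto simp: in_keys_iff l)
  have kb: "keys b \<subseteq> mons {1..m} n" using b by (simp add: lgA_iff)
  show "tens sc b v \<in> SLc \<mu>" using k kb v vs.subspace_scale[OF Om_subspace] by (auto simp: SLc_def l)
  have vV: "v \<in> V" using v by auto
  have mk: "mmon k \<in> dA m n" if "k \<in> keys b" for k using that kb by (intro mono_dA) auto
  have "\<theta> (tens sc b v) = (\<Sum>k\<in>keys b. \<phi> (mmon k) (sc (lookup b k) v))"
    unfolding \<theta>_superset[OF finite_keys k kb] l ..
  also have "\<dots> = (\<Sum>k\<in>keys b. \<phi> (lg_scale (lookup b k) (mmon k)) v)"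
    by (rule sum.cong[OF refl]) (use mk vV in \<open>simp del: lg_scale_single\<close>)
  also have "\<dots> = \<phi> (\<Sum>k\<in>keys b. lg_scale (lookup b k) (mmon k)) v"
    by (rule lin_left_simps(5)[OF \<phi>_lin_left[OF vV], symmetric]) (use mk in \<open>auto simp del: lg_scale_single\<close>)
  also have "\<dots> = \<phi> b v" by (subst lg_expand[of b, symmetric]) (rule refl)
  finally show "\<theta> (tens sc b v) = \<phi> b v" .
qed

text \<open>The parameter of the Shen-Larsson module: the weight of \<open>N\<close>, extended by \<open>0\<close> to the odd indices as \<open>\<Omega>\<close> is killed by the odd
  derivatives.\<close>

definition nu :: "(nat \<Rightarrow> complex) \<Rightarrow> nat \<Rightarrow> complex" where
  "nu \<mu> \<alpha> = (if \<alpha> \<le> m then \<mu> \<alpha> else 0)"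

abbreviation "SL \<mu> \<equiv> shen_larsson m n (OG \<mu>) (nu \<mu>)"

lemma SL_simps [simp]:
  "scal (SL \<mu>) = ms" "phi (SL \<mu>) = SL_phi (OG \<mu>)" "hphi (SL \<mu>) = SL_hphi m n (OG \<mu>)"
  "psi (SL \<mu>) = SL_psi m n (OG \<mu>) (nu \<mu>)"
  by (simp_all add: shen_larsson_def)

text \<open>A family with values in \<open>\<Omega>\<close> is split into its two parts by splitting each value, with the parity of the monomial taken
  into account.\<close>

lemma carr_SL: "carr (SL \<mu>) = SLc \<mu>"
proof -
  have P: "part (SL \<mu>) p = {f. keys f \<subseteq> mons {1..m} n \<and>
       (\<forall>k\<in>keys f. lookup f k \<in> Om \<mu> \<inter> part M (p \<noteq> mon_parity k))}" for p
    by (simp add: shen_larsson_def)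
  have 0: "0 \<in> Om \<mu>" by (rule vs.subspace_0[OF Om_subspace])
  interpret ms: vector_space ms by (rule vector_space_ms)
  show ?thesis
  proof
    have "part (SL \<mu>) p \<subseteq> SLc \<mu>" for p
      unfolding P SLc_def using 0 by (auto simp: in_keys_iff)
    then show "carr (SL \<mu>) \<subseteq> SLc \<mu>" unfolding carr_def using ms.subspace_add[OF SLc_subspace] by blast
    show "SLc \<mu> \<subseteq> carr (SL \<mu>)"
    proof
      fix fm assume fm: "fm \<in> SLc \<mu>"
      have "\<exists>x y. lookup fm k = x + y \<and> x \<in> Om \<mu> \<inter> part M False \<and> y \<in> Om \<mu> \<inter> part M True" for k
        using fm Om_graded[of \<mu>] unfolding SLc_def sub_superspace_def by blast
      then obtain h where h: "\<And>k. lookup fm k = h k False + h k True" "\<And>k p. h k p \<in> Om \<mu> \<inter> part M p"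
      proof -
        assume *: "\<And>h. (\<And>k. lookup fm k = h k False + h k True) \<Longrightarrow> (\<And>k p. h k p \<in> Om \<mu> \<inter> part M p) \<Longrightarrow> thesis"
        assume "\<And>k. \<exists>x y. lookup fm k = x + y \<and> x \<in> Om \<mu> \<inter> part M False \<and> y \<in> Om \<mu> \<inter> part M True"
        then obtain x y where "\<And>k. lookup fm k = x k + y k \<and> x k \<in> Om \<mu> \<inter> part M False \<and> y k \<in> Om \<mu> \<inter> part M True"
          by metis
        then show thesis by (intro *[of "\<lambda>k p. if p then y k else x k"]) auto
      qed
      define G where "G p = (\<Sum>k\<in>keys fm. single k (h k (p \<noteq> mon_parity k)))" for p
      have l: "lookup (G p) k = (if k \<in> keys fm then h k (p \<noteq> mon_parity k) else 0)" for p k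
        unfolding G_def by (rule sum_single_lookup) simp
      have "keys (G p) \<subseteq> keys fm" for p by (auto simp: in_keys_iff[of _ "G p"] l split: if_splits)
      then have "G p \<in> part (SL \<mu>) p" for p
        unfolding P using fm h(2) by (auto simp: l SLc_def in_keys_iff[of _ "G p"] split: if_splits)
      moreover have "fm = G False + G True"
      proof (rule poly_mapping_eqI)
        fix k show "lookup fm k = lookup (G False + G True) k"
          using h(1)[of k] by (cases "mon_parity k") (auto simp: lookup_add l in_keys_iff add.commute)
      qed
      ultimately show "fm \<in> carr (SL \<mu>)" unfolding carr_def by blast
    qed
  qed
qed

lemma E_Om': "\<alpha> \<le> m + n \<Longrightarrow> \<beta> \<le> m + n \<Longrightarrow> v \<in> Om \<mu> \<Longrightarrow> glact (OG \<mu>) (Emat \<alpha> \<beta>) v = E \<alpha> \<beta> v"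
  using Phi_Emat[of \<alpha> \<beta> v] by auto

lemma \<theta>_phi:
  assumes a: "a \<in> dA m n" and fm: "fm \<in> SLc \<mu>"
  shows "SL_phi (OG \<mu>) a fm \<in> SLc \<mu>" "\<theta> (SL_phi (OG \<mu>) a fm) = \<phi> a (\<theta> fm)"
proof -
  interpret ms: vector_space ms by (rule vector_space_ms)
  have k: "mmon k \<in> dA m n" "lookup fm k \<in> Om \<mu>" "lookup fm k \<in> V" if "k \<in> keys fm" for k
    using SLc_D[OF fm] that by auto
  have S: "tens sc (a \<star> mmon k) (lookup fm k) \<in> SLc \<mu>" if "k \<in> keys fm" for k
    using tens_SL(1)[OF lg_mult_lgA[OF a k(1)[OF that]] k(2)[OF that]] .
  show "SL_phi (OG \<mu>) a fm \<in> SLc \<mu>" unfolding SL_phi_def OG_simps by (rule ms.subspace_sum[OF SLc_subspace S])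
  have "\<theta> (SL_phi (OG \<mu>) a fm) = (\<Sum>k\<in>keys fm. \<theta> (tens sc (a \<star> mmon k) (lookup fm k)))"
    unfolding SL_phi_def OG_simps by (rule \<theta>_sum[OF S])
  also have "\<dots> = (\<Sum>k\<in>keys fm. \<phi> a (\<phi> (mmon k) (lookup fm k)))"
  proof (rule sum.cong[OF refl])
    fix j assume j: "j \<in> keys fm"
    show "\<theta> (tens sc (a \<star> mmon j) (lookup fm j)) = \<phi> a (\<phi> (mmon j) (lookup fm j))"
      unfolding tens_SL(2)[OF lg_mult_lgA[OF a k(1)[OF j]] k(2)[OF j]]
      by (rule \<phi>_mult[OF a k(1)[OF j] k(3)[OF j]])
  qed
  also have "\<dots> = \<phi> a (\<theta> fm)" unfolding \<theta>_def
    by (rule lin_on_simps(6)[OF \<phi>_lin[OF a], symmetric]) (use k in auto)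
  finally show "\<theta> (SL_phi (OG \<mu>) a fm) = \<phi> a (\<theta> fm)" .
qed

lemma \<theta>_hphi:
  assumes x: "x \<in> carr (gdot m n)" and fm: "fm \<in> SLc \<mu>"
  shows "SL_hphi m n (OG \<mu>) x fm \<in> SLc \<mu>" "\<theta> (SL_hphi m n (OG \<mu>) x fm) = hphi M x (\<theta> fm)"
proof -
  interpret ms: vector_space ms by (rule vector_space_ms)
  have k: "k \<in> mons {1..m} n" "mmon k \<in> dA m n" "lookup fm k \<in> Om \<mu>" "lookup fm k \<in> V" if "k \<in> keys fm" for k
    using SLc_D[OF fm] that by auto
  let ?t = "\<lambda>\<alpha> k. - ms (ksign (mon_parity k) (m < \<alpha>)) (tens sc (g_coord m x \<alpha> \<star> mmon k) (glact (OG \<mu>) (Emat 0 \<alpha>) (lookup fm k)))"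
  have T: "?t \<alpha> k \<in> SLc \<mu>" "\<theta> (?t \<alpha> k) = \<phi> (g_coord m x \<alpha>) (\<eta> \<alpha> (\<phi> (mmon k) (lookup fm k)))"
    if \<alpha>: "\<alpha> \<in> {..m+n}" and kF: "k \<in> keys fm" for \<alpha> k
  proof -
    note kk = k[OF kF]
    have g: "g_coord m x \<alpha> \<in> dA m n" using g_coord_dA[OF x] \<alpha> by auto
    have E0: "glact (OG \<mu>) (Emat 0 \<alpha>) (lookup fm k) = - \<eta> \<alpha> (lookup fm k)"
      using E_Om'[of 0 \<alpha> _ \<mu>] \<alpha> kk by (simp add: E_def)
    have eO: "- \<eta> \<alpha> (lookup fm k) \<in> Om \<mu>"
      using E_Om[of 0 _ \<mu> \<alpha>] kk(3) by (simp add: E_def)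
    have S: "tens sc (g_coord m x \<alpha> \<star> mmon k) (- \<eta> \<alpha> (lookup fm k)) \<in> SLc \<mu>"
      by (rule tens_SL(1)[OF lg_mult_lgA[OF g kk(2)] eO])
    have S2: "ms c (tens sc (g_coord m x \<alpha> \<star> mmon k) (- \<eta> \<alpha> (lookup fm k))) \<in> SLc \<mu>" for c
      by (rule ms.subspace_scale[OF SLc_subspace S])
    have eq: "?t \<alpha> k = ms (- ksign (mon_parity k) (m < \<alpha>)) (tens sc (g_coord m x \<alpha> \<star> mmon k) (- \<eta> \<alpha> (lookup fm k)))"
      unfolding E0 by simp
    show "?t \<alpha> k \<in> SLc \<mu>" unfolding eq by (rule S2)
    have "\<theta> (?t \<alpha> k) = sc (- ksign (mon_parity k) (m < \<alpha>)) (\<phi> (g_coord m x \<alpha> \<star> mmon k) (- \<eta> \<alpha> (lookup fm k)))"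
      unfolding eq \<theta>_scale[OF S] tens_SL(2)[OF lg_mult_lgA[OF g kk(2)] eO] ..
    also have "\<dots> = \<phi> (g_coord m x \<alpha>) (\<eta> \<alpha> (\<phi> (mmon k) (lookup fm k)))"
      unfolding \<eta>_\<phi>[OF mono_dP[OF kk(1)] kk(4)] using g kk
      by (cases "mon_parity k"; cases "m < \<alpha>"; simp add: \<phi>_mult)
    finally show "\<theta> (?t \<alpha> k) = \<phi> (g_coord m x \<alpha>) (\<eta> \<alpha> (\<phi> (mmon k) (lookup fm k)))" .
  qed
  have S: "(\<Sum>k\<in>keys fm. ?t \<alpha> k) \<in> SLc \<mu>" if "\<alpha> \<in> {..m+n}" for \<alpha>
    by (rule ms.subspace_sum[OF SLc_subspace T(1)[OF that]])
  show "SL_hphi m n (OG \<mu>) x fm \<in> SLc \<mu>" unfolding SL_hphi_def OG_simps(1) by (rule ms.subspace_sum[OF SLc_subspace S])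
  have "\<theta> (SL_hphi m n (OG \<mu>) x fm) = (\<Sum>\<alpha>\<le>m+n. \<theta> (\<Sum>k\<in>keys fm. ?t \<alpha> k))"
    unfolding SL_hphi_def OG_simps(1) by (rule \<theta>_sum[OF S])
  also have "\<dots> = (\<Sum>\<alpha>\<le>m+n. \<phi> (g_coord m x \<alpha>) (\<eta> \<alpha> (\<theta> fm)))"
  proof (rule sum.cong[OF refl])
    fix \<alpha> assume \<alpha>: "\<alpha> \<in> {..m+n}"
    have g: "g_coord m x \<alpha> \<in> dA m n" using g_coord_dA[OF x] \<alpha> by auto
    have "\<theta> (\<Sum>k\<in>keys fm. ?t \<alpha> k) = (\<Sum>k\<in>keys fm. \<theta> (?t \<alpha> k))"
      by (rule \<theta>_sum[OF T(1)[OF \<alpha>]])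
    also have "\<dots> = (\<Sum>k\<in>keys fm. \<phi> (g_coord m x \<alpha>) (\<eta> \<alpha> (\<phi> (mmon k) (lookup fm k))))"
      by (rule sum.cong[OF refl T(2)[OF \<alpha>]])
    also have "\<dots> = \<phi> (g_coord m x \<alpha>) (\<Sum>k\<in>keys fm. \<eta> \<alpha> (\<phi> (mmon k) (lookup fm k)))"
      by (rule lin_on_simps(6)[OF \<phi>_lin[OF g], symmetric]) (use k in auto)
    also have "(\<Sum>k\<in>keys fm. \<eta> \<alpha> (\<phi> (mmon k) (lookup fm k))) = \<eta> \<alpha> (\<theta> fm)"
      unfolding \<theta>_def by (rule lin_on_simps(6)[OF \<eta>_lin, symmetric]) (use k in auto)
    finally show "\<theta> (\<Sum>k\<in>keys fm. ?t \<alpha> k) = \<phi> (g_coord m x \<alpha>) (\<eta> \<alpha> (\<theta> fm))" .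
  qed
  also have "\<dots> = hphi M x (\<theta> fm)" by (rule psi_coord(2)[OF x \<theta>_V[OF fm], symmetric])
  finally show "\<theta> (SL_hphi m n (OG \<mu>) x fm) = hphi M x (\<theta> fm)" .
qed

lemma g_act_gen: "a \<in> dP m n p \<Longrightarrow> g_act (gen m n \<alpha>) a = pd m n \<alpha> a"
  unfolding gen_el using g_act_el[OF lg_one_in(1), of a m n p \<alpha>] by simp

text \<open>The structure formula applied to \<open>\<phi>(b) v\<close>: moving \<open>\<psi>(\<partial>\<^sub>\<alpha>)\<close> and \<open>E\<^sub>\<beta>\<^sub>\<alpha>\<close> past \<open>\<phi>(b)\<close> produces the derivative of \<open>b\<close> and
  the signs in the definition of the Shen-Larsson module.\<close>

lemma \<theta>_psi_hom:
  assumes a: "a \<in> dP m n p" and k: "k \<in> mons {1..m} n" and v: "v \<in> Om \<mu>" and \<alpha>: "\<alpha> \<le> m + n"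
  shows "SL_psi_hom m n (OG \<mu>) (nu \<mu>) \<alpha> p a k v \<in> SLc \<mu>"
    "\<theta> (SL_psi_hom m n (OG \<mu>) (nu \<mu>) \<alpha> p a k v) = \<psi> a \<alpha> (\<phi> (mmon k) v)"
proof -
  interpret ms: vector_space ms by (rule vector_space_ms)
  let ?b = "mmon k" and ?q = "mon_parity k"
  have b: "?b \<in> dP m n ?q" by (rule mono_dP[OF k])
  note A = dP_dA[OF a] dP_dA[OF b]
  have vV: "v \<in> V" using v by auto
  let ?s = "\<lambda>\<beta>. ksign (p \<noteq> ?q) (m < \<beta>) * ksign True (m < \<beta>) * ksign ?q (m < \<alpha>)"
  let ?u = "\<lambda>\<beta>. ms (?s \<beta>) (tens sc (pd m n \<beta> a \<star> ?b) (E \<beta> \<alpha> v))"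
  have EO: "E \<beta> \<alpha> v \<in> Om \<mu>" if "\<beta> \<in> {1..m+n}" for \<beta> using E_Om[OF _ v] that by auto
  have h1: "a \<star> (pd m n \<alpha> ?b + lg_scale (nu \<mu> \<alpha>) ?b) \<in> dA m n" using A by (auto simp del: lg_scale_single)
  have h2: "pd m n \<beta> a \<star> ?b \<in> dA m n" for \<beta> using A by auto
  have eq: "SL_psi_hom m n (OG \<mu>) (nu \<mu>) \<alpha> p a k v
    = tens sc (a \<star> (pd m n \<alpha> ?b + lg_scale (nu \<mu> \<alpha>) ?b)) v + (\<Sum>\<beta>\<in>{1..m+n}. ?u \<beta>)"
    unfolding SL_psi_hom_def Let_def OG_simps(1)
    by (intro arg_cong2[where f="(+)"] sum.cong refl)
      (use E_Om'[OF _ \<alpha> v] in \<open>simp_all add: g_act_gen[OF a] g_act_gen[OF b] del: lg_scale_single\<close>)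
  have S1: "tens sc (a \<star> (pd m n \<alpha> ?b + lg_scale (nu \<mu> \<alpha>) ?b)) v \<in> SLc \<mu>" by (rule tens_SL(1)[OF h1 v])
  have S2: "?u \<beta> \<in> SLc \<mu>" if "\<beta> \<in> {1..m+n}" for \<beta>
    by (rule ms.subspace_scale[OF SLc_subspace tens_SL(1)[OF h2 EO[OF that]]])
  have S3: "(\<Sum>\<beta>\<in>{1..m+n}. ?u \<beta>) \<in> SLc \<mu>" by (rule ms.subspace_sum[OF SLc_subspace S2])
  show "SL_psi_hom m n (OG \<mu>) (nu \<mu>) \<alpha> p a k v \<in> SLc \<mu>" unfolding eq by (rule ms.subspace_add[OF SLc_subspace S1 S3])
  have t1: "\<theta> (tens sc (a \<star> (pd m n \<alpha> ?b + lg_scale (nu \<mu> \<alpha>) ?b)) v) = \<phi> a (\<chi> \<alpha> (\<phi> ?b v))"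
  proof -
    have "\<chi> \<alpha> (\<phi> ?b v) = \<phi> (pd m n \<alpha> ?b + lg_scale (nu \<mu> \<alpha>) ?b) v"
      using \<chi>_\<phi>[OF b vV, of \<alpha>] \<chi>_Om[OF \<alpha> v] A vV by (auto simp: nu_def simp del: lg_scale_single)
    then show ?thesis unfolding tens_SL(2)[OF h1 v] using A vV by (simp add: \<phi>_mult del: lg_scale_single)
  qed
  have t2: "\<theta> (?u \<beta>) = sc (ksign (m < \<beta>) (\<not> p)) (\<phi> (pd m n \<beta> a) (E \<beta> \<alpha> (\<phi> ?b v)))" if \<beta>: "\<beta> \<in> {1..m+n}" for \<beta>
  proof -
    have "\<theta> (?u \<beta>) = sc (?s \<beta>) (\<phi> (pd m n \<beta> a \<star> ?b) (E \<beta> \<alpha> v))"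
      unfolding \<theta>_scale[OF tens_SL(1)[OF h2 EO[OF \<beta>]]] tens_SL(2)[OF h2 EO[OF \<beta>]] ..
    also have "\<dots> = sc (ksign (m < \<beta>) (\<not> p)) (\<phi> (pd m n \<beta> a) (E \<beta> \<alpha> (\<phi> ?b v)))"
      using E_\<phi>[OF _ b vV, of \<beta> \<alpha>] \<beta> A vV
      by (cases p; cases ?q; cases "m < \<alpha>"; cases "m < \<beta>"; simp add: \<phi>_mult)
    finally show ?thesis .
  qed
  have "\<theta> (SL_psi_hom m n (OG \<mu>) (nu \<mu>) \<alpha> p a k v) = \<phi> a (\<chi> \<alpha> (\<phi> ?b v)) + (\<Sum>\<beta>\<in>{1..m+n}. \<theta> (?u \<beta>))"
    unfolding eq \<theta>_add[OF S1 S3] t1 by (rule arg_cong[OF \<theta>_sum[OF S2]])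
  also have "\<dots> = \<psi> a \<alpha> (\<phi> ?b v)"
    using \<psi>_formula[OF a, of "\<phi> ?b v" \<alpha>] A vV t2 by simp
  finally show "\<theta> (SL_psi_hom m n (OG \<mu>) (nu \<mu>) \<alpha> p a k v) = \<psi> a \<alpha> (\<phi> (mmon k) v)" .
qed

lemma \<theta>_psi:
  assumes x: "x \<in> carr (gdot m n)" and fm: "fm \<in> SLc \<mu>"
  shows "SL_psi m n (OG \<mu>) (nu \<mu>) x fm \<in> SLc \<mu>" "\<theta> (SL_psi m n (OG \<mu>) (nu \<mu>) x fm) = psi M x (\<theta> fm)"
proof -
  interpret ms: vector_space ms by (rule vector_space_ms)
  have k: "k \<in> mons {1..m} n" "mmon k \<in> dA m n" "lookup fm k \<in> Om \<mu>" "lookup fm k \<in> V" if "k \<in> keys fm" for k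
    using SLc_D[OF fm] that by auto
  let ?t = "\<lambda>\<alpha> p k. SL_psi_hom m n (OG \<mu>) (nu \<mu>) \<alpha> p (lg_part p (g_coord m x \<alpha>)) k (lookup fm k)"
  have g: "g_coord m x \<alpha> \<in> dA m n" if "\<alpha> \<in> {..m+n}" for \<alpha> using g_coord_dA[OF x] that by auto
  have T: "?t \<alpha> p k \<in> SLc \<mu>" "\<theta> (?t \<alpha> p k) = \<psi> (lg_part p (g_coord m x \<alpha>)) \<alpha> (\<phi> (mmon k) (lookup fm k))"
    if \<alpha>: "\<alpha> \<in> {..m+n}" and kF: "k \<in> keys fm" for \<alpha> p k
    using \<theta>_psi_hom[OF lg_part_in[OF g[OF \<alpha>]] k(1)[OF kF] k(3)[OF kF]] \<alpha> by auto
  have S1: "(\<Sum>k\<in>keys fm. ?t \<alpha> p k) \<in> SLc \<mu>" if "\<alpha> \<in> {..m+n}" for \<alpha> p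
    by (rule ms.subspace_sum[OF SLc_subspace T(1)[OF that]])
  have S: "(\<Sum>p\<in>UNIV. \<Sum>k\<in>keys fm. ?t \<alpha> p k) \<in> SLc \<mu>" if "\<alpha> \<in> {..m+n}" for \<alpha>
    by (rule ms.subspace_sum[OF SLc_subspace S1[OF that]])
  show "SL_psi m n (OG \<mu>) (nu \<mu>) x fm \<in> SLc \<mu>" unfolding SL_psi_def by (rule ms.subspace_sum[OF SLc_subspace S])
  have "\<theta> (SL_psi m n (OG \<mu>) (nu \<mu>) x fm) = (\<Sum>\<alpha>\<le>m+n. \<theta> (\<Sum>p\<in>UNIV. \<Sum>k\<in>keys fm. ?t \<alpha> p k))"
    unfolding SL_psi_def by (rule \<theta>_sum[OF S])
  also have "\<dots> = (\<Sum>\<alpha>\<le>m+n. \<psi> (g_coord m x \<alpha>) \<alpha> (\<theta> fm))"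
  proof (rule sum.cong[OF refl])
    fix \<alpha> assume \<alpha>: "\<alpha> \<in> {..m+n}"
    have p: "\<theta> (\<Sum>k\<in>keys fm. ?t \<alpha> p k) = \<psi> (lg_part p (g_coord m x \<alpha>)) \<alpha> (\<theta> fm)" for p
    proof -
      have gp: "lg_part p (g_coord m x \<alpha>) \<in> dA m n" by (rule dP_dA[OF lg_part_in[OF g[OF \<alpha>]]])
      have "\<theta> (\<Sum>k\<in>keys fm. ?t \<alpha> p k) = (\<Sum>k\<in>keys fm. \<theta> (?t \<alpha> p k))"
        by (rule \<theta>_sum[OF T(1)[OF \<alpha>]])
      also have "\<dots> = (\<Sum>k\<in>keys fm. \<psi> (lg_part p (g_coord m x \<alpha>)) \<alpha> (\<phi> (mmon k) (lookup fm k)))"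
        by (rule sum.cong[OF refl T(2)[OF \<alpha>]])
      also have "\<dots> = \<psi> (lg_part p (g_coord m x \<alpha>)) \<alpha> (\<theta> fm)"
        unfolding \<theta>_def by (rule lin_on_simps(6)[OF \<psi>_lin[OF gp], symmetric]) (use k in auto)
      finally show ?thesis .
    qed
    have "\<theta> (\<Sum>p\<in>UNIV. \<Sum>k\<in>keys fm. ?t \<alpha> p k) = (\<Sum>p\<in>UNIV. \<theta> (\<Sum>k\<in>keys fm. ?t \<alpha> p k))"
      by (rule \<theta>_sum[OF S1[OF \<alpha>]])
    also have "\<dots> = \<psi> (lg_part False (g_coord m x \<alpha>)) \<alpha> (\<theta> fm) + \<psi> (lg_part True (g_coord m x \<alpha>)) \<alpha> (\<theta> fm)"
      unfolding p by (simp add: UNIV_bool)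
    also have "\<dots> = \<psi> (lg_part False (g_coord m x \<alpha>) + lg_part True (g_coord m x \<alpha>)) \<alpha> (\<theta> fm)"
      using dP_dA[OF lg_part_in[OF g[OF \<alpha>]]] \<theta>_V[OF fm] by simp
    finally show "\<theta> (\<Sum>p\<in>UNIV. \<Sum>k\<in>keys fm. ?t \<alpha> p k) = \<psi> (g_coord m x \<alpha>) \<alpha> (\<theta> fm)"
      unfolding lg_part_add .
  qed
  also have "\<dots> = psi M x (\<theta> fm)" by (rule psi_coord(1)[OF x \<theta>_V[OF fm], symmetric])
  finally show "\<theta> (SL_psi m n (OG \<mu>) (nu \<mu>) x fm) = psi M x (\<theta> fm)" .
qed

end

context simple_qp_mod begin

text \<open>Surjectivity is the expansion over \<open>\<Omega>\<close>, injectivity its uniqueness.\<close>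

lemma \<theta>_bij:
  assumes nz: "Om \<mu> \<noteq> {0}"
  shows "bij_betw \<theta> (SLc \<mu>) V"
  unfolding bij_betw_def
proof
  show "inj_on \<theta> (SLc \<mu>)"
  proof (rule inj_onI)
    fix fm G assume fm: "fm \<in> SLc \<mu>" and G: "G \<in> SLc \<mu>" and eq: "\<theta> fm = \<theta> G"
    let ?K = "keys fm \<union> keys G"
    have K: "finite ?K" "keys fm \<subseteq> ?K" "keys G \<subseteq> ?K" "?K \<subseteq> mons {1..m} n"
      using fm G by (auto simp: SLc_def)
    have O: "lookup fm k \<in> Om \<mu>" "lookup G k \<in> Om \<mu>" for k using fm G unfolding SLc_def by blast+
    have "(\<Sum>k\<in>?K. \<phi> (mmon k) (lookup fm k - lookup G k)) = (\<Sum>k\<in>?K. \<phi> (mmon k) (lookup fm k) - \<phi> (mmon k) (lookup G k))"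
      by (rule sum.cong[OF refl], rule lin_on_simps(3)[OF \<phi>_lin Om_V[OF O(1)] Om_V[OF O(2)]], rule mono_dA, rule subsetD[OF K(4)])
    also have "\<dots> = 0" using eq unfolding \<theta>_superset[OF K(1,2,4)] \<theta>_superset[OF K(1,3,4)] by (simp add: sum_subtractf)
    finally have z: "(\<Sum>k\<in>?K. \<phi> (mmon k) (lookup fm k - lookup G k)) = 0" .
    have "lookup fm k - lookup G k = 0" if k: "k \<in> ?K" for k
      by (rule mono_sum_inj[OF K(1,4) _ z k, of \<mu>]) (use O vs.subspace_diff[OF Om_subspace] in auto)
    moreover have "lookup fm k = 0 \<and> lookup G k = 0" if "k \<notin> ?K" for k using that by (auto simp: in_keys_iff)
    ultimately show "fm = G" by (intro poly_mapping_eqI) (metis right_minus_eq)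
  qed
  show "\<theta> ` SLc \<mu> = V"
  proof
    show "\<theta> ` SLc \<mu> \<subseteq> V" using \<theta>_V by auto
    show "V \<subseteq> \<theta> ` SLc \<mu>"
    proof
      fix v assume v: "v \<in> V"
      obtain K u where K: "finite K" "K \<subseteq> mons {1..m} n" "\<forall>k\<in>K. u k \<in> Om \<mu>" "v = (\<Sum>k\<in>K. \<phi> (mmon k) (u k))"
        using Om_expand[OF subset_refl Om_graded E_stable_Om nz v] by auto
      define fm where "fm = (\<Sum>k\<in>K. single k (u k))"
      have l: "lookup fm k = (if k \<in> K then u k else 0)" for k unfolding fm_def by (rule sum_single_lookup[OF K(1)])
      have kF: "keys fm \<subseteq> K" by (auto simp: in_keys_iff l split: if_splits)
      then have "fm \<in> SLc \<mu>" using K vs.subspace_0[OF Om_subspace] by (auto simp: SLc_def l)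
      moreover have "\<theta> fm = v" unfolding \<theta>_superset[OF K(1) kF K(2)] K(4) by (simp add: l)
      ultimately show "v \<in> \<theta> ` SLc \<mu>" by auto
    qed
  qed
qed

lemma SL_isomorphic:
  assumes nz: "Om \<mu> \<noteq> {0}"
  shows "qp_isomorphic m n M (SL \<mu>)"
proof -
  interpret ms: vector_space ms by (rule vector_space_ms)
  note bij = \<theta>_bij[OF nz]
  define f where "f = inv_into (SLc \<mu>) \<theta>"
  have f\<theta>: "f (\<theta> fm) = fm" if "fm \<in> SLc \<mu>" for fm
    using bij that by (simp add: f_def bij_betw_def inv_into_f_f)
  have fS: "f v \<in> SLc \<mu>" and \<theta>f: "\<theta> (f v) = v" if "v \<in> V" for v
    using bij that unfolding f_def bij_betw_def by (metis inv_into_into, metis f_inv_into_f)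
  have tl: "\<theta> (fm + G) = \<theta> fm + \<theta> G" "\<theta> (ms c fm) = sc c (\<theta> fm)" if "fm \<in> SLc \<mu>" "G \<in> SLc \<mu>" for fm G c
    using \<theta>_lin[of \<mu>] that by (auto simp: lin_on_def)
  have "bij_betw f V (SLc \<mu>)" unfolding f_def by (rule bij_betw_inv_into[OF bij])
  moreover have "lin_on sc ms V f"
    unfolding lin_on_def
  proof (intro conjI ballI allI)
    fix x y assume "x \<in> V" "y \<in> V"
    then show "f (x + y) = f x + f y"
      using f\<theta>[OF ms.subspace_add[OF SLc_subspace fS fS]] tl(1)[OF fS fS] \<theta>f by metis
  next
    fix c x assume "x \<in> V"
    then show "f (sc c x) = ms c (f x)"
      using f\<theta>[OF ms.subspace_scale[OF SLc_subspace fS]] tl(2)[OF fS fS] \<theta>f by metis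
  qed
  moreover have "f (\<phi> a v) = SL_phi (OG \<mu>) a (f v)" if "a \<in> dA m n" "v \<in> V" for a v
    using f\<theta>[OF \<theta>_phi(1)[OF that(1) fS[OF that(2)]]] \<theta>_phi(2)[OF that(1) fS[OF that(2)]] \<theta>f[OF that(2)] by simp
  moreover have "f (hphi M x v) = SL_hphi m n (OG \<mu>) x (f v)" if "x \<in> carr (gdot m n)" "v \<in> V" for x v
    using f\<theta>[OF \<theta>_hphi(1)[OF that(1) fS[OF that(2)]]] \<theta>_hphi(2)[OF that(1) fS[OF that(2)]] \<theta>f[OF that(2)] by simp
  moreover have "f (psi M x v) = SL_psi m n (OG \<mu>) (nu \<mu>) x (f v)" if "x \<in> carr (gdot m n)" "v \<in> V" for x v
    using f\<theta>[OF \<theta>_psi(1)[OF that(1) fS[OF that(2)]]] \<theta>_psi(2)[OF that(1) fS[OF that(2)]] \<theta>f[OF that(2)] by simp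
  ultimately show ?thesis unfolding qp_isomorphic_def carr_SL SL_simps by blast
qed

lemma T_simple_Om:
  assumes nz: "Om \<mu> \<noteq> {0}"
  shows "T_simple m n M (one_tens ` Om \<mu>)"
  unfolding T_simple_def
proof (intro conjI allI impI)
  have OV: "Om \<mu> \<subseteq> V" by auto
  show "T_submodule m n M (one_tens ` Om \<mu>)"
    using T_submodule_iff[OF OV] Om_graded E_stable_Om by simp
  have z: "one_tens (0::'v) = 0" by (simp add: one_tens_lin)
  have "0 \<in> Om \<mu>" by (rule vs.subspace_0[OF Om_subspace])
  then obtain u where "u \<in> Om \<mu>" "u \<noteq> 0" using nz by auto
  then show "one_tens ` Om \<mu> \<noteq> {0}" using one_tens_inj[of u 0] z by (metis image_eqI singletonD)
  fix U assume U: "U \<subseteq> one_tens ` Om \<mu> \<and> T_submodule m n M U"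
  define U' where "U' = {u \<in> Om \<mu>. one_tens u \<in> U}"
  have eq: "U = one_tens ` U'" using U by (auto simp: U'_def)
  have UO: "U' \<subseteq> Om \<mu>" by (auto simp: U'_def)
  then have UV: "U' \<subseteq> V" by auto
  have "sub_superspace M U' \<and> E_stable U'" using U T_submodule_iff[OF UV] unfolding eq by simp
  then have "U' = {0} \<or> U' = Om \<mu>" using Om_simple[OF UO] by blast
  then show "U = {0} \<or> U = one_tens ` Om \<mu>" unfolding eq using z by auto
qed

end

section \<open>Simple cuspidal QP-modules\<close>

theorem theorem3p16:
  fixes m n :: nat and M :: "('v::ab_group_add) qp_data" and \<mu>0 :: "qp_el \<Rightarrow> complex"
    and N \<Omega> :: "'v set"
  assumes "m > 0" and "n > 0"
    and "qp_simple m n M" and "cuspidal m n M"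
    and "\<mu>0 \<in> dual g_scale (cartan' m n)" and "qp_weight_sum m n M \<mu>0 \<noteq> {0}"
    and N: "N = qp_weight_sum m n M \<mu>0" and \<Omega>: "\<Omega> = Omega m n M N"
  shows
    "(\<forall>\<alpha>\<le>m + n. \<forall>u\<in>\<Omega>.
        (\<forall>j\<in>{1..m}. phi M (tpow j (-1)) (psi M (g_mult (emb (tpow j 1)) (gen m n \<alpha>)) u)
                        - psi M (gen m n \<alpha>) u \<in> \<Omega>) \<and>
        (\<forall>p\<in>{1..n}. phi M (zeta p) (psi M (gen m n \<alpha>) u)
                        - psi M (g_mult (emb (zeta p)) (gen m n \<alpha>)) u \<in> \<Omega>) \<and>
        hphi M (gen m n \<alpha>) u \<in> \<Omega>)
   \<and> (T_submodule m n M (one_tens ` \<Omega>) \<and>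
      bounded_weight g_scale (module.span g_scale (zeta_dzeta m n)) (scal M) \<Omega> (psi M))
   \<and> (\<forall>U. U \<subseteq> \<Omega> \<and> U \<noteq> {0} \<and> T_submodule m n M (one_tens ` U) \<longrightarrow>
        module.span (scal M) {phi M (lmono 0 I) u | I u. I \<subseteq> {1..n} \<and> u \<in> U} = N \<and>
        module.span (scal M) {phi M a u | a u. a \<in> carr (Adot m n) \<and> u \<in> U} = carr M)
   \<and> (T_simple m n M (one_tens ` \<Omega>) \<and>
      carr (Omega_gl m n M \<Omega>) = \<Omega> \<and> gl_admissible m n (Omega_gl m n M \<Omega>))
   \<and> (\<exists>(W :: 'v gl_data) (\<mu> :: nat \<Rightarrow> complex).
        gl_module m n W \<and> (\<forall>k\<in>{1..n}. \<mu> (m + k) = 0) \<and>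
        qp_isomorphic m n M (shen_larsson m n W \<mu>))"
proof -
  interpret cuspidal_qp_mod m n M
    by unfold_locales (use assms in \<open>auto simp: qp_simple_def\<close>)
  define \<mu> where "\<mu> i = \<mu>0 (gen m n i)" for i
  have Nwt: "N = wt \<mu>" unfolding N \<mu>_def by (rule weight_sum_eq[OF assms(5)])
  have Om: "\<Omega> = Om \<mu>" unfolding \<Omega> Nwt by (simp add: Omega_def Om_def \<chi>_def)
  have nz: "Om \<mu> \<noteq> {0}" using Om_nonzero[of \<mu>] assms(6) Nwt N by simp
  have OV: "Om \<mu> \<subseteq> V" by auto
  show ?thesis unfolding Om Nwt
  proof (intro conjI allI impI ballI)
    fix \<alpha> u assume \<alpha>: "\<alpha> \<le> m + n" and u: "u \<in> Om \<mu>"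
    have uV: "u \<in> V" using u by auto
    \<comment> \<open>up to sign the operators in question are the rows of \<open>Phi_E\<close>\<close>
    have P: "Phi_E m n M \<beta> \<alpha> u \<in> Om \<mu>" if "\<beta> \<le> m + n" for \<beta>
      using E_Om[OF that u] Phi_E_eq[OF that uV] by simp
    show "phi M (tpow j (-1)) (psi M (g_mult (emb (tpow j 1)) (gen m n \<alpha>)) u) - psi M (gen m n \<alpha>) u \<in> Om \<mu>"
      if "j \<in> {1..m}" for j
      using P[of j] that by (auto simp: Phi_E_def)
    show "phi M (zeta p) (psi M (gen m n \<alpha>) u) - psi M (g_mult (emb (zeta p)) (gen m n \<alpha>)) u \<in> Om \<mu>"
      if "p \<in> {1..n}" for p
      using vs.subspace_neg[OF Om_subspace P[of "m + p"]] that by (auto simp: Phi_E_def)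
    show "hphi M (gen m n \<alpha>) u \<in> Om \<mu>"
      using vs.subspace_neg[OF Om_subspace P[of 0]] by (simp add: Phi_E_def)
  next
    show "T_submodule m n M (one_tens ` Om \<mu>)" using T_submodule_iff[OF OV] Om_graded E_stable_Om by simp
    show "bounded_weight g_scale Z sc (Om \<mu>) (psi M)" by (rule Om_zeta_weights)
  next
    fix U assume U: "U \<subseteq> Om \<mu> \<and> U \<noteq> {0} \<and> T_submodule m n M (one_tens ` U)"
    then have UO: "U \<subseteq> Om \<mu>" and UV: "U \<subseteq> V" by auto
    have sU: "sub_superspace M U" "E_stable U" "U \<noteq> {0}" using U T_submodule_iff[OF UV] by auto
    show "vs.span {phi M (lmono 0 I) u | I u. I \<subseteq> {1..n} \<and> u \<in> U} = wt \<mu>" by (rule wt_expand[OF UO sU])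
    show "vs.span {phi M a u | a u. a \<in> carr (Adot m n) \<and> u \<in> U} = V" by (rule all_expand[OF UO sU])
  next
    show "T_simple m n M (one_tens ` Om \<mu>)" by (rule T_simple_Om[OF nz])
    show "carr (OG \<mu>) = Om \<mu>" by (rule carr_OG)
    show "gl_admissible m n (OG \<mu>)" by (rule OG_admissible[OF nz])
  next
    show "\<exists>(W :: 'v gl_data) (\<mu> :: nat \<Rightarrow> complex). gl_module m n W \<and> (\<forall>k\<in>{1..n}. \<mu> (m + k) = 0) \<and>
        qp_isomorphic m n M (shen_larsson m n W \<mu>)"
      using OG_module[of \<mu>] SL_isomorphic[OF nz]
      by (intro exI[of _ "OG \<mu>"] exI[of _ "nu \<mu>"]) (auto simp: nu_def)
  qed
qed

end
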